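(* Let $d\ge 2$. (i) For every $\lambda>0$ there exists a connected quasi-conical open set $\Omega\subset\mathbb{R}^d$ such that $\lambda$ is an eigenvalue of the Dirichlet Laplacian $-\Delta_{\mathrm D}^{\Omega}$, i.e. $\lambda\in\sigma_{\mathrm p}(-\Delta_{\mathrm D}^{\Omega})$. (ii) The connected quasi-conical open set in (i) can be chosen so that, in addition, the absolutely continuous spectrum of $-\Delta_{\mathrm D}^{\Omega}$ is empty: $\sigma_{\mathrm{ac}}(-\Delta_{\mathrm D}^{\Omega})=\varnothing$.
   Context: An open set $\Omega\subset\mathbb{R}^d$ is called quasi-conical if it contains balls of arbitrarily large radius. For an open set $\Omega\subset\mathbb{R}^d$, the Dirichlet Laplacian $-\Delta_{\mathrm D}^{\Omega}$ is the self-adjoint operator in $L^2(\Omega)$ associated (via the first representation theorem) with the closed quadratic form $u\mapsto\int_\Omega|\nabla u|^2\,\mathrm{d}x$ on the form domain $H^1_0(\Omega)$; equivalently $-\Delta_{\mathrm D}^{\Omega}u=-\Delta u$ on $\{u\in H^1_0(\Omega):\Delta u\in L^2(\Omega)\}$. $\sigma_{\mathrm p}$ denotes the set of eigenvalues and $\sigma_{\mathrm{ac}}$ the absolutely continuous spectrum. *)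

theory Defs
  imports "HOL-Analysis.Analysis"
begin

text \<open>Functions on the whole space; functions on an open set are extended by zero.\<close>

text \<open>C-infinity functions on the whole space: all iterated partial derivatives
  exist and are continuous (greatest class closed under taking partial derivatives).\<close>
definition smooth_fun :: "('a::euclidean_space \<Rightarrow> real) \<Rightarrow> bool" where
  "smooth_fun f \<longleftrightarrow> (\<exists>S. f \<in> S \<and>
     (\<forall>g\<in>S. continuous_on UNIV g \<and> (\<forall>x. g differentiable (at x)) \<and>
        (\<forall>b\<in>Basis. (\<lambda>x. frechet_derivative g (at x) b) \<in> S)))"

definition grad :: "('a::euclidean_space \<Rightarrow> real) \<Rightarrow> 'a \<Rightarrow> 'a" where
  "grad f x = (\<Sum>b\<in>Basis. frechet_derivative f (at x) b *\<^sub>R b)"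

definition test_fun :: "'a::euclidean_space set \<Rightarrow> ('a \<Rightarrow> real) \<Rightarrow> bool" where
  "test_fun \<Omega> \<phi> \<longleftrightarrow> smooth_fun \<phi> \<and>
     (\<exists>K. compact K \<and> K \<subseteq> \<Omega> \<and> (\<forall>x. x \<notin> K \<longrightarrow> \<phi> x = 0))"

definition L2_dist2 :: "('a::euclidean_space \<Rightarrow> 'b::real_normed_vector) \<Rightarrow> ('a \<Rightarrow> 'b) \<Rightarrow> ennreal" where
  "L2_dist2 f g = (\<integral>\<^sup>+ x. ennreal ((norm (f x - g x))\<^sup>2) \<partial>lebesgue)"

text \<open>H^1_0(Omega): pairs (u, G) where u is the H^1-limit of test functions and
  G is its (weak) gradient, i.e. the L^2-limit of the gradients.
  This is the closure of C_c^infinity(Omega) in H^1(R^d).\<close>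
definition H10 :: "'a::euclidean_space set \<Rightarrow> (('a \<Rightarrow> real) \<times> ('a \<Rightarrow> 'a)) set" where
  "H10 \<Omega> = {(u, G). u \<in> borel_measurable lebesgue \<and> G \<in> borel_measurable lebesgue \<and>
      (\<exists>\<phi>::nat \<Rightarrow> 'a \<Rightarrow> real. (\<forall>n. test_fun \<Omega> (\<phi> n)) \<and>
         (\<lambda>n. L2_dist2 (\<phi> n) u) \<longlonglongrightarrow> 0 \<and>
         (\<lambda>n. L2_dist2 (grad (\<phi> n)) G) \<longlonglongrightarrow> 0)}"

text \<open>Point spectrum of the Dirichlet Laplacian: by the first representation
  theorem, u is in the operator domain with -Delta_D u = lambda u iff
  u is in the form domain and the form identity holds for all v in H^1_0.\<close>
definition dirichlet_point_spectrum :: "'a::euclidean_space set \<Rightarrow> real set" where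
  "dirichlet_point_spectrum \<Omega> = {lam. \<exists>u G. (u, G) \<in> H10 \<Omega> \<and>
      (\<integral>\<^sup>+ x. ennreal ((u x)\<^sup>2) \<partial>lebesgue) > 0 \<and>
      (\<forall>v H. (v, H) \<in> H10 \<Omega> \<longrightarrow> (\<integral> x. G x \<bullet> H x \<partial>lebesgue) = lam * (\<integral> x. u x * v x \<partial>lebesgue))}"

definition L2_on :: "'a::euclidean_space set \<Rightarrow> ('a \<Rightarrow> real) set" where
  "L2_on \<Omega> = {f. f \<in> borel_measurable lebesgue \<and>
      (\<integral>\<^sup>+ x. ennreal ((f x)\<^sup>2) \<partial>lebesgue) < \<infinity> \<and> (\<forall>x. x \<notin> \<Omega> \<longrightarrow> f x = 0)}"

definition dirichlet_resolvent :: "'a::euclidean_space set \<Rightarrow> real \<Rightarrow> ('a \<Rightarrow> real) \<Rightarrow> ('a \<Rightarrow> real) \<Rightarrow> bool" where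
  "dirichlet_resolvent \<Omega> s f w \<longleftrightarrow> (\<exists>Gw. (w, Gw) \<in> H10 \<Omega> \<and>
      (\<forall>v H. (v, H) \<in> H10 \<Omega> \<longrightarrow> (\<integral> x. Gw x \<bullet> H x \<partial>lebesgue) + s * (\<integral> x. w x * v x \<partial>lebesgue)
                          = (\<integral> x. f x * v x \<partial>lebesgue)))"

text \<open>Spectral measure of f for the nonnegative operator -Delta_D: the finite Borel
  measure mu on [0,infinity) with  <(-Delta_D + s)^{-1} f, f> = int 1/(t+s) dmu(t)
  for all s > 0 (this determines mu uniquely).\<close>
definition is_spectral_measure :: "'a::euclidean_space set \<Rightarrow> ('a \<Rightarrow> real) \<Rightarrow> real measure \<Rightarrow> bool" where
  "is_spectral_measure \<Omega> f \<mu> \<longleftrightarrow> sets \<mu> = sets borel \<and> finite_measure \<mu> \<and>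
      emeasure \<mu> {..<0} = 0 \<and>
      (\<forall>s>0. \<forall>w. dirichlet_resolvent \<Omega> s f w \<longrightarrow>
          (\<integral> x. w x * f x \<partial>lebesgue) = (\<integral> t. 1 / (t + s) \<partial>\<mu>))"

text \<open>Absolutely continuous subspace: vectors whose spectral measure is absolutely
  continuous w.r.t. Lebesgue measure. The ac spectrum (spectrum of the operator
  restricted to this reducing subspace) is empty iff this subspace is trivial.\<close>
definition ac_subspace :: "'a::euclidean_space set \<Rightarrow> ('a \<Rightarrow> real) set" where
  "ac_subspace \<Omega> = {f \<in> L2_on \<Omega>. \<exists>\<mu>. is_spectral_measure \<Omega> f \<mu> \<and> absolutely_continuous lborel \<mu>}"

definition dirichlet_ac_spectrum_empty :: "'a::euclidean_space set \<Rightarrow> bool" where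
  "dirichlet_ac_spectrum_empty \<Omega> \<longleftrightarrow>
     (\<forall>f\<in>ac_subspace \<Omega>. AE x in lebesgue. f x = 0)"

definition quasi_conical :: "'a::euclidean_space set \<Rightarrow> bool" where
  "quasi_conical \<Omega> \<longleftrightarrow> (\<forall>r>0. \<exists>x. ball x r \<subseteq> \<Omega>)"

end

theory Submission
  imports Defs "HOL-Computational_Algebra.Polynomial"
begin

text \<open>
  Work with the resolvent \<open>A = (1 - \<Delta>)\<inverse>\<close>, which is compact on bounded sets, so that an eigenvalue \<open>a\<close>
  of \<open>A\<close> is the eigenvalue \<open>1 / a - 1\<close> of the Dirichlet Laplacian. The domain is a chain of larger and
  larger rooms along an axis, consecutive rooms being joined by thin tubes. Rooms end in cusps, so the
  strip around a tube that is removed by a cutoff is much thinner than the strip is long; Poincare's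
  inequality then shows that opening the tube changes the resolvent by an arbitrarily small amount in
  operator norm.

  Eigenvalue: among all pairs of a bounded chain and an eigenvalue choose one of least multiplicity
  \<open>m\<close>. Attach a new room whose length is such that it does not have this eigenvalue, and open a tube.
  After this small perturbation the eigenvalue could only move or split; by minimality of \<open>m\<close> it
  cannot split, so every eigenvector is followed by a nearby one. With summable
  perturbations the eigenvectors converge to an eigenvector on the unbounded chain; a dilation gives
  it the required eigenvalue.

  Absolutely continuous spectrum: finitely many eigenvectors of the \<open>n\<close>-th chain nearly span the range of its
  resolvent, and they remain approximate eigenvectors of \<open>A\<close> if later tubes are thin enough. Hence a
  polynomial of \<open>A\<close> that is small off a set of measure \<open>2\<^bsup>-n\<^esup>\<close> almost fixes their span. By Borel-Cantelli a
  vector with absolutely continuous spectral measure is annihilated in the limit.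
\<close>

section \<open>Projections and compact symmetric operators\<close>

text \<open>Attaching a room is never a small perturbation of the resolvent; only opening the tube
  is. Two devices deal with this. The length of the new room is chosen so that the room does not
  share the current eigenvalue: dilating a room moves a fixed eigenvalue through uncountably many
  values, while a compact operator has only countably many. Hence the eigenspace is unchanged until
  the tube is opened. And stages are compared only on functions supported in the older set, for
  which a detached room is invisible; the resolvents converge strongly, not in norm. The scales of a
  tube come from one product: a cutoff over length s has gradient of order 1/s, a strip of width of
  order s^2 has Poincare constant of order s^2, and the product tends to 0 with s. Norms of
  resolvent differences are read off from quadratic forms: the resolvent is the compression of an
  orthogonal projection, its form is a maximum over trial functions, and trial functions can be cut
  off. The spectral measure enters only through resolvents, whose expansion around -1 gives its
  moments in the variable y = 1/(1+t).\<close>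

lemma closed_subspace_projection_exists:
  fixes V :: "'h::{real_inner,banach} set"
  assumes V: "subspace V" "closed V"
  shows "\<exists>p\<in>V. \<forall>v\<in>V. (x - p) \<bullet> v = 0"
proof -
  define d where "d = Inf ((\<lambda>v. (norm (x - v))\<^sup>2) ` V)"
  have V0: "0 \<in> V" using V by (simp add: subspace_0)
  have bdd: "bdd_below ((\<lambda>v. (norm (x - v))\<^sup>2) ` V)"
    by (rule bdd_belowI[of _ 0]) auto
  have d_le: "d \<le> (norm (x - v))\<^sup>2" if "v \<in> V" for v
    unfolding d_def using that bdd by (auto intro: cInf_lower)
  have "\<exists>v\<in>V. (norm (x - v))\<^sup>2 < d + inverse (real (Suc n))" for n
  proof -
    have "d < d + inverse (real (Suc n))" by simp
    then show ?thesis
      unfolding d_def using V0 bdd by (subst (asm) (1) cInf_less_iff) auto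
  qed
  then obtain v where vV: "\<And>n. v n \<in> V"
    and v: "\<And>n. (norm (x - v n))\<^sup>2 < d + inverse (real (Suc n))"
    by metis
  \<comment> \<open>The midpoint of two competitors stays in \<open>V\<close> and cannot beat the
    infimum \<open>d\<close>; the parallelogram identity turns this into closeness of the
    competitors.\<close>
  have parallelogram: "(norm (v m - v n))\<^sup>2 \<le> 2 * inverse (real (Suc m)) + 2 * inverse (real (Suc n))" for m n
  proof -
    have "(1/2) *\<^sub>R (v m + v n) \<in> V"
      using V vV by (simp add: subspace_scale subspace_add)
    then have "d \<le> (norm (x - (1/2) *\<^sub>R (v m + v n)))\<^sup>2" by (rule d_le)
    moreover have "(norm (v m - v n))\<^sup>2 = 2 * (norm (x - v m))\<^sup>2 + 2 * (norm (x - v n))\<^sup>2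
        - 4 * (norm (x - (1/2) *\<^sub>R (v m + v n)))\<^sup>2"
      unfolding power2_norm_eq_inner by (simp add: algebra_simps inner_commute)
    ultimately show ?thesis using v[of m] v[of n] by linarith
  qed
  have "Cauchy v"
  proof (rule metric_CauchyI)
    fix e :: real assume "e > 0"
    then obtain N where N: "inverse (real (Suc N)) < e\<^sup>2 / 4"
      using reals_Archimedean[of "e\<^sup>2/4"] by auto
    have "dist (v m) (v n) < e" if "m \<ge> N" "n \<ge> N" for m n
    proof -
      have "inverse (real (Suc m)) \<le> inverse (real (Suc N))" "inverse (real (Suc n)) \<le> inverse (real (Suc N))"
        using that by (auto intro!: le_imp_inverse_le)
      then have "(norm (v m - v n))\<^sup>2 < e\<^sup>2" using parallelogram[of m n] N by linarith
      then show ?thesis using \<open>e > 0\<close> by (simp add: dist_norm power2_less_imp_less)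
    qed
    then show "\<exists>M. \<forall>m\<ge>M. \<forall>n\<ge>M. dist (v m) (v n) < e" by blast
  qed
  then obtain p where p: "v \<longlonglongrightarrow> p" using Cauchy_convergent_iff convergent_def by blast
  have pV: "p \<in> V" using V(2) vV p closed_sequentially by blast
  have "(norm (x - p))\<^sup>2 \<le> d"
  proof (rule LIMSEQ_le)
    show "(\<lambda>n. (norm (x - v n))\<^sup>2) \<longlonglongrightarrow> (norm (x - p))\<^sup>2" by (intro tendsto_intros p)
    show "(\<lambda>n. d + inverse (real (Suc n))) \<longlonglongrightarrow> d"
      using tendsto_add[OF tendsto_const LIMSEQ_inverse_real_of_nat, of d] by simp
  qed (use v less_imp_le in blast)
  moreover have "(x - p) \<bullet> w = 0" if "w \<in> V" "(norm (x - p))\<^sup>2 \<le> d" for w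
  proof (cases "w = 0")
    case False
    \<comment> \<open>This \<open>t\<close> minimizes the distance from \<open>x\<close> to
      \<open>p + t *\<^sub>R w\<close>. The square of the distance would drop by
      \<open>((x - p) \<bullet> w)\<^sup>2 / (w \<bullet> w)\<close>, so this quantity must
      vanish.\<close>
    define t where "t = ((x - p) \<bullet> w) / (w \<bullet> w)"
    have ww: "w \<bullet> w > 0" using False by simp
    have "p + t *\<^sub>R w \<in> V" using V pV that by (simp add: subspace_scale subspace_add)
    then have "(norm (x - p))\<^sup>2 \<le> (norm (x - (p + t *\<^sub>R w)))\<^sup>2" using d_le[of "p + t *\<^sub>R w"] that by linarith
    also have "\<dots> = (norm (x - p))\<^sup>2 - 2 * t * ((x - p) \<bullet> w) + t * t * (w \<bullet> w)"
      unfolding power2_norm_eq_inner by (simp add: algebra_simps inner_commute)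
    also have "\<dots> = (norm (x - p))\<^sup>2 - ((x - p) \<bullet> w)\<^sup>2 / (w \<bullet> w)"
      using ww by (simp add: t_def power2_eq_square field_simps)
    finally have "((x - p) \<bullet> w)\<^sup>2 / (w \<bullet> w) \<le> 0" by simp
    then have "((x - p) \<bullet> w)\<^sup>2 \<le> 0" using ww by (simp add: field_simps)
    then show ?thesis by simp
  qed simp
  ultimately show ?thesis using pV by blast
qed

definition hproj :: "'h::{real_inner,banach} set \<Rightarrow> 'h \<Rightarrow> 'h" where
  "hproj V x = (SOME p. p \<in> V \<and> (\<forall>v\<in>V. (x - p) \<bullet> v = 0))"

context
  fixes V :: "'h::{real_inner,banach} set"
  assumes V: "subspace V" "closed V"
begin

lemma hproj_in: "hproj V x \<in> V"
  and hproj_orth: "v \<in> V \<Longrightarrow> (x - hproj V x) \<bullet> v = 0"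
proof -
  have "hproj V x \<in> V \<and> (\<forall>v\<in>V. (x - hproj V x) \<bullet> v = 0)"
    unfolding hproj_def using closed_subspace_projection_exists[OF V, of x]
    by (intro someI_ex[of "\<lambda>p. p \<in> V \<and> (\<forall>v\<in>V. (x - p) \<bullet> v = 0)"]) blast
  then show "hproj V x \<in> V" "v \<in> V \<Longrightarrow> (x - hproj V x) \<bullet> v = 0" by auto
qed

lemma hproj_inner: "v \<in> V \<Longrightarrow> hproj V x \<bullet> v = x \<bullet> v"
  using hproj_orth[of v x] by (simp add: inner_diff_left)

lemma hproj_unique:
  assumes "p \<in> V" "\<And>v. v \<in> V \<Longrightarrow> p \<bullet> v = x \<bullet> v"
  shows "hproj V x = p"
proof -
  let ?d = "hproj V x - p"
  have "?d \<in> V" using V hproj_in assms by (simp add: subspace_diff)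
  then have "?d \<bullet> ?d = 0" using hproj_inner[of ?d x] assms(2)[of ?d] by (simp add: inner_diff_left)
  then show ?thesis by simp
qed

lemma linear_hproj: "linear (hproj V)"
proof (rule linearI)
  show "hproj V (x + y) = hproj V x + hproj V y" for x y
    using V by (intro hproj_unique) (auto simp: subspace_add hproj_in inner_add_left hproj_inner)
  show "hproj V (c *\<^sub>R x) = c *\<^sub>R hproj V x" for c x
    using V by (intro hproj_unique) (auto simp: subspace_scale hproj_in hproj_inner)
qed

lemma hproj_symmetric: "hproj V x \<bullet> y = x \<bullet> hproj V y"
  using hproj_inner[of "hproj V y" x] hproj_inner[of "hproj V x" y] hproj_in
  by (metis inner_commute)

lemma norm_hproj: "(norm (hproj V x))\<^sup>2 = hproj V x \<bullet> x"
  using hproj_inner[of "hproj V x" x] hproj_in by (simp add: power2_norm_eq_inner inner_commute)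

text \<open>Expand the square of \<open>hproj V x - v\<close>. Equality holds at
  \<open>v = hproj V x\<close>, so the form \<open>hproj V x \<bullet> x\<close> is a maximum over
  trial vectors. This makes resolvent forms monotone in the form space and comparable by cutting off
  a trial function.\<close>

lemma hproj_maximizes: "v \<in> V \<Longrightarrow> 2 * (x \<bullet> v) - (norm v)\<^sup>2 \<le> hproj V x \<bullet> x"
proof -
  assume v: "v \<in> V"
  have "0 \<le> (norm (hproj V x - v))\<^sup>2" by simp
  also have "\<dots> = hproj V x \<bullet> hproj V x - 2 * (hproj V x \<bullet> v) + (norm v)\<^sup>2"
    unfolding power2_norm_eq_inner by (simp add: algebra_simps inner_commute)
  also have "\<dots> = hproj V x \<bullet> x - 2 * (x \<bullet> v) + (norm v)\<^sup>2"
    using hproj_inner[OF v] norm_hproj by (simp add: power2_norm_eq_inner)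
  finally show ?thesis by simp
qed

end

text \<open>The last inequality says \<open>A^2 \<le> A\<close>, which for symmetric
  \<open>A\<close> amounts to \<open>0 \<le> A \<le> 1\<close>. It is what the compression of an
  orthogonal projection satisfies directly.\<close>

definition pos_contraction :: "('h::real_inner \<Rightarrow> 'h) \<Rightarrow> bool" where
  "pos_contraction A \<longleftrightarrow> linear A \<and> (\<forall>x y. A x \<bullet> y = x \<bullet> A y) \<and> (\<forall>x. (norm (A x))\<^sup>2 \<le> A x \<bullet> x)"

definition compact_op :: "('h::real_normed_vector \<Rightarrow> 'h) \<Rightarrow> bool" where
  "compact_op A \<longleftrightarrow> (\<forall>x. (\<forall>n::nat. norm (x n) \<le> 1) \<longrightarrow>
     (\<exists>l r. strict_mono (r::nat \<Rightarrow> nat) \<and> (\<lambda>n. A (x (r n))) \<longlonglongrightarrow> l))"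

lemma compact_opE:
  assumes "compact_op A" "\<And>n. norm (x n) \<le> 1"
  obtains l r where "strict_mono (r::nat \<Rightarrow> nat)" "(\<lambda>n. A (x (r n))) \<longlonglongrightarrow> l"
  using assms unfolding compact_op_def by blast

definition eigenspace :: "('h::real_vector \<Rightarrow> 'h) \<Rightarrow> real \<Rightarrow> 'h set" where
  "eigenspace A a = {x. A x = a *\<^sub>R x}"

context
  fixes A :: "'h::real_inner \<Rightarrow> 'h"
  assumes A: "pos_contraction A"
begin

lemma pos_contraction_linear: "linear A"
  and pos_contraction_symmetric: "A x \<bullet> y = x \<bullet> A y"
  and pos_contraction_norm_sq: "(norm (A x))\<^sup>2 \<le> A x \<bullet> x"
  using A by (auto simp: pos_contraction_def)

lemma pos_contraction_nonneg: "0 \<le> A x \<bullet> x"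
  using pos_contraction_norm_sq[of x] zero_le_power2 order_trans by blast

lemma pos_contraction_norm: "norm (A x) \<le> norm x"
proof (cases "A x = 0")
  case False
  have "(norm (A x))\<^sup>2 \<le> norm (A x) * norm x"
    using pos_contraction_norm_sq[of x] norm_cauchy_schwarz[of "A x" x] by linarith
  then show ?thesis using False by (simp add: power2_eq_square)
qed simp

lemma pos_contraction_inner_le: "A x \<bullet> x \<le> (norm x)\<^sup>2"
proof -
  have "A x \<bullet> x \<le> norm (A x) * norm x" by (rule norm_cauchy_schwarz)
  also have "\<dots> \<le> norm x * norm x" by (intro mult_right_mono pos_contraction_norm) auto
  finally show ?thesis by (simp add: power2_eq_square)
qed

lemma pos_contraction_bounded_linear: "bounded_linear A"
  using pos_contraction_linear pos_contraction_norm
  by (intro bounded_linear_intro[where K = 1]) (auto simp: linear_add linear_cmul)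

lemma pos_contraction_tendsto: "(f \<longlongrightarrow> l) F \<Longrightarrow> ((\<lambda>x. A (f x)) \<longlongrightarrow> A l) F"
  by (rule bounded_linear.tendsto[OF pos_contraction_bounded_linear])

lemma subspace_eigenspace: "subspace (eigenspace A a)"
  using pos_contraction_linear
  by (auto simp: subspace_def eigenspace_def linear_0 linear_add linear_cmul scaleR_add_right scaleR_left_commute)

lemma closed_eigenspace: "closed (eigenspace A a)"
  unfolding eigenspace_def
  by (intro closed_Collect_eq bounded_linear.continuous_on[OF pos_contraction_bounded_linear] continuous_intros)

lemma eigenvalue_range:
  assumes "A x = a *\<^sub>R x" "x \<noteq> 0"
  shows "0 \<le> a" "a \<le> 1"
proof -
  have "0 \<le> a * (x \<bullet> x)" "a * (x \<bullet> x) \<le> 1 * (x \<bullet> x)"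
    using pos_contraction_nonneg[of x] pos_contraction_inner_le[of x] assms by (auto simp: power2_norm_eq_inner)
  moreover have "x \<bullet> x > 0" using assms by simp
  ultimately show "0 \<le> a" "a \<le> 1" by (auto simp: zero_le_mult_iff)
qed

lemma eigenvectors_orthogonal:
  assumes "A x = a *\<^sub>R x" "A y = b *\<^sub>R y" "a \<noteq> b"
  shows "x \<bullet> y = 0"
proof -
  have "a * (x \<bullet> y) = b * (x \<bullet> y)" using pos_contraction_symmetric[of x y] assms by simp
  then show ?thesis using assms(3) by simp
qed

text \<open>The Rayleigh quotient on the orthogonal complement of known eigenvectors attains its supremum.\<close>

lemma next_eigenvector:
  assumes cpt: "compact_op A" and "\<epsilon> > 0"
    and \<Phi>: "\<And>\<phi>. \<phi> \<in> \<Phi> \<Longrightarrow> \<exists>a. A \<phi> = a *\<^sub>R \<phi>"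
    and z: "\<And>\<phi>. \<phi> \<in> \<Phi> \<Longrightarrow> z \<bullet> \<phi> = 0" "norm (A z) > \<epsilon> * norm z"
  shows "\<exists>\<psi> a. norm \<psi> = 1 \<and> (\<forall>\<phi>\<in>\<Phi>. \<psi> \<bullet> \<phi> = 0) \<and> A \<psi> = a *\<^sub>R \<psi> \<and> a \<ge> \<epsilon>"
proof -
  define W where "W = {x. \<forall>\<phi>\<in>\<Phi>. x \<bullet> \<phi> = 0}"
  have W: "subspace W" unfolding W_def subspace_def by (auto simp: inner_add_left)
  have AW: "A x \<in> W" if "x \<in> W" for x
    using that \<Phi> pos_contraction_symmetric unfolding W_def by fastforce
  define S where "S = {x \<in> W. norm x = 1}"
  define M where "M = (SUP x\<in>S. A x \<bullet> x)"
  have z0: "z \<noteq> 0" using z(2) linear_0[OF pos_contraction_linear] by auto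
  have zW: "z \<in> W" using z(1) by (auto simp: W_def)
  then have "(1 / norm z) *\<^sub>R z \<in> S" using W z0 by (simp add: S_def subspace_scale)
  then have Sne: "S \<noteq> {}" by blast
  have bdd: "bdd_above ((\<lambda>x. A x \<bullet> x) ` S)"
  proof (rule bdd_aboveI2[of _ _ 1])
    show "A x \<bullet> x \<le> 1" if "x \<in> S" for x
      using that pos_contraction_inner_le[of x] by (simp add: S_def)
  qed
  have S_le: "A x \<bullet> x \<le> M" if "x \<in> S" for x
    unfolding M_def using that bdd by (rule cSUP_upper)
  have W_le: "A x \<bullet> x \<le> M * (norm x)\<^sup>2" if "x \<in> W" for x
  proof (cases "x = 0")
    case False
    then have "(1 / norm x) *\<^sub>R x \<in> S" using W that by (simp add: S_def subspace_scale)
    from S_le[OF this] show ?thesis using False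
      by (simp add: linear_cmul[OF pos_contraction_linear] power2_eq_square field_simps)
  qed (simp add: linear_0[OF pos_contraction_linear])
  have M0: "0 \<le> M" using Sne S_le pos_contraction_nonneg by (meson ex_in_conv order_trans)
  have norm_le: "norm (A x) \<le> M * norm x" if "x \<in> W" for x
  proof (cases "M = 0 \<or> A x = 0")
    case False
    then have M: "M > 0" using M0 by simp
    \<comment> \<open>Positivity at \<open>M x - A x\<close> makes maximizing sequences approximate eigenvectors.\<close>
    have "0 \<le> A (M *\<^sub>R x - A x) \<bullet> (M *\<^sub>R x - A x)" by (rule pos_contraction_nonneg)
    also have "\<dots> = M * M * (A x \<bullet> x) - 2 * M * (A x \<bullet> A x) + A (A x) \<bullet> A x"
      using pos_contraction_symmetric[of "A x" x]
      by (simp add: linear_diff[OF pos_contraction_linear] linear_cmul[OF pos_contraction_linear] algebra_simps inner_commute)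
    also have "\<dots> \<le> M * M * (M * (norm x)\<^sup>2) - 2 * M * (A x \<bullet> A x) + M * (norm (A x))\<^sup>2"
      using W_le[OF that] W_le[OF AW[OF that]] M by (intro add_mono diff_mono mult_left_mono) auto
    also have "\<dots> = M * ((M * norm x)\<^sup>2 - (norm (A x))\<^sup>2)"
      by (simp add: power2_norm_eq_inner[symmetric] power2_eq_square algebra_simps)
    finally have "(norm (A x))\<^sup>2 \<le> (M * norm x)\<^sup>2" using M by (simp add: zero_le_mult_iff)
    then show ?thesis by (rule power2_le_imp_le) (use M in auto)
  next
    case True
    then have "A x = 0"
    proof
      assume "M = 0"
      then have "(norm (A x))\<^sup>2 \<le> 0" using W_le[OF that] pos_contraction_norm_sq[of x] by (metis mult_zero_left order_trans)
      then show ?thesis by simp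
    qed
    then show ?thesis using M0 by simp
  qed
  \<comment> \<open>On the invariant complement the norm of \<open>A\<close> is at most the supremum
    \<open>M\<close> of its form, so the vector \<open>z\<close> forces
    \<open>M > \<epsilon>\<close>.\<close>
  have Me: "M > \<epsilon>" using norm_le[OF zW] z(2) z0
    by (meson less_le_trans mult_less_cancel_right_pos zero_less_norm_iff)
  have "\<exists>x\<in>S. M - inverse (real (Suc n)) < A x \<bullet> x" for n
    unfolding M_def using less_cSUP_iff[OF Sne bdd, of "M - inverse (real (Suc n))"] by (simp add: M_def)
  then obtain x where xS: "\<And>n. x n \<in> S" and x: "\<And>n. M - inverse (real (Suc n)) < A (x n) \<bullet> x n" by metis
  obtain l r where r: "strict_mono (r::nat\<Rightarrow>nat)" and l: "(\<lambda>n. A (x (r n))) \<longlonglongrightarrow> l"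
    by (rule compact_opE[OF cpt, of x]) (use xS in \<open>auto simp: S_def\<close>)
  \<comment> \<open>With \<open>norm (x n) = 1\<close> and \<open>norm (A (x n)) \<le> M\<close> the
    expanded square is at most \<open>2 * M * (M - A (x n) \<bullet> x n)\<close>: almost maximizers
    are almost eigenvectors.\<close>
  have "(norm (A (x n) - M *\<^sub>R x n))\<^sup>2 \<le> 2 * M * inverse (real (Suc n))" for n
  proof -
    have "norm (A (x n)) \<le> M" using norm_le[of "x n"] xS[of n] by (simp add: S_def)
    then have "(norm (A (x n)))\<^sup>2 \<le> M\<^sup>2" using norm_ge_zero power_mono by blast
    moreover have "(norm (A (x n) - M *\<^sub>R x n))\<^sup>2 = (norm (A (x n)))\<^sup>2 - 2 * M * (A (x n) \<bullet> x n) + M\<^sup>2 * (norm (x n))\<^sup>2"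
      unfolding power2_norm_eq_inner by (simp add: algebra_simps inner_commute power2_eq_square)
    moreover have "M * (A (x n) \<bullet> x n) \<ge> M * (M - inverse (real (Suc n)))"
      using x[of n] M0 by (intro mult_left_mono) auto
    ultimately show ?thesis using xS[of n] by (simp add: S_def power2_eq_square algebra_simps)
  qed
  then have "norm (A (x n) - M *\<^sub>R x n) \<le> sqrt (2 * M * inverse (real (Suc n)))" for n
    by (simp add: real_le_rsqrt)
  moreover have lim0: "(\<lambda>n. sqrt (2 * M * inverse (real (Suc n)))) \<longlonglongrightarrow> 0"
    using tendsto_real_sqrt[OF tendsto_mult[OF tendsto_const LIMSEQ_inverse_real_of_nat, of "2*M"]] by simp
  ultimately have "(\<lambda>n. A (x n) - M *\<^sub>R x n) \<longlonglongrightarrow> 0"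
    by (intro Lim_null_comparison[OF _ lim0]) auto
  then have "(\<lambda>n. A (x (r n)) - M *\<^sub>R x (r n)) \<longlonglongrightarrow> 0"
    using LIMSEQ_subseq_LIMSEQ[OF _ r] by (auto simp: o_def)
  \<comment> \<open>Compactness gives convergence of the images only; dividing by
    \<open>M > 0\<close> transfers it to the vectors.\<close>
  from tendsto_diff[OF l this] have "(\<lambda>n. M *\<^sub>R x (r n)) \<longlonglongrightarrow> l" by simp
  from tendsto_scaleR[OF tendsto_const this, of "1/M"]
  have lim: "(\<lambda>n. x (r n)) \<longlonglongrightarrow> (1/M) *\<^sub>R l" using Me \<open>\<epsilon> > 0\<close> by simp
  define \<psi> where "\<psi> = (1/M) *\<^sub>R l"
  have "(\<lambda>n. A (x (r n))) \<longlonglongrightarrow> A \<psi>" using pos_contraction_tendsto[OF lim] by (simp add: \<psi>_def)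
  then have "A \<psi> = l" using l LIMSEQ_unique by blast
  then have "A \<psi> = M *\<^sub>R \<psi>" using Me \<open>\<epsilon> > 0\<close> by (simp add: \<psi>_def)
  moreover have "norm \<psi> = 1"
  proof -
    have "(\<lambda>n. norm (x (r n))) \<longlonglongrightarrow> norm \<psi>" unfolding \<psi>_def by (intro tendsto_norm lim)
    moreover have "norm (x (r n)) = 1" for n using xS by (simp add: S_def)
    ultimately show ?thesis using LIMSEQ_unique[OF tendsto_const] by fastforce
  qed
  moreover have "\<psi> \<bullet> \<phi> = 0" if "\<phi> \<in> \<Phi>" for \<phi>
  proof -
    have "(\<lambda>n. x (r n) \<bullet> \<phi>) \<longlonglongrightarrow> \<psi> \<bullet> \<phi>" unfolding \<psi>_def by (intro tendsto_intros lim)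
    moreover have "x (r n) \<bullet> \<phi> = 0" for n using xS that by (simp add: S_def W_def)
    ultimately show ?thesis using LIMSEQ_unique[OF tendsto_const] by fastforce
  qed
  ultimately show ?thesis using Me by (intro exI[of _ \<psi>] exI[of _ M]) auto
qed

end

section \<open>Finite orthonormal systems and the truncated spectral decomposition\<close>

definition orthonormal :: "'h::real_inner set \<Rightarrow> bool" where
  "orthonormal \<Phi> \<longleftrightarrow> (\<forall>\<phi>\<in>\<Phi>. norm \<phi> = 1) \<and> (\<forall>\<phi>\<in>\<Phi>. \<forall>\<psi>\<in>\<Phi>. \<phi> \<noteq> \<psi> \<longrightarrow> \<phi> \<bullet> \<psi> = 0)"

text \<open>The images of two distinct eigenvectors are orthogonal and of length at least
  \<open>\<epsilon>\<close>, hence at distance at least \<open>\<epsilon>\<close>; no subsequence of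
  such images is Cauchy.\<close>

lemma infinite_orthonormal_not_compact:
  assumes A: "compact_op A" and \<Phi>: "orthonormal \<Phi>" "infinite \<Phi>" "\<epsilon> > 0"
    and a: "\<And>\<phi>. \<phi> \<in> \<Phi> \<Longrightarrow> A \<phi> = a \<phi> *\<^sub>R \<phi>" "\<And>\<phi>. \<phi> \<in> \<Phi> \<Longrightarrow> a \<phi> \<ge> \<epsilon>"
  shows False
proof -
  obtain x :: "nat \<Rightarrow> 'a" where x: "inj x" "range x \<subseteq> \<Phi>"
    using infinite_countable_subset[OF \<Phi>(2)] by blast
  then have xn: "norm (x n) = 1" for n using \<Phi> by (auto simp: orthonormal_def)
  obtain l r where r: "strict_mono (r::nat\<Rightarrow>nat)" and l: "(\<lambda>n. A (x (r n))) \<longlonglongrightarrow> l"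
    by (rule compact_opE[OF A, of x]) (use xn in auto)
  from l have "Cauchy (\<lambda>n. A (x (r n)))" by (simp add: LIMSEQ_imp_Cauchy)
  then obtain N where N: "\<And>m n. m \<ge> N \<Longrightarrow> n \<ge> N \<Longrightarrow> dist (A (x (r m))) (A (x (r n))) < \<epsilon>"
    using \<Phi>(3) unfolding Cauchy_def by blast
  let ?u = "x (r N)" and ?v = "x (r (Suc N))"
  have ne: "?u \<noteq> ?v" using x(1) r by (metis injD lessI less_irrefl strict_mono_less)
  have uv: "?u \<in> \<Phi>" "?v \<in> \<Phi>" using x by auto
  then have o: "?u \<bullet> ?v = 0" "?v \<bullet> ?u = 0" using \<Phi>(1) ne by (auto simp: orthonormal_def inner_commute)
  have eq: "(norm (A ?u - A ?v))\<^sup>2 = (a ?u)\<^sup>2 + (a ?v)\<^sup>2"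
    unfolding power2_norm_eq_inner using a(1) uv o xn
    by (simp add: inner_diff_left inner_diff_right power2_eq_square norm_eq_1)
  have "\<epsilon>\<^sup>2 \<le> (a ?u)\<^sup>2" using a(2)[OF uv(1)] \<Phi>(3) by (intro power_mono) auto
  then have "\<epsilon>\<^sup>2 \<le> (norm (A ?u - A ?v))\<^sup>2" unfolding eq by (simp add: add_increasing2)
  then have "norm (A ?u - A ?v) \<ge> \<epsilon>" by (rule power2_le_imp_le) simp
  then show False using N[of N "Suc N"] by (simp add: dist_norm)
qed

text \<open>A finite form of the spectral theorem: \<open>A\<close> is diagonalized above the level
  \<open>\<epsilon>\<close> and has norm at most \<open>\<epsilon>\<close> on the rest. Only
  finitely many vectors have to be controlled when \<open>A\<close> is later perturbed.\<close>

definition eigen_truncation :: "('h::real_inner \<Rightarrow> 'h) \<Rightarrow> real \<Rightarrow> 'h set \<Rightarrow> ('h \<Rightarrow> real) \<Rightarrow> bool" where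
  "eigen_truncation A \<epsilon> \<Phi> a \<longleftrightarrow> finite \<Phi> \<and> orthonormal \<Phi> \<and>
     (\<forall>\<phi>\<in>\<Phi>. A \<phi> = a \<phi> *\<^sub>R \<phi> \<and> \<epsilon> \<le> a \<phi> \<and> a \<phi> \<le> 1) \<and>
     (\<forall>x. (\<forall>\<phi>\<in>\<Phi>. x \<bullet> \<phi> = 0) \<longrightarrow> norm (A x) \<le> \<epsilon> * norm x)"

text \<open>Zorn's lemma yields a maximal orthonormal set of eigenvectors with eigenvalues at least
  \<open>\<epsilon>\<close>. It is finite by compactness, and if \<open>A\<close> still exceeded
  \<open>\<epsilon>\<close> on the complement, \<open>next_eigenvector\<close> would enlarge
  it.\<close>

lemma compact_spectral_truncation:
  fixes A :: "'h::real_inner \<Rightarrow> 'h"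
  assumes A: "pos_contraction A" "compact_op A" and e: "\<epsilon> > 0"
  shows "\<exists>\<Phi> a. eigen_truncation A \<epsilon> \<Phi> a"
proof -
  define \<O> where "\<O> = {\<Phi>. orthonormal \<Phi> \<and> (\<forall>\<phi>\<in>\<Phi>. \<exists>a. A \<phi> = a *\<^sub>R \<phi> \<and> a \<ge> \<epsilon>)}"
  have "\<exists>M\<in>\<O>. \<forall>X\<in>\<O>. M \<subseteq> X \<longrightarrow> X = M"
  proof (rule subset_Zorn')
    fix C assume C: "subset.chain \<O> C"
    have "orthonormal (\<Union>C)" unfolding orthonormal_def
    proof (intro conjI ballI impI)
      show "norm \<phi> = 1" if "\<phi> \<in> \<Union>C" for \<phi>
        using that C by (auto simp: subset.chain_def \<O>_def orthonormal_def)
      show "\<phi> \<bullet> \<psi> = 0" if h: "\<phi> \<in> \<Union>C" "\<psi> \<in> \<Union>C" "\<phi> \<noteq> \<psi>" for \<phi> \<psi>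
      proof -
        obtain X Y where "X \<in> C" "Y \<in> C" "\<phi> \<in> X" "\<psi> \<in> Y" using h by blast
        moreover have "X \<subseteq> Y \<or> Y \<subseteq> X" using C \<open>X \<in> C\<close> \<open>Y \<in> C\<close> by (simp add: subset_chain_def)
        ultimately obtain Z where Z: "Z \<in> C" "\<phi> \<in> Z" "\<psi> \<in> Z" by blast
        then have "Z \<in> \<O>" using C by (auto simp: subset_chain_def)
        then show ?thesis using Z h(3) by (simp add: \<O>_def orthonormal_def)
      qed
    qed
    then show "\<Union>C \<in> \<O>" using C unfolding subset_chain_def \<O>_def by blast
  qed
  then obtain \<Phi> where \<Phi>: "\<Phi> \<in> \<O>" and max: "\<And>X. X \<in> \<O> \<Longrightarrow> \<Phi> \<subseteq> X \<Longrightarrow> X = \<Phi>" by blast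
  obtain a where a: "\<And>\<phi>. \<phi> \<in> \<Phi> \<Longrightarrow> A \<phi> = a \<phi> *\<^sub>R \<phi> \<and> a \<phi> \<ge> \<epsilon>"
    using \<Phi> bchoice[of \<Phi> "\<lambda>\<phi> a. A \<phi> = a *\<^sub>R \<phi> \<and> a \<ge> \<epsilon>"] by (auto simp: \<O>_def)
  have on: "orthonormal \<Phi>" using \<Phi> by (simp add: \<O>_def)
  have "eigen_truncation A \<epsilon> \<Phi> a" unfolding eigen_truncation_def
  proof (intro conjI ballI allI impI)
    show "finite \<Phi>" using infinite_orthonormal_not_compact[OF A(2) on _ e] a by blast
    show "a \<phi> \<le> 1" if "\<phi> \<in> \<Phi>" for \<phi>
      using a[OF that] eigenvalue_range(2)[OF A(1), of \<phi> "a \<phi>"] on that by (force simp: orthonormal_def)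
    show "norm (A x) \<le> \<epsilon> * norm x" if x: "\<forall>\<phi>\<in>\<Phi>. x \<bullet> \<phi> = 0" for x
    proof (rule ccontr)
      assume "\<not> norm (A x) \<le> \<epsilon> * norm x"
      then obtain \<psi> b where \<psi>: "norm \<psi> = 1" "\<And>\<phi>. \<phi> \<in> \<Phi> \<Longrightarrow> \<psi> \<bullet> \<phi> = 0" "A \<psi> = b *\<^sub>R \<psi>" "b \<ge> \<epsilon>"
        using next_eigenvector[OF A e, of \<Phi> x] a x by (metis not_le)
      then have "insert \<psi> \<Phi> \<in> \<O>" using \<Phi> by (auto simp: \<O>_def orthonormal_def inner_commute)
      then have "\<psi> \<in> \<Phi>" using max[of "insert \<psi> \<Phi>"] by auto
      then show False using \<psi>(1) \<psi>(2)[of \<psi>] by auto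
    qed
  qed (use a on in auto)
  then show ?thesis by blast
qed

lemma orthonormal_sum_inner:
  assumes "finite \<Phi>" "orthonormal \<Phi>" "\<psi> \<in> \<Phi>"
  shows "(\<Sum>\<phi>\<in>\<Phi>. c \<phi> *\<^sub>R \<phi>) \<bullet> \<psi> = c \<psi>"
proof -
  have "(\<Sum>\<phi>\<in>\<Phi>. c \<phi> *\<^sub>R \<phi>) \<bullet> \<psi> = (\<Sum>\<phi>\<in>\<Phi>. if \<phi> = \<psi> then c \<psi> else 0)"
    unfolding inner_sum_left using assms(2,3)
    by (intro sum.cong) (auto simp: orthonormal_def norm_eq_1)
  then show ?thesis using assms by simp
qed

lemma orthonormal_sum_norm:
  assumes "finite \<Phi>" "orthonormal \<Phi>"
  shows "(norm (\<Sum>\<phi>\<in>\<Phi>. c \<phi> *\<^sub>R \<phi>))\<^sup>2 = (\<Sum>\<phi>\<in>\<Phi>. (c \<phi>)\<^sup>2)"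
  unfolding power2_norm_eq_inner inner_sum_right
  using orthonormal_sum_inner[OF assms] by (simp add: power2_eq_square)

context
  fixes \<Phi> :: "'h::real_inner set"
  assumes \<Phi>: "finite \<Phi>" "orthonormal \<Phi>"
begin

definition fourier_sum :: "'h \<Rightarrow> 'h" where
  "fourier_sum x = (\<Sum>\<phi>\<in>\<Phi>. (x \<bullet> \<phi>) *\<^sub>R \<phi>)"

lemma fourier_sum_inner: "\<psi> \<in> \<Phi> \<Longrightarrow> fourier_sum x \<bullet> \<psi> = x \<bullet> \<psi>"
  unfolding fourier_sum_def by (rule orthonormal_sum_inner[OF \<Phi>])

lemma fourier_sum_residual: "\<psi> \<in> \<Phi> \<Longrightarrow> (x - fourier_sum x) \<bullet> \<psi> = 0"
  by (simp add: inner_diff_left fourier_sum_inner)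

lemma fourier_sum_in_span: "fourier_sum x \<in> span \<Phi>"
  unfolding fourier_sum_def by (intro span_sum span_scale span_base)

lemma fourier_sum_pythagoras:
  "(norm x)\<^sup>2 = (norm (fourier_sum x))\<^sup>2 + (norm (x - fourier_sum x))\<^sup>2"
proof -
  have "(x - fourier_sum x) \<bullet> fourier_sum x = 0"
    by (simp add: fourier_sum_def[of x] inner_sum_right fourier_sum_residual[unfolded fourier_sum_def])
  then show ?thesis
    unfolding power2_norm_eq_inner by (simp add: algebra_simps inner_commute)
qed

lemma norm_fourier_residual: "norm (x - fourier_sum x) \<le> norm x"
  by (rule power2_le_imp_le) (use fourier_sum_pythagoras[of x] in auto)

end

lemma eigen_truncationD:
  assumes "eigen_truncation A \<epsilon> \<Phi> a"
  shows "finite \<Phi>" "orthonormal \<Phi>" "\<And>\<phi>. \<phi> \<in> \<Phi> \<Longrightarrow> A \<phi> = a \<phi> *\<^sub>R \<phi>"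
    "\<And>\<phi>. \<phi> \<in> \<Phi> \<Longrightarrow> \<epsilon> \<le> a \<phi> \<and> a \<phi> \<le> 1"
    "\<And>x. (\<And>\<phi>. \<phi> \<in> \<Phi> \<Longrightarrow> x \<bullet> \<phi> = 0) \<Longrightarrow> norm (A x) \<le> \<epsilon> * norm x"
  using assms by (auto simp: eigen_truncation_def)

text \<open>The approximant is \<open>A\<close> applied to the Fourier sum of \<open>x\<close>; the
  error is \<open>A\<close> applied to the residual, which is orthogonal to \<Phi>.\<close>

lemma compact_approx_by_eigenvectors:
  fixes A :: "'h::real_inner \<Rightarrow> 'h"
  assumes A: "pos_contraction A"
    and T: "eigen_truncation A \<epsilon> \<Phi> a" and e: "\<epsilon> \<ge> 0"
  shows "\<exists>h\<in>span \<Phi>. norm (A x - h) \<le> \<epsilon> * norm x"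
proof
  note \<Phi> = eigen_truncationD[OF T]
  let ?h = "A (fourier_sum \<Phi> x)"
  have "?h = (\<Sum>\<phi>\<in>\<Phi>. (x \<bullet> \<phi>) *\<^sub>R (a \<phi> *\<^sub>R \<phi>))"
    unfolding fourier_sum_def[OF \<Phi>(1,2)] linear_sum[OF pos_contraction_linear[OF A]]
    using \<Phi>(3) by (intro sum.cong) (auto simp: linear_cmul[OF pos_contraction_linear[OF A]])
  then show "?h \<in> span \<Phi>" by (simp add: span_sum span_scale span_base)
  have "norm (A x - ?h) = norm (A (x - fourier_sum \<Phi> x))"
    by (simp add: linear_diff[OF pos_contraction_linear[OF A]])
  also have "\<dots> \<le> \<epsilon> * norm (x - fourier_sum \<Phi> x)"
    by (intro \<Phi>(5) fourier_sum_residual[OF \<Phi>(1,2)])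
  also have "\<dots> \<le> \<epsilon> * norm x" by (intro mult_left_mono norm_fourier_residual[OF \<Phi>(1,2)] e)
  finally show "norm (A x - ?h) \<le> \<epsilon> * norm x" .
qed

text \<open>Remove from an eigenvector its components with the same eigenvalue. The rest is
  orthogonal to all of \<Phi>, the other eigenvalues being different, so \<open>A\<close> shrinks it
  by at least the factor \<open>\<epsilon>\<close>, yet multiplies it by
  \<open>a > \<epsilon>\<close>; it vanishes.\<close>

lemma eigenspace_subset_span:
  fixes A :: "'h::real_inner \<Rightarrow> 'h"
  assumes A: "pos_contraction A"
    and T: "eigen_truncation A \<epsilon> \<Phi> b" and e: "0 \<le> \<epsilon>" "\<epsilon> < a"
  shows "eigenspace A a \<subseteq> span {\<phi>\<in>\<Phi>. b \<phi> = a}"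
proof
  note \<Phi> = eigen_truncationD[OF T]
  fix x assume x: "x \<in> eigenspace A a"
  let ?\<Psi> = "{\<phi>\<in>\<Phi>. b \<phi> = a}"
  have \<Psi>: "finite ?\<Psi>" "orthonormal ?\<Psi>" using \<Phi> by (auto simp: orthonormal_def)
  let ?p = "fourier_sum ?\<Psi> x"
  have pE: "?p \<in> eigenspace A a"
    unfolding fourier_sum_def[OF \<Psi>] using \<Phi>
    by (intro subspace_sum[OF subspace_eigenspace[OF A]] subspace_scale[OF subspace_eigenspace[OF A]])
       (auto simp: eigenspace_def)
  let ?y = "x - ?p"
  have yE: "?y \<in> eigenspace A a" using x pE subspace_eigenspace[OF A] by (simp add: subspace_diff)
  have "?y \<bullet> \<phi> = 0" if "\<phi> \<in> \<Phi>" for \<phi>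
  proof (cases "b \<phi> = a")
    case True then show ?thesis using fourier_sum_residual[OF \<Psi>, of \<phi> x] that by simp
  next
    case False then show ?thesis
      using eigenvectors_orthogonal[OF A, of ?y a \<phi> "b \<phi>"] yE \<Phi>(3)[OF that] by (auto simp: eigenspace_def)
  qed
  then have "norm (A ?y) \<le> \<epsilon> * norm ?y" by (rule \<Phi>(5))
  then have "a * norm ?y \<le> \<epsilon> * norm ?y" using yE e by (simp add: eigenspace_def)
  then have "norm ?y = 0" using e
    by (simp add: mult_le_cancel_right)
  then show "x \<in> span ?\<Psi>" using fourier_sum_in_span[OF \<Psi>, of x] by simp
qed

section \<open>Multiplicities and stability of eigenvalues\<close>

definition has_dim :: "'h::real_vector set \<Rightarrow> nat \<Rightarrow> bool" where
  "has_dim E m \<longleftrightarrow> (\<exists>B. finite B \<and> independent B \<and> span B = E \<and> card B = m)"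

lemma eigenspace_finite_dim:
  fixes A :: "'h::real_inner \<Rightarrow> 'h"
  assumes A: "pos_contraction A" "compact_op A" and a: "a > 0"
  obtains m where "has_dim (eigenspace A a) m"
proof -
  obtain \<Phi> b where T: "eigen_truncation A (a/2) \<Phi> b"
    using compact_spectral_truncation[OF A half_gt_zero[OF a]] by blast
  note \<Phi> = eigen_truncationD[OF T]
  have sub: "eigenspace A a \<subseteq> span {\<phi>\<in>\<Phi>. b \<phi> = a}"
    using a by (intro eigenspace_subset_span[OF A(1) T]) auto
  obtain B where B: "B \<subseteq> eigenspace A a" "independent B" "eigenspace A a \<subseteq> span B"
    by (rule real_vector.maximal_independent_subset)
  have "finite B" using independent_span_bound[of "{\<phi>\<in>\<Phi>. b \<phi> = a}" B] B sub \<Phi>(1) by auto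
  moreover have "span B = eigenspace A a"
    using B span_minimal[OF B(1) subspace_eigenspace[OF A(1)]] by auto
  ultimately show ?thesis using that B(2) unfolding has_dim_def by blast
qed

text \<open>A truncation at level \<open>1/(n+1)\<close> lists all eigenvalues above it.
  Countability is what later lets a room length avoid a prescribed eigenvalue.\<close>

lemma countable_eigenvalues:
  fixes A :: "'h::real_inner \<Rightarrow> 'h"
  assumes A: "pos_contraction A" "compact_op A"
  shows "countable {a. a > 0 \<and> eigenspace A a \<noteq> {0}}"
proof -
  have "finite {a. a > inverse (real (Suc n)) \<and> eigenspace A a \<noteq> {0}}" for n
  proof -
    have i0: "0 < inverse (real (Suc n))" by simp
    obtain \<Phi> b where T: "eigen_truncation A (inverse (real (Suc n))) \<Phi> b"
    using compact_spectral_truncation[OF A i0] by blast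
  note \<Phi> = eigen_truncationD[OF T]
    have "a \<in> b ` \<Phi>" if "a > inverse (real (Suc n))" "eigenspace A a \<noteq> {0}" for a
    proof (rule ccontr)
      assume "a \<notin> b ` \<Phi>"
      then have "{\<phi>\<in>\<Phi>. b \<phi> = a} = {}" by auto
      then have "eigenspace A a \<subseteq> {0}"
        using eigenspace_subset_span[OF A(1) T _ that(1)] by (metis inverse_nonnegative_iff_nonnegative of_nat_0_le_iff span_empty)
      then show False using that(2) subspace_0[OF subspace_eigenspace[OF A(1), of a]] by blast
    qed
    then have "{a. a > inverse (real (Suc n)) \<and> eigenspace A a \<noteq> {0}} \<subseteq> b ` \<Phi>" by blast
    then show ?thesis by (rule finite_surj[OF \<Phi>(1)])
  qed
  moreover have "{a. a > 0 \<and> eigenspace A a \<noteq> {0}}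
      \<subseteq> (\<Union>n. {a. a > inverse (real (Suc n)) \<and> eigenspace A a \<noteq> {0}})"
    using reals_Archimedean by auto
  ultimately show ?thesis
    by (intro countable_subset[OF \<open>_ \<subseteq> _\<close>] countable_UN) (auto intro: countable_finite)
qed

lemma compact_eigenvalue_exists:
  fixes A :: "'h::real_inner \<Rightarrow> 'h"
  assumes A: "pos_contraction A" "compact_op A" and x: "A x \<noteq> 0"
  shows "\<exists>a>0. eigenspace A a \<noteq> {0}"
proof -
  have x0: "x \<noteq> 0" using x linear_0[OF pos_contraction_linear[OF A(1)]] by auto
  define \<epsilon> where "\<epsilon> = norm (A x) / (2 * norm x)"
  have e: "\<epsilon> > 0" "\<epsilon> * norm x < norm (A x)" using x x0 by (auto simp: \<epsilon>_def)
  obtain \<psi> a where "norm \<psi> = 1" "A \<psi> = a *\<^sub>R \<psi>" "a \<ge> \<epsilon>"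
    using next_eigenvector[OF A e(1), of "{}" x] e(2) by auto
  then have "\<psi> \<in> eigenspace A a" "\<psi> \<noteq> 0" "a > 0" using e(1) by (auto simp: eigenspace_def)
  then show ?thesis by blast
qed

text \<open>Otherwise there are unit vectors orthogonal to the eigenspace on which
  \<open>A - a\<close> tends to 0. By compactness, and since \<open>a > 0\<close>, a subsequence
  converges to a unit vector that lies in the eigenspace and is orthogonal to it.\<close>

lemma compact_spectral_gap:
  fixes A :: "'h::real_inner \<Rightarrow> 'h"
  assumes A: "pos_contraction A" "compact_op A" and a: "a > 0"
  obtains \<gamma> where "\<gamma> > 0" "\<And>x. (\<And>y. y \<in> eigenspace A a \<Longrightarrow> x \<bullet> y = 0) \<Longrightarrow> \<gamma> * norm x \<le> norm (A x - a *\<^sub>R x)"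
proof (rule ccontr)
  let ?W = "{x. \<forall>y\<in>eigenspace A a. x \<bullet> y = 0}"
  assume "\<not> thesis"
  then have "\<exists>x\<in>?W. norm (A x - a *\<^sub>R x) < inverse (real (Suc n)) * norm x" for n
    using that[of "inverse (real (Suc n))"] by (force simp: not_le)
  then have "\<forall>n. \<exists>x. x \<in> ?W \<and> norm (A x - a *\<^sub>R x) < inverse (real (Suc n)) * norm x" by blast
  from choice[OF this] obtain z where zW: "\<And>n. z n \<in> ?W"
    and z: "\<And>n. norm (A (z n) - a *\<^sub>R z n) < inverse (real (Suc n)) * norm (z n)"
    by blast
  define x where "x n = (1 / norm (z n)) *\<^sub>R z n" for n
  have z0: "z n \<noteq> 0" for n using z[of n] by (metis mult_zero_right norm_not_less_zero norm_zero)
  have xn: "norm (x n) = 1" for n using z0 by (simp add: x_def)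
  have xW: "x n \<in> ?W" for n using zW by (auto simp: x_def)
  have "A (x n) - a *\<^sub>R x n = (1 / norm (z n)) *\<^sub>R (A (z n) - a *\<^sub>R z n)" for n
    by (simp add: x_def linear_cmul[OF pos_contraction_linear[OF A(1)]] scaleR_diff_right)
  then have "norm (A (x n) - a *\<^sub>R x n) = norm (A (z n) - a *\<^sub>R z n) / norm (z n)" for n by simp
  then have "norm (A (x n) - a *\<^sub>R x n) \<le> inverse (real (Suc n))" for n
    using z[of n] z0[of n] by (simp add: divide_le_eq less_imp_le)
  then have lim0: "(\<lambda>n. A (x n) - a *\<^sub>R x n) \<longlonglongrightarrow> 0"
    by (intro Lim_null_comparison[OF _ LIMSEQ_inverse_real_of_nat]) auto
  obtain l r where r: "strict_mono (r::nat\<Rightarrow>nat)" and l: "(\<lambda>n. A (x (r n))) \<longlonglongrightarrow> l"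
    by (rule compact_opE[OF A(2), of x]) (use xn in auto)
  have "(\<lambda>n. A (x (r n)) - a *\<^sub>R x (r n)) \<longlonglongrightarrow> 0"
    using LIMSEQ_subseq_LIMSEQ[OF lim0 r] by (auto simp: o_def)
  from tendsto_diff[OF l this] have "(\<lambda>n. a *\<^sub>R x (r n)) \<longlonglongrightarrow> l" by simp
  from tendsto_scaleR[OF tendsto_const this, of "1/a"]
  have lim: "(\<lambda>n. x (r n)) \<longlonglongrightarrow> (1/a) *\<^sub>R l" using a by simp
  define \<psi> where "\<psi> = (1/a) *\<^sub>R l"
  have "(\<lambda>n. A (x (r n))) \<longlonglongrightarrow> A \<psi>" using pos_contraction_tendsto[OF A(1) lim] by (simp add: \<psi>_def)
  then have "A \<psi> = l" using l LIMSEQ_unique by blast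
  then have \<psi>E: "\<psi> \<in> eigenspace A a" using a by (simp add: \<psi>_def eigenspace_def)
  have "(\<lambda>n. x (r n) \<bullet> \<psi>) \<longlonglongrightarrow> \<psi> \<bullet> \<psi>" using lim unfolding \<psi>_def by (intro tendsto_intros)
  moreover have "x (r n) \<bullet> \<psi> = 0" for n using xW \<psi>E by blast
  ultimately have "\<psi> \<bullet> \<psi> = 0" using LIMSEQ_unique[OF tendsto_const] by fastforce
  moreover have "(\<lambda>n. norm (x (r n))) \<longlonglongrightarrow> norm \<psi>" unfolding \<psi>_def by (intro tendsto_norm lim)
  then have "norm \<psi> = 1" using xn LIMSEQ_unique[OF tendsto_const] by fastforce
  ultimately show False by simp
qed

text \<open>Truncate at \<open>a/2\<close>. On the span of the truncation all eigenvalues would be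
  farther than \<delta> from \<open>a\<close>; on its complement \<open>A\<close> is at most
  \<open>a/2\<close>, so \<open>A - a\<close> is bounded below by \<open>a/2 > \<delta>\<close>. The
  two parts are orthogonal, and Pythagoras contradicts the smallness of
  \<open>(A - a) u\<close>.\<close>

lemma approximate_eigenvector_eigenvalue:
  fixes A :: "'h::real_inner \<Rightarrow> 'h"
  assumes A: "pos_contraction A" "compact_op A" and d: "0 < \<delta>" "2 * \<delta> < a"
    and u: "norm (A u - a *\<^sub>R u) \<le> \<delta> * norm u" "u \<noteq> 0"
  shows "\<exists>b. \<bar>b - a\<bar> \<le> \<delta> \<and> eigenspace A b \<noteq> {0}"
proof (rule ccontr)
  assume no: "\<not> ?thesis"
  have a0: "0 < a" using d by linarith
  obtain \<Phi> b where T: "eigen_truncation A (a/2) \<Phi> b"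
    using compact_spectral_truncation[OF A half_gt_zero[OF a0]] by blast
  note \<Phi> = eigen_truncationD[OF T]
  have far: "\<bar>b \<phi> - a\<bar> > \<delta>" if "\<phi> \<in> \<Phi>" for \<phi>
  proof -
    have "\<phi> \<in> eigenspace A (b \<phi>)" "\<phi> \<noteq> 0" using \<Phi>(2,3) that by (auto simp: eigenspace_def orthonormal_def)
    then show ?thesis using no by (metis not_le singletonD)
  qed
  let ?p = "fourier_sum \<Phi> u"
  let ?y = "u - ?p"
  have y: "?y \<bullet> \<phi> = 0" if "\<phi> \<in> \<Phi>" for \<phi> using fourier_sum_residual[OF \<Phi>(1,2) that] .
  have Ap: "A ?p - a *\<^sub>R ?p = (\<Sum>\<phi>\<in>\<Phi>. ((b \<phi> - a) * (u \<bullet> \<phi>)) *\<^sub>R \<phi>)"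
    unfolding fourier_sum_def[OF \<Phi>(1,2)] linear_sum[OF pos_contraction_linear[OF A(1)]]
    by (simp add: scaleR_sum_right sum_subtractf[symmetric] linear_cmul[OF pos_contraction_linear[OF A(1)]]
        \<Phi>(3) algebra_simps cong: sum.cong)
  have "(norm (A ?p - a *\<^sub>R ?p))\<^sup>2 = (\<Sum>\<phi>\<in>\<Phi>. (b \<phi> - a)\<^sup>2 * (u \<bullet> \<phi>)\<^sup>2)"
    unfolding Ap orthonormal_sum_norm[OF \<Phi>(1,2)] by (simp add: power_mult_distrib)
  moreover have "\<delta>\<^sup>2 * (norm ?p)\<^sup>2 = (\<Sum>\<phi>\<in>\<Phi>. \<delta>\<^sup>2 * (u \<bullet> \<phi>)\<^sup>2)"
    unfolding fourier_sum_def[OF \<Phi>(1,2)] orthonormal_sum_norm[OF \<Phi>(1,2)] by (simp add: sum_distrib_left)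
  moreover have sq: "\<delta>\<^sup>2 < (b \<phi> - a)\<^sup>2" if "\<phi> \<in> \<Phi>" for \<phi>
    using power_strict_mono[OF far[OF that], of 2] d(1) by simp
  \<comment> \<open>Summing keeps only the weak inequality, because all coefficients may vanish.
    Strictness is recovered at the end from a coefficient that is not zero.\<close>
  moreover have "(\<Sum>\<phi>\<in>\<Phi>. \<delta>\<^sup>2 * (u \<bullet> \<phi>)\<^sup>2) \<le> (\<Sum>\<phi>\<in>\<Phi>. (b \<phi> - a)\<^sup>2 * (u \<bullet> \<phi>)\<^sup>2)"
    using sq by (intro sum_mono mult_right_mono) (auto intro: less_imp_le)
  ultimately have p_le: "\<delta>\<^sup>2 * (norm ?p)\<^sup>2 \<le> (norm (A ?p - a *\<^sub>R ?p))\<^sup>2"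
    by simp
  have "norm (A ?y - a *\<^sub>R ?y) \<ge> a * norm ?y - (a/2) * norm ?y"
    using \<Phi>(5)[of ?y] y norm_triangle_ineq2[of "a *\<^sub>R ?y" "A ?y"] d by (simp add: norm_minus_commute)
  then have "(a/2) * norm ?y \<le> norm (A ?y - a *\<^sub>R ?y)" by simp
  then have y_le: "(a/2)\<^sup>2 * (norm ?y)\<^sup>2 \<le> (norm (A ?y - a *\<^sub>R ?y))\<^sup>2"
    using d by (metis mult_nonneg_nonneg norm_ge_zero power_mono power_mult_distrib less_imp_le half_gt_zero order_less_trans mult_pos_pos zero_less_numeral)
  have orth: "(A ?p - a *\<^sub>R ?p) \<bullet> (A ?y - a *\<^sub>R ?y) = 0"
  proof -
    have "\<phi> \<bullet> (A ?y - a *\<^sub>R ?y) = 0" if "\<phi> \<in> \<Phi>" for \<phi>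
      using y[OF that] pos_contraction_symmetric[OF A(1), of \<phi> ?y] \<Phi>(3)[OF that]
      by (simp add: inner_diff_right inner_commute)
    then show ?thesis unfolding Ap by (simp add: inner_sum_left)
  qed
  have "A u - a *\<^sub>R u = (A ?p - a *\<^sub>R ?p) + (A ?y - a *\<^sub>R ?y)"
    by (simp add: linear_diff[OF pos_contraction_linear[OF A(1)]] algebra_simps)
  then have split: "(norm (A u - a *\<^sub>R u))\<^sup>2 = (norm (A ?p - a *\<^sub>R ?p))\<^sup>2 + (norm (A ?y - a *\<^sub>R ?y))\<^sup>2"
    using orth by (simp add: power2_norm_eq_inner inner_add_left inner_add_right inner_commute)
  have "(norm (A u - a *\<^sub>R u))\<^sup>2 \<le> \<delta>\<^sup>2 * (norm u)\<^sup>2"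
    using u(1) d(1) by (metis norm_ge_zero power_mono power_mult_distrib)
  then have le: "(norm (A ?p - a *\<^sub>R ?p))\<^sup>2 + (norm (A ?y - a *\<^sub>R ?y))\<^sup>2 \<le> \<delta>\<^sup>2 * (norm ?p)\<^sup>2 + \<delta>\<^sup>2 * (norm ?y)\<^sup>2"
    using split fourier_sum_pythagoras[OF \<Phi>(1,2), of u] by (simp add: distrib_left)
  have d2: "\<delta>\<^sup>2 < (a/2)\<^sup>2" using d by (intro power_strict_mono) auto
  have "(a/2)\<^sup>2 * (norm ?y)\<^sup>2 \<le> \<delta>\<^sup>2 * (norm ?y)\<^sup>2" using le p_le y_le by linarith
  then have y0: "?y = 0" using d2 by (metis leD mult_less_cancel_right_pos zero_less_norm_iff zero_less_power)
  then have "(\<Sum>\<phi>\<in>\<Phi>. (b \<phi> - a)\<^sup>2 * (u \<bullet> \<phi>)\<^sup>2) \<le> (\<Sum>\<phi>\<in>\<Phi>. \<delta>\<^sup>2 * (u \<bullet> \<phi>)\<^sup>2)"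
    using le \<open>(norm (A ?p - a *\<^sub>R ?p))\<^sup>2 = _\<close> \<open>\<delta>\<^sup>2 * (norm ?p)\<^sup>2 = _\<close> by (simp add: linear_0[OF pos_contraction_linear[OF A(1)]])
  moreover have "(\<Sum>\<phi>\<in>\<Phi>. \<delta>\<^sup>2 * (u \<bullet> \<phi>)\<^sup>2) < (\<Sum>\<phi>\<in>\<Phi>. (b \<phi> - a)\<^sup>2 * (u \<bullet> \<phi>)\<^sup>2)" if "\<phi> \<in> \<Phi>" "u \<bullet> \<phi> \<noteq> 0" for \<phi>
  proof (rule sum_strict_mono_ex1[OF \<Phi>(1)])
    show "\<forall>\<psi>\<in>\<Phi>. \<delta>\<^sup>2 * (u \<bullet> \<psi>)\<^sup>2 \<le> (b \<psi> - a)\<^sup>2 * (u \<bullet> \<psi>)\<^sup>2"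
      using sq by (intro ballI mult_right_mono) (auto intro: less_imp_le)
    show "\<exists>\<psi>\<in>\<Phi>. \<delta>\<^sup>2 * (u \<bullet> \<psi>)\<^sup>2 < (b \<psi> - a)\<^sup>2 * (u \<bullet> \<psi>)\<^sup>2"
      using sq[OF that(1)] that by (intro bexI[of _ \<phi>]) auto
  qed
  ultimately have "u \<bullet> \<phi> = 0" if "\<phi> \<in> \<Phi>" for \<phi> using that by fastforce
  then have "?p = 0" unfolding fourier_sum_def[OF \<Phi>(1,2)] by simp
  then show False using y0 u(2) by simp
qed

text \<open>If no eigenspace of the perturbed operator is smaller than the unperturbed one, the
  orthogonal projection between the two nearby eigenspaces is onto, so a given eigenvector
  is followed by a nearby one.\<close>

lemma eigenvector_persistence:
  fixes K :: "'h::{real_inner,banach} \<Rightarrow> 'h"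
  assumes K: "pos_contraction K" "compact_op K" and a: "a > 0" and m: "has_dim (eigenspace K a) m" "m > 0"
    and \<eta>: "\<eta> > 0"
  obtains \<delta> where "\<delta> > 0"
    "\<And>L u. \<lbrakk>pos_contraction L; compact_op L; \<And>x. norm (L x - K x) \<le> \<delta> * norm x;
        \<And>b n. b > 0 \<Longrightarrow> eigenspace L b \<noteq> {0} \<Longrightarrow> has_dim (eigenspace L b) n \<Longrightarrow> m \<le> n;
        u \<in> eigenspace K a\<rbrakk>
      \<Longrightarrow> \<exists>b v. b > 0 \<and> \<bar>b - a\<bar> \<le> \<eta> \<and> v \<in> eigenspace L b \<and> norm (v - u) \<le> \<eta> * norm u \<and>
            has_dim (eigenspace L b) m"
proof -
  let ?E = "eigenspace K a"
  obtain B where B: "finite B" "independent B" "span B = ?E" "card B = m" using m by (auto simp: has_dim_def)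
  obtain \<gamma> where \<gamma>: "\<gamma> > 0" "\<And>x. (\<And>y. y \<in> ?E \<Longrightarrow> x \<bullet> y = 0) \<Longrightarrow> \<gamma> * norm x \<le> norm (K x - a *\<^sub>R x)"
    using compact_spectral_gap[OF K a] by blast
  note E = subspace_eigenspace[OF K(1), of a] closed_eigenspace[OF K(1), of a]
  \<comment> \<open>\<open>\<theta> \<le> 1/2\<close> makes the projection injective on the nearby
    eigenspace and gives \<open>norm v \<le> 2 * norm u\<close>; with this factor 2,
    \<open>\<theta> \<le> \<eta>/2\<close> gives the claimed closeness.\<close>
  define \<theta> where "\<theta> = min (1/2) (\<eta>/2)"
  have \<theta>: "0 < \<theta>" "\<theta> \<le> 1/2" "\<theta> \<le> \<eta>/2" using \<eta> by (auto simp: \<theta>_def)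
  \<comment> \<open>The bound \<open>a/4\<close> keeps the perturbed eigenvalue positive and meets
    \<open>2 * \<delta> < a\<close>; the bound \<eta> controls its displacement; the last bound
    beats the spectral gap \<gamma>.\<close>
  define \<delta> where "\<delta> = min (min (a/4) \<eta>) (\<gamma> * \<theta> / 2)"
  have \<delta>: "\<delta> > 0" "\<delta> \<le> a/4" "\<delta> \<le> \<eta>" "2 * \<delta> \<le> \<gamma> * \<theta>" using a \<gamma> \<theta> \<eta> by (auto simp: \<delta>_def)
  show ?thesis
  proof (rule that[OF \<delta>(1)])
    fix L u
    assume L: "pos_contraction L" "compact_op L" and LK: "\<And>x. norm (L x - K x) \<le> \<delta> * norm x"
      and min: "\<And>b n. b > 0 \<Longrightarrow> eigenspace L b \<noteq> {0} \<Longrightarrow> has_dim (eigenspace L b) n \<Longrightarrow> m \<le> n"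
      and u: "u \<in> ?E"
    \<comment> \<open>Any eigenvector of \<open>K\<close> is an approximate eigenvector of
      \<open>L\<close>; this is how a nearby eigenvalue \<open>b\<close> of \<open>L\<close> is
      found.\<close>
    obtain w where w: "w \<in> B" using m(2) B by fastforce
    have wE: "w \<in> ?E" using w B(3) span_base by blast
    have w0: "w \<noteq> 0" using w B(2) real_vector.dependent_zero by blast
    have "norm (L w - a *\<^sub>R w) \<le> \<delta> * norm w" using LK[of w] wE by (simp add: eigenspace_def)
    then obtain b where b: "\<bar>b - a\<bar> \<le> \<delta>" "eigenspace L b \<noteq> {0}"
      using approximate_eigenvector_eigenvalue[OF L, of \<delta> a w] \<delta> a w0 by auto
    let ?F = "eigenspace L b"
    have b0: "b > 0" using b(1) \<delta>(2) a by linarith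
    obtain n where n: "has_dim ?F n" using eigenspace_finite_dim[OF L b0] .
    then obtain C where C: "finite C" "independent C" "span C = ?F" "card C = n" by (auto simp: has_dim_def)
    have mn: "m \<le> n" using min[OF b0 b(2) n] .
    let ?P = "hproj ?E"
    \<comment> \<open>Apply the gap to the part of \<open>x\<close> orthogonal to the old
      eigenspace. There \<open>K - a\<close> acts as on \<open>x\<close> itself, and
      \<open>(K - a) x = (K - L) x + (b - a) x\<close> consists of two terms of size at most
      \<open>\<delta> * norm x\<close>.\<close>
    have close: "norm (x - ?P x) \<le> \<theta> * norm x" if x: "x \<in> ?F" for x
    proof -
      let ?y = "x - ?P x"
      have "\<gamma> * norm ?y \<le> norm (K ?y - a *\<^sub>R ?y)"
        using hproj_orth[OF E, of _ x] by (intro \<gamma>(2)) auto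
      also have "K ?y - a *\<^sub>R ?y = K x - a *\<^sub>R x"
        using hproj_in[OF E, of x] by (simp add: linear_diff[OF pos_contraction_linear[OF K(1)]] eigenspace_def algebra_simps)
      also have "\<dots> = (K x - L x) + (b - a) *\<^sub>R x" using x by (simp add: eigenspace_def algebra_simps)
      also have "norm \<dots> \<le> norm (K x - L x) + \<bar>b - a\<bar> * norm x"
        using norm_triangle_ineq[of "K x - L x" "(b - a) *\<^sub>R x"] by simp
      also have "\<dots> \<le> \<delta> * norm x + \<delta> * norm x"
        using LK[of x] b(1) by (intro add_mono mult_right_mono) (auto simp: norm_minus_commute)
      also have "\<dots> \<le> (\<gamma> * \<theta>) * norm x" using mult_right_mono[OF \<delta>(4), of "norm x"] by simp
      finally show ?thesis using \<gamma>(1) by simp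
    qed
    have "inj_on ?P (span C)"
    proof (rule inj_onI)
      fix x y assume xy: "x \<in> span C" "y \<in> span C" "?P x = ?P y"
      then have "x - y \<in> ?F" using C(3) span_diff by blast
      moreover have "?P (x - y) = 0" using xy(3) linear_diff[OF linear_hproj[OF E]] by simp
      ultimately have "norm (x - y) \<le> \<theta> * norm (x - y)" using close[of "x - y"] by simp
      then have "norm (x - y) \<le> (1/2) * norm (x - y)" using mult_right_mono[OF \<theta>(2), of "norm (x - y)"] by linarith
      then show "x = y" by simp
    qed
    then have ind: "independent (?P ` C)"
      using C(2) linear_independent_injective_image[OF linear_hproj[OF E]] by blast
    have cardP: "card (?P ` C) = n"
      using C(4) card_image[of ?P C] inj_on_subset[OF \<open>inj_on ?P (span C)\<close>] span_superset by blast
    have PC: "?P ` C \<subseteq> ?E" using hproj_in[OF E] by auto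
    \<comment> \<open>Injectivity of the projection gives \<open>n \<le> m\<close>; minimality of
      \<open>m\<close> gives the converse. This excludes a splitting of the eigenvalue.\<close>
    have "n \<le> m" using independent_span_bound[OF B(1) ind] PC B cardP by auto
    then have nm: "n = m" using mn by simp
    \<comment> \<open>The injective image has the full dimension \<open>m\<close>, so it exhausts
      the old eigenspace and \<open>u\<close> is the projection of some \<open>v\<close>.\<close>
    have "u \<in> span (?P ` C)"
    proof (rule ccontr)
      assume h: "u \<notin> span (?P ` C)"
      then have "independent (insert u (?P ` C))" using ind by (rule real_vector.independent_insertI)
      moreover have "insert u (?P ` C) \<subseteq> span B" using PC u B(3) by auto
      ultimately have "card (insert u (?P ` C)) \<le> m" using independent_span_bound[OF B(1)] B(4) by blast
      moreover have "u \<notin> ?P ` C" using h span_base[of u "?P ` C"] by auto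
      ultimately show False using C(1) cardP nm by simp
    qed
    then obtain v where v: "v \<in> span C" "u = ?P v"
      using linear_span_image[OF linear_hproj[OF E], of C] by blast
    have "norm (v - u) \<le> \<theta> * norm v" using close[of v] v C(3) by simp
    also have "norm v \<le> 2 * norm u"
    proof -
      have "norm v \<le> norm u + norm (v - u)" by (metis add_diff_cancel_left' norm_triangle_sub add.commute)
      also have "\<dots> \<le> norm u + (1/2) * norm v"
        using \<open>norm (v - u) \<le> \<theta> * norm v\<close> mult_right_mono[OF \<theta>(2), of "norm v"] by simp
      finally show ?thesis by simp
    qed
    finally have "norm (v - u) \<le> \<theta> * (2 * norm u)" using \<theta>(1) by simp
    also have "\<dots> \<le> \<eta> * norm u" using mult_right_mono[OF \<theta>(3), of "2 * norm u"] by simp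
    finally have vu: "norm (v - u) \<le> \<eta> * norm u" .
    have "\<bar>b - a\<bar> \<le> \<eta>" using b(1) \<delta>(3) by simp
    then show "\<exists>b v. b > 0 \<and> \<bar>b - a\<bar> \<le> \<eta> \<and> v \<in> eigenspace L b \<and> norm (v - u) \<le> \<eta> * norm u \<and>
            has_dim (eigenspace L b) m"
      using b0 v vu C(3) n nm by blast
  qed
qed

section \<open>Polynomials of an operator and spectral measures\<close>

primrec op_power :: "('h \<Rightarrow> 'h) \<Rightarrow> nat \<Rightarrow> 'h \<Rightarrow> 'h" where
  "op_power A 0 x = x"
| "op_power A (Suc n) x = A (op_power A n x)"

definition poly_op :: "('h::real_vector \<Rightarrow> 'h) \<Rightarrow> real poly \<Rightarrow> 'h \<Rightarrow> 'h" where
  "poly_op A p x = fold_coeffs (\<lambda>c y. c *\<^sub>R x + A y) p 0"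

context
  fixes A :: "'h::real_inner \<Rightarrow> 'h"
  assumes A: "pos_contraction A"
begin

private lemmas lin = pos_contraction_linear[OF A]

lemma op_power_Suc_right: "op_power A (Suc n) x = op_power A n (A x)"
  by (induction n) auto

lemma norm_op_power: "norm (op_power A n x) \<le> norm x"
  by (induction n) (auto intro: order_trans[OF pos_contraction_norm[OF A]])

lemma poly_op_0 [simp]: "poly_op A 0 x = 0"
  by (simp add: poly_op_def)

text \<open>\<open>fold_coeffs\<close> discards zero leading coefficients, so \<open>c = 0\<close>,
  \<open>p = 0\<close> is a separate case; it is consistent because \<open>A 0 = 0\<close>.\<close>

lemma poly_op_pCons [simp]: "poly_op A (pCons c p) x = c *\<^sub>R x + A (poly_op A p x)"
  by (cases "p = 0 \<and> c = 0") (auto simp: poly_op_def linear_0[OF lin])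

lemma poly_op_1 [simp]: "poly_op A 1 x = x"
  by (simp add: one_pCons linear_0[OF lin])

lemma poly_op_add: "poly_op A (p + q) x = poly_op A p x + poly_op A q x"
  by (induction p q rule: poly_induct2) (auto simp: linear_add[OF lin] algebra_simps)

lemma poly_op_smult: "poly_op A (smult c p) x = c *\<^sub>R poly_op A p x"
  by (induction p) (auto simp: linear_cmul[OF lin] algebra_simps)

lemma poly_op_diff: "poly_op A (p - q) x = poly_op A p x - poly_op A q x"
  using poly_op_add[of p "smult (-1) q" x] poly_op_smult[of "-1" q x] by simp

lemma linear_poly_op: "linear (poly_op A p)"
proof (rule linearI)
  show "poly_op A p (x + y) = poly_op A p x + poly_op A p y" for x y
    by (induction p) (auto simp: linear_add[OF lin] algebra_simps)
  show "poly_op A p (c *\<^sub>R x) = c *\<^sub>R poly_op A p x" for c x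
    by (induction p) (auto simp: linear_cmul[OF lin] algebra_simps)
qed

lemma poly_op_commute: "poly_op A p (A x) = A (poly_op A p x)"
  by (induction p) (auto simp: linear_0[OF lin] linear_add[OF lin] linear_cmul[OF lin])

lemma poly_op_mult: "poly_op A (p * q) x = poly_op A p (poly_op A q x)"
  by (induction p) (auto simp: poly_op_add poly_op_smult)

lemma poly_op_symmetric: "poly_op A p x \<bullet> y = x \<bullet> poly_op A p y"
proof (induction p arbitrary: y)
  case (pCons c p)
  have "A (poly_op A p x) \<bullet> y = x \<bullet> A (poly_op A p y)"
    using pCons(2)[of "A y"] by (simp add: pos_contraction_symmetric[OF A] poly_op_commute)
  then show ?case by (simp add: inner_add_left inner_add_right)
qed simp

text \<open>The spectrum of \<open>A\<close> and the number \<open>a\<close> lie in the unit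
  interval, so \<open>A - a\<close> has norm at most 1. Argued through the form:
  \<open>A^2 \<le> A\<close> removes the square, and only the positive part of
  \<open>1 - 2 * a\<close> has to be kept.\<close>

lemma norm_shift_le:
  assumes "0 \<le> a" "a \<le> 1"
  shows "norm (A x - a *\<^sub>R x) \<le> norm x"
proof -
  have "(norm (A x - a *\<^sub>R x))\<^sup>2 = (norm (A x))\<^sup>2 - 2 * a * (A x \<bullet> x) + a\<^sup>2 * (norm x)\<^sup>2"
    unfolding power2_norm_eq_inner by (simp add: algebra_simps inner_commute power2_eq_square)
  also have "\<dots> \<le> (1 - 2 * a) * (A x \<bullet> x) + a\<^sup>2 * (norm x)\<^sup>2"
    using pos_contraction_norm_sq[OF A, of x] by (simp add: algebra_simps)
  also have "\<dots> \<le> max 0 (1 - 2 * a) * (norm x)\<^sup>2 + a\<^sup>2 * (norm x)\<^sup>2"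
    using pos_contraction_nonneg[OF A, of x] pos_contraction_inner_le[OF A, of x]
    by (intro add_right_mono mult_mono) auto
  also have "\<dots> = (max 0 (1 - 2 * a) + a\<^sup>2) * (norm x)\<^sup>2" by (simp add: distrib_right)
  also have "\<dots> \<le> 1 * (norm x)\<^sup>2"
  proof (rule mult_right_mono)
    have "a\<^sup>2 \<le> 1" using assms by (simp add: power_le_one)
    moreover have "(1 - 2 * a) + a\<^sup>2 = (1 - a)\<^sup>2" by (simp add: power2_eq_square algebra_simps)
    moreover have "(1 - a)\<^sup>2 \<le> 1" using assms by (simp add: power_le_one)
    ultimately show "max 0 (1 - 2 * a) + a\<^sup>2 \<le> 1" by auto
  qed simp
  finally show ?thesis by (intro power2_le_imp_le[of "norm _"]) auto
qed

end

section \<open>Polynomials that select finitely many eigenvalues\<close>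

definition bell_poly :: "real \<Rightarrow> real poly" where
  "bell_poly a = 1 - [:-a, 1:] * [:-a, 1:]"

lemma poly_bell_poly: "poly (bell_poly a) y = 1 - (y - a)\<^sup>2"
  by (simp add: bell_poly_def power2_eq_square algebra_simps)

context
  fixes A :: "'h::real_inner \<Rightarrow> 'h" and a :: real
  assumes A: "pos_contraction A" and a: "0 \<le> a" "a \<le> 1"
begin

lemma poly_op_shift: "poly_op A [:-a, 1:] x = A x - a *\<^sub>R x"
  by (simp add: poly_op_pCons[OF A] poly_op_0[OF A] linear_0[OF pos_contraction_linear[OF A]])

lemma poly_op_bell: "poly_op A (bell_poly a) x = x - poly_op A [:-a, 1:] (poly_op A [:-a, 1:] x)"
  unfolding bell_poly_def by (simp only: poly_op_diff[OF A] poly_op_1[OF A] poly_op_mult[OF A])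

lemma norm_poly_op_shift: "norm (poly_op A [:-a, 1:] x) \<le> norm x"
  unfolding poly_op_shift by (rule norm_shift_le[OF A a])

text \<open>With \<open>T = A - a\<close> of norm at most 1, the square of the norm of
  \<open>(1 - T^2) x\<close> is \<open>|x|^2 - 2 |T x|^2 + |T^2 x|^2\<close>, and the last term is
  at most half of what is subtracted. The bell equals 1 at \<open>a\<close> and is smaller
  elsewhere, so its powers concentrate at \<open>a\<close>.\<close>

lemma norm_poly_op_bell: "norm (poly_op A (bell_poly a) x) \<le> norm x"
proof -
  let ?z = "poly_op A [:-a, 1:]"
  have "(norm (poly_op A (bell_poly a) x))\<^sup>2 = (norm x)\<^sup>2 - 2 * (x \<bullet> ?z (?z x)) + (norm (?z (?z x)))\<^sup>2"
    unfolding poly_op_bell power2_norm_eq_inner by (simp add: algebra_simps inner_commute)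
  also have "x \<bullet> ?z (?z x) = (norm (?z x))\<^sup>2"
    unfolding power2_norm_eq_inner by (metis poly_op_symmetric[OF A])
  also have "(norm x)\<^sup>2 - 2 * (norm (?z x))\<^sup>2 + (norm (?z (?z x)))\<^sup>2 \<le> (norm x)\<^sup>2"
    using power_mono[OF norm_poly_op_shift[of "?z x"] norm_ge_zero, of 2] zero_le_power2[of "norm (?z x)"] by linarith
  finally show ?thesis by (rule power2_le_imp_le) simp
qed

lemma norm_poly_op_bell_power: "norm (poly_op A (bell_poly a ^ k) x) \<le> norm x"
  by (induction k)
     (auto simp: poly_op_1[OF A] poly_op_mult[OF A] intro: order_trans[OF norm_poly_op_bell])

text \<open>The even exponent makes the power the square of a symmetric contraction, so the
  computation for \<open>1 - T^2\<close> applies again.\<close>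

lemma norm_poly_op_notch: "norm (poly_op A (1 - bell_poly a ^ (2 * M)) x) \<le> norm x"
proof -
  let ?t = "poly_op A (bell_poly a ^ M)"
  have eq: "poly_op A (1 - bell_poly a ^ (2 * M)) x = x - ?t (?t x)"
    by (simp only: poly_op_diff[OF A] poly_op_1[OF A] mult_2 power_add poly_op_mult[OF A])
  have "(norm (x - ?t (?t x)))\<^sup>2 = (norm x)\<^sup>2 - 2 * (x \<bullet> ?t (?t x)) + (norm (?t (?t x)))\<^sup>2"
    unfolding power2_norm_eq_inner by (simp add: algebra_simps inner_commute)
  also have "x \<bullet> ?t (?t x) = (norm (?t x))\<^sup>2"
    unfolding power2_norm_eq_inner by (metis poly_op_symmetric[OF A])
  also have "(norm x)\<^sup>2 - 2 * (norm (?t x))\<^sup>2 + (norm (?t (?t x)))\<^sup>2 \<le> (norm x)\<^sup>2"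
    using power_mono[OF norm_poly_op_bell_power[of M "?t x"] norm_ge_zero, of 2] zero_le_power2[of "norm (?t x)"] by linarith
  finally show ?thesis unfolding eq by (rule power2_le_imp_le) simp
qed

text \<open>Telescoping \<open>1 - p^(k+1) = (1 - p) + p (1 - p^k)\<close>: each of the
  \<open>k\<close> steps costs at most one \<open>norm (A x - a *\<^sub>R x)\<close>, since
  \<open>1 - p\<close> is the square of the shift \<open>A - a\<close> and both factors are
  contractions.\<close>

lemma norm_poly_op_notch_eigen:
  "norm (poly_op A (1 - bell_poly a ^ k) x) \<le> real k * norm (A x - a *\<^sub>R x)"
proof (induction k)
  case 0
  show ?case by (simp add: poly_op_0[OF A])
next
  case (Suc k)
  have "1 - bell_poly a ^ Suc k = (1 - bell_poly a) + bell_poly a * (1 - bell_poly a ^ k)"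
    by (simp add: algebra_simps)
  then have "poly_op A (1 - bell_poly a ^ Suc k) x
      = poly_op A (1 - bell_poly a) x + poly_op A (bell_poly a) (poly_op A (1 - bell_poly a ^ k) x)"
    by (simp only: poly_op_add[OF A] poly_op_mult[OF A])
  also have "norm \<dots> \<le> norm (poly_op A (1 - bell_poly a) x) + norm (poly_op A (1 - bell_poly a ^ k) x)"
    by (intro order_trans[OF norm_triangle_ineq] add_left_mono norm_poly_op_bell)
  also have "poly_op A (1 - bell_poly a) x = poly_op A [:-a, 1:] (poly_op A [:-a, 1:] x)"
    by (simp add: poly_op_diff[OF A] poly_op_1[OF A] poly_op_bell)
  also have "norm \<dots> \<le> norm (A x - a *\<^sub>R x)"
    using norm_poly_op_shift poly_op_shift by metis
  also have "norm (A x - a *\<^sub>R x) + norm (poly_op A (1 - bell_poly a ^ k) x) \<le> real (Suc k) * norm (A x - a *\<^sub>R x)"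
    using Suc by (simp add: algebra_simps)
  finally show ?case by simp
qed

end

text \<open>Vanishes at every point of \<open>S\<close> and, for large \<open>M\<close>, is close to
  1 on the part of the unit interval away from \<open>S\<close>.\<close>

definition notch_poly :: "real set \<Rightarrow> nat \<Rightarrow> real poly" where
  "notch_poly S M = (\<Prod>a\<in>S. 1 - bell_poly a ^ (2 * M))"

lemma norm_notch_poly:
  assumes A: "pos_contraction A" and S: "finite S" "S \<subseteq> {0..1}"
  shows "norm (poly_op A (notch_poly S M) x) \<le> norm x"
  using S
proof (induction S rule: finite_induct)
  case empty
  show ?case by (simp add: notch_poly_def poly_op_1[OF A])
next
  case (insert a S)
  have "notch_poly (insert a S) M = (1 - bell_poly a ^ (2 * M)) * notch_poly S M"
    using insert by (simp add: notch_poly_def)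
  then have "norm (poly_op A (notch_poly (insert a S) M) x) \<le> norm (poly_op A (notch_poly S M) x)"
    using insert.prems norm_poly_op_notch[OF A, of a M] by (simp add: poly_op_mult[OF A])
  then show ?case using insert by simp
qed

lemma norm_notch_poly_eigen:
  assumes A: "pos_contraction A" and S: "finite S" "S \<subseteq> {0..1}" "a \<in> S"
  shows "norm (poly_op A (notch_poly S M) x) \<le> real (2 * M) * norm (A x - a *\<^sub>R x)"
proof -
  have "notch_poly S M = notch_poly (S - {a}) M * (1 - bell_poly a ^ (2 * M))"
    unfolding notch_poly_def using S by (subst prod.remove[of S a]) (auto simp: mult.commute)
  then have "norm (poly_op A (notch_poly S M) x) \<le> norm (poly_op A (1 - bell_poly a ^ (2 * M)) x)"
    using norm_notch_poly[OF A, of "S - {a}" M] S by (auto simp: poly_op_mult[OF A])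
  also have "\<dots> \<le> real (2 * M) * norm (A x - a *\<^sub>R x)"
    using S by (intro norm_poly_op_notch_eigen[OF A]) auto
  finally show ?thesis .
qed

lemma one_minus_prod_bounds:
  fixes q :: "'i \<Rightarrow> real"
  assumes "finite S" "\<And>i. i \<in> S \<Longrightarrow> 0 \<le> q i \<and> q i \<le> 1"
  shows "0 \<le> 1 - (\<Prod>i\<in>S. 1 - q i)" "1 - (\<Prod>i\<in>S. 1 - q i) \<le> 1" "1 - (\<Prod>i\<in>S. 1 - q i) \<le> (\<Sum>i\<in>S. q i)"
proof -
  show "0 \<le> 1 - (\<Prod>i\<in>S. 1 - q i)" using assms by (simp add: prod_le_1)
  show "1 - (\<Prod>i\<in>S. 1 - q i) \<le> 1" using assms by (simp add: prod_nonneg)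
  show "1 - (\<Prod>i\<in>S. 1 - q i) \<le> (\<Sum>i\<in>S. q i)" using assms
  proof (induction S rule: finite_induct)
    case (insert i S)
    have "0 \<le> (\<Prod>i\<in>S. 1 - q i)" "(\<Prod>i\<in>S. 1 - q i) \<le> 1"
      using insert by (auto intro!: prod_nonneg prod_le_1)
    then have "q i * (\<Prod>i\<in>S. 1 - q i) \<le> q i" using insert.prems[of i] by (simp add: mult_left_le)
    then show ?case using insert by (simp add: algebra_simps)
  qed simp
qed

text \<open>\<open>Q\<close> is one minus the notch polynomial of the eigenvalues. The order of
  quantifiers matters: \<delta>, \<open>Q\<close> and \<open>Y\<close> depend only on the
  eigenvectors, the eigenvalues and \<open>e\<close>, and serve every \<open>A\<close> that almost
  preserves them. They are fixed at a stage at which the final resolvent is still unknown.\<close>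

lemma spectral_selector:
  fixes \<Phi> :: "'h::real_inner set" and a :: "'h \<Rightarrow> real"
  assumes \<Phi>: "finite \<Phi>" "orthonormal \<Phi>" and a: "\<And>\<phi>. \<phi> \<in> \<Phi> \<Longrightarrow> 0 \<le> a \<phi> \<and> a \<phi> \<le> 1"
    and e: "e > 0"
  shows "\<exists>\<delta>>0. \<exists>Q Y. open Y \<and> emeasure lborel Y \<le> ennreal e \<and>
    (\<forall>y\<in>{0..1}. 0 \<le> poly Q y \<and> poly Q y \<le> 1) \<and> (\<forall>y\<in>{0..1} - Y. poly Q y \<le> e) \<and>
    (\<forall>A. pos_contraction A \<longrightarrow> (\<forall>\<phi>\<in>\<Phi>. norm (A \<phi> - a \<phi> *\<^sub>R \<phi>) \<le> \<delta>) \<longrightarrow>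
       (\<forall>h\<in>span \<Phi>. norm (h - poly_op A Q h) \<le> e * norm h))"
proof -
  define S where "S = a ` \<Phi>"
  have S: "finite S" "S \<subseteq> {0..1}" using \<Phi>(1) a by (auto simp: S_def)
  \<comment> \<open>\<open>J\<close> dominates both cardinalities, so that errors
    \<open>e / J\<close> per eigenvalue or per eigenvector add up to at most
    \<open>e\<close>.\<close>
  define J where "J = real (card \<Phi>) + real (card S) + 1"
  have J: "J \<ge> 1" "real (card S) \<le> J" "real (card \<Phi>) \<le> J" by (auto simp: J_def)
  \<comment> \<open>Radius of the intervals around the eigenvalues: their total length
    \<open>2 * \<eta> * card S\<close> is at most \<open>e\<close>, and
    \<open>\<eta> \<le> 1/2\<close> keeps \<open>1 - \<eta>\<^sup>2\<close> below 1 and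
    nonnegative.\<close>
  define \<eta> where "\<eta> = min (1/2) (e / (2 * J))"
  have \<eta>: "0 < \<eta>" "\<eta> \<le> 1/2" "\<eta> \<le> e / (2 * J)" using e J by (auto simp: \<eta>_def)
  have "(\<lambda>M. (1 - \<eta>\<^sup>2) ^ M) \<longlonglongrightarrow> 0"
  proof (rule LIMSEQ_realpow_zero)
    show "0 \<le> 1 - \<eta>\<^sup>2" "1 - \<eta>\<^sup>2 < 1" using \<eta> by (auto simp: power_le_one)
  qed
  then have "eventually (\<lambda>M. (1 - \<eta>\<^sup>2) ^ M < e / J) sequentially"
    using e J by (intro order_tendstoD(2)[where a = "e / J"]) auto
  then obtain M0 where M0: "\<And>M. M \<ge> M0 \<Longrightarrow> (1 - \<eta>\<^sup>2) ^ M < e / J" by (auto simp: eventually_sequentially)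
  define M where "M = M0"
  have M: "(1 - \<eta>\<^sup>2) ^ (2 * M) < e / J" by (rule M0) (simp add: M_def)
  \<comment> \<open>A vector of the span has at most \<open>J\<close> components, each contributing
    at most \<open>2 * M * \<delta>\<close> times its norm. The extra 1 avoids division by zero for
    \<open>M = 0\<close>.\<close>
  define \<delta> where "\<delta> = e / (J * (real (2 * M) + 1))"
  have \<delta>: "\<delta> > 0" using e J by (simp add: \<delta>_def add_nonneg_pos)
  define Q where "Q = 1 - notch_poly S M"
  define Y where "Y = (\<Union>\<alpha>\<in>S. {\<alpha> - \<eta><..<\<alpha> + \<eta>})"
  have Qy: "poly Q y = 1 - (\<Prod>\<alpha>\<in>S. 1 - (1 - (y - \<alpha>)\<^sup>2) ^ (2 * M))" for y
    by (simp add: Q_def notch_poly_def poly_prod poly_bell_poly)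
  have q: "0 \<le> (1 - (y - \<alpha>)\<^sup>2) ^ (2 * M) \<and> (1 - (y - \<alpha>)\<^sup>2) ^ (2 * M) \<le> 1"
    if "y \<in> {0..1}" "\<alpha> \<in> S" for y \<alpha>
  proof -
    have "\<bar>y - \<alpha>\<bar> \<le> 1" using that S by (auto simp: abs_if subset_iff)
    then have "(y - \<alpha>)\<^sup>2 \<le> 1" by (simp add: abs_square_le_1)
    then show ?thesis by (auto intro: power_le_one)
  qed
  have small: "poly Q y \<le> e" if y: "y \<in> {0..1} - Y" for y
  proof -
    have "poly Q y \<le> (\<Sum>\<alpha>\<in>S. (1 - (y - \<alpha>)\<^sup>2) ^ (2 * M))"
      unfolding Qy using one_minus_prod_bounds(3)[OF S(1), of "\<lambda>\<alpha>. (1 - (y - \<alpha>)\<^sup>2) ^ (2 * M)"] q y by auto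
    also have "\<dots> \<le> (\<Sum>\<alpha>\<in>S. e / J)"
    proof (rule sum_mono)
      fix \<alpha> assume \<alpha>: "\<alpha> \<in> S"
      have "\<eta> \<le> \<bar>y - \<alpha>\<bar>" using y \<alpha> unfolding Y_def by (auto simp: abs_if)
      then have "\<eta>\<^sup>2 \<le> (y - \<alpha>)\<^sup>2" using \<eta>(1) by (metis abs_of_pos abs_le_square_iff)
      moreover have "\<bar>y - \<alpha>\<bar> \<le> 1" using y \<alpha> S by (auto simp: abs_if subset_iff)
      then have "(y - \<alpha>)\<^sup>2 \<le> 1" by (simp add: abs_square_le_1)
      ultimately have "(1 - (y - \<alpha>)\<^sup>2) ^ (2 * M) \<le> (1 - \<eta>\<^sup>2) ^ (2 * M)" by (intro power_mono) auto
      then show "(1 - (y - \<alpha>)\<^sup>2) ^ (2 * M) \<le> e / J" using M by simp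
    qed
    also have "\<dots> = real (card S) * (e / J)" by simp
    also have "\<dots> \<le> J * (e / J)" using J e by (intro mult_right_mono) auto
    also have "\<dots> = e" using J by simp
    finally show ?thesis .
  qed
  have "emeasure lborel Y \<le> (\<Sum>\<alpha>\<in>S. emeasure lborel {\<alpha> - \<eta><..<\<alpha> + \<eta>})"
    unfolding Y_def by (intro emeasure_subadditive_finite S) auto
  also have "\<dots> = ennreal (real (card S) * (2 * \<eta>))"
    using \<eta> by (simp add: ennreal_mult' ennreal_of_nat_eq_real_of_nat)
  also have "\<dots> \<le> ennreal e"
  proof (rule ennreal_leI)
    have "real (card S) * (2 * \<eta>) \<le> J * (2 * (e / (2 * J)))"
      using \<eta> J by (intro mult_mono) auto
    then show "real (card S) * (2 * \<eta>) \<le> e" using J by simp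
  qed
  finally have Y_le: "emeasure lborel Y \<le> ennreal e" .
  have on_span: "norm (h - poly_op A Q h) \<le> e * norm h"
    if A: "pos_contraction A" and near: "\<forall>\<phi>\<in>\<Phi>. norm (A \<phi> - a \<phi> *\<^sub>R \<phi>) \<le> \<delta>" and h: "h \<in> span \<Phi>" for A h
  proof -
    let ?R = "poly_op A (notch_poly S M)"
    obtain c where c: "h = (\<Sum>\<phi>\<in>\<Phi>. c \<phi> *\<^sub>R \<phi>)" using h span_finite[OF \<Phi>(1)] by auto
    have c_le: "\<bar>c \<phi>\<bar> \<le> norm h" if "\<phi> \<in> \<Phi>" for \<phi>
      using Cauchy_Schwarz_ineq2[of h \<phi>] orthonormal_sum_inner[OF \<Phi> that, of c] \<Phi>(2) that
      by (simp add: c[symmetric] orthonormal_def)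
    have "norm (?R \<phi>) \<le> real (2 * M) * \<delta>" if "\<phi> \<in> \<Phi>" for \<phi>
    proof -
      have "norm (?R \<phi>) \<le> real (2 * M) * norm (A \<phi> - a \<phi> *\<^sub>R \<phi>)"
        using that by (intro norm_notch_poly_eigen[OF A S]) (auto simp: S_def)
      also have "\<dots> \<le> real (2 * M) * \<delta>" using near that by (intro mult_left_mono) auto
      finally show ?thesis .
    qed
    then have "norm (c \<phi> *\<^sub>R ?R \<phi>) \<le> norm h * (real (2 * M) * \<delta>)" if "\<phi> \<in> \<Phi>" for \<phi>
      using c_le that by (auto intro!: mult_mono)
    then have "norm (\<Sum>\<phi>\<in>\<Phi>. c \<phi> *\<^sub>R ?R \<phi>) \<le> (\<Sum>\<phi>\<in>\<Phi>. norm h * (real (2 * M) * \<delta>))"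
      by (rule sum_norm_le)
    also have "\<dots> = real (card \<Phi>) * (norm h * (real (2 * M) * \<delta>))" by simp
    also have "\<dots> \<le> J * (norm h * ((real (2 * M) + 1) * \<delta>))"
      using J \<delta> by (intro mult_mono mult_left_mono mult_right_mono) auto
    also have "\<dots> = e * norm h" using J by (simp add: \<delta>_def add_nonneg_eq_0_iff)
    finally have "norm (\<Sum>\<phi>\<in>\<Phi>. c \<phi> *\<^sub>R ?R \<phi>) \<le> e * norm h" .
    moreover have "h - poly_op A Q h = ?R h"
      by (simp add: Q_def poly_op_diff[OF A] poly_op_1[OF A])
    moreover have "?R h = (\<Sum>\<phi>\<in>\<Phi>. c \<phi> *\<^sub>R ?R \<phi>)"
      unfolding c by (simp add: linear_sum[OF linear_poly_op[OF A]] linear_cmul[OF linear_poly_op[OF A]])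
    ultimately show ?thesis by simp
  qed
  have "open Y" by (auto simp: Y_def)
  have Q01: "\<forall>y\<in>{0..1}. 0 \<le> poly Q y \<and> poly Q y \<le> 1"
    unfolding Qy by (intro ballI conjI one_minus_prod_bounds(1,2)[OF S(1)] q)
  have smallY: "\<forall>y\<in>{0..1} - Y. poly Q y \<le> e" using small by simp
  have span: "\<forall>A. pos_contraction A \<longrightarrow> (\<forall>\<phi>\<in>\<Phi>. norm (A \<phi> - a \<phi> *\<^sub>R \<phi>) \<le> \<delta>) \<longrightarrow>
       (\<forall>h\<in>span \<Phi>. norm (h - poly_op A Q h) \<le> e * norm h)" using on_span by simp
  show ?thesis
    using \<delta> \<open>open Y\<close> Y_le Q01 smallY span by blast
qed


section \<open>Spectral measures seen through the moments of the resolvent\<close>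

lemma sums_zero_coeffs_zero:
  fixes c :: "nat \<Rightarrow> real"
  assumes "\<And>x. \<lbrakk>x \<noteq> 0; \<bar>x\<bar> < 1\<rbrakk> \<Longrightarrow> (\<lambda>n. c n * x ^ n) sums 0"
  shows "c k = 0"
  using assms
proof (induction k arbitrary: c)
  case 0
  have "((\<lambda>_. 0) \<longlongrightarrow> c 0) (at (0::real))"
    using 0 by (intro powser_limit_0_strong[of 1 c "\<lambda>_. 0"]) auto
  then show ?case by (simp add: tendsto_const_iff)
next
  case (Suc k)
  have "((\<lambda>_. 0) \<longlongrightarrow> c 0) (at (0::real))"
    using Suc.prems by (intro powser_limit_0_strong[of 1 c "\<lambda>_. 0"]) auto
  then have c0: "c 0 = 0" by (simp add: tendsto_const_iff)
  show ?case
  proof (rule Suc.IH[of "\<lambda>n. c (Suc n)"])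
    \<comment> \<open>Dropping the constant term and dividing by \<open>x\<close> shifts the
      coefficients by one. Hence the identity is assumed away from 0, and the constant term is
      recovered as a limit.\<close>
    fix x :: real assume x: "x \<noteq> 0" "\<bar>x\<bar> < 1"
    have "(\<lambda>n. c (Suc n) * x ^ Suc n) sums 0"
      using sums_Suc_iff[of "\<lambda>n. c n * x ^ n" 0] Suc.prems[OF x] c0 by simp
    from sums_mult[OF this, of "inverse x"] show "(\<lambda>n. c (Suc n) * x ^ n) sums 0"
      using x by (simp add: field_simps)
  qed
qed

text \<open>The Neumann series of \<open>(1 - x A)\<inverse> A\<close>. If \<open>A\<close> is the
  resolvent at -1, then \<open>w\<close> is the resolvent at \<open>-s\<close> with
  \<open>s = 1 - x\<close>, so the range \<open>|x| < 1\<close> corresponds to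
  \<open>0 < s < 2\<close>.\<close>

lemma resolvent_power_series:
  fixes A :: "'h::{real_inner,banach} \<Rightarrow> 'h"
  assumes A: "pos_contraction A" and x: "\<bar>x\<bar> < 1"
  shows "\<exists>w. w = A (f + x *\<^sub>R w) \<and> (\<lambda>k. x ^ k * (op_power A (Suc k) f \<bullet> f)) sums (w \<bullet> f)"
proof -
  let ?t = "\<lambda>k. x ^ k *\<^sub>R op_power A (Suc k) f"
  have "summable (\<lambda>k. norm f * \<bar>x\<bar> ^ k)" using x by (intro summable_mult summable_geometric) auto
  then have sm: "summable ?t"
  proof (rule summable_comparison_test'[where N = 0])
    show "norm (?t n) \<le> norm f * \<bar>x\<bar> ^ n" for n
      using mult_left_mono[OF norm_op_power[OF A, of "Suc n" f], of "\<bar>x\<bar> ^ n"]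
      by (simp add: power_abs mult.commute)
  qed
  define w where "w = suminf ?t"
  have w: "?t sums w" using sm by (simp add: w_def summable_sums)
  have "(\<lambda>k. x *\<^sub>R A (?t k)) sums (x *\<^sub>R A w)"
    by (intro sums_scaleR_right bounded_linear.sums[OF pos_contraction_bounded_linear[OF A] w])
  moreover have "x *\<^sub>R A (?t k) = ?t (Suc k)" for k
    by (simp add: linear_cmul[OF pos_contraction_linear[OF A]])
  ultimately have "(\<lambda>k. ?t (Suc k)) sums (x *\<^sub>R A w)" by (simp only:)
  then have "?t sums (x *\<^sub>R A w + ?t 0)" by (rule sums_Suc)
  then have "w = x *\<^sub>R A w + A f" using w sums_unique2 by fastforce
  then have "w = A (f + x *\<^sub>R w)"
    by (simp add: linear_add[OF pos_contraction_linear[OF A]] linear_cmul[OF pos_contraction_linear[OF A]] add.commute)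
  moreover have "(\<lambda>k. x ^ k * (op_power A (Suc k) f \<bullet> f)) sums (w \<bullet> f)"
    using bounded_linear.sums[OF bounded_linear_inner_left[of f] w] by (simp only: inner_scaleR_left)
  ultimately show ?thesis by blast
qed

lemma spectral_integrand_bounds:
  assumes "(t::real) \<ge> 0" shows "0 \<le> 1 / (1 + t)" "1 / (1 + t) \<le> 1"
  using assms by auto

context
  fixes \<mu> :: "real measure"
  assumes \<mu>: "sets \<mu> = sets borel" "finite_measure \<mu>" "emeasure \<mu> {..<0} = 0"
begin

lemma AE_nonneg_spectral: "AE t in \<mu>. 0 \<le> t"
  using \<mu> by (intro AE_I'[of "{..<0}"]) (auto simp: null_sets_def)

lemma integrable_spectral:
  fixes h :: "real \<Rightarrow> real"
  assumes [measurable]: "h \<in> borel_measurable borel" and h: "\<And>y. \<lbrakk>0 \<le> y; y \<le> 1\<rbrakk> \<Longrightarrow> \<bar>h y\<bar> \<le> C"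
  shows "integrable \<mu> (\<lambda>t. h (1 / (1 + t)))"
proof (rule finite_measure.integrable_const_bound[OF \<mu>(2)])
  show "AE t in \<mu>. norm (h (1 / (1 + t))) \<le> C"
    using AE_nonneg_spectral by eventually_elim (use h spectral_integrand_bounds in simp)
  show "(\<lambda>t. h (1 / (1 + t))) \<in> borel_measurable \<mu>"
    unfolding measurable_cong_sets[OF \<mu>(1) refl] by measurable
qed

lemma integrable_spectral_poly: "integrable \<mu> (\<lambda>t. (1 / (1 + t)) ^ k * poly p (1 / (1 + t)))"
proof -
  have "compact ((\<lambda>y. y ^ k * poly p y) ` {0..1})"
    by (intro compact_continuous_image continuous_intros) auto
  then have "bounded ((\<lambda>y. y ^ k * poly p y) ` {0..1})" by (rule compact_imp_bounded)
  then obtain C where "\<forall>z\<in>(\<lambda>y. y ^ k * poly p y) ` {0..1}. norm z \<le> C" by (auto simp: bounded_iff)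
  then have C: "\<bar>y ^ k * poly p y\<bar> \<le> C" if "y \<in> {0..1}" for y using that by auto
  have "(\<lambda>y. y ^ k * poly p y) \<in> borel_measurable borel"
    by (intro borel_measurable_continuous_onI continuous_intros)
  from integrable_spectral[OF this, of C] C show ?thesis by simp
qed

text \<open>Expand both sides of the resolvent identity in powers of \<open>x = 1 - s\<close>: the
  left by the Neumann series, the right by the geometric series of \<open>1 / (t + 1 - x)\<close>
  with \<open>y = 1 / (1 + t)\<close>. Comparing coefficients gives the moments from the first on,
  because resolvents only see \<open>A f\<close>.\<close>

lemma spectral_moments:
  fixes A :: "'h::{real_inner,banach} \<Rightarrow> 'h"
  assumes A: "pos_contraction A"
    and res: "\<And>s w. \<lbrakk>0 < s; s < 2; w = A (f + (1 - s) *\<^sub>R w)\<rbrakk> \<Longrightarrow> w \<bullet> f = (\<integral> t. 1 / (t + s) \<partial>\<mu>)"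
  shows "op_power A (Suc k) f \<bullet> f = (\<integral> t. (1 / (1 + t)) ^ Suc k \<partial>\<mu>)"
proof -
  let ?m = "\<lambda>k. op_power A (Suc k) f \<bullet> f" and ?y = "\<lambda>t::real. 1 / (1 + t)"
  let ?n = "\<lambda>k. \<integral> t. ?y t ^ Suc k \<partial>\<mu>"
  have int: "integrable \<mu> (\<lambda>t. ?y t ^ j)" for j using integrable_spectral_poly[of j 1] by simp
  have "(\<lambda>k. (?m k - ?n k) * x ^ k) sums 0" if x: "x \<noteq> 0" "\<bar>x\<bar> < 1" for x
  proof -
    obtain w where w: "w = A (f + x *\<^sub>R w)" "(\<lambda>k. x ^ k * ?m k) sums (w \<bullet> f)"
      using resolvent_power_series[OF A x(2)] by blast
    have wf: "w \<bullet> f = (\<integral> t. 1 / (t + (1 - x)) \<partial>\<mu>)"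
      using x w by (intro res) (auto simp: abs_if split: if_splits)
    \<comment> \<open>Sum and integral may be exchanged: almost everywhere the \<open>k\<close>-th
      term is at most \<open>|x|^k\<close>, and the measure is finite.\<close>
    have "(\<lambda>k. \<integral> t. x ^ k * ?y t ^ Suc k \<partial>\<mu>) sums (\<integral> t. (\<Sum>k. x ^ k * ?y t ^ Suc k) \<partial>\<mu>)"
    proof (rule sums_integral)
      show "integrable \<mu> (\<lambda>t. x ^ k * ?y t ^ Suc k)" for k by (intro integrable_mult_right int)
      have bound: "norm (x ^ k * ?y t ^ Suc k) \<le> \<bar>x\<bar> ^ k" if "t \<ge> 0" for t k
      proof -
        have "\<bar>?y t\<bar> ^ Suc k \<le> 1" using spectral_integrand_bounds[OF that] by (intro power_le_one) auto
        then show ?thesis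
          using mult_left_mono[of "\<bar>?y t\<bar> ^ Suc k" 1 "\<bar>x\<bar> ^ k"] by (simp only: real_norm_def abs_mult power_abs) simp
      qed
      have geo: "summable (\<lambda>k. \<bar>x\<bar> ^ k)" using x by (intro summable_geometric) auto
      show "AE t in \<mu>. summable (\<lambda>k. norm (x ^ k * ?y t ^ Suc k))"
        using AE_nonneg_spectral
        by eventually_elim (rule summable_comparison_test'[OF geo, where N = 0], use bound in auto)
      show "summable (\<lambda>k. \<integral> t. norm (x ^ k * ?y t ^ Suc k) \<partial>\<mu>)"
      proof (rule summable_comparison_test'[where N = 0])
        show "summable (\<lambda>k. \<bar>x\<bar> ^ k * measure \<mu> (space \<mu>))" by (intro summable_mult2 geo)
        show "norm (\<integral> t. norm (x ^ k * ?y t ^ Suc k) \<partial>\<mu>) \<le> \<bar>x\<bar> ^ k * measure \<mu> (space \<mu>)" for k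
        proof -
          have "(\<integral> t. norm (x ^ k * ?y t ^ Suc k) \<partial>\<mu>) \<le> (\<integral> t. \<bar>x\<bar> ^ k \<partial>\<mu>)"
          proof (rule integral_mono_AE)
            show "integrable \<mu> (\<lambda>t. norm (x ^ k * ?y t ^ Suc k))"
              by (intro integrable_norm integrable_mult_right int)
            show "integrable \<mu> (\<lambda>t. \<bar>x\<bar> ^ k)" using \<mu>(2) by (simp add: finite_measure.integrable_const)
            show "AE t in \<mu>. norm (x ^ k * ?y t ^ Suc k) \<le> \<bar>x\<bar> ^ k"
              using AE_nonneg_spectral by eventually_elim (rule bound)
          qed
          then show ?thesis by (simp add: mult.commute)
        qed
      qed
    qed
    moreover have "(\<integral> t. (\<Sum>k. x ^ k * ?y t ^ Suc k) \<partial>\<mu>) = (\<integral> t. 1 / (t + (1 - x)) \<partial>\<mu>)"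
    proof (rule integral_cong_AE)
      have "(\<Sum>k. x ^ k * ?y t ^ Suc k) = 1 / (t + (1 - x))" if t: "t \<ge> 0" for t
      proof -
        have "norm (x * ?y t) < 1"
          using x spectral_integrand_bounds[OF t] mult_right_le_one_le[of "\<bar>x\<bar>" "?y t"] by (simp add: abs_mult)
        from sums_mult[OF geometric_sums[OF this], of "?y t"]
        have "(\<lambda>k. x ^ k * ?y t ^ Suc k) sums (?y t * (1 / (1 - x * ?y t)))"
          by (simp add: power_mult_distrib mult_ac power_divide)
        moreover have "?y t * (1 / (1 - x * ?y t)) = 1 / (t + (1 - x))"
          using t x by (simp add: field_simps abs_if split: if_splits)
        ultimately show ?thesis by (simp add: sums_iff)
      qed
      note series = this
      show "AE t in \<mu>. (\<Sum>k. x ^ k * ?y t ^ Suc k) = 1 / (t + (1 - x))"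
        using AE_nonneg_spectral by eventually_elim (rule series)
      show "(\<lambda>t. \<Sum>k. x ^ k * ?y t ^ Suc k) \<in> borel_measurable \<mu>" "(\<lambda>t. 1 / (t + (1 - x))) \<in> borel_measurable \<mu>"
        unfolding measurable_cong_sets[OF \<mu>(1) refl] by measurable
    qed
    ultimately have "(\<lambda>k. x ^ k * ?n k) sums (w \<bullet> f)" unfolding wf by (simp only: integral_mult_right_zero)
    from sums_diff[OF w(2) this] show ?thesis by (simp add: algebra_simps)
  qed
  then have "?m k - ?n k = 0" by (rule sums_zero_coeffs_zero)
  then show ?thesis by simp
qed

text \<open>The spectral isometry on polynomials applied to \<open>A f\<close>; the factor
  \<open>y^2\<close> comes from the two copies of \<open>A\<close> and keeps all moments at positive
  order.\<close>

lemma spectral_poly_norm: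
  fixes A :: "'h::{real_inner,banach} \<Rightarrow> 'h"
  assumes A: "pos_contraction A"
    and m: "\<And>k. op_power A (Suc k) f \<bullet> f = (\<integral> t. (1 / (1 + t)) ^ Suc k \<partial>\<mu>)"
  shows "(norm (poly_op A p (A f)))\<^sup>2 = (\<integral> t. (1 / (1 + t)) ^ 2 * (poly p (1 / (1 + t)))\<^sup>2 \<partial>\<mu>)"
proof -
  let ?y = "\<lambda>t::real. 1 / (1 + t)"
  \<comment> \<open>An extra power of \<open>A\<close> is carried along, because peeling off one
    coefficient of \<open>q\<close> turns \<open>k\<close> into \<open>k + 1\<close>.\<close>
  have *: "op_power A k (poly_op A q (A f)) \<bullet> A f = (\<integral> t. ?y t ^ (k + 2) * poly q (?y t) \<partial>\<mu>)" for k q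
  proof (induction q arbitrary: k)
    case 0
    have "op_power A k 0 = 0" for k by (induction k) (auto simp: linear_0[OF pos_contraction_linear[OF A]])
    then show ?case by (simp add: poly_op_0[OF A])
  next
    case (pCons c q)
    have i1: "integrable \<mu> (\<lambda>t. ?y t ^ (k + 2))"
      using integrable_spectral_poly[of "k + 2" 1] by (simp only: poly_1 mult_1_right)
    have lin: "op_power A k (x + y) = op_power A k x + op_power A k y"
      "op_power A k (c *\<^sub>R x) = c *\<^sub>R op_power A k x" for k x y c
      by (induction k) (auto simp: linear_add[OF pos_contraction_linear[OF A]] linear_cmul[OF pos_contraction_linear[OF A]])
    have "op_power A k (A f) \<bullet> A f = op_power A (Suc (Suc k)) f \<bullet> f"
      using op_power_Suc_right[OF A, of k f] by (simp add: pos_contraction_symmetric[OF A, of "op_power A k (A f)"])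
    then have "op_power A k (poly_op A (pCons c q) (A f)) \<bullet> A f
        = c * (\<integral> t. ?y t ^ (k + 2) \<partial>\<mu>) + (\<integral> t. ?y t ^ (Suc k + 2) * poly q (?y t) \<partial>\<mu>)"
      using pCons(2)[of "Suc k"] m[of "Suc k"] op_power_Suc_right[OF A, of k]
      by (simp add: poly_op_pCons[OF A] lin inner_add_left)
    also have "\<dots> = (\<integral> t. c * ?y t ^ (k + 2) + ?y t ^ (Suc k + 2) * poly q (?y t) \<partial>\<mu>)"
      using integrable_mult_right[OF i1, of c] integrable_spectral_poly[of "Suc k + 2" q]
      by (simp only: Bochner_Integration.integral_add integral_mult_right_zero)
    also have "\<dots> = (\<integral> t. ?y t ^ (k + 2) * poly (pCons c q) (?y t) \<partial>\<mu>)"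
    proof -
      have "c * y ^ (k + 2) + y ^ (Suc k + 2) * poly q y = y ^ (k + 2) * poly (pCons c q) y" for y
        by (simp add: algebra_simps)
      then show ?thesis by (simp only:)
    qed
    finally show ?case .
  qed
  have "(norm (poly_op A p (A f)))\<^sup>2 = poly_op A (p * p) (A f) \<bullet> A f"
    by (simp add: power2_norm_eq_inner poly_op_mult[OF A] poly_op_symmetric[OF A] )
  also have "\<dots> = (\<integral> t. ?y t ^ 2 * poly (p * p) (?y t) \<partial>\<mu>)" using *[of 0 "p * p"] by (simp only: op_power.simps add_0)
  finally show ?thesis by (simp add: power2_eq_square)
qed

text \<open>The inverse substitution \<open>1 / y - 1\<close> is differentiable for
  \<open>y > 0\<close> and therefore maps null sets to null sets; absolute continuity does the rest.
  Only \<open>y > 0\<close> occurs, since the measure lives on \<open>t \<ge> 0\<close>.\<close>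

lemma spectral_pullback_null:
  assumes ac: "absolutely_continuous lborel \<mu>" and N: "AE y in lborel. P y"
  shows "AE t in \<mu>. P (1 / (1 + t))"
proof -
  from N obtain N0 where N0: "{y. \<not> P y} \<subseteq> N0" "N0 \<in> null_sets lborel"
    by (auto elim!: AE_E simp: null_sets_def)
  let ?S = "N0 \<inter> {0<..}"
  have "negligible N0" using N0(2) by (simp add: negligible_iff_null_sets null_sets_completionI)
  then have "negligible ?S" by (rule negligible_subset) auto
  then have "negligible ((\<lambda>y. 1 / y - 1) ` ?S)"
    by (rule negligible_differentiable_image_negligible[OF order_refl])
       (auto simp: differentiable_on_def intro!: derivative_intros)
  then obtain N1 where N1: "(\<lambda>y. 1 / y - 1) ` ?S \<subseteq> N1" "N1 \<in> null_sets lborel"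
    unfolding negligible_iff_null_sets null_sets_completion_iff2 by blast
  then have "N1 \<in> null_sets \<mu>" using ac by (auto simp: absolutely_continuous_def)
  then have "AE t in \<mu>. t \<notin> N1" by (rule AE_not_in)
  then show ?thesis using AE_nonneg_spectral
  proof eventually_elim
    case (elim t)
    show ?case
    proof (rule ccontr)
      assume "\<not> P (1 / (1 + t))"
      then have "1 / (1 + t) \<in> ?S" using N0(1) elim by auto
      then have "1 / (1 / (1 + t)) - 1 \<in> N1" using N1(1) by blast
      then show False using elim by simp
    qed
  qed
qed

text \<open>The sets \<open>Y n\<close> have summable measures, so almost every \<open>y\<close>
  finally leaves them and \<open>Q n\<close> tends to 0 almost everywhere for the spectral measure.
  Hence \<open>Q n\<close> of \<open>A\<close>, applied to \<open>A f\<close>, tends to 0, whereas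
  it almost fixes \<open>h n\<close>, which tends to \<open>A f\<close>.\<close>

lemma spectrally_singular_imp_zero:
  fixes A :: "'h::{real_inner,banach} \<Rightarrow> 'h"
  assumes A: "pos_contraction A" and ac: "absolutely_continuous lborel \<mu>"
    and m: "\<And>k. op_power A (Suc k) f \<bullet> f = (\<integral> t. (1 / (1 + t)) ^ Suc k \<partial>\<mu>)"
    and Y: "\<And>n. open (Y n)" "\<And>n. emeasure lborel (Y n) \<le> ennreal ((1/2) ^ n)"
    and Q: "\<And>n y. y \<in> {0..1} \<Longrightarrow> 0 \<le> poly (Q n) y \<and> poly (Q n) y \<le> 1"
      "\<And>n y. y \<in> {0..1} - Y n \<Longrightarrow> poly (Q n) y \<le> (1/2) ^ n"
    and h: "\<And>n. norm (h n - poly_op A (Q n) (h n)) \<le> (1/2) ^ n * norm (h n)" "h \<longlonglongrightarrow> A f"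
  shows "A f = 0"
proof -
  let ?g = "A f" and ?y = "\<lambda>t::real. 1 / (1 + t)"
  have geo: "(\<lambda>n. (1/2::real) ^ n) \<longlonglongrightarrow> 0" by (rule LIMSEQ_realpow_zero) auto
  have "AE y in lborel. eventually (\<lambda>n. y \<in> space lborel - Y n) sequentially"
  proof (rule borel_cantelli_AE1)
    show "Y n \<in> sets lborel" for n using Y(1) by simp
    show "emeasure lborel (Y n) < \<infinity>" for n using Y(2)[of n] by (metis ennreal_less_top infinity_ennreal_def order_le_less_trans)
    show "summable (\<lambda>n. measure lborel (Y n))"
    proof (rule summable_comparison_test'[where N = 0])
      show "summable (\<lambda>n. (1/2::real) ^ n)" by (intro summable_geometric) auto
      show "norm (measure lborel (Y n)) \<le> (1/2) ^ n" for n
        using Y(2)[of n] by (simp add: measure_def enn2real_leI)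
    qed
  qed
  from spectral_pullback_null[OF ac this]
  have ev: "AE t in \<mu>. eventually (\<lambda>n. ?y t \<notin> Y n) sequentially" by simp
  have "(\<lambda>n. (norm (poly_op A (Q n) ?g))\<^sup>2) \<longlonglongrightarrow> 0"
  proof -
    have "(\<lambda>n. \<integral> t. ?y t ^ 2 * (poly (Q n) (?y t))\<^sup>2 \<partial>\<mu>) \<longlonglongrightarrow> (\<integral> t. 0 \<partial>\<mu>)"
    proof (rule integral_dominated_convergence)
      show "integrable \<mu> (\<lambda>t. 1::real)" using \<mu>(2) by (simp add: finite_measure.integrable_const)
      show "(\<lambda>t. ?y t ^ 2 * (poly (Q n) (?y t))\<^sup>2) \<in> borel_measurable \<mu>" for n
        using integrable_spectral_poly[of 2 "Q n * Q n"] by (simp add: power2_eq_square)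
      show "AE t in \<mu>. (\<lambda>n. ?y t ^ 2 * (poly (Q n) (?y t))\<^sup>2) \<longlonglongrightarrow> 0"
        using ev AE_nonneg_spectral
      proof eventually_elim
        case (elim t)
        have y: "?y t \<in> {0..1}" using spectral_integrand_bounds[OF elim(2)] by simp
        have "(\<lambda>n. poly (Q n) (?y t)) \<longlonglongrightarrow> 0"
        proof (rule Lim_null_comparison[OF _ geo])
          show "eventually (\<lambda>n. norm (poly (Q n) (?y t)) \<le> (1/2) ^ n) sequentially"
            using elim(1) by eventually_elim (use Q y in auto)
        qed
        from tendsto_mult[OF tendsto_const[of "?y t ^ 2"] tendsto_power[OF this, of 2]] show ?case by simp
      qed
      show "AE t in \<mu>. norm (?y t ^ 2 * (poly (Q n) (?y t))\<^sup>2) \<le> 1" for n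
        using AE_nonneg_spectral
      proof eventually_elim
        case (elim t)
        have y: "?y t \<in> {0..1}" using spectral_integrand_bounds[OF elim] by simp
        have "?y t ^ 2 \<le> 1" "(poly (Q n) (?y t))\<^sup>2 \<le> 1" using y Q(1)[OF y, of n] by (auto intro!: power_le_one)
        then show ?case using mult_le_one[of "?y t ^ 2" "(poly (Q n) (?y t))\<^sup>2"] by simp
      qed
    qed simp
    then show ?thesis using spectral_poly_norm[OF A m] by simp
  qed
  from tendsto_real_sqrt[OF this] have Qg: "(\<lambda>n. norm (poly_op A (Q n) ?g)) \<longlonglongrightarrow> 0" by simp
  have hn: "(\<lambda>n. norm (h n)) \<longlonglongrightarrow> norm ?g" by (intro tendsto_norm h)
  \<comment> \<open>By symmetry the polynomial is moved onto \<open>A f\<close>. Working with the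
    inner product avoids any bound for the operator norm of the polynomials.\<close>
  have "(\<lambda>n. ?g \<bullet> h n) \<longlonglongrightarrow> 0"
  proof (rule Lim_null_comparison)
    show "(\<lambda>n. norm (poly_op A (Q n) ?g) * norm (h n) + norm ?g * ((1/2) ^ n * norm (h n))) \<longlonglongrightarrow> 0"
      using tendsto_add[OF tendsto_mult[OF Qg hn] tendsto_mult[OF tendsto_const[of "norm ?g"] tendsto_mult[OF geo hn]]]
      by simp
    show "eventually (\<lambda>n. norm (?g \<bullet> h n) \<le> norm (poly_op A (Q n) ?g) * norm (h n) + norm ?g * ((1/2) ^ n * norm (h n))) sequentially"
    proof (intro always_eventually allI)
      fix n
      have "?g \<bullet> h n = poly_op A (Q n) ?g \<bullet> h n + ?g \<bullet> (h n - poly_op A (Q n) (h n))"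
        by (simp add: poly_op_symmetric[OF A] inner_diff_right)
      then have "\<bar>?g \<bullet> h n\<bar> \<le> \<bar>poly_op A (Q n) ?g \<bullet> h n\<bar> + \<bar>?g \<bullet> (h n - poly_op A (Q n) (h n))\<bar>" by linarith
      also have "\<dots> \<le> norm (poly_op A (Q n) ?g) * norm (h n) + norm ?g * norm (h n - poly_op A (Q n) (h n))"
        by (intro add_mono Cauchy_Schwarz_ineq2)
      also have "\<dots> \<le> norm (poly_op A (Q n) ?g) * norm (h n) + norm ?g * ((1/2) ^ n * norm (h n))"
        by (intro add_left_mono mult_left_mono h) auto
      finally show "norm (?g \<bullet> h n) \<le> norm (poly_op A (Q n) ?g) * norm (h n) + norm ?g * ((1/2) ^ n * norm (h n))"
        by simp
    qed
  qed
  moreover have "(\<lambda>n. ?g \<bullet> h n) \<longlonglongrightarrow> ?g \<bullet> ?g" by (intro tendsto_intros h)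
  ultimately have "?g \<bullet> ?g = 0" using LIMSEQ_unique by blast
  then show ?thesis by simp
qed

end

section \<open>The Hilbert space of square integrable functions\<close>

definition L2_fun :: "('a::euclidean_space \<Rightarrow> 'b::euclidean_space) \<Rightarrow> bool" where
  "L2_fun f \<longleftrightarrow> f \<in> borel_measurable lebesgue \<and> integrable lebesgue (\<lambda>x. (norm (f x))\<^sup>2)"

lemma L2_fun_measurable [measurable_dest]: "L2_fun f \<Longrightarrow> f \<in> borel_measurable lebesgue"
  and L2_fun_integrable_sq: "L2_fun f \<Longrightarrow> integrable lebesgue (\<lambda>x. (norm (f x))\<^sup>2)"
  by (auto simp: L2_fun_def)

lemma norm_sum_sq_le: "(norm (x + y))\<^sup>2 \<le> 2 * (norm x)\<^sup>2 + 2 * (norm (y::'a::real_inner))\<^sup>2"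
proof -
  have "0 \<le> (norm (x - y))\<^sup>2" by simp
  then show ?thesis
    unfolding power2_norm_eq_inner by (simp add: algebra_simps inner_commute)
qed

lemma L2_fun_bound:
  assumes "f \<in> borel_measurable lebesgue" "L2_fun g" "AE x in lebesgue. norm (f x) \<le> C * norm (g x)"
  shows "L2_fun f"
  unfolding L2_fun_def
proof
  show "integrable lebesgue (\<lambda>x. (norm (f x))\<^sup>2)"
  proof (rule Bochner_Integration.integrable_bound)
    show "integrable lebesgue (\<lambda>x. C\<^sup>2 * (norm (g x))\<^sup>2)" using assms(2) by (simp add: L2_fun_def)
    show "AE x in lebesgue. norm ((norm (f x))\<^sup>2) \<le> norm (C\<^sup>2 * (norm (g x))\<^sup>2)"
      using assms(3)
    proof eventually_elim
      case (elim x)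
      then have "(norm (f x))\<^sup>2 \<le> (C * norm (g x))\<^sup>2" by (intro power_mono) auto
      then show ?case by (simp add: power_mult_distrib)
    qed
  qed (use assms in measurable)
qed (rule assms)

lemma L2_fun_zero: "L2_fun (\<lambda>x. 0)"
  by (simp add: L2_fun_def)

lemma L2_fun_add:
  assumes [measurable_dest]: "L2_fun f" "L2_fun g" shows "L2_fun (\<lambda>x. f x + g x)"
  unfolding L2_fun_def
proof
  have [measurable]: "f \<in> borel_measurable lebesgue" "g \<in> borel_measurable lebesgue"
    using assms by (auto simp: L2_fun_def)
  show "(\<lambda>x. f x + g x) \<in> borel_measurable lebesgue" by measurable
  show "integrable lebesgue (\<lambda>x. (norm (f x + g x))\<^sup>2)"
  proof (rule Bochner_Integration.integrable_bound)
    show "integrable lebesgue (\<lambda>x. 2 * (norm (f x))\<^sup>2 + 2 * (norm (g x))\<^sup>2)"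
      using assms by (intro Bochner_Integration.integrable_add integrable_mult_right L2_fun_integrable_sq)
    show "AE x in lebesgue. norm ((norm (f x + g x))\<^sup>2) \<le> norm (2 * (norm (f x))\<^sup>2 + 2 * (norm (g x))\<^sup>2)"
      using norm_sum_sq_le by (intro AE_I2) auto
  qed measurable
qed

lemma L2_fun_scaleR: assumes "L2_fun f" shows "L2_fun (\<lambda>x. c *\<^sub>R f x)"
  by (rule L2_fun_bound[of _ f "\<bar>c\<bar>"]) (use assms in \<open>auto simp: L2_fun_def\<close>)

lemma L2_fun_uminus: "L2_fun f \<Longrightarrow> L2_fun (\<lambda>x. - f x)"
  using L2_fun_scaleR[of f "-1"] by simp

lemma L2_fun_diff: "L2_fun f \<Longrightarrow> L2_fun g \<Longrightarrow> L2_fun (\<lambda>x. f x - g x)"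
  using L2_fun_add[of f "\<lambda>x. - g x"] L2_fun_uminus[of g] by simp

lemma integrable_inner_L2:
  assumes "L2_fun f" "L2_fun g" shows "integrable lebesgue (\<lambda>x. f x \<bullet> g x)"
proof (rule Bochner_Integration.integrable_bound)
  show "(\<lambda>x. f x \<bullet> g x) \<in> borel_measurable lebesgue"
    using assms by (intro borel_measurable_inner) (auto simp: L2_fun_def)
  show "integrable lebesgue (\<lambda>x. (norm (f x))\<^sup>2 + (norm (g x))\<^sup>2)"
    using assms by (intro Bochner_Integration.integrable_add L2_fun_integrable_sq)
  show "AE x in lebesgue. norm (f x \<bullet> g x) \<le> norm ((norm (f x))\<^sup>2 + (norm (g x))\<^sup>2)"
  proof (rule AE_I2)
    fix x
    have "\<bar>f x \<bullet> g x\<bar> \<le> norm (f x) * norm (g x)" by (rule Cauchy_Schwarz_ineq2)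
    also have "\<dots> \<le> (norm (f x))\<^sup>2 + (norm (g x))\<^sup>2"
      using sum_squares_bound[of "norm (f x)" "norm (g x)"]
        mult_nonneg_nonneg[OF norm_ge_zero norm_ge_zero, of "f x" "g x"] by linarith
    finally show "norm (f x \<bullet> g x) \<le> norm ((norm (f x))\<^sup>2 + (norm (g x))\<^sup>2)" by simp
  qed
qed

\<comment> \<open>Classes modulo almost everywhere equality; the relation is partial because only
  square integrable functions are represented. The value type is a parameter so that functions and
  gradient fields live in types of the same kind and their pairs form a product Hilbert
  space.\<close>
quotient_type (overloaded) ('a, 'b) l2 = "'a::euclidean_space \<Rightarrow> 'b::euclidean_space" /
  partial: "\<lambda>f g. L2_fun f \<and> L2_fun g \<and> (AE x in lebesgue. f x = g x)"
proof (rule part_equivpI)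
  show "\<exists>f::'a \<Rightarrow> 'b. L2_fun f \<and> L2_fun f \<and> (AE x in lebesgue. f x = f x)"
    using L2_fun_zero by (intro exI[of _ "\<lambda>_. 0"]) auto
  show "symp (\<lambda>f g::'a \<Rightarrow> 'b. L2_fun f \<and> L2_fun g \<and> (AE x in lebesgue. f x = g x))"
    by (rule sympI) (auto simp: eq_commute)
  show "transp (\<lambda>f g::'a \<Rightarrow> 'b. L2_fun f \<and> L2_fun g \<and> (AE x in lebesgue. f x = g x))"
    by (rule transpI) auto
qed

instantiation l2 :: (euclidean_space, euclidean_space) real_vector
begin

lift_definition zero_l2 :: "('a, 'b) l2" is "\<lambda>x. 0"
  by (simp add: L2_fun_zero)

lift_definition plus_l2 :: "('a, 'b) l2 \<Rightarrow> ('a, 'b) l2 \<Rightarrow> ('a, 'b) l2" is "\<lambda>f g x. f x + g x"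
  by (auto simp: L2_fun_add)

lift_definition minus_l2 :: "('a, 'b) l2 \<Rightarrow> ('a, 'b) l2 \<Rightarrow> ('a, 'b) l2" is "\<lambda>f g x. f x - g x"
  by (auto simp: L2_fun_diff)

lift_definition uminus_l2 :: "('a, 'b) l2 \<Rightarrow> ('a, 'b) l2" is "\<lambda>f x. - f x"
  by (auto simp: L2_fun_uminus)

lift_definition scaleR_l2 :: "real \<Rightarrow> ('a, 'b) l2 \<Rightarrow> ('a, 'b) l2" is "\<lambda>c f x. c *\<^sub>R f x"
  by (auto simp: L2_fun_scaleR)

instance
proof
  fix x y z :: "('a, 'b) l2" and a b :: real
  show "x + y + z = x + (y + z)" by transfer (auto simp: L2_fun_add algebra_simps)
  show "x + y = y + x" by transfer (auto simp: L2_fun_add algebra_simps)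
  show "0 + x = x" by transfer (auto simp: L2_fun_add L2_fun_zero)
  show "- x + x = 0" by transfer (auto simp: L2_fun_zero)
  show "x - y = x + - y" by transfer (auto simp: L2_fun_diff)
  show "a *\<^sub>R (x + y) = a *\<^sub>R x + a *\<^sub>R y" by transfer (auto simp: L2_fun_add L2_fun_scaleR algebra_simps)
  show "(a + b) *\<^sub>R x = a *\<^sub>R x + b *\<^sub>R x" by transfer (auto simp: L2_fun_add L2_fun_scaleR algebra_simps)
  show "a *\<^sub>R b *\<^sub>R x = (a * b) *\<^sub>R x" by transfer (auto simp: L2_fun_scaleR)
  show "1 *\<^sub>R x = x" by transfer auto
qed

end

instantiation l2 :: (euclidean_space, euclidean_space) real_inner
begin

lift_definition inner_l2 :: "('a, 'b) l2 \<Rightarrow> ('a, 'b) l2 \<Rightarrow> real" is "\<lambda>f g. \<integral> x. f x \<bullet> g x \<partial>lebesgue"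
proof -
  fix f f' g g' :: "'a \<Rightarrow> 'b"
  assume f: "L2_fun f \<and> L2_fun f' \<and> (AE x in lebesgue. f x = f' x)"
    and g: "L2_fun g \<and> L2_fun g' \<and> (AE x in lebesgue. g x = g' x)"
  then have [measurable]: "f \<in> borel_measurable lebesgue" "g \<in> borel_measurable lebesgue"
    "f' \<in> borel_measurable lebesgue" "g' \<in> borel_measurable lebesgue" by (auto simp: L2_fun_def)
  show "(\<integral> x. f x \<bullet> g x \<partial>lebesgue) = (\<integral> x. f' x \<bullet> g' x \<partial>lebesgue)"
    using f g by (intro integral_cong_AE) auto
qed

definition norm_l2 :: "('a, 'b) l2 \<Rightarrow> real" where "norm_l2 f = sqrt (f \<bullet> f)"
definition sgn_l2 :: "('a, 'b) l2 \<Rightarrow> ('a, 'b) l2" where "sgn_l2 f = f /\<^sub>R norm f"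
definition dist_l2 :: "('a, 'b) l2 \<Rightarrow> ('a, 'b) l2 \<Rightarrow> real" where "dist_l2 f g = norm (f - g)"
definition uniformity_l2 :: "(('a, 'b) l2 \<times> ('a, 'b) l2) filter" where
  "uniformity_l2 = (INF e\<in>{0<..}. principal {(f, g). dist f g < e})"
definition open_l2 :: "('a, 'b) l2 set \<Rightarrow> bool" where
  "open_l2 U = (\<forall>x\<in>U. eventually (\<lambda>(x', y). x' = x \<longrightarrow> y \<in> U) uniformity)"

instance
proof
  fix x y z :: "('a, 'b) l2" and a :: real and U :: "('a, 'b) l2 set"
  show "dist x y = norm (x - y)" by (simp add: dist_l2_def)
  show "sgn x = x /\<^sub>R norm x" by (simp add: sgn_l2_def)
  show "uniformity = (INF e\<in>{0<..}. principal {(x::('a, 'b) l2, y). dist x y < e})"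
    by (simp add: uniformity_l2_def)
  show "open U = (\<forall>x\<in>U. \<forall>\<^sub>F (x', y) in uniformity. x' = x \<longrightarrow> y \<in> U)" by (simp add: open_l2_def)
  show "x \<bullet> y = y \<bullet> x" by transfer (auto simp: inner_commute)
  show "(x + y) \<bullet> z = x \<bullet> z + y \<bullet> z"
    by transfer (auto simp: inner_add_left integrable_inner_L2)
  show "(a *\<^sub>R x) \<bullet> y = a * (x \<bullet> y)" by transfer auto
  show "0 \<le> x \<bullet> x" by transfer auto
  show "(x \<bullet> x = 0) = (x = 0)"
  proof transfer
    fix f :: "'a \<Rightarrow> 'b"
    assume f: "L2_fun f \<and> L2_fun f \<and> (AE x in lebesgue. f x = f x)"
    have "((\<integral> x. f x \<bullet> f x \<partial>lebesgue) = 0) = (AE x in lebesgue. f x \<bullet> f x = 0)"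
      using f by (intro integral_nonneg_eq_0_iff_AE integrable_inner_L2) auto
    then show "((\<integral> x. f x \<bullet> f x \<partial>lebesgue) = 0) = (L2_fun f \<and> L2_fun (\<lambda>x. 0::'b) \<and> (AE x in lebesgue. f x = 0))"
      using f L2_fun_zero by auto
  qed
  show "norm x = sqrt (x \<bullet> x)" by (simp add: norm_l2_def)
qed

end

lemma L2_fun_rep: "L2_fun (rep_l2 f)"
  using Quotient3_rep_reflp[OF Quotient3_l2, of f] by simp

lemma abs_rep_l2 [simp]: "abs_l2 (rep_l2 f) = f"
  by (rule Quotient3_abs_rep[OF Quotient3_l2])

lemma abs_l2_eq_iff: "L2_fun f \<Longrightarrow> L2_fun g \<Longrightarrow> abs_l2 f = abs_l2 g \<longleftrightarrow> (AE x in lebesgue. f x = g x)"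
  using Quotient3_rel[OF Quotient3_l2, of f g] by auto

lemma rep_abs_l2: assumes "L2_fun f" shows "AE x in lebesgue. rep_l2 (abs_l2 f) x = f x"
  using abs_l2_eq_iff[OF L2_fun_rep[of "abs_l2 f"] assms] by simp

lemma inner_abs_l2: "L2_fun f \<Longrightarrow> L2_fun g \<Longrightarrow> abs_l2 f \<bullet> abs_l2 g = (\<integral> x. f x \<bullet> g x \<partial>lebesgue)"
  by (simp add: inner_l2.abs_eq)

lemma abs_l2_add: "L2_fun f \<Longrightarrow> L2_fun g \<Longrightarrow> abs_l2 f + abs_l2 g = abs_l2 (\<lambda>x. f x + g x)"
  by (simp add: plus_l2.abs_eq)

lemma abs_l2_diff: "L2_fun f \<Longrightarrow> L2_fun g \<Longrightarrow> abs_l2 f - abs_l2 g = abs_l2 (\<lambda>x. f x - g x)"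
  by (simp add: minus_l2.abs_eq)

lemma abs_l2_scaleR: "L2_fun f \<Longrightarrow> c *\<^sub>R abs_l2 f = abs_l2 (\<lambda>x. c *\<^sub>R f x)"
  by (simp add: scaleR_l2.abs_eq)

lemma abs_l2_zero: "abs_l2 (\<lambda>x. 0) = 0"
  by (simp add: zero_l2_def)

lemma norm_abs_l2: "L2_fun f \<Longrightarrow> (norm (abs_l2 f))\<^sup>2 = (\<integral> x. (norm (f x))\<^sup>2 \<partial>lebesgue)"
  by (simp add: power2_norm_eq_inner inner_abs_l2)

lemma nn_integral_L2:
  assumes "L2_fun f" shows "(\<integral>\<^sup>+ x. ennreal ((norm (f x))\<^sup>2) \<partial>lebesgue) = ennreal ((norm (abs_l2 f))\<^sup>2)"
  using assms by (simp add: norm_abs_l2 nn_integral_eq_integral L2_fun_integrable_sq)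

lemma L2_fun_iff_nn_integral:
  "L2_fun f \<longleftrightarrow> f \<in> borel_measurable lebesgue \<and> (\<integral>\<^sup>+ x. ennreal ((norm (f x))\<^sup>2) \<partial>lebesgue) < \<infinity>"
  unfolding L2_fun_def by (auto simp: integrable_iff_bounded)

section \<open>Completeness of the space of square integrable functions\<close>

lemma fast_Cauchy_subsequence:
  fixes X :: "nat \<Rightarrow> 'm::metric_space"
  assumes "Cauchy X" "\<And>n. e n > 0"
  obtains r where "strict_mono (r::nat \<Rightarrow> nat)" "\<And>n m. m \<ge> n \<Longrightarrow> dist (X (r m)) (X (r n)) < e n"
proof -
  have "\<exists>N. \<forall>m\<ge>N. \<forall>k\<ge>N. dist (X m) (X k) < e n" for n
    using assms by (auto simp: Cauchy_def)
  then obtain N where N: "\<And>n m k. m \<ge> N n \<Longrightarrow> k \<ge> N n \<Longrightarrow> dist (X m) (X k) < e n" by metis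
  define r where "r n = (\<Sum>i\<le>n. Suc (N i))" for n
  have r: "strict_mono r" by (rule strict_monoI_Suc) (simp add: r_def)
  have ge: "r n \<ge> N n" for n
  proof -
    have "Suc (N n) \<le> r n" unfolding r_def by (rule member_le_sum) auto
    then show ?thesis by simp
  qed
  show ?thesis
  proof (rule that[OF r])
    show "dist (X (r m)) (X (r n)) < e n" if "m \<ge> n" for m n
      using ge[of n] strict_mono_less_eq[OF r, of n m] that by (intro N) auto
  qed
qed

text \<open>Weight the squared increments by \<open>4^n\<close>. The weighted sum still has finite
  integral, so it is finite almost everywhere; there the increments are at most a constant times
  \<open>2^-n\<close> and hence summable.\<close>

lemma fast_L2_sequence_converges_AE:
  fixes f :: "nat \<Rightarrow> 'a::euclidean_space \<Rightarrow> 'b::euclidean_space"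
  assumes f: "\<And>n. L2_fun (f n)"
    and fast: "\<And>n. (\<integral>\<^sup>+ x. ennreal ((norm (f (Suc n) x - f n x))\<^sup>2) \<partial>lebesgue) \<le> ennreal ((1/16) ^ n)"
  shows "AE x in lebesgue. convergent (\<lambda>n. f n x)"
proof -
  have [measurable]: "f n \<in> borel_measurable lebesgue" for n using f by (simp add: L2_fun_def)
  let ?d = "\<lambda>n x. ennreal (4 ^ n) * ennreal ((norm (f (Suc n) x - f n x))\<^sup>2)"
  have "(\<integral>\<^sup>+ x. (\<Sum>n. ?d n x) \<partial>lebesgue) = (\<Sum>n. \<integral>\<^sup>+ x. ?d n x \<partial>lebesgue)"
    by (rule nn_integral_suminf) measurable
  also have "\<dots> \<le> (\<Sum>n. ennreal ((1/4) ^ n))"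
  proof (intro suminf_le allI)
    fix n
    have "(\<integral>\<^sup>+ x. ?d n x \<partial>lebesgue) = ennreal (4 ^ n) * (\<integral>\<^sup>+ x. ennreal ((norm (f (Suc n) x - f n x))\<^sup>2) \<partial>lebesgue)"
      by (rule nn_integral_cmult) measurable
    also have "\<dots> \<le> ennreal (4 ^ n) * ennreal ((1/16) ^ n)" by (intro mult_left_mono fast) auto
    also have "\<dots> = ennreal ((1/4) ^ n)"
      by (subst ennreal_mult[symmetric]) (auto simp: power_mult_distrib[symmetric])
    finally show "(\<integral>\<^sup>+ x. ?d n x \<partial>lebesgue) \<le> ennreal ((1/4) ^ n)" .
  qed auto
  also have "\<dots> < \<infinity>"
  proof -
    have "(\<Sum>n. ennreal ((1/4::real) ^ n)) = ennreal (\<Sum>n. (1/4) ^ n)"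
      by (intro suminf_ennreal2 summable_geometric) auto
    then show ?thesis by simp
  qed
  finally have fin: "(\<integral>\<^sup>+ x. (\<Sum>n. ?d n x) \<partial>lebesgue) \<noteq> \<infinity>" by simp
  have "AE x in lebesgue. (\<Sum>n. ?d n x) \<noteq> \<infinity>"
    by (rule nn_integral_PInf_AE[OF _ fin]) measurable
  then show ?thesis
  proof eventually_elim
    case (elim x)
    then obtain C where C: "(\<Sum>n. ?d n x) = ennreal C" "C \<ge> 0" by (cases "\<Sum>n. ?d n x" rule: ennreal_cases) auto
    have le: "norm (f (Suc n) x - f n x) \<le> sqrt C * (1/2) ^ n" for n
    proof -
      have "?d n x \<le> ennreal C" using C(1) sum_le_suminf[of "\<lambda>n. ?d n x" "{n}"] by auto
      then have "4 ^ n * (norm (f (Suc n) x - f n x))\<^sup>2 \<le> C"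
        using C(2) by (simp add: ennreal_mult[symmetric])
      moreover have "(4::real) ^ n = (2 ^ n)\<^sup>2" by (simp add: power2_eq_square flip: power_mult_distrib)
      ultimately have "(2 ^ n * norm (f (Suc n) x - f n x))\<^sup>2 \<le> C"
        by (simp only: power_mult_distrib)
      then have "2 ^ n * norm (f (Suc n) x - f n x) \<le> sqrt C" by (rule real_le_rsqrt)
      then show ?thesis by (simp add: field_simps power_divide)
    qed
    have "summable (\<lambda>n. f (Suc n) x - f n x)"
    proof (rule summable_comparison_test'[where N = 0])
      show "summable (\<lambda>n. sqrt C * (1/2) ^ n)" by (intro summable_mult summable_geometric) auto
    qed (rule le)
    then have "convergent (\<lambda>n. \<Sum>k<n. f (Suc k) x - f k x)" by (simp add: summable_iff_convergent)
    moreover have "(\<Sum>k<n. f (Suc k) x - f k x) = f n x - f 0 x" for n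
      using sum_lessThan_telescope[of "\<lambda>k. f k x" n] by simp
    ultimately have "convergent (\<lambda>n. f n x - f 0 x)" by simp
    then have "convergent (\<lambda>n. (f n x - f 0 x) + f 0 x)" by (intro convergent_add convergent_const)
    then show ?case by simp
  qed
qed

instance l2 :: (euclidean_space, euclidean_space) banach
proof
  fix X :: "nat \<Rightarrow> ('a, 'b) l2"
  assume X: "Cauchy X"
  \<comment> \<open>The rate \<open>(1/4)^n\<close> for norms becomes \<open>(1/16)^n\<close> for
    the squared increments, as \<open>fast_L2_sequence_converges_AE\<close> requires.\<close>
  obtain r where r: "strict_mono r" "\<And>n m. m \<ge> n \<Longrightarrow> dist (X (r m)) (X (r n)) < (1/4) ^ n"
    using fast_Cauchy_subsequence[OF X, of "\<lambda>n. (1/4) ^ n"] by auto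
  define f where "f n = rep_l2 (X (r n))" for n
  have f: "L2_fun (f n)" "abs_l2 (f n) = X (r n)" for n by (auto simp: f_def L2_fun_rep)
  then have fm [measurable]: "f n \<in> borel_measurable lebesgue" for n by (simp add: L2_fun_def)
  have dist_eq: "(\<integral>\<^sup>+ x. ennreal ((norm (f m x - f n x))\<^sup>2) \<partial>lebesgue) = ennreal ((dist (X (r m)) (X (r n)))\<^sup>2)" for m n
    using nn_integral_L2[OF L2_fun_diff[OF f(1)[of m] f(1)[of n]]] f
    by (simp add: dist_norm abs_l2_diff[symmetric])
  have "(\<integral>\<^sup>+ x. ennreal ((norm (f (Suc n) x - f n x))\<^sup>2) \<partial>lebesgue) \<le> ennreal ((1/16) ^ n)" for n
  proof -
    have "(dist (X (r (Suc n))) (X (r n)))\<^sup>2 \<le> ((1/4) ^ n)\<^sup>2"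
      using r(2)[of n "Suc n"] by (intro power_mono) auto
    then show ?thesis unfolding dist_eq
      by (intro ennreal_leI) (simp add: power2_eq_square power_mult_distrib[symmetric])
  qed
  from fast_L2_sequence_converges_AE[OF f(1) this]
  have conv: "AE x in lebesgue. convergent (\<lambda>n. f n x)" .
  define g where "g x = lim (\<lambda>n. f n x)" for x
  have [measurable]: "g \<in> borel_measurable lebesgue"
    unfolding g_def by (rule borel_measurable_lim_metric) measurable
  \<comment> \<open>Fatou's lemma transfers the Cauchy bound to the pointwise limit.\<close>
  have bound: "(\<integral>\<^sup>+ x. ennreal ((norm (g x - f n x))\<^sup>2) \<partial>lebesgue) \<le> ennreal (((1/4) ^ n)\<^sup>2)" for n
  proof -
    have "(\<integral>\<^sup>+ x. ennreal ((norm (g x - f n x))\<^sup>2) \<partial>lebesgue)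
        = (\<integral>\<^sup>+ x. liminf (\<lambda>m. ennreal ((norm (f m x - f n x))\<^sup>2)) \<partial>lebesgue)"
    proof (rule nn_integral_cong_AE)
      show "AE x in lebesgue. ennreal ((norm (g x - f n x))\<^sup>2) = liminf (\<lambda>m. ennreal ((norm (f m x - f n x))\<^sup>2))"
        using conv
      proof eventually_elim
        case (elim x)
        then have "(\<lambda>m. f m x) \<longlonglongrightarrow> g x" by (simp add: g_def convergent_LIMSEQ_iff)
        then have "(\<lambda>m. ennreal ((norm (f m x - f n x))\<^sup>2)) \<longlonglongrightarrow> ennreal ((norm (g x - f n x))\<^sup>2)"
          by (intro tendsto_ennrealI tendsto_intros)
        then show ?case using lim_imp_Liminf[OF sequentially_bot] by metis
      qed
    qed
    also have "\<dots> \<le> liminf (\<lambda>m. \<integral>\<^sup>+ x. ennreal ((norm (f m x - f n x))\<^sup>2) \<partial>lebesgue)"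
      by (rule nn_integral_liminf) measurable
    also have "\<dots> \<le> limsup (\<lambda>m. \<integral>\<^sup>+ x. ennreal ((norm (f m x - f n x))\<^sup>2) \<partial>lebesgue)"
      by (intro Liminf_le_Limsup) auto
    also have "\<dots> \<le> ennreal (((1/4) ^ n)\<^sup>2)"
    proof (rule Limsup_bounded, unfold dist_eq)
      show "eventually (\<lambda>m. ennreal ((dist (X (r m)) (X (r n)))\<^sup>2) \<le> ennreal (((1/4) ^ n)\<^sup>2)) sequentially"
        using eventually_ge_at_top[of n]
        by eventually_elim (intro ennreal_leI power_mono, use r(2) less_imp_le in auto)
    qed
    finally show ?thesis .
  qed
  have gf: "L2_fun (\<lambda>x. g x - f n x)" for n
    unfolding L2_fun_iff_nn_integral
  proof
    show "(\<integral>\<^sup>+ x. ennreal ((norm (g x - f n x))\<^sup>2) \<partial>lebesgue) < \<infinity>"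
      using bound[of n] by (metis ennreal_less_top infinity_ennreal_def order_le_less_trans)
  qed measurable
  then have g: "L2_fun g" using L2_fun_add[OF gf[of 0] f(1)[of 0]] by simp
  have "(\<lambda>n. X (r n)) \<longlonglongrightarrow> abs_l2 g"
  proof (rule metric_LIMSEQ_I)
    fix e :: real assume "e > 0"
    have d: "dist (X (r n)) (abs_l2 g) \<le> (1/4) ^ n" for n
    proof -
      have "ennreal ((norm (abs_l2 g - X (r n)))\<^sup>2) \<le> ennreal (((1/4) ^ n)\<^sup>2)"
        using bound[of n] nn_integral_L2[OF gf[of n]] f g by (simp add: abs_l2_diff[symmetric])
      then have "(norm (abs_l2 g - X (r n)))\<^sup>2 \<le> ((1/4) ^ n)\<^sup>2" by (subst (asm) ennreal_le_iff) auto
      then have "norm (abs_l2 g - X (r n)) \<le> (1/4) ^ n" by (rule power2_le_imp_le) simp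
      then show ?thesis by (simp add: dist_norm norm_minus_commute)
    qed
    have "(\<lambda>n. (1/4::real) ^ n) \<longlonglongrightarrow> 0" by (rule LIMSEQ_realpow_zero) auto
    then have "eventually (\<lambda>n. (1/4::real) ^ n < e) sequentially" using \<open>e > 0\<close> by (rule order_tendstoD)
    then obtain N where "\<And>n. n \<ge> N \<Longrightarrow> (1/4::real) ^ n < e" by (auto simp: eventually_sequentially)
    then show "\<exists>N. \<forall>n\<ge>N. dist (X (r n)) (abs_l2 g) < e" using d le_less_trans by blast
  qed
  then have "(X \<circ> r) \<longlonglongrightarrow> abs_l2 g" by (simp add: o_def)
  then have "X \<longlonglongrightarrow> abs_l2 g" using Cauchy_converges_subseq[OF X r(1)] by simp
  then show "convergent X" by (auto simp: convergent_def)
qed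

section \<open>Smooth functions\<close>

text \<open>Differentiability of finite order, recursive in \<open>k\<close>, so that closure
  properties are plain inductions; the greatest class behind \<open>smooth_fun\<close> would need a
  new witness set for each of them. Continuity at positive order follows from
  differentiability.\<close>

primrec Ck :: "nat \<Rightarrow> ('a::euclidean_space \<Rightarrow> real) \<Rightarrow> bool" where
  "Ck 0 f \<longleftrightarrow> continuous_on UNIV f"
| "Ck (Suc k) f \<longleftrightarrow> (\<forall>x. f differentiable (at x)) \<and> (\<forall>b\<in>Basis. Ck k (\<lambda>x. frechet_derivative f (at x) b))"

lemma frechet_derivative_eqI: "(f has_derivative D) (at x) \<Longrightarrow> frechet_derivative f (at x) = D"
  using frechet_derivative_at by metis

lemma frechet_derivative_has: "f differentiable (at x) \<Longrightarrow> (f has_derivative frechet_derivative f (at x)) (at x)"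
  by (simp add: frechet_derivative_works)

lemma differentiable_imp_continuous_UNIV: "(\<And>x. f differentiable (at x)) \<Longrightarrow> continuous_on UNIV f"
  by (simp add: continuous_at_imp_continuous_on differentiable_imp_continuous_within)

lemma Ck_Suc_imp: "Ck (Suc k) f \<Longrightarrow> Ck k f"
  by (induction k arbitrary: f) (auto intro: differentiable_imp_continuous_UNIV)

text \<open>The functions that are \<open>Ck\<close> for all \<open>k\<close> form a class closed
  under partial derivatives, and every such class consists of them.\<close>

lemma smooth_fun_iff_Ck: "smooth_fun f \<longleftrightarrow> (\<forall>k. Ck k f)"
proof
  assume "smooth_fun f"
  then obtain S where S: "f \<in> S" "\<And>g. g \<in> S \<Longrightarrow> continuous_on UNIV g \<and> (\<forall>x. g differentiable (at x)) \<and>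
        (\<forall>b\<in>Basis. (\<lambda>x. frechet_derivative g (at x) b) \<in> S)"
    unfolding smooth_fun_def by blast
  have "Ck k g" if "g \<in> S" for k g
    using that by (induction k arbitrary: g) (use S(2) in auto)
  then show "\<forall>k. Ck k f" using S(1) by blast
next
  assume f: "\<forall>k. Ck k f"
  have "continuous_on UNIV g \<and> (\<forall>x. g differentiable (at x)) \<and>
        (\<forall>b\<in>Basis. (\<lambda>x. frechet_derivative g (at x) b) \<in> {g. \<forall>k. Ck k g})" if "\<forall>k. Ck k g" for g :: "'a \<Rightarrow> real"
  proof -
    have "Ck 0 g" "Ck (Suc k) g" for k using that by blast+
    then show ?thesis by auto
  qed
  then show "smooth_fun f" unfolding smooth_fun_def using f by (intro exI[of _ "{g. \<forall>k. Ck k g}"]) blast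
qed

lemma Ck_SucI:
  assumes "\<And>x. (f has_derivative D x) (at x)" "\<And>b. b \<in> Basis \<Longrightarrow> Ck k (\<lambda>x. D x b)"
  shows "Ck (Suc k) f"
proof -
  have "frechet_derivative f (at x) = D x" for x using assms(1) by (rule frechet_derivative_eqI)
  then show ?thesis using assms by (auto simp: differentiable_def)
qed

lemma Ck_SucD: "Ck (Suc k) f \<Longrightarrow> (f has_derivative frechet_derivative f (at x)) (at x)"
  by (simp add: frechet_derivative_has)

lemma Ck_const: "Ck k (\<lambda>x. c)"
proof (induction k arbitrary: c)
  case (Suc k)
  show ?case by (rule Ck_SucI[where D = "\<lambda>_ _. 0"]) (auto intro: Suc)
qed simp

lemma Ck_add: "Ck k f \<Longrightarrow> Ck k g \<Longrightarrow> Ck k (\<lambda>x. f x + g x)"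
proof (induction k arbitrary: f g)
  case (Suc k)
  show ?case
    by (rule Ck_SucI[OF has_derivative_add[OF Ck_SucD[OF Suc.prems(1)] Ck_SucD[OF Suc.prems(2)]]])
       (use Suc in auto)
qed (auto intro: continuous_intros)

lemma Ck_mult: "Ck k f \<Longrightarrow> Ck k g \<Longrightarrow> Ck k (\<lambda>x. f x * g x)"
proof (induction k arbitrary: f g)
  case (Suc k)
  show ?case
  proof (rule Ck_SucI[OF has_derivative_mult[OF Ck_SucD[OF Suc.prems(1)] Ck_SucD[OF Suc.prems(2)]]])
    show "Ck k (\<lambda>x. f x * frechet_derivative g (at x) b + frechet_derivative f (at x) b * g x)" if "b \<in> Basis" for b
      using Suc.prems that Ck_Suc_imp[OF Suc.prems(1)] Ck_Suc_imp[OF Suc.prems(2)]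
      by (intro Ck_add Suc.IH) auto
  qed
qed (auto intro: continuous_intros)

lemma Ck_inverse: "Ck k g \<Longrightarrow> (\<And>x. g x \<noteq> 0) \<Longrightarrow> Ck k (\<lambda>x. inverse (g x))"
proof (induction k arbitrary: g)
  case (Suc k)
  show ?case
  proof (rule Ck_SucI)
    show "((\<lambda>x. inverse (g x)) has_derivative (\<lambda>h. - (inverse (g x) * frechet_derivative g (at x) h * inverse (g x)))) (at x)" for x
      using Suc.prems by (intro Deriv.has_derivative_inverse Ck_SucD[of k]) auto
    show "Ck k (\<lambda>x. - (inverse (g x) * frechet_derivative g (at x) b * inverse (g x)))" if "b \<in> Basis" for b
    proof -
      have "Ck k (\<lambda>x. (-1) * (inverse (g x) * frechet_derivative g (at x) b * inverse (g x)))"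
        using Suc.prems that Ck_Suc_imp[OF Suc.prems(1)] by (intro Ck_mult Ck_const Suc.IH) auto
      then show ?thesis by simp
    qed
  qed
qed (auto intro: continuous_intros)

lemma Ck_sum: "(\<And>i. i \<in> I \<Longrightarrow> Ck k (f i)) \<Longrightarrow> Ck k (\<lambda>x. \<Sum>i\<in>I. f i x)"
  by (induction I rule: infinite_finite_induct) (auto intro: Ck_const Ck_add)

lemma Ck_prod: "(\<And>i. i \<in> I \<Longrightarrow> Ck k (f i)) \<Longrightarrow> Ck k (\<lambda>x. \<Prod>i\<in>I. f i x)"
  by (induction I rule: infinite_finite_induct) (auto intro: Ck_const Ck_mult)

lemma Ck_compose_affine:
  fixes f :: "'b::euclidean_space \<Rightarrow> real" and L :: "'a::euclidean_space \<Rightarrow> 'b"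
  assumes L: "bounded_linear L"
  shows "Ck k f \<Longrightarrow> Ck k (\<lambda>x. f (L x + c))"
proof (induction k arbitrary: f)
  case 0
  have "continuous_on UNIV (\<lambda>x. L x + c)"
    by (intro continuous_intros linear_continuous_on L)
  then show ?case using 0 continuous_on_compose2[of UNIV f UNIV "\<lambda>x. L x + c"] by simp
next
  case (Suc k)
  let ?D = "\<lambda>x h. frechet_derivative f (at (L x + c)) (L h)"
  have D: "((\<lambda>x. f (L x + c)) has_derivative ?D x) (at x)" for x
  proof -
    have "((\<lambda>x. L x + c) has_derivative L) (at x)"
      using has_derivative_add[OF bounded_linear_imp_has_derivative[OF L] has_derivative_const[of c]] by simp
    then show ?thesis
      using has_derivative_compose[of "\<lambda>x. L x + c" L x UNIV f] Ck_SucD[OF Suc.prems, of "L x + c"] by simp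
  qed
  show ?case
  proof (rule Ck_SucI[OF D])
    fix b :: 'a assume "b \<in> Basis"
    have "?D x b = (\<Sum>i\<in>Basis. (L b \<bullet> i) * frechet_derivative f (at (L x + c)) i)" for x
    proof -
      have "linear (frechet_derivative f (at (L x + c)))"
        using Ck_SucD[OF Suc.prems] has_derivative_linear by blast
      then show ?thesis
        by (subst (1) euclidean_representation[of "L b", symmetric]) (simp add: linear_sum linear_cmul)
    qed
    moreover have "Ck k (\<lambda>x. \<Sum>i\<in>Basis. (L b \<bullet> i) * frechet_derivative f (at (L x + c)) i)"
      using Suc.prems by (intro Ck_sum Ck_mult Ck_const Suc.IH) auto
    ultimately show "Ck k (\<lambda>x. ?D x b)" by simp
  qed
qed

lemma Ck_real_SucI:
  fixes f :: "real \<Rightarrow> real"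
  assumes "\<And>t. (f has_real_derivative f' t) (at t)" "Ck k f'"
  shows "Ck (Suc k) f"
  by (rule Ck_SucI[where D = "\<lambda>t h. f' t * h"])
     (use assms in \<open>auto simp: has_field_derivative_def\<close>)

lemma smooth_fun_const: "smooth_fun (\<lambda>x. c)"
  and smooth_fun_add: "smooth_fun f \<Longrightarrow> smooth_fun g \<Longrightarrow> smooth_fun (\<lambda>x. f x + g x)"
  and smooth_fun_mult: "smooth_fun f \<Longrightarrow> smooth_fun g \<Longrightarrow> smooth_fun (\<lambda>x. f x * g x)"
  by (auto simp: smooth_fun_iff_Ck Ck_const Ck_add Ck_mult)

lemma smooth_fun_prod: "(\<And>i. i \<in> I \<Longrightarrow> smooth_fun (f i)) \<Longrightarrow> smooth_fun (\<lambda>x. \<Prod>i\<in>I. f i x)"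
  by (auto simp: smooth_fun_iff_Ck Ck_prod)

lemma smooth_fun_compose_affine: "bounded_linear L \<Longrightarrow> smooth_fun f \<Longrightarrow> smooth_fun (\<lambda>x. f (L x + c))"
  by (auto simp: smooth_fun_iff_Ck Ck_compose_affine)

lemma smooth_fun_differentiable: "smooth_fun f \<Longrightarrow> f differentiable (at x)"
  and smooth_fun_continuous: "smooth_fun f \<Longrightarrow> continuous_on UNIV f"
  and smooth_fun_partial_continuous: "smooth_fun f \<Longrightarrow> b \<in> Basis \<Longrightarrow> continuous_on UNIV (\<lambda>x. frechet_derivative f (at x) b)"
proof -
  assume "smooth_fun f"
  then have *: "Ck 0 f" "Ck 1 f" by (auto simp: smooth_fun_iff_Ck)
  then show "f differentiable (at x)" "continuous_on UNIV f"
    "b \<in> Basis \<Longrightarrow> continuous_on UNIV (\<lambda>x. frechet_derivative f (at x) b)" by auto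
qed

section \<open>A smooth step function\<close>

definition flat_exp :: "real \<Rightarrow> real" where
  "flat_exp t = (if t > 0 then exp (- inverse t) else 0)"

lemma poly_times_exp_tendsto_0:
  fixes p :: "real poly"
  shows "((\<lambda>y. poly p y * exp (- y)) \<longlongrightarrow> 0) at_top"
proof -
  have "((\<lambda>y::real. coeff p i * (y ^ i / exp y)) \<longlongrightarrow> 0) at_top" for i
    using tendsto_mult[OF tendsto_const[of "coeff p i"] tendsto_power_div_exp_0[of i]] by simp
  then have "((\<lambda>y::real. \<Sum>i\<le>degree p. coeff p i * (y ^ i / exp y)) \<longlongrightarrow> (\<Sum>i\<le>degree p. 0)) at_top"
    by (intro tendsto_sum)
  then show ?thesis
    by (simp add: poly_altdef exp_minus divide_inverse sum_distrib_right mult.assoc)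
qed

text \<open>The functions \<open>p (1/t) * exp (- 1/t)\<close> with polynomial \<open>p\<close>,
  extended by 0, are closed under differentiation. At 0 the difference quotient belongs to the
  polynomial \<open>X * p\<close> and tends to 0, as the exponential beats every power of
  \<open>1/t\<close>.\<close>

lemma smooth_flat_exp: "smooth_fun flat_exp"
proof -
  \<comment> \<open>\<open>F p\<close> is the extended function with polynomial \<open>p\<close>.
    Since the derivative of \<open>1/t\<close> is \<open>-1/t^2\<close>, differentiation replaces
    \<open>p\<close> by \<open>d p = X^2 * (p - p')\<close>.\<close>
  define F :: "real poly \<Rightarrow> real \<Rightarrow> real" where
    "F p t = (if t > 0 then poly p (inverse t) * exp (- inverse t) else 0)" for p t
  define d :: "real poly \<Rightarrow> real poly" where "d p = [:0, 0, 1:] * (p - pderiv p)" for p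
  have deriv: "(F p has_real_derivative F (d p) t) (at t)" for p t
  proof -
    consider "t > 0" | "t < 0" | "t = 0" by linarith
    then show ?thesis
    proof cases
      case 1
      have "((\<lambda>t. poly p (inverse t) * exp (- inverse t)) has_real_derivative
          poly (pderiv p) (inverse t) * (- (inverse t ^ 2)) * exp (- inverse t)
            + (exp (- inverse t) * (inverse t ^ 2)) * poly p (inverse t)) (at t)"
        using 1 by (auto intro!: derivative_eq_intros DERIV_chain2[OF poly_DERIV] simp: power2_eq_square)
      moreover have "poly (pderiv p) (inverse t) * (- (inverse t ^ 2)) * exp (- inverse t)
            + (exp (- inverse t) * (inverse t ^ 2)) * poly p (inverse t) = F (d p) t"
        using 1 by (simp add: F_def d_def power2_eq_square algebra_simps)
      moreover have "\<forall>\<^sub>F s in nhds t. F p s = poly p (inverse s) * exp (- inverse s)"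
        using eventually_nhds_in_open[of "{0<..}" t] 1 by (auto simp: F_def elim: eventually_mono)
      ultimately show ?thesis by (subst DERIV_cong_ev[OF refl _ refl]) auto
    next
      case 2
      have "\<forall>\<^sub>F s in nhds t. F p s = 0"
        using eventually_nhds_in_open[of "{..<0}" t] 2 by (auto simp: F_def elim!: eventually_mono)
      moreover have "((\<lambda>_. 0) has_real_derivative 0) (at t)" by simp
      moreover have "F (d p) t = 0" using 2 by (simp add: F_def)
      ultimately show ?thesis by (subst DERIV_cong_ev[OF refl _ refl]) auto
    next
      case 3
      have right: "((\<lambda>h. F p h / h) \<longlongrightarrow> 0) (at_right 0)"
      proof -
        have "((\<lambda>h. poly ([:0, 1:] * p) (inverse h) * exp (- inverse h)) \<longlongrightarrow> 0) (at_right (0::real))"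
          using filterlim_compose[OF poly_times_exp_tendsto_0[of "[:0, 1:] * p"] filterlim_inverse_at_top_right] .
        moreover have "\<forall>\<^sub>F h in at_right (0::real). poly ([:0, 1:] * p) (inverse h) * exp (- inverse h) = F p h / h"
          using eventually_at_right_less[of 0] by eventually_elim (simp add: F_def divide_inverse)
        ultimately show ?thesis by (rule Lim_transform_eventually)
      qed
      have left: "((\<lambda>h. F p h / h) \<longlongrightarrow> 0) (at_left 0)"
      proof (rule tendsto_eventually)
        show "\<forall>\<^sub>F h in at_left (0::real). F p h / h = 0"
          by (auto simp: eventually_at_filter F_def)
      qed
      have "((\<lambda>h. F p h / h) \<longlongrightarrow> 0) (at 0)" using left right by (simp add: filterlim_at_split)
      then show ?thesis using 3 by (simp add: has_field_derivative_iff F_def)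
    qed
  qed
  have "Ck k (F p)" for k p
  proof (induction k arbitrary: p)
    case 0
    have "isCont (F p) t" for t using deriv by (rule DERIV_isCont)
    then show ?case by (simp add: continuous_at_imp_continuous_on)
  next
    case (Suc k)
    then show ?case by (intro Ck_real_SucI[OF deriv])
  qed
  moreover have "F 1 = flat_exp" by (auto simp: F_def flat_exp_def)
  ultimately show ?thesis by (metis smooth_fun_iff_Ck)
qed

lemma flat_exp_nonneg: "0 \<le> flat_exp t" and flat_exp_pos: "t > 0 \<Longrightarrow> 0 < flat_exp t"
  and flat_exp_zero: "t \<le> 0 \<Longrightarrow> flat_exp t = 0" and flat_exp_le_1: "flat_exp t \<le> 1"
  by (auto simp: flat_exp_def)

definition smooth_step :: "real \<Rightarrow> real" where
  "smooth_step t = flat_exp t * inverse (flat_exp t + flat_exp (1 - t))"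

lemma flat_exp_sum_pos: "flat_exp t + flat_exp (1 - t) > 0"
proof (cases "t > 0")
  case True
  then show ?thesis by (intro add_pos_nonneg flat_exp_pos flat_exp_nonneg)
next
  case False
  then show ?thesis by (intro add_nonneg_pos flat_exp_pos flat_exp_nonneg) simp
qed

lemma smooth_smooth_step: "smooth_fun smooth_step"
proof -
  have "smooth_fun (\<lambda>t. flat_exp (- t + 1))"
    by (rule smooth_fun_compose_affine[OF bounded_linear_minus[OF bounded_linear_ident] smooth_flat_exp])
  then have "Ck k (\<lambda>t. flat_exp (1 - t))" for k by (simp add: smooth_fun_iff_Ck add.commute)
  moreover have "Ck k flat_exp" for k using smooth_flat_exp by (simp add: smooth_fun_iff_Ck)
  ultimately have "Ck k (\<lambda>t. flat_exp t * inverse (flat_exp t + flat_exp (1 - t)))" for k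
    using flat_exp_sum_pos by (intro Ck_mult Ck_inverse Ck_add) (auto simp: less_imp_neq[symmetric])
  then show ?thesis by (simp add: smooth_fun_iff_Ck smooth_step_def[abs_def])
qed

lemma smooth_step_0: "t \<le> 0 \<Longrightarrow> smooth_step t = 0"
  by (simp add: smooth_step_def flat_exp_zero)

lemma smooth_step_1: "t \<ge> 1 \<Longrightarrow> smooth_step t = 1"
  using flat_exp_pos[of t] by (simp add: smooth_step_def flat_exp_zero)

lemma smooth_step_range: "0 \<le> smooth_step t" "smooth_step t \<le> 1"
proof -
  show "0 \<le> smooth_step t" using flat_exp_sum_pos[of t] flat_exp_nonneg[of t] by (simp add: smooth_step_def)
  show "smooth_step t \<le> 1"
    using flat_exp_sum_pos[of t] flat_exp_nonneg[of "1 - t"] by (simp add: smooth_step_def field_simps)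
qed

lemma smooth_step_deriv_bound:
  obtains C D where "C > 0" "\<And>t. (smooth_step has_real_derivative D t) (at t)" "\<And>t. \<bar>D t\<bar> \<le> C"
proof -
  define D where "D t = frechet_derivative smooth_step (at t) 1" for t
  have D: "(smooth_step has_real_derivative D t) (at t)" for t
  proof -
    have h: "(smooth_step has_derivative frechet_derivative smooth_step (at t)) (at t)"
      by (intro frechet_derivative_has smooth_fun_differentiable smooth_smooth_step)
    then have "frechet_derivative smooth_step (at t) h = D t * h" for h
      using linear_cmul[OF has_derivative_linear[OF h], of h 1] by (simp add: D_def mult.commute)
    then have "frechet_derivative smooth_step (at t) = (*) (D t)" by auto
    then show ?thesis using h by (simp add: has_field_derivative_def)
  qed
  have "continuous_on UNIV D" unfolding D_def
    by (rule smooth_fun_partial_continuous[OF smooth_smooth_step]) simp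
  then have "continuous_on {0..1} D" by (rule continuous_on_subset) simp
  then have "compact (D ` {0..1})" by (intro compact_continuous_image) simp_all
  then have "bounded (D ` {0..1})" by (rule compact_imp_bounded)
  then obtain B where B: "\<forall>z\<in>D ` {0..1}. norm z \<le> B" by (auto simp: bounded_iff)
  have "norm (D 0) \<le> B" using B by simp
  then have B0: "B \<ge> 0" by (rule order_trans[OF norm_ge_zero])
  \<comment> \<open>\<open>B\<close> is only known to be nonnegative; the added 1 supplies a
    positive constant. Outside the unit interval the step is locally constant.\<close>
  have "\<bar>D t\<bar> \<le> B + 1" for t
  proof -
    consider "t \<in> {0..1}" | "t < 0" | "t > 1" by fastforce
    then show ?thesis
    proof cases
      case 1
      then have "norm (D t) \<le> B" using B by blast
      then show ?thesis by simp
    next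
      case 2
      have "\<forall>\<^sub>F s in nhds t. smooth_step s = 0"
        using eventually_nhds_in_open[of "{..<0}" t] 2 by (auto simp: smooth_step_0 elim!: eventually_mono)
      then have "(smooth_step has_real_derivative 0) (at t)"
        using DERIV_cong_ev[of t t smooth_step "\<lambda>_. 0" 0 0] by simp
      then have "D t = 0" using D DERIV_unique by blast
      then show ?thesis using B0 by simp
    next
      case 3
      have "\<forall>\<^sub>F s in nhds t. smooth_step s = 1"
        using eventually_nhds_in_open[of "{1<..}" t] 3 by (auto simp: smooth_step_1 elim!: eventually_mono)
      then have "(smooth_step has_real_derivative 0) (at t)"
        using DERIV_cong_ev[of t t smooth_step "\<lambda>_. 1" 0 0] by simp
      then have "D t = 0" using D DERIV_unique by blast
      then show ?thesis using B0 by simp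
    qed
  qed
  then show ?thesis using that[of "B + 1" D] D B0 by simp
qed

section \<open>Gradients and test functions\<close>

lemma grad_eqI:
  assumes "(f has_derivative (\<lambda>h. v \<bullet> h)) (at x)" shows "grad f x = v"
  using frechet_derivative_eqI[OF assms] by (simp add: grad_def euclidean_representation)

lemma grad_inner:
  assumes "f differentiable (at x)" shows "grad f x \<bullet> h = frechet_derivative f (at x) h"
proof -
  have lin: "linear (frechet_derivative f (at x))"
    using frechet_derivative_has[OF assms] has_derivative_linear by blast
  have "frechet_derivative f (at x) h = frechet_derivative f (at x) (\<Sum>b\<in>Basis. (h \<bullet> b) *\<^sub>R b)"
    by (simp add: euclidean_representation)
  also have "\<dots> = (\<Sum>b\<in>Basis. (h \<bullet> b) * frechet_derivative f (at x) b)"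
    by (simp add: linear_sum[OF lin] linear_cmul[OF lin])
  finally show ?thesis by (simp add: grad_def inner_sum_left inner_commute[of h] mult.commute)
qed

lemma has_derivative_grad: "f differentiable (at x) \<Longrightarrow> (f has_derivative (\<lambda>h. grad f x \<bullet> h)) (at x)"
  using frechet_derivative_has[of f x] by (simp add: grad_inner)

lemma grad_add: "f differentiable (at x) \<Longrightarrow> g differentiable (at x) \<Longrightarrow> grad (\<lambda>x. f x + g x) x = grad f x + grad g x"
  by (rule grad_eqI) (auto intro!: derivative_eq_intros has_derivative_grad simp: inner_add_left)

lemma grad_mult:
  "f differentiable (at x) \<Longrightarrow> g differentiable (at x) \<Longrightarrow> grad (\<lambda>x. f x * g x) x = f x *\<^sub>R grad g x + g x *\<^sub>R grad f x"
  by (rule grad_eqI) (auto intro!: derivative_eq_intros has_derivative_grad simp: inner_add_left mult.commute)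

lemma grad_cong_open:
  assumes "open S" "x \<in> S" "\<And>y. y \<in> S \<Longrightarrow> f y = g y" "g differentiable (at x)"
  shows "grad f x = grad g x"
  by (rule grad_eqI, rule has_derivative_transform_within_open[OF has_derivative_grad[OF assms(4)] assms(1,2)])
     (use assms(3) in auto)

lemma continuous_grad: "smooth_fun f \<Longrightarrow> continuous_on UNIV (grad f)"
  unfolding grad_def[abs_def] by (intro continuous_intros smooth_fun_partial_continuous)

lemma L2_fun_continuous_compact:
  fixes f :: "'a::euclidean_space \<Rightarrow> 'b::euclidean_space"
  assumes f: "continuous_on UNIV f" and K: "compact K" "\<And>x. x \<notin> K \<Longrightarrow> f x = 0"
  shows "L2_fun f"
  unfolding L2_fun_def
proof
  show m: "f \<in> borel_measurable lebesgue"
    using borel_measurable_continuous_onI[OF f] by (simp add: measurable_completion)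
  have "compact (f ` K)" by (rule compact_continuous_image[OF continuous_on_subset[OF f] K(1)]) simp
  then obtain C where C: "\<And>x. x \<in> K \<Longrightarrow> norm (f x) \<le> C"
    using compact_imp_bounded[of "f ` K"] by (auto simp: bounded_iff)
  show "integrable lebesgue (\<lambda>x. (norm (f x))\<^sup>2)"
  proof (rule Bochner_Integration.integrable_bound)
    have "K \<in> lmeasurable" using K(1) by (rule lmeasurable_compact)
    then show "integrable lebesgue (\<lambda>x. C\<^sup>2 * indicator K x :: real)"
      by (intro integrable_mult_right integrable_real_indicator) (auto simp: fmeasurable_def)
    show "(\<lambda>x. (norm (f x))\<^sup>2) \<in> borel_measurable lebesgue" using m by measurable
    show "AE x in lebesgue. norm ((norm (f x))\<^sup>2) \<le> norm (C\<^sup>2 * indicator K x)"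
    proof (rule AE_I2)
      fix x
      show "norm ((norm (f x))\<^sup>2) \<le> norm (C\<^sup>2 * indicator K x)"
        using C[of x] K(2)[of x] by (cases "x \<in> K") (auto intro: power_mono)
    qed
  qed
qed

lemma test_fun_grad_zero:
  assumes "smooth_fun \<phi>" "compact K" "\<And>x. x \<notin> K \<Longrightarrow> \<phi> x = 0" "x \<notin> K"
  shows "grad \<phi> x = 0"
proof -
  have "grad \<phi> x = grad (\<lambda>_. 0) x"
    by (rule grad_cong_open[of "- K"]) (use assms compact_imp_closed in auto)
  also have "\<dots> = 0" by (rule grad_eqI) simp
  finally show ?thesis .
qed

lemma test_fun_smooth: "test_fun \<Omega> \<phi> \<Longrightarrow> smooth_fun \<phi>"
  and test_fun_differentiable: "test_fun \<Omega> \<phi> \<Longrightarrow> \<phi> differentiable (at x)"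
  by (auto simp: test_fun_def smooth_fun_differentiable)

lemma L2_fun_test: assumes "test_fun \<Omega> \<phi>" shows "L2_fun \<phi>" "L2_fun (grad \<phi>)"
proof -
  obtain K where K: "smooth_fun \<phi>" "compact K" "\<And>x. x \<notin> K \<Longrightarrow> \<phi> x = 0"
    using assms by (auto simp: test_fun_def)
  show "L2_fun \<phi>" by (rule L2_fun_continuous_compact[OF smooth_fun_continuous[OF K(1)] K(2,3)])
  show "L2_fun (grad \<phi>)"
    by (rule L2_fun_continuous_compact[OF continuous_grad[OF K(1)] K(2)]) (rule test_fun_grad_zero[OF K])
qed

lemma test_fun_zero_outside: assumes "test_fun \<Omega> \<phi>" "x \<notin> \<Omega>" shows "\<phi> x = 0" "grad \<phi> x = 0"
proof -
  obtain K where K: "smooth_fun \<phi>" "compact K" "\<And>x. x \<notin> K \<Longrightarrow> \<phi> x = 0" "K \<subseteq> \<Omega>"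
    using assms by (auto simp: test_fun_def)
  then show "\<phi> x = 0" "grad \<phi> x = 0" using test_fun_grad_zero[OF K(1-3)] assms(2) by blast+
qed

lemma test_fun_mono: "test_fun \<Omega> \<phi> \<Longrightarrow> \<Omega> \<subseteq> \<Omega>' \<Longrightarrow> test_fun \<Omega>' \<phi>"
  by (auto simp: test_fun_def)

lemma test_fun_zero: "test_fun \<Omega> (\<lambda>x. 0)"
  by (auto simp: test_fun_def smooth_fun_const intro!: exI[of _ "{}"])

lemma test_fun_add: assumes "test_fun \<Omega> \<phi>" "test_fun \<Omega> \<psi>" shows "test_fun \<Omega> (\<lambda>x. \<phi> x + \<psi> x)"
proof -
  obtain K L where "smooth_fun \<phi>" "compact K" "K \<subseteq> \<Omega>" "\<And>x. x \<notin> K \<Longrightarrow> \<phi> x = 0"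
    "smooth_fun \<psi>" "compact L" "L \<subseteq> \<Omega>" "\<And>x. x \<notin> L \<Longrightarrow> \<psi> x = 0"
    using assms by (auto simp: test_fun_def)
  then show ?thesis unfolding test_fun_def
    by (intro conjI smooth_fun_add exI[of _ "K \<union> L"]) auto
qed

text \<open>The closed set \<open>C\<close> carries the cutoff, so the support of the product stays
  compact and may be placed in a different open set. This is how test functions are moved to a
  smaller domain.\<close>

lemma test_fun_mult:
  assumes "test_fun \<Omega> \<phi>" "smooth_fun \<xi>" "closed C" "\<And>x. x \<notin> C \<Longrightarrow> \<xi> x = 0" "\<Omega> \<inter> C \<subseteq> \<Omega>'"
  shows "test_fun \<Omega>' (\<lambda>x. \<xi> x * \<phi> x)"
proof -
  obtain K where K: "smooth_fun \<phi>" "compact K" "K \<subseteq> \<Omega>" "\<And>x. x \<notin> K \<Longrightarrow> \<phi> x = 0"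
    using assms(1) by (auto simp: test_fun_def)
  have "compact (K \<inter> C)" using K(2) assms(3) by (rule compact_Int_closed)
  moreover have "K \<inter> C \<subseteq> \<Omega>'" using K(3) assms(5) by auto
  moreover have "\<xi> x * \<phi> x = 0" if "x \<notin> K \<inter> C" for x using that K(4) assms(4) by auto
  ultimately show ?thesis unfolding test_fun_def using smooth_fun_mult[OF assms(2) K(1)] by blast
qed

section \<open>The resolvent of the Dirichlet Laplacian\<close>

definition test_graph :: "'a::euclidean_space set \<Rightarrow> (('a, real) l2 \<times> ('a, 'a) l2) set" where
  "test_graph \<Omega> = {(abs_l2 \<phi>, abs_l2 (grad \<phi>)) | \<phi>. test_fun \<Omega> \<phi>}"

text \<open>The space \<open>H10\<close> with the weak gradient kept as a second coordinate. The
  product norm is then the \<open>H\<^sup>1\<close> norm, and the Dirichlet form domain becomes a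
  closed subspace to which orthogonal projection applies.\<close>

definition form_space :: "'a::euclidean_space set \<Rightarrow> (('a, real) l2 \<times> ('a, 'a) l2) set" where
  "form_space \<Omega> = closure (test_graph \<Omega>)"

lemma grad_zero: "grad (\<lambda>x. 0) = (\<lambda>x. 0)"
  by (rule ext, rule grad_eqI) simp

lemma subspace_test_graph: "subspace (test_graph \<Omega>)"
  unfolding subspace_def
proof (intro conjI ballI allI)
  show "0 \<in> test_graph \<Omega>"
    unfolding test_graph_def zero_prod_def using test_fun_zero
    by (auto simp: grad_zero abs_l2_zero intro!: exI[of _ "\<lambda>x. 0"])
next
  fix x y assume "x \<in> test_graph \<Omega>" "y \<in> test_graph \<Omega>"
  then obtain \<phi> \<psi> where *: "x = (abs_l2 \<phi>, abs_l2 (grad \<phi>))" "test_fun \<Omega> \<phi>"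
    "y = (abs_l2 \<psi>, abs_l2 (grad \<psi>))" "test_fun \<Omega> \<psi>" by (auto simp: test_graph_def)
  have "grad (\<lambda>x. \<phi> x + \<psi> x) = (\<lambda>x. grad \<phi> x + grad \<psi> x)"
    using * by (auto intro!: grad_add test_fun_differentiable)
  then have "x + y = (abs_l2 (\<lambda>x. \<phi> x + \<psi> x), abs_l2 (grad (\<lambda>x. \<phi> x + \<psi> x)))"
    using * L2_fun_test[OF *(2)] L2_fun_test[OF *(4)] by (simp add: abs_l2_add)
  then show "x + y \<in> test_graph \<Omega>" using test_fun_add[OF *(2,4)] by (auto simp: test_graph_def)
next
  fix x and c :: real assume "x \<in> test_graph \<Omega>"
  then obtain \<phi> where *: "x = (abs_l2 \<phi>, abs_l2 (grad \<phi>))" "test_fun \<Omega> \<phi>" by (auto simp: test_graph_def)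
  have "grad (\<lambda>x. c * \<phi> x) = (\<lambda>x. c *\<^sub>R grad \<phi> x)"
  proof
    fix x show "grad (\<lambda>x. c * \<phi> x) x = c *\<^sub>R grad \<phi> x"
      using grad_mult[of "\<lambda>_. c" x \<phi>] test_fun_differentiable[OF *(2)] grad_eqI[of "\<lambda>_. c" 0 x] by simp
  qed
  then have "c *\<^sub>R x = (abs_l2 (\<lambda>x. c * \<phi> x), abs_l2 (grad (\<lambda>x. c * \<phi> x)))"
    using * L2_fun_test[OF *(2)] by (simp add: abs_l2_scaleR)
  moreover have "test_fun \<Omega> (\<lambda>x. c * \<phi> x)"
    using test_fun_mult[OF *(2) smooth_fun_const[of c], of UNIV \<Omega>] by simp
  ultimately show "c *\<^sub>R x \<in> test_graph \<Omega>" by (auto simp: test_graph_def)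
qed

lemma subspace_closure:
  fixes S :: "'h::real_normed_vector set"
  assumes S: "subspace S" shows "subspace (closure S)"
  unfolding subspace_def
proof (intro conjI ballI allI)
  show "0 \<in> closure S" using subspace_0[OF S] closure_subset by blast
  fix x assume x: "x \<in> closure S"
  then obtain f where f: "\<And>n. f n \<in> S" "f \<longlonglongrightarrow> x" by (auto simp: closure_sequential)
  show "c *\<^sub>R x \<in> closure S" for c
    unfolding closure_sequential using f S
    by (intro exI[of _ "\<lambda>n. c *\<^sub>R f n"]) (auto intro!: tendsto_intros simp: subspace_scale)
  fix y assume "y \<in> closure S"
  then obtain g where g: "\<And>n. g n \<in> S" "g \<longlonglongrightarrow> y" by (auto simp: closure_sequential)
  show "x + y \<in> closure S"
    unfolding closure_sequential using f g S
    by (intro exI[of _ "\<lambda>n. f n + g n"]) (auto intro!: tendsto_intros simp: subspace_add)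
qed

lemma subspace_form_space: "subspace (form_space \<Omega>)"
  unfolding form_space_def by (rule subspace_closure[OF subspace_test_graph])

lemma closed_form_space: "closed (form_space \<Omega>)"
  by (simp add: form_space_def)

lemmas form_space_props = subspace_form_space closed_form_space

lemma test_in_form_space: "test_fun \<Omega> \<phi> \<Longrightarrow> (abs_l2 \<phi>, abs_l2 (grad \<phi>)) \<in> form_space \<Omega>"
  unfolding form_space_def using closure_subset by (fastforce simp: test_graph_def)

lemma form_space_mono: "\<Omega> \<subseteq> \<Omega>' \<Longrightarrow> form_space \<Omega> \<subseteq> form_space \<Omega>'"
  unfolding form_space_def test_graph_def by (intro closure_mono) (use test_fun_mono in blast)

text \<open>Density principle: estimates that are closed conditions on the pair need to be checked
  for test functions only.\<close>

lemma form_space_induct: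
  assumes "p \<in> form_space \<Omega>" "closed {p. P p}" "\<And>\<phi>. test_fun \<Omega> \<phi> \<Longrightarrow> P (abs_l2 \<phi>, abs_l2 (grad \<phi>))"
  shows "P p"
proof -
  have "test_graph \<Omega> \<subseteq> {p. P p}" using assms(3) by (auto simp: test_graph_def)
  then show ?thesis using assms(1,2) closure_minimal unfolding form_space_def by blast
qed

text \<open>The resolvent of the Dirichlet Laplacian at \<open>-1\<close>: the Riesz representative with respect to the
  \<open>H\<^sup>1\<close> inner product is the projection of \<open>(f, 0)\<close> onto the graph of the weak gradient.\<close>

definition dres :: "'a::euclidean_space set \<Rightarrow> ('a, real) l2 \<Rightarrow> ('a, real) l2" where
  "dres \<Omega> f = fst (hproj (form_space \<Omega>) (f, 0))"

lemma dres_inner: "dres \<Omega> f \<bullet> g = hproj (form_space \<Omega>) (f, 0) \<bullet> (g, 0)"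
  by (simp add: dres_def inner_prod_def)

text \<open>\<open>dres\<close> is the compression of an orthogonal projection to the first factor.
  Symmetry is inherited, and dropping the gradient coordinate can only shorten the projected vector,
  whose squared norm is the form.\<close>

lemma pos_contraction_dres: "pos_contraction (dres \<Omega>)"
  unfolding pos_contraction_def
proof (intro conjI allI)
  note lin = linear_hproj[OF form_space_props, of \<Omega>]
  show "linear (dres \<Omega>)"
  proof (rule linearI)
    show "dres \<Omega> (x + y) = dres \<Omega> x + dres \<Omega> y" for x y
      using linear_add[OF lin, of "(x, 0)" "(y, 0)"] by (simp add: dres_def)
    show "dres \<Omega> (c *\<^sub>R x) = c *\<^sub>R dres \<Omega> x" for c x
      using linear_cmul[OF lin, of c "(x, 0)"] by (simp add: dres_def)
  qed
  show "dres \<Omega> x \<bullet> y = x \<bullet> dres \<Omega> y" for x y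
    using hproj_symmetric[OF form_space_props, of \<Omega> "(x, 0)" "(y, 0)"] dres_inner[of \<Omega> x y] dres_inner[of \<Omega> y x]
    by (simp add: inner_commute)
  show "(norm (dres \<Omega> x))\<^sup>2 \<le> dres \<Omega> x \<bullet> x" for x
  proof -
    have "(norm (dres \<Omega> x))\<^sup>2 \<le> (norm (hproj (form_space \<Omega>) (x, 0)))\<^sup>2"
      by (simp add: dres_def norm_prod_def)
    then show ?thesis by (simp add: norm_hproj[OF form_space_props] dres_inner)
  qed
qed

lemma dres_eqI:
  assumes "(w, G) \<in> form_space \<Omega>" "\<And>v H. (v, H) \<in> form_space \<Omega> \<Longrightarrow> w \<bullet> v + G \<bullet> H = f \<bullet> v"
  shows "dres \<Omega> f = w"
proof -
  have "hproj (form_space \<Omega>) (f, 0) = (w, G)"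
    using assms by (intro hproj_unique[OF form_space_props]) (auto simp: inner_prod_def)
  then show ?thesis by (simp add: dres_def)
qed

lemma dresE:
  obtains G where "(dres \<Omega> f, G) \<in> form_space \<Omega>" "\<And>v H. (v, H) \<in> form_space \<Omega> \<Longrightarrow> dres \<Omega> f \<bullet> v + G \<bullet> H = f \<bullet> v"
proof (rule that[of "snd (hproj (form_space \<Omega>) (f, 0))"])
  show "(dres \<Omega> f, snd (hproj (form_space \<Omega>) (f, 0))) \<in> form_space \<Omega>"
    using hproj_in[OF form_space_props] by (simp add: dres_def)
  show "dres \<Omega> f \<bullet> v + snd (hproj (form_space \<Omega>) (f, 0)) \<bullet> H = f \<bullet> v" if "(v, H) \<in> form_space \<Omega>" for v H
    using hproj_inner[OF form_space_props that, of "(f, 0)"] by (simp add: dres_def inner_prod_def)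
qed

section \<open>Dependence of the resolvent on the domain\<close>

lemma dres_mono:
  assumes "\<Omega>' \<subseteq> \<Omega>" shows "dres \<Omega>' f \<bullet> f \<le> dres \<Omega> f \<bullet> f"
proof -
  let ?v = "hproj (form_space \<Omega>') (f, 0)"
  have "?v \<in> form_space \<Omega>" using hproj_in[OF form_space_props] form_space_mono[OF assms] by blast
  from hproj_maximizes[OF form_space_props this, of "(f, 0)"]
  show ?thesis using norm_hproj[OF form_space_props, of \<Omega>' "(f, 0)"]
    by (simp add: dres_inner inner_commute[of "(f, 0)"])
qed

text \<open>A bound on the form of a nonnegative symmetric operator becomes a bound on its norm by
  evaluating positivity at \<open>c *\<^sub>R x - D x\<close>; no spectral theorem is
  involved.\<close>

lemma psd_norm_le:
  fixes D :: "'h::real_inner \<Rightarrow> 'h"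
  assumes D: "linear D" "\<And>x y. D x \<bullet> y = x \<bullet> D y" "\<And>x. 0 \<le> D x \<bullet> x" "\<And>x. D x \<bullet> x \<le> c * (norm x)\<^sup>2" and c: "c > 0"
  shows "norm (D x) \<le> c * norm x"
proof -
  have "0 \<le> D (c *\<^sub>R x - D x) \<bullet> (c *\<^sub>R x - D x)" by (rule D)
  also have "\<dots> = c * c * (D x \<bullet> x) - 2 * c * (D x \<bullet> D x) + D (D x) \<bullet> D x"
    using D(2)[of "D x" x] by (simp add: linear_diff[OF D(1)] linear_cmul[OF D(1)] algebra_simps inner_commute)
  also have "\<dots> \<le> c * c * (c * (norm x)\<^sup>2) - 2 * c * (D x \<bullet> D x) + c * (norm (D x))\<^sup>2"
    using D(4) c by (intro add_mono diff_mono mult_left_mono) auto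
  also have "\<dots> = c * ((c * norm x)\<^sup>2 - (norm (D x))\<^sup>2)"
    by (simp add: power2_norm_eq_inner[symmetric] power2_eq_square algebra_simps)
  finally have "(norm (D x))\<^sup>2 \<le> (c * norm x)\<^sup>2" using c by (simp add: zero_le_mult_iff)
  then show ?thesis by (rule power2_le_imp_le) (use c in auto)
qed

text \<open>The difference of the resolvents is nonnegative by monotonicity, so its form only has to
  be bounded above. In the maximum principle a near maximizer on the large domain is replaced by its
  cutoff. The linear term loses at most \<open>2 c |f| |p|\<close>, the quadratic one at most
  \<open>c |p|^2\<close>, and \<open>|p| \<le> |f|\<close>; this gives the factor 3.\<close>

lemma dres_perturbation:
  assumes sub: "\<Omega>' \<subseteq> \<Omega>" and c: "c > 0"
    and approx: "\<And>\<phi>. test_fun \<Omega> \<phi> \<Longrightarrow> \<exists>\<psi>. test_fun \<Omega>' \<psi> \<and>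
      norm (abs_l2 \<phi> - abs_l2 \<psi>) \<le> c * norm (abs_l2 \<phi>, abs_l2 (grad \<phi>)) \<and>
      (norm (abs_l2 \<psi>, abs_l2 (grad \<psi>)))\<^sup>2 \<le> (1 + c) * (norm (abs_l2 \<phi>, abs_l2 (grad \<phi>)))\<^sup>2"
  shows "norm (dres \<Omega> f - dres \<Omega>' f) \<le> 3 * c * norm f"
proof -
  let ?D = "\<lambda>f. dres \<Omega> f - dres \<Omega>' f"
  note A = pos_contraction_dres[of \<Omega>] and A' = pos_contraction_dres[of \<Omega>']
  have le: "?D f \<bullet> f \<le> 3 * c * (norm f)\<^sup>2" for f
  proof -
    let ?p = "hproj (form_space \<Omega>) (f, 0)"
    \<comment> \<open>The estimate is written with an arbitrary \<open>p\<close> because the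
      maximizer is not a test function; both sides are continuous in \<open>p\<close>, so density
      applies.\<close>
    have key: "2 * ((f, 0) \<bullet> p) - (norm p)\<^sup>2 \<le> dres \<Omega>' f \<bullet> f + 2 * c * norm f * norm p + c * (norm p)\<^sup>2"
      if p: "p \<in> form_space \<Omega>" for p
      using p
    proof (rule form_space_induct)
      show "closed {p. 2 * ((f, 0) \<bullet> p) - (norm p)\<^sup>2 \<le> dres \<Omega>' f \<bullet> f + 2 * c * norm f * norm p + c * (norm p)\<^sup>2}"
        by (intro closed_Collect_le continuous_intros)
      fix \<phi> assume \<phi>: "test_fun \<Omega> \<phi>"
      let ?q = "(abs_l2 \<phi>, abs_l2 (grad \<phi>))"
      obtain \<psi> where \<psi>: "test_fun \<Omega>' \<psi>" "norm (abs_l2 \<phi> - abs_l2 \<psi>) \<le> c * norm ?q"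
        "(norm (abs_l2 \<psi>, abs_l2 (grad \<psi>)))\<^sup>2 \<le> (1 + c) * (norm ?q)\<^sup>2"
        using approx[OF \<phi>] by blast
      let ?r = "(abs_l2 \<psi>, abs_l2 (grad \<psi>))"
      have "2 * ((f, 0) \<bullet> ?r) - (norm ?r)\<^sup>2 \<le> dres \<Omega>' f \<bullet> f"
        using hproj_maximizes[OF form_space_props test_in_form_space[OF \<psi>(1)], of "(f, 0)"] by (simp add: dres_inner)
      moreover have "(f, 0) \<bullet> ?q - (f, 0) \<bullet> ?r \<le> norm f * (c * norm ?q)"
      proof -
        have "(f, 0) \<bullet> ?q - (f, 0) \<bullet> ?r = f \<bullet> (abs_l2 \<phi> - abs_l2 \<psi>)" by (simp add: inner_prod_def inner_diff_right)
        also have "\<dots> \<le> norm f * norm (abs_l2 \<phi> - abs_l2 \<psi>)" by (rule norm_cauchy_schwarz)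
        also have "\<dots> \<le> norm f * (c * norm ?q)" using \<psi>(2) by (intro mult_left_mono) auto
        finally show ?thesis .
      qed
      moreover have "(norm ?r)\<^sup>2 \<le> (norm ?q)\<^sup>2 + c * (norm ?q)\<^sup>2" using \<psi>(3) by (simp add: distrib_right)
      ultimately show "2 * ((f, 0) \<bullet> ?q) - (norm ?q)\<^sup>2 \<le> dres \<Omega>' f \<bullet> f + 2 * c * norm f * norm ?q + c * (norm ?q)\<^sup>2"
        by (simp add: mult.assoc mult.left_commute)
    qed
    have p: "(norm ?p)\<^sup>2 = dres \<Omega> f \<bullet> f" by (simp add: norm_hproj[OF form_space_props] dres_inner)
    then have "(norm ?p)\<^sup>2 \<le> (norm f)\<^sup>2" using pos_contraction_inner_le[OF A] by simp
    then have pf: "norm ?p \<le> norm f" by (rule power2_le_imp_le) simp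
    have "dres \<Omega> f \<bullet> f = 2 * ((f, 0) \<bullet> ?p) - (norm ?p)\<^sup>2"
      unfolding p by (simp add: dres_inner inner_commute[of "(f, 0)"])
    also have "\<dots> \<le> dres \<Omega>' f \<bullet> f + 2 * c * norm f * norm ?p + c * (norm ?p)\<^sup>2"
      by (rule key[OF hproj_in[OF form_space_props]])
    also have "\<dots> \<le> dres \<Omega>' f \<bullet> f + 2 * c * norm f * norm f + c * (norm f)\<^sup>2"
      using c pf by (intro add_mono mult_left_mono power_mono) auto
    finally show ?thesis by (simp add: inner_diff_left power2_eq_square)
  qed
  show ?thesis
  proof (rule psd_norm_le[where D = ?D])
    show "linear ?D" by (intro linear_compose_sub pos_contraction_linear A A')
    show "?D x \<bullet> y = x \<bullet> ?D y" for x y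
      by (simp add: inner_diff_left inner_diff_right pos_contraction_symmetric[OF A] pos_contraction_symmetric[OF A'])
    show "0 \<le> ?D x \<bullet> x" for x using dres_mono[OF sub, of x] by (simp add: inner_diff_left)
  qed (use le c in auto)
qed

text \<open>The limit projection is approximated by a test function, whose compact support already
  lies in some \<open>U N\<close>. From then on it competes with the projection onto the form space
  of \<open>U n\<close>, which is the best approximation there.\<close>

lemma dres_exhaustion:
  assumes U: "\<And>n. open (U n)" "\<And>n. U n \<subseteq> U (Suc n)"
  shows "(\<lambda>n. dres (U n) f) \<longlonglongrightarrow> dres (\<Union>n. U n) f"
proof -
  let ?O = "\<Union>n. U n"
  let ?p = "hproj (form_space ?O) (f, 0)" and ?q = "\<lambda>n. hproj (form_space (U n)) (f, 0)"
  have mono: "U m \<subseteq> U n" if "m \<le> n" for m n using U(2) that by (rule lift_Suc_mono_le)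
  have "(\<lambda>n. ?q n) \<longlonglongrightarrow> ?p"
  proof (rule metric_LIMSEQ_I)
    fix e :: real assume e: "e > 0"
    have "?p \<in> closure (test_graph ?O)" using hproj_in[OF form_space_props] by (metis form_space_def)
    then obtain r where "r \<in> test_graph ?O" "dist r ?p < e" using e by (auto simp: closure_approachable)
    then obtain \<phi> where \<phi>: "test_fun ?O \<phi>" and re: "dist (abs_l2 \<phi>, abs_l2 (grad \<phi>)) ?p < e"
      by (auto simp: test_graph_def)
    then obtain K where K: "smooth_fun \<phi>" "compact K" "K \<subseteq> ?O" "\<And>x. x \<notin> K \<Longrightarrow> \<phi> x = 0"
      by (auto simp: test_fun_def)
    obtain I where I: "finite I" "K \<subseteq> (\<Union>n\<in>I. U n)"
      by (rule compactE_image[OF K(2), of UNIV U]) (use U(1) K(3) in auto)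
    obtain N where N: "\<And>i. i \<in> I \<Longrightarrow> i \<le> N" using I(1) by (auto simp: finite_nat_set_iff_bounded_le)
    have KN: "K \<subseteq> U N"
    proof
      fix x assume "x \<in> K"
      then obtain i where "i \<in> I" "x \<in> U i" using I(2) by auto
      then show "x \<in> U N" using mono[OF N[of i]] by auto
    qed
    have "dist (?q n) ?p < e" if "n \<ge> N" for n
    proof -
      have "test_fun (U n) \<phi>" using K KN mono[OF that] unfolding test_fun_def by blast
      then have rn: "(abs_l2 \<phi>, abs_l2 (grad \<phi>)) \<in> form_space (U n)" (is "?r \<in> _") by (rule test_in_form_space)
      have sub: "form_space (U n) \<subseteq> form_space ?O" by (rule form_space_mono) auto
      \<comment> \<open>Both projections represent the same functional on the smaller space, so
        \<open>?q n\<close> is also the projection of \<open>?p\<close>.\<close>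
      have orth: "(?p - ?q n) \<bullet> v = 0" if "v \<in> form_space (U n)" for v
        using hproj_inner[OF form_space_props that, of "(f, 0)"] hproj_inner[OF form_space_props, of v ?O "(f, 0)"] sub that
        by (auto simp: inner_diff_left)
      have "?q n - ?r \<in> form_space (U n)"
        using hproj_in[OF form_space_props] rn by (intro subspace_diff[OF subspace_form_space])
      then have "(norm (?p - ?r))\<^sup>2 = (norm (?p - ?q n))\<^sup>2 + (norm (?q n - ?r))\<^sup>2"
        using orth[of "?q n - ?r"] unfolding power2_norm_eq_inner
        by (simp add: inner_diff_left inner_diff_right inner_commute)
      then have "(norm (?p - ?q n))\<^sup>2 \<le> (norm (?p - ?r))\<^sup>2" by simp
      then have "norm (?p - ?q n) \<le> norm (?p - ?r)" by (rule power2_le_imp_le) simp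
      then show ?thesis using re by (simp add: dist_norm norm_minus_commute)
    qed
    then show "\<exists>N. \<forall>n\<ge>N. dist (?q n) ?p < e" by blast
  qed
  from tendsto_fst[OF this] show ?thesis by (simp add: dres_def)
qed

section \<open>Restriction to a set and decomposition over separated components\<close>

definition restr :: "'a::euclidean_space set \<Rightarrow> ('a, 'b::euclidean_space) l2 \<Rightarrow> ('a, 'b) l2" where
  "restr S f = abs_l2 (\<lambda>x. indicator S x *\<^sub>R rep_l2 f x)"

lemma L2_fun_indicator:
  assumes "S \<in> sets lebesgue" "L2_fun f" shows "L2_fun (\<lambda>x. indicator S x *\<^sub>R f x)"
proof (rule L2_fun_bound[where g = f and C = 1])
  show "(\<lambda>x. indicator S x *\<^sub>R f x) \<in> borel_measurable lebesgue"
    using assms by (intro borel_measurable_scaleR borel_measurable_indicator) (auto simp: L2_fun_def)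
qed (auto simp: assms indicator_def)

context
  fixes S :: "'a::euclidean_space set"
  assumes S: "S \<in> sets lebesgue"
begin

lemma restr_abs_l2: assumes "L2_fun f" shows "restr S (abs_l2 f) = abs_l2 (\<lambda>x. indicator S x *\<^sub>R f x)"
  unfolding restr_def
  using rep_abs_l2[OF assms] by (subst abs_l2_eq_iff) (auto intro!: L2_fun_indicator S L2_fun_rep assms)

lemma restr_symmetric: "restr S f \<bullet> g = f \<bullet> restr S g"
proof -
  have "restr S (abs_l2 (rep_l2 f)) \<bullet> abs_l2 (rep_l2 g) = abs_l2 (rep_l2 f) \<bullet> restr S (abs_l2 (rep_l2 g))"
    unfolding restr_abs_l2[OF L2_fun_rep] by (simp add: inner_abs_l2 L2_fun_rep L2_fun_indicator S del: abs_rep_l2)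
  then show ?thesis by simp
qed

lemma restr_idem: "restr S (restr S f) = restr S f"
proof -
  have "restr S (restr S (abs_l2 (rep_l2 f))) = restr S (abs_l2 (rep_l2 f))"
    by (simp add: restr_abs_l2 L2_fun_rep L2_fun_indicator S indicator_inter_arith[symmetric] del: abs_rep_l2)
  then show ?thesis by simp
qed

lemma linear_restr: "linear (restr S :: ('a, 'b::euclidean_space) l2 \<Rightarrow> _)"
proof (rule linearI)
  fix f g :: "('a, 'b) l2" and c :: real
  have "restr S (abs_l2 (rep_l2 f) + abs_l2 (rep_l2 g)) = restr S (abs_l2 (rep_l2 f)) + restr S (abs_l2 (rep_l2 g))"
    by (simp add: restr_abs_l2 abs_l2_add L2_fun_add L2_fun_rep L2_fun_indicator S scaleR_add_right del: abs_rep_l2)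
  then show "restr S (f + g) = restr S f + restr S g" by simp
  have "restr S (c *\<^sub>R abs_l2 (rep_l2 f)) = c *\<^sub>R restr S (abs_l2 (rep_l2 f))"
    by (simp add: restr_abs_l2 abs_l2_scaleR L2_fun_scaleR L2_fun_rep L2_fun_indicator S mult.commute del: abs_rep_l2)
  then show "restr S (c *\<^sub>R f) = c *\<^sub>R restr S f" by simp
qed

lemma pos_contraction_restr: "pos_contraction (restr S :: ('a, 'b::euclidean_space) l2 \<Rightarrow> _)"
  unfolding pos_contraction_def
  by (auto simp: linear_restr restr_symmetric power2_norm_eq_inner restr_idem)

lemma restr_eq_self_iff: "restr S f = f \<longleftrightarrow> (AE x in lebesgue. x \<notin> S \<longrightarrow> rep_l2 f x = 0)"
proof -
  have "restr S f = f \<longleftrightarrow> abs_l2 (\<lambda>x. indicator S x *\<^sub>R rep_l2 f x) = abs_l2 (rep_l2 f)"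
    unfolding restr_def by simp
  also have "\<dots> \<longleftrightarrow> (AE x in lebesgue. indicator S x *\<^sub>R rep_l2 f x = rep_l2 f x)"
    by (rule abs_l2_eq_iff[OF L2_fun_indicator[OF S L2_fun_rep] L2_fun_rep])
  also have "\<dots> \<longleftrightarrow> (AE x in lebesgue. x \<notin> S \<longrightarrow> rep_l2 f x = 0)"
    by (intro AE_cong) (auto simp: indicator_def)
  finally show ?thesis .
qed

lemma restr_abs_l2_self: "L2_fun f \<Longrightarrow> (\<And>x. x \<notin> S \<Longrightarrow> f x = 0) \<Longrightarrow> restr S (abs_l2 f) = abs_l2 f"
proof -
  assume f: "L2_fun f" and "\<And>x. x \<notin> S \<Longrightarrow> f x = 0"
  then have "indicator S x *\<^sub>R f x = f x" for x by (cases "x \<in> S") auto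
  then show ?thesis by (simp add: restr_abs_l2[OF f])
qed

lemma continuous_restr: "continuous_on UNIV (restr S :: ('a, 'b::euclidean_space) l2 \<Rightarrow> _)"
  by (rule bounded_linear.continuous_on[OF pos_contraction_bounded_linear[OF pos_contraction_restr] continuous_on_id])

end

lemma restr_restr:
  assumes "S \<in> sets lebesgue" "T \<in> sets lebesgue"
  shows "restr S (restr T f) = restr (S \<inter> T) f"
proof -
  have ST: "S \<inter> T \<in> sets lebesgue" using assms by auto
  have "restr S (restr T (abs_l2 (rep_l2 f))) = restr (S \<inter> T) (abs_l2 (rep_l2 f))"
    by (simp add: restr_abs_l2 assms ST L2_fun_rep L2_fun_indicator indicator_inter_arith del: abs_rep_l2)
  then show ?thesis by simp
qed

lemma restr_empty: "restr {} f = 0"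
  by (simp add: restr_def abs_l2_zero)

lemma restr_disjoint_union:
  assumes "S \<in> sets lebesgue" "T \<in> sets lebesgue" "S \<inter> T = {}"
  shows "restr (S \<union> T) f = restr S f + restr T f"
proof -
  have "abs_l2 (\<lambda>x. indicator S x *\<^sub>R rep_l2 f x) + abs_l2 (\<lambda>x. indicator T x *\<^sub>R rep_l2 f x)
      = abs_l2 (\<lambda>x. indicator S x *\<^sub>R rep_l2 f x + indicator T x *\<^sub>R rep_l2 f x)"
    by (intro abs_l2_add L2_fun_indicator L2_fun_rep assms)
  moreover have "indicator (S \<union> T) x *\<^sub>R rep_l2 f x = indicator S x *\<^sub>R rep_l2 f x + indicator T x *\<^sub>R rep_l2 f x" for x
    using assms(3) by (auto simp: indicator_def)
  ultimately show ?thesis unfolding restr_def by (simp only:)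
qed

lemma continuous_on_restr_compose [continuous_intros]:
  "S \<in> sets lebesgue \<Longrightarrow> continuous_on A g \<Longrightarrow> continuous_on A (\<lambda>x. restr S (g x))"
  by (rule continuous_on_compose2[OF continuous_restr]) auto

lemma form_space_support:
  assumes \<Omega>: "open \<Omega>" and p: "(u, G) \<in> form_space \<Omega>"
  shows "restr \<Omega> u = u" "restr \<Omega> G = G"
proof -
  have m: "\<Omega> \<in> sets lebesgue" using \<Omega> by simp
  have "restr \<Omega> (fst p) = fst p \<and> restr \<Omega> (snd p) = snd p" if "p \<in> form_space \<Omega>" for p
    using that
  proof (rule form_space_induct)
    show "closed {p. restr \<Omega> (fst p) = fst p \<and> restr \<Omega> (snd p :: ('a,'a) l2) = snd p}"
      using m by (intro closed_Collect_conj closed_Collect_eq continuous_intros)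
    show "restr \<Omega> (fst (abs_l2 \<phi>, abs_l2 (grad \<phi>))) = fst (abs_l2 \<phi>, abs_l2 (grad \<phi>)) \<and>
         restr \<Omega> (snd (abs_l2 \<phi>, abs_l2 (grad \<phi>))) = snd (abs_l2 \<phi>, abs_l2 (grad \<phi>))" if "test_fun \<Omega> \<phi>" for \<phi>
      using L2_fun_test[OF that] test_fun_zero_outside[OF that] by (simp add: restr_abs_l2_self[OF m])
  qed
  from this[OF p] show "restr \<Omega> u = u" "restr \<Omega> G = G" by auto
qed

lemma dres_support:
  assumes "open \<Omega>" shows "restr \<Omega> (dres \<Omega> f) = dres \<Omega> f" "dres \<Omega> (restr \<Omega> f) = dres \<Omega> f"
proof -
  have m: "\<Omega> \<in> sets lebesgue" using assms by simp
  obtain G where G: "(dres \<Omega> f, G) \<in> form_space \<Omega>" "\<And>v H. (v, H) \<in> form_space \<Omega> \<Longrightarrow> dres \<Omega> f \<bullet> v + G \<bullet> H = f \<bullet> v"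
    by (rule dresE) blast
  show "restr \<Omega> (dres \<Omega> f) = dres \<Omega> f" by (rule form_space_support[OF assms G(1)])
  show "dres \<Omega> (restr \<Omega> f) = dres \<Omega> f"
  proof (rule dres_eqI[OF G(1)])
    fix v and H :: "('a, 'a) l2" assume v: "(v, H) \<in> form_space \<Omega>"
    then show "dres \<Omega> f \<bullet> v + G \<bullet> H = restr \<Omega> f \<bullet> v"
      using G(2)[OF v] form_space_support(1)[OF assms v] restr_symmetric[OF m, of f v] by simp
  qed
qed

text \<open>The two open sets may touch at the hyperplane \<open>x \<bullet> e = b\<close>, but the
  support of a test function is compact and its part in \<open>U\<close> stays away from the
  hyperplane. A smooth cutoff depending only on \<open>x \<bullet> e\<close> therefore acts as the
  indicator of \<open>U\<close>.\<close>

lemma restr_form_space: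
  fixes e :: "'a::euclidean_space"
  assumes U: "open U" "open W" "\<And>x. x \<in> U \<Longrightarrow> x \<bullet> e < b" "\<And>x. x \<in> W \<Longrightarrow> x \<bullet> e > b"
    and p: "(u, G) \<in> form_space (U \<union> W)"
  shows "(restr U u, restr U G) \<in> form_space U"
proof -
  have m: "U \<in> sets lebesgue" using U by simp
  have "(restr U (fst p), restr U (snd p)) \<in> form_space U" if "p \<in> form_space (U \<union> W)" for p
    using that
  proof (rule form_space_induct)
    show "closed {p. (restr U (fst p), restr U (snd p :: ('a,'a) l2)) \<in> form_space U}"
      using m by (intro closed_vimage[unfolded vimage_def, OF closed_form_space] continuous_intros)
    fix \<phi> assume \<phi>: "test_fun (U \<union> W) \<phi>"
    then obtain K where K: "smooth_fun \<phi>" "compact K" "K \<subseteq> U \<union> W" "\<And>x. x \<notin> K \<Longrightarrow> \<phi> x = 0"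
      by (auto simp: test_fun_def)
    \<comment> \<open>No point of the support lies on the hyperplane, so the open condition can be
      exchanged for a closed one; this makes the part in \<open>U\<close> compact.\<close>
    have "K \<inter> U = K \<inter> {x. x \<bullet> e \<le> b}" using K(3) U(3,4) by fastforce
    moreover have "closed {x. x \<bullet> e \<le> b}" by (intro closed_Collect_le continuous_intros)
    ultimately have cKU: "compact (K \<inter> U)" using K(2) compact_Int_closed by metis
    obtain c where c: "c < b" "\<And>x. x \<in> K \<inter> U \<Longrightarrow> x \<bullet> e \<le> c"
    proof (cases "K \<inter> U = {}")
      case True
      then show ?thesis using that[of "b - 1"] by auto
    next
      case False
      have "continuous_on (K \<inter> U) (\<lambda>x. x \<bullet> e)" by (intro continuous_intros)
      from continuous_attains_sup[OF cKU False this] show ?thesis using that U(3) by auto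
    qed
    define \<xi> where "\<xi> x = smooth_step (((-1 / (b - c)) *\<^sub>R (x \<bullet> e)) + b / (b - c))" for x
    have bl: "bounded_linear (\<lambda>x. (-1 / (b - c)) *\<^sub>R (x \<bullet> e))"
      by (intro bounded_linear_const_scaleR bounded_linear_inner_left)
    have sm: "smooth_fun \<xi>" unfolding \<xi>_def[abs_def]
      by (rule smooth_fun_compose_affine[OF bl smooth_smooth_step])
    have \<xi>: "\<xi> x = smooth_step ((b - x \<bullet> e) / (b - c))" for x
      by (simp add: \<xi>_def diff_divide_distrib)
    have \<xi>1: "\<xi> x = 1" if "x \<bullet> e \<le> c" for x using that c(1) by (simp add: \<xi> smooth_step_1)
    have \<xi>0: "\<xi> x = 0" if "x \<bullet> e \<ge> b" for x using that c(1) by (simp add: \<xi> smooth_step_0 divide_nonpos_pos)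
    define \<psi> where "\<psi> x = \<xi> x * \<phi> x" for x
    have sm\<psi>: "smooth_fun \<psi>" unfolding \<psi>_def[abs_def] by (rule smooth_fun_mult[OF sm K(1)])
    have inU: "\<psi> x = \<phi> x" if "x \<in> U" for x
      using that K(4)[of x] c(2)[of x] \<xi>1[of x] by (cases "x \<in> K") (auto simp: \<psi>_def)
    have outU: "\<psi> x = 0" if "x \<notin> K \<inter> U" for x
    proof (cases "x \<in> K")
      case True
      then have "x \<in> W" using that K(3) by auto
      then have "x \<bullet> e \<ge> b" using U(4) less_imp_le by blast
      then show ?thesis by (simp add: \<psi>_def \<xi>0)
    qed (simp add: \<psi>_def K(4))
    have t: "test_fun U \<psi>" unfolding test_fun_def using sm\<psi> cKU outU by (intro conjI exI[of _ "K \<inter> U"]) auto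
    have g: "grad \<psi> x = indicator U x *\<^sub>R grad \<phi> x" for x
    proof (cases "x \<in> U")
      case True
      then show ?thesis
        using grad_cong_open[OF U(1) True, of \<psi> \<phi>] inU smooth_fun_differentiable[OF K(1)] by simp
    next
      case False
      then show ?thesis using test_fun_zero_outside(2)[OF t] by simp
    qed
    have "restr U (abs_l2 \<phi>) = abs_l2 \<psi>"
    proof -
      have "indicator U x *\<^sub>R \<phi> x = \<psi> x" for x using inU outU by (cases "x \<in> U") auto
      then show ?thesis by (simp add: restr_abs_l2[OF m L2_fun_test(1)[OF \<phi>]])
    qed
    moreover have "restr U (abs_l2 (grad \<phi>)) = abs_l2 (grad \<psi>)"
    proof -
      have "grad \<psi> = (\<lambda>x. indicator U x *\<^sub>R grad \<phi> x)" using g by auto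
      then show ?thesis by (simp add: restr_abs_l2[OF m L2_fun_test(2)[OF \<phi>]])
    qed
    ultimately show "(restr U (fst (abs_l2 \<phi>, abs_l2 (grad \<phi>))), restr U (snd (abs_l2 \<phi>, abs_l2 (grad \<phi>)))) \<in> form_space U"
      using test_in_form_space[OF t] by simp
  qed
  from this[OF p] show ?thesis by simp
qed

text \<open>Restricting the solution and its gradient to \<open>U\<close> stays in the form space,
  and the weak equation tested with functions supported in \<open>U\<close> does not notice the
  restriction.\<close>

lemma dres_restr_component:
  fixes e :: "'a::euclidean_space"
  assumes U: "open U" "open W" "\<And>x. x \<in> U \<Longrightarrow> x \<bullet> e < b" "\<And>x. x \<in> W \<Longrightarrow> x \<bullet> e > b"
  shows "dres U f = restr U (dres (U \<union> W) f)"
proof -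
  have m: "U \<in> sets lebesgue" using U by simp
  obtain G where G: "(dres (U \<union> W) f, G) \<in> form_space (U \<union> W)"
    "\<And>v H. (v, H) \<in> form_space (U \<union> W) \<Longrightarrow> dres (U \<union> W) f \<bullet> v + G \<bullet> H = f \<bullet> v"
    by (rule dresE) blast
  show ?thesis
  proof (rule dres_eqI[OF restr_form_space[OF U G(1)]])
    fix v and H :: "('a, 'a) l2" assume v: "(v, H) \<in> form_space U"
    then have "(v, H) \<in> form_space (U \<union> W)" using form_space_mono[of U "U \<union> W"] by auto
    then show "restr U (dres (U \<union> W) f) \<bullet> v + restr U G \<bullet> H = f \<bullet> v"
      using G(2) form_space_support[OF U(1) v] by (simp add: restr_symmetric[OF m])
  qed
qed

lemma dres_disjoint_union:
  fixes e :: "'a::euclidean_space"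
  assumes U: "open U" "open W" "\<And>x. x \<in> U \<Longrightarrow> x \<bullet> e < b" "\<And>x. x \<in> W \<Longrightarrow> x \<bullet> e > b"
  shows "dres (U \<union> W) f = dres U f + dres W f"
proof -
  \<comment> \<open>Reversing \<open>e\<close> exchanges the two sides of the hyperplane.\<close>
  have "dres W f = restr W (dres (W \<union> U) f)"
    by (rule dres_restr_component[of W U "- e" "- b"]) (use U in auto)
  moreover have "dres U f = restr U (dres (U \<union> W) f)" by (rule dres_restr_component[OF U])
  moreover have "restr (U \<union> W) (dres (U \<union> W) f) = restr U (dres (U \<union> W) f) + restr W (dres (U \<union> W) f)"
    using U by (intro restr_disjoint_union) (auto dest: less_asym)
  ultimately show ?thesis using dres_support(1)[of "U \<union> W" f] U by (simp add: Un_commute open_Un)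
qed

text \<open>An eigenvector of the union splits into its restrictions, each an eigenvector on its own
  component. The part on \<open>W\<close> vanishes by assumption. Since \<open>a \<noteq> 0\<close>,
  an eigenvector is a multiple of its image and so is supported in the domain.\<close>

lemma eigenspace_disjoint_union:
  fixes e :: "'a::euclidean_space"
  assumes U: "open U" "open W" "\<And>x. x \<in> U \<Longrightarrow> x \<bullet> e < b" "\<And>x. x \<in> W \<Longrightarrow> x \<bullet> e > b"
    and a: "a \<noteq> 0" and W: "eigenspace (dres W) a = {0}"
  shows "eigenspace (dres (U \<union> W)) a = eigenspace (dres U) a"
proof -
  have m: "U \<in> sets lebesgue" "W \<in> sets lebesgue" using U by auto
  have disj: "W \<inter> U = {}" "U \<inter> W = {}" using U(3,4) by (auto dest: less_asym)
  have cross: "dres W (restr U x) = 0" "dres U (restr W x) = 0" for x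
  proof -
    have "dres W (restr U x) = dres W (restr W (restr U x))" using dres_support(2)[OF U(2)] by simp
    then show "dres W (restr U x) = 0" using disj linear_0[OF pos_contraction_linear[OF pos_contraction_dres]]
      by (simp add: restr_restr m restr_empty)
    have "dres U (restr W x) = dres U (restr U (restr W x))" using dres_support(2)[OF U(1)] by simp
    then show "dres U (restr W x) = 0" using disj linear_0[OF pos_contraction_linear[OF pos_contraction_dres]]
      by (simp add: restr_restr m restr_empty)
  qed
  have self: "restr V x = x" if "dres V x = a *\<^sub>R x" "open V" for V x
  proof -
    have "restr V (a *\<^sub>R x) = a *\<^sub>R x" using dres_support(1)[OF that(2), of x] that(1) by simp
    moreover have "restr V (a *\<^sub>R x) = a *\<^sub>R restr V x" using that(2) by (intro linear_cmul linear_restr) simp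
    ultimately show ?thesis using a by simp
  qed
  note D = dres_disjoint_union[OF U]
  show ?thesis
  proof (intro set_eqI iffI)
    fix x assume "x \<in> eigenspace (dres U) a"
    then have x: "dres U x = a *\<^sub>R x" by (simp add: eigenspace_def)
    then have "dres W x = 0" using self[OF x U(1)] cross(1)[of x] by simp
    then show "x \<in> eigenspace (dres (U \<union> W)) a" using x by (simp add: eigenspace_def D)
  next
    fix x assume "x \<in> eigenspace (dres (U \<union> W)) a"
    then have x: "dres (U \<union> W) x = a *\<^sub>R x" by (simp add: eigenspace_def)
    have "restr (U \<union> W) x = x" by (rule self[OF x]) (use U in auto)
    then have dec: "x = restr U x + restr W x" using restr_disjoint_union[OF m disj(2)] by metis
    have "dres W x = restr W (dres (W \<union> U) x)"
      by (rule dres_restr_component[of W U "- e" "- b"]) (use U in auto)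
    then have "dres W (restr W x) = a *\<^sub>R restr W x"
      using x dres_support(2)[OF U(2), of x] linear_cmul[OF linear_restr[OF m(2)]] by (simp add: Un_commute)
    then have "restr W x = 0" using W by (auto simp: eigenspace_def)
    then have rU: "x = restr U x" using dec by simp
    have "dres W x = 0" using cross(1)[of x] rU by simp
    then show "x \<in> eigenspace (dres U) a" using x by (simp add: eigenspace_def D)
  qed
qed

section \<open>From the function-level definitions to the Hilbert space\<close>

lemma L2_dist2_eq:
  assumes "L2_fun f" "L2_fun g" shows "L2_dist2 f g = ennreal ((norm (abs_l2 f - abs_l2 g))\<^sup>2)"
  using nn_integral_L2[OF L2_fun_diff[OF assms]] by (simp add: L2_dist2_def abs_l2_diff[OF assms])

lemma L2_fun_of_dist2:
  assumes f: "L2_fun f" and g: "g \<in> borel_measurable lebesgue" and "L2_dist2 f g < \<infinity>"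
  shows "L2_fun g"
proof -
  have "L2_fun (\<lambda>x. f x - g x)"
    using assms by (auto simp: L2_fun_iff_nn_integral L2_dist2_def L2_fun_def)
  from L2_fun_diff[OF f this] show ?thesis by simp
qed

lemma L2_dist2_tendsto_iff:
  assumes "\<And>n. L2_fun (f n)" "L2_fun g"
  shows "(\<lambda>n. L2_dist2 (f n) g) \<longlonglongrightarrow> 0 \<longleftrightarrow> (\<lambda>n. abs_l2 (f n)) \<longlonglongrightarrow> abs_l2 g"
proof -
  have "(\<lambda>n. L2_dist2 (f n) g) \<longlonglongrightarrow> 0 \<longleftrightarrow> (\<lambda>n. ennreal ((norm (abs_l2 (f n) - abs_l2 g))\<^sup>2)) \<longlonglongrightarrow> ennreal 0"
    using assms by (simp add: L2_dist2_eq)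
  also have "\<dots> \<longleftrightarrow> (\<lambda>n. (norm (abs_l2 (f n) - abs_l2 g))\<^sup>2) \<longlonglongrightarrow> 0"
    by (rule tendsto_ennreal_iff) auto
  also have "\<dots> \<longleftrightarrow> (\<lambda>n. norm (abs_l2 (f n) - abs_l2 g)) \<longlonglongrightarrow> 0"
    using tendsto_power[of "\<lambda>n. norm (abs_l2 (f n) - abs_l2 g)" 0 sequentially 2]
      tendsto_real_sqrt[of "\<lambda>n. (norm (abs_l2 (f n) - abs_l2 g))\<^sup>2" 0 sequentially] by auto
  also have "\<dots> \<longleftrightarrow> (\<lambda>n. abs_l2 (f n)) \<longlonglongrightarrow> abs_l2 g"
    by (simp add: tendsto_norm_zero_iff LIM_zero_iff)
  finally show ?thesis .
qed

text \<open>Sequential limits in the two \<open>L2_dist2\<close> distances are limits in the product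
  Hilbert space, so the definition by sequences is membership in the closure.\<close>

lemma H10_iff: "(u, G) \<in> H10 \<Omega> \<longleftrightarrow> L2_fun u \<and> L2_fun G \<and> (abs_l2 u, abs_l2 G) \<in> form_space \<Omega>"
proof
  assume "(u, G) \<in> H10 \<Omega>"
  then obtain \<phi> where m: "u \<in> borel_measurable lebesgue" "G \<in> borel_measurable lebesgue"
    and \<phi>: "\<And>n. test_fun \<Omega> (\<phi> n)" "(\<lambda>n. L2_dist2 (\<phi> n) u) \<longlonglongrightarrow> 0" "(\<lambda>n. L2_dist2 (grad (\<phi> n)) G) \<longlonglongrightarrow> 0"
    by (auto simp: H10_def)
  \<comment> \<open>Square integrability of \<open>u\<close> and \<open>G\<close> has to be derived:
    a single approximating test function at finite distance provides it.\<close>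
  have "eventually (\<lambda>n. L2_dist2 (\<phi> n) u < 1 \<and> L2_dist2 (grad (\<phi> n)) G < 1) sequentially"
    using \<phi>(2,3) by (intro eventually_conj order_tendstoD(2)) auto
  then obtain n where "L2_dist2 (\<phi> n) u < 1" "L2_dist2 (grad (\<phi> n)) G < 1"
    by (auto simp: eventually_sequentially)
  then have L: "L2_fun u" "L2_fun G"
    using L2_fun_of_dist2[OF L2_fun_test(1)[OF \<phi>(1)[of n]] m(1)] L2_fun_of_dist2[OF L2_fun_test(2)[OF \<phi>(1)[of n]] m(2)]
    by (auto intro: less_trans[OF _ ennreal_one_less_top])
  have "(\<lambda>n. (abs_l2 (\<phi> n), abs_l2 (grad (\<phi> n)))) \<longlonglongrightarrow> (abs_l2 u, abs_l2 G)"
    using \<phi> L2_fun_test[OF \<phi>(1)] L by (intro tendsto_Pair) (auto simp: L2_dist2_tendsto_iff)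
  moreover have "(abs_l2 (\<phi> n), abs_l2 (grad (\<phi> n))) \<in> test_graph \<Omega>" for n using \<phi>(1) by (auto simp: test_graph_def)
  ultimately have "(abs_l2 u, abs_l2 G) \<in> form_space \<Omega>" unfolding form_space_def closure_sequential
    by (intro exI[of _ "\<lambda>n. (abs_l2 (\<phi> n), abs_l2 (grad (\<phi> n)))"]) simp
  then show "L2_fun u \<and> L2_fun G \<and> (abs_l2 u, abs_l2 G) \<in> form_space \<Omega>" using L by simp
next
  assume L: "L2_fun u \<and> L2_fun G \<and> (abs_l2 u, abs_l2 G) \<in> form_space \<Omega>"
  then obtain p where p: "\<And>n. p n \<in> test_graph \<Omega>" "p \<longlonglongrightarrow> (abs_l2 u, abs_l2 G)"
    unfolding form_space_def closure_sequential by blast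
  have "\<forall>n. \<exists>\<phi>. test_fun \<Omega> \<phi> \<and> p n = (abs_l2 \<phi>, abs_l2 (grad \<phi>))" using p(1) by (auto simp: test_graph_def)
  from choice[OF this] obtain \<phi> where \<phi>: "\<And>n. test_fun \<Omega> (\<phi> n)" "\<And>n. p n = (abs_l2 (\<phi> n), abs_l2 (grad (\<phi> n)))"
    by blast
  have "(\<lambda>n. abs_l2 (\<phi> n)) \<longlonglongrightarrow> abs_l2 u" "(\<lambda>n. abs_l2 (grad (\<phi> n))) \<longlonglongrightarrow> abs_l2 G"
    using tendsto_fst[OF p(2)] tendsto_snd[OF p(2)] \<phi>(2) by auto
  then have "(\<lambda>n. L2_dist2 (\<phi> n) u) \<longlonglongrightarrow> 0" "(\<lambda>n. L2_dist2 (grad (\<phi> n)) G) \<longlonglongrightarrow> 0"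
    using L L2_fun_test[OF \<phi>(1)] by (auto simp: L2_dist2_tendsto_iff)
  then show "(u, G) \<in> H10 \<Omega>" using L \<phi>(1) by (auto simp: H10_def L2_fun_def)
qed

lemma H10_rep_iff: "(rep_l2 u, rep_l2 G) \<in> H10 \<Omega> \<longleftrightarrow> (u, G) \<in> form_space \<Omega>"
  by (simp add: H10_iff L2_fun_rep)

lemma inner_rep_abs:
  assumes "L2_fun f" shows "u \<bullet> abs_l2 f = (\<integral> x. rep_l2 u x \<bullet> f x \<partial>lebesgue)"
  using inner_abs_l2[OF L2_fun_rep[of u] assms] by simp

text \<open>The equation for the resolvent at \<open>-s\<close> is rewritten with the operator
  \<open>1 - \<Delta>\<close>, which moves \<open>(1 - s) w\<close> to the right-hand side. This
  matches the fixed point equation of the Neumann series.\<close>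

lemma dirichlet_resolvent_dres:
  assumes f: "L2_fun f" and w: "w = dres \<Omega> (abs_l2 f + (1 - s) *\<^sub>R w)"
  shows "dirichlet_resolvent \<Omega> s f (rep_l2 w)"
proof -
  obtain G where G: "(w, G) \<in> form_space \<Omega>"
    "\<And>v H. (v, H) \<in> form_space \<Omega> \<Longrightarrow> w \<bullet> v + G \<bullet> H = (abs_l2 f + (1 - s) *\<^sub>R w) \<bullet> v"
    using w by (metis dresE)
  show ?thesis unfolding dirichlet_resolvent_def
  proof (intro exI[of _ "rep_l2 G"] conjI allI impI)
    show "(rep_l2 w, rep_l2 G) \<in> H10 \<Omega>" using G(1) by (simp add: H10_rep_iff)
    fix v H assume "(v, H) \<in> H10 \<Omega>"
    then have v: "L2_fun v" "L2_fun H" "(abs_l2 v, abs_l2 H) \<in> form_space \<Omega>" by (auto simp: H10_iff)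
    have "G \<bullet> abs_l2 H + s * (w \<bullet> abs_l2 v) = abs_l2 f \<bullet> abs_l2 v"
      using G(2)[OF v(3)] by (simp add: algebra_simps)
    then show "(\<integral> x. rep_l2 G x \<bullet> H x \<partial>lebesgue) + s * (\<integral> x. rep_l2 w x * v x \<partial>lebesgue) = (\<integral> x. f x * v x \<partial>lebesgue)"
      using inner_abs_l2[OF f v(1)] inner_rep_abs[OF v(1), of w] inner_rep_abs[OF v(2), of G] by simp
  qed
qed

lemma dres_eigenvalue_imp_point_spectrum:
  assumes x: "dres \<Omega> x = a *\<^sub>R x" "x \<noteq> 0" "a > 0"
  shows "1 / a - 1 \<in> dirichlet_point_spectrum \<Omega>"
proof -
  obtain G where G: "(a *\<^sub>R x, G) \<in> form_space \<Omega>" "\<And>v H. (v, H) \<in> form_space \<Omega> \<Longrightarrow> a *\<^sub>R x \<bullet> v + G \<bullet> H = x \<bullet> v"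
    using x(1) by (metis dresE)
  let ?g = "(1 / a) *\<^sub>R G"
  have "(1 / a) *\<^sub>R (a *\<^sub>R x, G) \<in> form_space \<Omega>" by (intro subspace_scale subspace_form_space G)
  then have "(rep_l2 x, rep_l2 ?g) \<in> H10 \<Omega>" using x(3) by (simp add: H10_rep_iff)
  moreover have "(\<integral>\<^sup>+ y. ennreal ((rep_l2 x y)\<^sup>2) \<partial>lebesgue) > 0"
    using nn_integral_L2[OF L2_fun_rep[of x]] x(2) by simp
  moreover have "(\<integral> y. rep_l2 ?g y \<bullet> H y \<partial>lebesgue) = (1 / a - 1) * (\<integral> y. rep_l2 x y * v y \<partial>lebesgue)"
    if "(v, H) \<in> H10 \<Omega>" for v H
  proof -
    have v: "L2_fun v" "L2_fun H" "(abs_l2 v, abs_l2 H) \<in> form_space \<Omega>" using that by (auto simp: H10_iff)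
    have "?g \<bullet> abs_l2 H = (1 / a - 1) * (x \<bullet> abs_l2 v)" using G(2)[OF v(3)] x(3) by (simp add: field_simps)
    then show ?thesis unfolding inner_rep_abs[OF v(1)] inner_rep_abs[OF v(2)] by simp
  qed
  ultimately show ?thesis unfolding dirichlet_point_spectrum_def by blast
qed

lemma point_spectrum_imp_dres_eigenvalue:
  assumes "lam \<in> dirichlet_point_spectrum \<Omega>"
  shows "lam \<ge> 0" "eigenspace (dres \<Omega>) (1 / (1 + lam)) \<noteq> {0}"
proof -
  obtain u G where u: "(u, G) \<in> H10 \<Omega>" "(\<integral>\<^sup>+ x. ennreal ((u x)\<^sup>2) \<partial>lebesgue) > 0"
    "\<And>v H. (v, H) \<in> H10 \<Omega> \<Longrightarrow> (\<integral> x. G x \<bullet> H x \<partial>lebesgue) = lam * (\<integral> x. u x * v x \<partial>lebesgue)"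
    using assms by (auto simp: dirichlet_point_spectrum_def)
  have L: "L2_fun u" "L2_fun G" "(abs_l2 u, abs_l2 G) \<in> form_space \<Omega>" using u(1) by (auto simp: H10_iff)
  have u0: "abs_l2 u \<noteq> 0" using u(2) nn_integral_L2[OF L(1)] by auto
  have eq: "abs_l2 G \<bullet> H = lam * (abs_l2 u \<bullet> v)" if "(v, H) \<in> form_space \<Omega>" for v H
  proof -
    have "(\<integral> x. G x \<bullet> rep_l2 H x \<partial>lebesgue) = lam * (\<integral> x. u x * rep_l2 v x \<partial>lebesgue)"
      using u(3)[of "rep_l2 v" "rep_l2 H"] that by (simp add: H10_rep_iff)
    then show ?thesis
      using inner_abs_l2[OF L(2) L2_fun_rep[of H]] inner_abs_l2[OF L(1) L2_fun_rep[of v]] by simp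
  qed
  have "lam * (abs_l2 u \<bullet> abs_l2 u) \<ge> 0" using eq[OF L(3)] inner_ge_zero[of "abs_l2 G"] by simp
  moreover have "abs_l2 u \<bullet> abs_l2 u > 0" using u0 by simp
  ultimately show lam: "lam \<ge> 0" by (simp add: zero_le_mult_iff)
  have "dres \<Omega> ((1 + lam) *\<^sub>R abs_l2 u) = abs_l2 u"
    by (rule dres_eqI[OF L(3)]) (simp add: eq algebra_simps)
  then have "(1 + lam) *\<^sub>R dres \<Omega> (abs_l2 u) = abs_l2 u"
    using linear_cmul[OF pos_contraction_linear[OF pos_contraction_dres]] by metis
  then have "(1 / (1 + lam)) *\<^sub>R ((1 + lam) *\<^sub>R dres \<Omega> (abs_l2 u)) = (1 / (1 + lam)) *\<^sub>R abs_l2 u" by simp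
  then have "dres \<Omega> (abs_l2 u) = (1 / (1 + lam)) *\<^sub>R abs_l2 u" using lam by simp
  then show "eigenspace (dres \<Omega>) (1 / (1 + lam)) \<noteq> {0}" using u0 by (auto simp: eigenspace_def)
qed

section \<open>Poincare inequality and compactness on bounded sets\<close>

text \<open>The variance of \<open>g\<close> over the unit interval is nonnegative.\<close>

lemma integral_square_le:
  fixes g :: "real \<Rightarrow> real"
  assumes g: "continuous_on UNIV g"
  shows "ennreal ((integral {0..1} g)\<^sup>2) \<le> (\<integral>\<^sup>+ t. indicator {0..1} t * ennreal ((g t)\<^sup>2) \<partial>lborel)"
proof -
  let ?m = "integral {0..1} g"
  have c: "continuous_on {0..1} g" by (rule continuous_on_subset[OF g]) simp
  have i: "g integrable_on {0..1}" "(\<lambda>t. (g t)\<^sup>2) integrable_on {0..1}"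
    using c by (auto intro!: integrable_continuous_interval continuous_intros)
  have "((\<lambda>t. (g t)\<^sup>2 - 2 * ?m * g t + ?m\<^sup>2) has_integral (integral {0..1} (\<lambda>t. (g t)\<^sup>2) - 2 * ?m * ?m + ?m\<^sup>2)) {0..1}"
    using has_integral_const_real[of "?m\<^sup>2" 0 1]
    by (intro has_integral_add has_integral_diff has_integral_mult_right integrable_integral i) auto
  moreover have "(g t)\<^sup>2 - 2 * ?m * g t + ?m\<^sup>2 = (g t - ?m)\<^sup>2" for t by (simp add: power2_eq_square algebra_simps)
  ultimately have "((\<lambda>t. (g t - ?m)\<^sup>2) has_integral (integral {0..1} (\<lambda>t. (g t)\<^sup>2) - 2 * ?m * ?m + ?m\<^sup>2)) {0..1}"
    by simp
  then have "0 \<le> integral {0..1} (\<lambda>t. (g t)\<^sup>2) - 2 * ?m * ?m + ?m\<^sup>2"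
    by (rule has_integral_nonneg) simp
  then have "?m\<^sup>2 \<le> integral {0..1} (\<lambda>t. (g t)\<^sup>2)" by (simp add: power2_eq_square)
  then have "ennreal (?m\<^sup>2) \<le> ennreal (integral {0..1} (\<lambda>t. (g t)\<^sup>2))" by (rule ennreal_leI)
  also have "\<dots> = (\<integral>\<^sup>+ t. indicator {0..1} t * ennreal ((g t)\<^sup>2) \<partial>lborel)"
  proof -
    have m: "(\<lambda>t. (g t)\<^sup>2) \<in> borel_measurable borel"
      using g by (intro borel_measurable_continuous_onI continuous_intros)
    have "(\<integral>\<^sup>+ t. ennreal (indicator {0..1} t * (g t)\<^sup>2) \<partial>lborel) = ennreal (integral {0..1} (\<lambda>t. (g t)\<^sup>2))"
    proof (rule nn_integral_has_integral_lborel)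
      have "(\<lambda>t. indicator {0..1} t * (g t)\<^sup>2) = (\<lambda>t. if t \<in> {0..1} then (g t)\<^sup>2 else 0)"
        by (auto simp: indicator_def)
      then show "((\<lambda>t. indicator {0..1} t * (g t)\<^sup>2) has_integral integral {0..1} (\<lambda>t. (g t)\<^sup>2)) UNIV"
        using integrable_integral[OF i(2)] by (simp only: has_integral_restrict_UNIV)
    qed (use m in auto)
    moreover have "ennreal (indicator {0..1} t * (g t)\<^sup>2) = indicator {0..1} t * ennreal ((g t)\<^sup>2)" for t
      by (auto simp: indicator_def)
    ultimately show ?thesis by simp
  qed
  finally show ?thesis .
qed

lemma nn_integral_lborel_shift:
  fixes f :: "'a::euclidean_space \<Rightarrow> ennreal"
  assumes [measurable]: "f \<in> borel_measurable borel"
  shows "(\<integral>\<^sup>+ x. f (x + c) \<partial>lborel) = (\<integral>\<^sup>+ x. f x \<partial>lborel)"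
proof -
  have "(\<integral>\<^sup>+ x. f x \<partial>lborel) = (\<integral>\<^sup>+ x. f x \<partial>(distr lborel borel ((+) c)))"
    by (simp add: lborel_distr_plus)
  also have "\<dots> = (\<integral>\<^sup>+ x. f (c + x) \<partial>lborel)" by (rule nn_integral_distr) measurable
  finally show ?thesis by (simp add: add.commute)
qed

text \<open>The increment is the integral of the gradient along the segment from \<open>x\<close> to
  \<open>x + z\<close>. After the Cauchy-Schwarz inequality and Fubini's theorem every slice is a
  translate, and invariance of \<open>S\<close> in the direction \<open>z\<close> keeps the gradient
  integral inside \<open>S\<close>.\<close>

lemma translation_estimate:
  fixes \<phi> :: "'a::euclidean_space \<Rightarrow> real"
  assumes \<phi>: "smooth_fun \<phi>" and S [measurable]: "S \<in> sets borel" and inv: "\<And>x t. x + t *\<^sub>R z \<in> S \<longleftrightarrow> x \<in> S"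
  shows "(\<integral>\<^sup>+ x. indicator S x * ennreal ((\<phi> (x + z) - \<phi> x)\<^sup>2) \<partial>lborel)
     \<le> ennreal ((norm z)\<^sup>2) * (\<integral>\<^sup>+ x. indicator S x * ennreal ((norm (grad \<phi> x))\<^sup>2) \<partial>lborel)"
proof -
  let ?n = "\<lambda>x. ennreal ((norm (grad \<phi> x))\<^sup>2)"
  have cg: "continuous_on UNIV (grad \<phi>)" by (rule continuous_grad[OF \<phi>])
  have gm [measurable]: "grad \<phi> \<in> borel_measurable borel" by (rule borel_measurable_continuous_onI[OF cg])
  have point: "ennreal ((\<phi> (x + z) - \<phi> x)\<^sup>2) \<le> (\<integral>\<^sup>+ t. indicator {0..1} t * (ennreal ((norm z)\<^sup>2) * ?n (x + t *\<^sub>R z)) \<partial>lborel)" for x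
  proof -
    let ?g = "\<lambda>t. grad \<phi> (x + t *\<^sub>R z) \<bullet> z"
    have "((\<lambda>t. \<phi> (x + t *\<^sub>R z)) has_vector_derivative ?g t) (at t within {0..1})" for t
    proof -
      have "((\<lambda>t. \<phi> (x + t *\<^sub>R z)) has_derivative (\<lambda>h. grad \<phi> (x + t *\<^sub>R z) \<bullet> (h *\<^sub>R z))) (at t)"
        by (rule has_derivative_compose[OF _ has_derivative_grad[OF smooth_fun_differentiable[OF \<phi>]]])
           (auto intro!: derivative_eq_intros)
      then have "((\<lambda>t. \<phi> (x + t *\<^sub>R z)) has_derivative (\<lambda>h. h *\<^sub>R ?g t)) (at t within {0..1})"
        by (auto intro: has_derivative_at_withinI)
      then show ?thesis by (simp add: has_vector_derivative_def)
    qed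
    then have "(?g has_integral (\<phi> (x + 1 *\<^sub>R z) - \<phi> (x + 0 *\<^sub>R z))) {0..1}"
      by (intro fundamental_theorem_of_calculus) auto
    then have eq: "integral {0..1} ?g = \<phi> (x + z) - \<phi> x" by (simp add: integral_unique)
    have "continuous_on UNIV ?g"
      by (intro continuous_intros continuous_on_compose2[OF cg]) auto
    from integral_square_le[OF this]
    have "ennreal ((\<phi> (x + z) - \<phi> x)\<^sup>2) \<le> (\<integral>\<^sup>+ t. indicator {0..1} t * ennreal ((?g t)\<^sup>2) \<partial>lborel)" by (simp add: eq)
    also have "\<dots> \<le> (\<integral>\<^sup>+ t. indicator {0..1} t * (ennreal ((norm z)\<^sup>2) * ?n (x + t *\<^sub>R z)) \<partial>lborel)"
    proof (intro nn_integral_mono mult_left_mono)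
      fix t
      have "\<bar>?g t\<bar> \<le> norm z * norm (grad \<phi> (x + t *\<^sub>R z))"
        using Cauchy_Schwarz_ineq2[of "grad \<phi> (x + t *\<^sub>R z)" z] by (simp add: mult.commute)
      then have "(?g t)\<^sup>2 \<le> (norm z * norm (grad \<phi> (x + t *\<^sub>R z)))\<^sup>2"
        by (metis abs_ge_zero power2_abs power_mono)
      then show "ennreal ((?g t)\<^sup>2) \<le> ennreal ((norm z)\<^sup>2) * ?n (x + t *\<^sub>R z)"
        by (simp add: ennreal_mult[symmetric] power_mult_distrib ennreal_leI)
    qed auto
    finally show ?thesis .
  qed
  have "(\<integral>\<^sup>+ x. indicator S x * ennreal ((\<phi> (x + z) - \<phi> x)\<^sup>2) \<partial>lborel)
      \<le> (\<integral>\<^sup>+ x. indicator S x * (\<integral>\<^sup>+ t. indicator {0..1} t * (ennreal ((norm z)\<^sup>2) * ?n (x + t *\<^sub>R z)) \<partial>lborel) \<partial>lborel)"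
    by (intro nn_integral_mono mult_left_mono point) auto
  also have "\<dots> = (\<integral>\<^sup>+ x. (\<integral>\<^sup>+ t. indicator S x * (indicator {0..1} t * (ennreal ((norm z)\<^sup>2) * ?n (x + t *\<^sub>R z))) \<partial>lborel) \<partial>lborel)"
    by (intro nn_integral_cong nn_integral_cmult[symmetric]) measurable
  also have "\<dots> = (\<integral>\<^sup>+ t. (\<integral>\<^sup>+ x. indicator S x * (indicator {0..1} t * (ennreal ((norm z)\<^sup>2) * ?n (x + t *\<^sub>R z))) \<partial>lborel) \<partial>lborel)"
    by (rule lborel_pair.Fubini'[symmetric]) measurable
  also have "\<dots> = (\<integral>\<^sup>+ t. (indicator {0..1} t * ennreal ((norm z)\<^sup>2)) * (\<integral>\<^sup>+ x. indicator S x * ?n x \<partial>lborel) \<partial>(lborel :: real measure))"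
  proof (intro nn_integral_cong)
    fix t :: real
    have "(\<integral>\<^sup>+ x. indicator S x * (indicator {0..1} t * (ennreal ((norm z)\<^sup>2) * ?n (x + t *\<^sub>R z))) \<partial>lborel)
        = (\<integral>\<^sup>+ x. (indicator {0..1} t * ennreal ((norm z)\<^sup>2)) * (indicator S (x + t *\<^sub>R z) * ?n (x + t *\<^sub>R z)) \<partial>lborel)"
      using inv by (intro nn_integral_cong) (auto simp: indicator_def mult_ac)
    also have "\<dots> = (indicator {0..1} t * ennreal ((norm z)\<^sup>2)) * (\<integral>\<^sup>+ x. indicator S (x + t *\<^sub>R z) * ?n (x + t *\<^sub>R z) \<partial>lborel)"
      by (rule nn_integral_cmult) measurable
    also have "(\<integral>\<^sup>+ x. indicator S (x + t *\<^sub>R z) * ?n (x + t *\<^sub>R z) \<partial>lborel) = (\<integral>\<^sup>+ x. indicator S x * ?n x \<partial>lborel)"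
      using nn_integral_lborel_shift[of "\<lambda>x. indicator S x * ?n x" "t *\<^sub>R z"] by simp
    finally show "(\<integral>\<^sup>+ x. indicator S x * (indicator {0..1} t * (ennreal ((norm z)\<^sup>2) * ?n (x + t *\<^sub>R z))) \<partial>lborel)
      = (indicator {0..1} t * ennreal ((norm z)\<^sup>2)) * (\<integral>\<^sup>+ x. indicator S x * ?n x \<partial>lborel)" .
  qed
  also have "\<dots> = (\<integral>\<^sup>+ t. indicator {0..1::real} t \<partial>lborel) * (ennreal ((norm z)\<^sup>2) * (\<integral>\<^sup>+ x. indicator S x * ?n x \<partial>lborel))"
    by (simp add: nn_integral_multc mult.assoc)
  also have "(\<integral>\<^sup>+ t. indicator {0..1::real} t \<partial>lborel) = 1" by simp
  finally show ?thesis by simp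
qed

lemma norm_restr_nn_integral:
  assumes "S \<in> sets lebesgue" "L2_fun f"
  shows "ennreal ((norm (restr S (abs_l2 f)))\<^sup>2) = (\<integral>\<^sup>+ x. indicator S x * ennreal ((norm (f x))\<^sup>2) \<partial>lborel)"
proof -
  have "ennreal ((norm (restr S (abs_l2 f)))\<^sup>2) = (\<integral>\<^sup>+ x. ennreal ((norm (indicator S x *\<^sub>R f x))\<^sup>2) \<partial>lebesgue)"
    using nn_integral_L2[OF L2_fun_indicator[OF assms]] by (simp add: restr_abs_l2 assms)
  also have "\<dots> = (\<integral>\<^sup>+ x. indicator S x * ennreal ((norm (f x))\<^sup>2) \<partial>lborel)"
    unfolding nn_integral_completion by (intro nn_integral_cong) (auto simp: indicator_def)
  finally show ?thesis .
qed

text \<open>Translating by twice the width moves every point of the strip out of \<open>\<Omega>\<close>.\<close>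

lemma strip_poincare:
  fixes e e2 :: "'a::euclidean_space"
  assumes e2: "norm e2 = 1" "e \<bullet> e2 = 0" and I: "I \<in> sets borel" and M: "M > 0"
    and width: "\<And>x. x \<in> \<Omega> \<Longrightarrow> x \<bullet> e \<in> I \<Longrightarrow> \<bar>x \<bullet> e2\<bar> < M"
    and p: "(u, G) \<in> form_space \<Omega>"
  shows "norm (restr {x. x \<bullet> e \<in> I} u) \<le> 2 * M * norm (restr {x. x \<bullet> e \<in> I} G)"
proof -
  let ?S = "{x. x \<bullet> e \<in> I}"
  have S: "?S \<in> sets borel"
    using measurable_sets_borel[of "\<lambda>x. x \<bullet> e" borel I] I by (simp add: vimage_def)
  then have SL: "?S \<in> sets lebesgue" by simp
  have "norm (restr ?S (fst p)) \<le> 2 * M * norm (restr ?S (snd p))" if "p \<in> form_space \<Omega>" for p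
    using that
  proof (rule form_space_induct)
    show "closed {p. norm (restr ?S (fst p)) \<le> 2 * M * norm (restr ?S (snd p :: ('a,'a) l2))}"
      using SL by (intro closed_Collect_le continuous_intros)
    fix \<phi> assume \<phi>: "test_fun \<Omega> \<phi>"
    let ?z = "(2 * M) *\<^sub>R e2"
    have out: "x + ?z \<notin> \<Omega>" if "x \<in> \<Omega>" "x \<in> ?S" for x
    proof
      assume "x + ?z \<in> \<Omega>"
      moreover have "(x + ?z) \<bullet> e \<in> I" using that e2 by (simp add: inner_add_left inner_commute[of e2])
      ultimately have "\<bar>(x + ?z) \<bullet> e2\<bar> < M" by (rule width)
      moreover have "(x + ?z) \<bullet> e2 = x \<bullet> e2 + 2 * M" using e2(1) by (simp add: inner_add_left norm_eq_1)
      moreover have "\<bar>x \<bullet> e2\<bar> < M" using width that by simp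
      ultimately show False by linarith
    qed
    have "ennreal ((norm (restr ?S (abs_l2 \<phi>)))\<^sup>2) = (\<integral>\<^sup>+ x. indicator ?S x * ennreal ((\<phi> x)\<^sup>2) \<partial>lborel)"
      using norm_restr_nn_integral[OF SL L2_fun_test(1)[OF \<phi>]] by simp
    \<comment> \<open>At a point of the domain in the strip the translated value is 0, so the
      increment is minus the value itself; at other points of the strip \<phi> vanishes.\<close>
    also have "\<dots> \<le> (\<integral>\<^sup>+ x. indicator ?S x * ennreal ((\<phi> (x + ?z) - \<phi> x)\<^sup>2) \<partial>lborel)"
    proof (rule nn_integral_mono)
      fix x
      show "indicator ?S x * ennreal ((\<phi> x)\<^sup>2) \<le> indicator ?S x * ennreal ((\<phi> (x + ?z) - \<phi> x)\<^sup>2)"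
        using out[of x] test_fun_zero_outside(1)[OF \<phi>, of x] test_fun_zero_outside(1)[OF \<phi>, of "x + ?z"]
        by (cases "x \<in> \<Omega>"; cases "x \<in> ?S") auto
    qed
    also have "\<dots> \<le> ennreal ((norm ?z)\<^sup>2) * (\<integral>\<^sup>+ x. indicator ?S x * ennreal ((norm (grad \<phi> x))\<^sup>2) \<partial>lborel)"
      using e2(2) by (intro translation_estimate[OF test_fun_smooth[OF \<phi>] S]) (simp add: inner_add_left inner_commute[of e2])
    also have "\<dots> = ennreal ((2 * M)\<^sup>2 * (norm (restr ?S (abs_l2 (grad \<phi>))))\<^sup>2)"
      using norm_restr_nn_integral[OF SL L2_fun_test(2)[OF \<phi>]] e2(1) M by (simp add: ennreal_mult)
    finally have "(norm (restr ?S (abs_l2 \<phi>)))\<^sup>2 \<le> (2 * M * norm (restr ?S (abs_l2 (grad \<phi>))))\<^sup>2"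
      by (simp add: power_mult_distrib)
    then have "norm (restr ?S (abs_l2 \<phi>)) \<le> 2 * M * norm (restr ?S (abs_l2 (grad \<phi>)))"
      by (rule power2_le_imp_le) (use M in simp)
    then show "norm (restr ?S (fst (abs_l2 \<phi>, abs_l2 (grad \<phi>)))) \<le> 2 * M * norm (restr ?S (snd (abs_l2 \<phi>, abs_l2 (grad \<phi>))))"
      by simp
  qed
  from this[OF p] show ?thesis by simp
qed

section \<open>Compactness through sampling on a grid\<close>

lemma compact_coefficient_sums:
  fixes \<Phi> :: "'h::real_normed_vector set"
  assumes "finite \<Phi>"
  shows "compact {\<Sum>\<phi>\<in>\<Phi>. c \<phi> *\<^sub>R \<phi> | c. \<forall>\<phi>. \<bar>c \<phi>\<bar> \<le> 1}"
  using assms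
proof (induction \<Phi> rule: finite_induct)
  case empty
  have "{\<Sum>\<phi>\<in>{}. c \<phi> *\<^sub>R (\<phi>::'h) | c. \<forall>\<phi>. \<bar>c \<phi>\<bar> \<le> 1} = {0}"
    by (auto intro: exI[of _ "\<lambda>_. 0"])
  then show ?case by simp
next
  case (insert x \<Phi>)
  let ?T = "{\<Sum>\<phi>\<in>\<Phi>. c \<phi> *\<^sub>R \<phi> | c. \<forall>\<phi>. \<bar>c \<phi>\<bar> \<le> 1}" and ?L = "(\<lambda>t. t *\<^sub>R x) ` {-1..1}"
  have "compact ?L" by (intro compact_continuous_image continuous_intros) simp
  then have c: "compact {a + b | a b. a \<in> ?L \<and> b \<in> ?T}" by (rule compact_sums[OF _ insert.IH])
  have "{\<Sum>\<phi>\<in>insert x \<Phi>. c \<phi> *\<^sub>R \<phi> | c. \<forall>\<phi>. \<bar>c \<phi>\<bar> \<le> 1} = {a + b | a b. a \<in> ?L \<and> b \<in> ?T}" (is "?A = ?B")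
  proof (intro set_eqI iffI)
    fix y assume "y \<in> ?A"
    then obtain c where c: "y = (\<Sum>\<phi>\<in>insert x \<Phi>. c \<phi> *\<^sub>R \<phi>)" "\<forall>\<phi>. \<bar>c \<phi>\<bar> \<le> 1" by blast
    have "y = c x *\<^sub>R x + (\<Sum>\<phi>\<in>\<Phi>. c \<phi> *\<^sub>R \<phi>)" using c(1) insert.hyps by simp
    moreover have "c x *\<^sub>R x \<in> ?L" using c(2) by (intro imageI) (simp add: abs_le_iff minus_le_iff)
    moreover have "(\<Sum>\<phi>\<in>\<Phi>. c \<phi> *\<^sub>R \<phi>) \<in> ?T" using c(2) by blast
    ultimately show "y \<in> ?B" by blast
  next
    fix y assume "y \<in> ?B"
    then obtain t c where c: "y = t *\<^sub>R x + (\<Sum>\<phi>\<in>\<Phi>. c \<phi> *\<^sub>R \<phi>)" "\<forall>\<phi>. \<bar>c \<phi>\<bar> \<le> 1" "-1 \<le> t" "t \<le> 1" by auto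
    let ?c = "c(x := t)"
    have "(\<Sum>\<phi>\<in>\<Phi>. ?c \<phi> *\<^sub>R \<phi>) = (\<Sum>\<phi>\<in>\<Phi>. c \<phi> *\<^sub>R \<phi>)"
      using insert.hyps by (intro sum.cong) auto
    then have "y = (\<Sum>\<phi>\<in>insert x \<Phi>. ?c \<phi> *\<^sub>R \<phi>)" using c(1) insert.hyps by simp
    moreover have "\<forall>\<phi>. \<bar>?c \<phi>\<bar> \<le> 1" using c by auto
    ultimately show "y \<in> ?A" by blast
  qed
  then show ?case using c by simp
qed

text \<open>The image of the unit ball lies within \<open>e/4\<close> of a compact set of
  combinations with coefficients at most 1 in absolute value, hence it is totally bounded;
  completeness turns this into sequential compactness.\<close>

lemma compact_op_of_finite_rank_approx:
  fixes K :: "'h::{real_inner,banach} \<Rightarrow> 'h"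
  assumes K: "\<And>x. norm (K x) \<le> norm x"
    and approx: "\<And>\<epsilon>. \<epsilon> > 0 \<Longrightarrow> \<exists>\<Phi>. finite \<Phi> \<and> orthonormal \<Phi> \<and> (\<forall>x. norm x \<le> 1 \<longrightarrow> norm (K x - fourier_sum \<Phi> (K x)) \<le> \<epsilon>)"
  shows "compact_op K"
proof -
  let ?S = "closure (K ` cball 0 1)"
  have "compact ?S"
    unfolding compact_eq_totally_bounded
  proof (intro conjI allI impI)
    show "complete ?S" by (simp add: complete_eq_closed)
    fix e :: real assume e: "e > 0"
    then obtain \<Phi> where \<Phi>: "finite \<Phi>" "orthonormal \<Phi>" "\<And>x. norm x \<le> 1 \<Longrightarrow> norm (K x - fourier_sum \<Phi> (K x)) \<le> e / 4"
      using approx[of "e / 4"] by auto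
    let ?T = "{\<Sum>\<phi>\<in>\<Phi>. c \<phi> *\<^sub>R \<phi> | c. \<forall>\<phi>. \<bar>c \<phi>\<bar> \<le> 1}"
    obtain k where k: "finite k" "?T \<subseteq> (\<Union>x\<in>k. ball x (e / 4))"
      using compact_coefficient_sums[OF \<Phi>(1)] e unfolding compact_eq_totally_bounded by (meson zero_less_divide_iff zero_less_numeral)
    have near: "\<exists>y\<in>k. dist y (K x) < e / 2" if x: "norm x \<le> 1" for x
    proof -
      let ?c = "\<lambda>\<phi>. if \<phi> \<in> \<Phi> then K x \<bullet> \<phi> else 0"
      have "fourier_sum \<Phi> (K x) = (\<Sum>\<phi>\<in>\<Phi>. ?c \<phi> *\<^sub>R \<phi>)"
        unfolding fourier_sum_def[OF \<Phi>(1,2)] by (intro sum.cong) auto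
      moreover have "\<forall>\<phi>. \<bar>?c \<phi>\<bar> \<le> 1"
      proof
        fix \<phi>
        show "\<bar>?c \<phi>\<bar> \<le> 1"
        proof (cases "\<phi> \<in> \<Phi>")
          case True
          then have "\<bar>K x \<bullet> \<phi>\<bar> \<le> norm (K x) * 1"
            using Cauchy_Schwarz_ineq2[of "K x" \<phi>] \<Phi>(2) by (simp add: orthonormal_def)
          then show ?thesis using True K[of x] x by simp
        qed simp
      qed
      ultimately have "fourier_sum \<Phi> (K x) \<in> ?T" by (intro CollectI exI[of _ ?c] conjI)
      then obtain y where y: "y \<in> k" "dist y (fourier_sum \<Phi> (K x)) < e / 4" using k(2) by auto
      have "dist y (K x) \<le> dist y (fourier_sum \<Phi> (K x)) + dist (fourier_sum \<Phi> (K x)) (K x)" by (rule dist_triangle)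
      also have "\<dots> < e / 4 + e / 4"
        using y(2) \<Phi>(3)[OF x] by (intro add_less_le_mono) (auto simp: dist_norm norm_minus_commute)
      finally show ?thesis using y(1) by auto
    qed
    have "?S \<subseteq> (\<Union>x\<in>k. ball x e)"
    proof
      fix s assume "s \<in> ?S"
      then have "\<exists>y\<in>K ` cball 0 1. dist y s < e / 2" using e half_gt_zero by (simp only: closure_approachable)
      then obtain x where x: "norm x \<le> 1" "dist (K x) s < e / 2" by auto
      obtain y where y: "y \<in> k" "dist y (K x) < e / 2" using near[OF x(1)] by blast
      have "dist y s < e" using dist_triangle[of y s "K x"] x(2) y(2) by linarith
      then show "s \<in> (\<Union>x\<in>k. ball x e)" using y(1) by auto
    qed
    then show "\<exists>k. finite k \<and> ?S \<subseteq> (\<Union>x\<in>k. ball x e)" using k(1) by blast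
  qed
  then have seq: "seq_compact ?S" by (rule compact_imp_seq_compact)
  show ?thesis unfolding compact_op_def
  proof (intro allI impI)
    fix x :: "nat \<Rightarrow> 'h" assume "\<forall>n. norm (x n) \<le> 1"
    then have "\<forall>n. K (x n) \<in> ?S" by (intro allI subsetD[OF closure_subset] imageI) simp
    from seq_compactE[OF seq this] obtain l r where "strict_mono (r :: nat \<Rightarrow> nat)" "((\<lambda>n. K (x n)) \<circ> r) \<longlonglongrightarrow> l" .
    then show "\<exists>l r. strict_mono (r :: nat \<Rightarrow> nat) \<and> (\<lambda>n. K (x (r n))) \<longlonglongrightarrow> l" by (auto simp: o_def)
  qed
qed

lemma fourier_sum_best_approx:
  assumes \<Phi>: "finite \<Phi>" "orthonormal \<Phi>" and g: "g \<in> span \<Phi>"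
  shows "norm (x - fourier_sum \<Phi> x) \<le> norm (x - g)"
proof -
  let ?d = "fourier_sum \<Phi> x - g"
  have "?d \<in> span \<Phi>" using g fourier_sum_in_span[OF \<Phi>] span_diff by blast
  then have "orthogonal (x - fourier_sum \<Phi> x) ?d"
    using orthogonal_to_span[of ?d \<Phi> "x - fourier_sum \<Phi> x"] fourier_sum_residual[OF \<Phi>, of _ x]
    by (auto simp: orthogonal_def)
  then have "(norm (x - g))\<^sup>2 = (norm (x - fourier_sum \<Phi> x))\<^sup>2 + (norm ?d)\<^sup>2"
    unfolding power2_norm_eq_inner orthogonal_def by (simp add: inner_diff_left inner_diff_right inner_commute)
  then have "(norm (x - fourier_sum \<Phi> x))\<^sup>2 \<le> (norm (x - g))\<^sup>2" by simp
  then show ?thesis by (rule power2_le_imp_le) simp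
qed

lemma orthonormal_normalize:
  fixes v :: "'i \<Rightarrow> 'h::real_inner"
  assumes I: "finite I" and orth: "\<And>i j. i \<in> I \<Longrightarrow> j \<in> I \<Longrightarrow> i \<noteq> j \<Longrightarrow> v i \<bullet> v j = 0"
  shows "\<exists>\<Phi>. finite \<Phi> \<and> orthonormal \<Phi> \<and> v ` I \<subseteq> span \<Phi>"
proof (intro exI conjI)
  let ?\<Phi> = "(\<lambda>i. (1 / norm (v i)) *\<^sub>R v i) ` {i\<in>I. v i \<noteq> 0}"
  show "finite ?\<Phi>" using I by simp
  show "orthonormal ?\<Phi>" unfolding orthonormal_def using orth by auto
  show "v ` I \<subseteq> span ?\<Phi>"
  proof
    fix y assume "y \<in> v ` I"
    then obtain i where i: "i \<in> I" "y = v i" by blast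
    show "y \<in> span ?\<Phi>"
    proof (cases "v i = 0")
      case False
      then have "(1 / norm (v i)) *\<^sub>R v i \<in> span ?\<Phi>" using i by (intro span_base) auto
      then have "norm (v i) *\<^sub>R ((1 / norm (v i)) *\<^sub>R v i) \<in> span ?\<Phi>" by (rule span_scale)
      then show ?thesis using False i by simp
    qed (simp add: i span_zero)
  qed
qed

lemma abs_l2_sum:
  assumes "finite I" "\<And>i. i \<in> I \<Longrightarrow> L2_fun (f i)"
  shows "L2_fun (\<lambda>x. \<Sum>i\<in>I. f i x)" "(\<Sum>i\<in>I. abs_l2 (f i)) = abs_l2 (\<lambda>x. \<Sum>i\<in>I. f i x)"
proof -
  have "L2_fun (\<lambda>x. \<Sum>i\<in>I. f i x) \<and> (\<Sum>i\<in>I. abs_l2 (f i)) = abs_l2 (\<lambda>x. \<Sum>i\<in>I. f i x)"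
    using assms
  proof (induction I rule: finite_induct)
    case empty
    show ?case by (simp add: L2_fun_zero abs_l2_zero)
  next
    case (insert i I)
    then show ?case by (simp add: L2_fun_add abs_l2_add)
  qed
  then show "L2_fun (\<lambda>x. \<Sum>i\<in>I. f i x)" "(\<Sum>i\<in>I. abs_l2 (f i)) = abs_l2 (\<lambda>x. \<Sum>i\<in>I. f i x)" by auto
qed

definition grid_corner :: "real \<Rightarrow> 'a::euclidean_space \<Rightarrow> 'a" where
  "grid_corner h x = (\<Sum>b\<in>Basis. (h * of_int \<lfloor>(x \<bullet> b) / h\<rfloor>) *\<^sub>R b)"

lemma grid_corner_inner: "b \<in> Basis \<Longrightarrow> grid_corner h x \<bullet> b = h * of_int \<lfloor>(x \<bullet> b) / h\<rfloor>"
  by (simp add: grid_corner_def)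

lemma measurable_grid_corner [measurable]: "grid_corner h \<in> borel_measurable borel"
  unfolding grid_corner_def[abs_def] by measurable

lemma grid_corner_bounds:
  assumes "h > 0" "b \<in> Basis" shows "0 \<le> (x - grid_corner h x) \<bullet> b" "(x - grid_corner h x) \<bullet> b < h"
proof -
  have "h * of_int \<lfloor>(x \<bullet> b) / h\<rfloor> \<le> h * ((x \<bullet> b) / h)"
    using assms(1) by (intro mult_left_mono of_int_floor_le) auto
  moreover have "h * ((x \<bullet> b) / h) < h * (of_int \<lfloor>(x \<bullet> b) / h\<rfloor> + 1)"
    using assms(1) by (intro mult_strict_left_mono) linarith+
  ultimately show "0 \<le> (x - grid_corner h x) \<bullet> b" "(x - grid_corner h x) \<bullet> b < h"
    using assms by (auto simp: inner_diff_left grid_corner_inner algebra_simps)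
qed

text \<open>Sampling \<open>\<phi>\<close> at offset \<open>w\<close> inside each grid cell and averaging over \<open>w\<close> costs only translations
  by less than the mesh size.\<close>

lemma grid_sampling_estimate:
  fixes \<phi> :: "'a::euclidean_space \<Rightarrow> real"
  assumes \<phi>: "smooth_fun \<phi>" and h: "h > 0"
  shows "(\<integral>\<^sup>+ w. indicator (box 0 (h *\<^sub>R One)) w *
        (\<integral>\<^sup>+ x. ennreal ((\<phi> (grid_corner h x + w) - \<phi> x)\<^sup>2) \<partial>lborel) \<partial>lborel)
    \<le> ennreal ((2 * h) ^ DIM('a)) * (ennreal ((real DIM('a) * h)\<^sup>2) * (\<integral>\<^sup>+ x. ennreal ((norm (grad \<phi> x))\<^sup>2) \<partial>lborel))"
proof -
  \<comment> \<open>\<open>?W\<close> contains the sampling offsets \<open>w\<close>. The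
    translation from \<open>x\<close> to the sample point is
    \<open>z = w - (x - grid_corner h x)\<close>, all of whose coordinates lie between
    \<open>-h\<close> and \<open>h\<close>; \<open>?Z\<close> collects these, which explains the
    volume \<open>(2 * h) ^ DIM('a)\<close>.\<close>
  let ?W = "box 0 (h *\<^sub>R One) :: 'a set" and ?Z = "cbox (- h *\<^sub>R One) (h *\<^sub>R One) :: 'a set"
  let ?d = "\<lambda>x y. ennreal ((\<phi> y - \<phi> x)\<^sup>2)"
  have [measurable]: "\<phi> \<in> borel_measurable borel"
    by (rule borel_measurable_continuous_onI[OF smooth_fun_continuous[OF \<phi>]])
  have "(\<integral>\<^sup>+ w. indicator ?W w * (\<integral>\<^sup>+ x. ?d x (grid_corner h x + w) \<partial>lborel) \<partial>lborel)
      = (\<integral>\<^sup>+ w. (\<integral>\<^sup>+ x. indicator ?W w * ?d x (grid_corner h x + w) \<partial>lborel) \<partial>lborel)"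
    by (intro nn_integral_cong nn_integral_cmult[symmetric]) measurable
  also have "\<dots> = (\<integral>\<^sup>+ x. (\<integral>\<^sup>+ w. indicator ?W w * ?d x (grid_corner h x + w) \<partial>lborel) \<partial>lborel)"
    by (rule lborel_pair.Fubini') measurable
  also have "\<dots> \<le> (\<integral>\<^sup>+ x. (\<integral>\<^sup>+ z. indicator ?Z z * ?d x (x + z) \<partial>lborel) \<partial>lborel)"
  proof (rule nn_integral_mono)
    fix x :: 'a
    let ?s = "x - grid_corner h x"
    have "(\<integral>\<^sup>+ w. indicator ?W w * ?d x (grid_corner h x + w) \<partial>lborel)
        = (\<integral>\<^sup>+ z. indicator ?W (z + ?s) * ?d x (grid_corner h x + (z + ?s)) \<partial>lborel)"
      by (rule nn_integral_lborel_shift[symmetric]) measurable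
    also have "\<dots> \<le> (\<integral>\<^sup>+ z. indicator ?Z z * ?d x (x + z) \<partial>lborel)"
    proof (rule nn_integral_mono)
      fix z :: 'a
      have "z \<in> ?Z" if z: "z + ?s \<in> ?W"
      proof -
        have "- h \<le> z \<bullet> b \<and> z \<bullet> b \<le> h" if b: "b \<in> Basis" for b
        proof -
          have "0 < (z + ?s) \<bullet> b" "(z + ?s) \<bullet> b < h" using z b by (auto simp: mem_box)
          then show ?thesis using grid_corner_bounds[OF h b, of x] by (simp add: inner_add_left)
        qed
        then show ?thesis by (auto simp: mem_box)
      qed
      then show "indicator ?W (z + ?s) * ?d x (grid_corner h x + (z + ?s)) \<le> indicator ?Z z * ?d x (x + z)"
        by (cases "z + ?s \<in> ?W") (auto simp: add.commute)
    qed
    finally show "(\<integral>\<^sup>+ w. indicator ?W w * ?d x (grid_corner h x + w) \<partial>lborel) \<le> (\<integral>\<^sup>+ z. indicator ?Z z * ?d x (x + z) \<partial>lborel)" .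
  qed
  also have "\<dots> = (\<integral>\<^sup>+ z. (\<integral>\<^sup>+ x. indicator ?Z z * ?d x (x + z) \<partial>lborel) \<partial>lborel)"
    by (rule lborel_pair.Fubini'[symmetric]) measurable
  also have "\<dots> \<le> (\<integral>\<^sup>+ z. indicator ?Z z * (ennreal ((real DIM('a) * h)\<^sup>2) * (\<integral>\<^sup>+ x. ennreal ((norm (grad \<phi> x))\<^sup>2) \<partial>lborel)) \<partial>lborel)"
  proof (rule nn_integral_mono)
    fix z :: 'a
    let ?N = "\<integral>\<^sup>+ x. ennreal ((norm (grad \<phi> x))\<^sup>2) \<partial>lborel"
    have "(\<integral>\<^sup>+ x. indicator ?Z z * ?d x (x + z) \<partial>lborel) = indicator ?Z z * (\<integral>\<^sup>+ x. ?d x (x + z) \<partial>lborel)"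
      by (rule nn_integral_cmult) measurable
    also have "\<dots> \<le> indicator ?Z z * (ennreal ((real DIM('a) * h)\<^sup>2) * ?N)"
    proof (cases "z \<in> ?Z")
      case True
      have "norm z \<le> (\<Sum>b\<in>Basis. \<bar>z \<bullet> b\<bar>)" by (rule norm_le_l1)
      also have "\<dots> \<le> (\<Sum>b\<in>(Basis::'a set). h)" using True by (intro sum_mono) (auto simp: mem_box abs_le_iff minus_le_iff)
      finally have "norm z \<le> real DIM('a) * h" by simp
      then have "(norm z)\<^sup>2 \<le> (real DIM('a) * h)\<^sup>2" by (intro power_mono) auto
      moreover have "(\<integral>\<^sup>+ x. ?d x (x + z) \<partial>lborel) \<le> ennreal ((norm z)\<^sup>2) * ?N"
        using translation_estimate[OF \<phi>, of UNIV z] by simp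
      ultimately have "(\<integral>\<^sup>+ x. ?d x (x + z) \<partial>lborel) \<le> ennreal ((real DIM('a) * h)\<^sup>2) * ?N"
        using order_trans[OF _ mult_right_mono[OF ennreal_leI, of "(norm z)\<^sup>2" "(real DIM('a) * h)\<^sup>2" ?N]] by simp
      then show ?thesis by (intro mult_left_mono) auto
    qed simp
    finally show "(\<integral>\<^sup>+ x. indicator ?Z z * ?d x (x + z) \<partial>lborel) \<le> indicator ?Z z * (ennreal ((real DIM('a) * h)\<^sup>2) * ?N)" .
  qed
  also have "\<dots> = emeasure lborel ?Z * (ennreal ((real DIM('a) * h)\<^sup>2) * (\<integral>\<^sup>+ x. ennreal ((norm (grad \<phi> x))\<^sup>2) \<partial>lborel))"
    by (simp add: nn_integral_multc)
  also have "emeasure lborel ?Z = ennreal ((2 * h) ^ DIM('a))"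
    using h by (subst emeasure_lborel_cbox) (auto simp: algebra_simps)
  finally show ?thesis .
qed


lemma norm_abs_l2_mono:
  assumes "L2_fun f" "L2_fun g" "C \<ge> 0" "\<And>x. norm (f x) \<le> C * norm (g x)"
  shows "norm (abs_l2 f) \<le> C * norm (abs_l2 g)"
proof -
  have "(norm (abs_l2 f))\<^sup>2 = (\<integral> x. (norm (f x))\<^sup>2 \<partial>lebesgue)" by (rule norm_abs_l2[OF assms(1)])
  also have "\<dots> \<le> (\<integral> x. C\<^sup>2 * (norm (g x))\<^sup>2 \<partial>lebesgue)"
  proof (rule integral_mono)
    show "(norm (f x))\<^sup>2 \<le> C\<^sup>2 * (norm (g x))\<^sup>2" for x
      using power_mono[OF assms(4) norm_ge_zero, of x 2] by (simp add: power_mult_distrib)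
  qed (use assms L2_fun_integrable_sq in auto)
  also have "\<dots> = (C * norm (abs_l2 g))\<^sup>2" by (simp add: norm_abs_l2[OF assms(2)] power_mult_distrib)
  finally show ?thesis by (rule power2_le_imp_le) (use assms(3) in simp)
qed

text \<open>A quantitative Rellich theorem. For every offset \<open>w\<close> the sampled function
  is a combination of the same finitely many cell indicators, so the distance of \<phi> to their
  span is bounded by each sampling error and thus by the average over \<open>w\<close>. Averaging
  matters because single point values are not controlled by the \<open>H\<^sup>1\<close>
  norm.\<close>

lemma grid_approximation:
  fixes U :: "'a::euclidean_space set"
  assumes U: "bounded U" and h: "h > 0"
  shows "\<exists>\<Phi>. finite \<Phi> \<and> orthonormal \<Phi> \<and> (\<forall>u G. (u, G) \<in> form_space U \<longrightarrow>
     norm (u - fourier_sum \<Phi> u) \<le> sqrt (2 ^ DIM('a)) * real DIM('a) * h * norm G)"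
proof -
  obtain R where R: "\<And>x. x \<in> U \<Longrightarrow> norm x \<le> R" using U by (auto simp: bounded_iff)
  \<comment> \<open>The extra 1 accounts for the offset: a sample point in \<open>U\<close> may
    belong to a cell whose corner lies up to \<open>h\<close> farther out in a coordinate.\<close>
  define N where "N = \<lceil>R / h\<rceil> + 1"
  define I where "I = (PiE (Basis::'a set) (\<lambda>_. {-N..N}))"
  have fI: "finite I" unfolding I_def by (intro finite_PiE) auto
  define cell :: "('a \<Rightarrow> int) \<Rightarrow> 'a set" where "cell k = {x. \<forall>b\<in>Basis. \<lfloor>(x \<bullet> b) / h\<rfloor> = k b}" for k
  define corner :: "('a \<Rightarrow> int) \<Rightarrow> 'a" where "corner k = (\<Sum>b\<in>Basis. (h * of_int (k b)) *\<^sub>R b)" for k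
  have gc: "grid_corner h x = corner k" if "x \<in> cell k" for x k
    using that unfolding grid_corner_def corner_def cell_def by (intro sum.cong) auto
  have cell_m: "cell k \<in> sets borel" for k
  proof -
    have "{x \<in> space borel. \<forall>b\<in>(Basis::'a set). \<lfloor>(x \<bullet> b) / h\<rfloor> = k b} \<in> sets borel" by measurable
    then show ?thesis by (simp add: cell_def)
  qed
  have cell_b: "bounded (cell k)" for k
  proof (rule bounded_subset[OF bounded_cbox])
    show "cell k \<subseteq> cbox (corner k) (corner k + h *\<^sub>R One)"
    proof
      fix x assume x: "x \<in> cell k"
      show "x \<in> cbox (corner k) (corner k + h *\<^sub>R One)"
        unfolding mem_box gc[OF x, symmetric]
        using grid_corner_bounds[OF h, of _ x] by (force simp: inner_diff_left inner_add_left)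
    qed
  qed
  have L: "L2_fun (\<lambda>x. indicator (cell k) x :: real)" for k
  proof -
    have "cell k \<in> lmeasurable" using cell_m by (intro bounded_set_imp_lmeasurable cell_b) auto
    then have "integrable lebesgue (\<lambda>x. indicator (cell k) x :: real)"
      by (intro integrable_real_indicator) (auto simp: fmeasurable_def)
    moreover have "(norm (indicator (cell k) x :: real))\<^sup>2 = indicator (cell k) x" for x by (simp add: indicator_def)
    ultimately show ?thesis unfolding L2_fun_def by auto
  qed
  define v where "v k = abs_l2 (\<lambda>x. indicator (cell k) x :: real)" for k
  have "v k \<bullet> v j = 0" if kj: "k \<in> I" "j \<in> I" "k \<noteq> j" for k j
  proof -
    obtain b where b: "b \<in> Basis" "k b \<noteq> j b"
      using PiE_ext[OF kj(1,2)[unfolded I_def]] kj(3) by auto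
    have "x \<notin> cell k \<or> x \<notin> cell j" for x using b unfolding cell_def by force
    then have "indicator (cell k) x * indicator (cell j) x = (0::real)" for x
      by (auto simp: indicator_def)
    then show ?thesis unfolding v_def inner_abs_l2[OF L L] inner_real_def by (simp only: Bochner_Integration.integral_zero)
  qed
  then have "\<exists>\<Phi>. finite \<Phi> \<and> orthonormal \<Phi> \<and> v ` I \<subseteq> span \<Phi>" by (rule orthonormal_normalize[OF fI])
  then obtain \<Phi> where \<Phi>: "finite \<Phi>" "orthonormal \<Phi>" "v ` I \<subseteq> span \<Phi>" by (elim exE conjE)
  let ?C = "sqrt (2 ^ DIM('a)) * real DIM('a) * h"
  have "norm (fst p - fourier_sum \<Phi> (fst p)) \<le> ?C * norm (snd p)" if "p \<in> form_space U" for p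
    using that
  proof (rule form_space_induct)
    show "closed {p. norm (fst p - fourier_sum \<Phi> (fst p)) \<le> ?C * norm (snd p :: ('a,'a) l2)}"
      unfolding fourier_sum_def[OF \<Phi>(1,2)] by (intro closed_Collect_le continuous_intros)
    fix \<phi> assume \<phi>: "test_fun U \<phi>"
    let ?r = "abs_l2 \<phi> - fourier_sum \<Phi> (abs_l2 \<phi>)"
    \<comment> \<open>The left-hand side does not depend on \<open>w\<close>, as the span is the
      same for all offsets; this is what makes averaging possible.\<close>
    have step: "ennreal ((norm ?r)\<^sup>2) \<le> (\<integral>\<^sup>+ x. ennreal ((\<phi> (grid_corner h x + w) - \<phi> x)\<^sup>2) \<partial>lborel)"
      if w: "w \<in> box 0 (h *\<^sub>R One)" for w
    proof -
      let ?g = "\<lambda>x. \<phi> (grid_corner h x + w)"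
      have g_eq: "?g x = (\<Sum>k\<in>I. \<phi> (corner k + w) *\<^sub>R indicator (cell k) x)" for x
      proof -
        define k0 where "k0 = restrict (\<lambda>b. \<lfloor>(x \<bullet> b) / h\<rfloor>) Basis"
        have x0: "x \<in> cell k0" by (simp add: cell_def k0_def)
        have uniq: "k = k0" if "k \<in> I" "x \<in> cell k" for k
          using that by (intro extensionalityI[of k Basis k0]) (auto simp: I_def k0_def cell_def PiE_def)
        show ?thesis
        proof (cases "k0 \<in> I")
          case True
          have "(\<Sum>k\<in>I. \<phi> (corner k + w) *\<^sub>R indicator (cell k) x) = (\<Sum>k\<in>I. if k = k0 then \<phi> (corner k0 + w) else 0)"
          proof (rule sum.cong[OF refl])
            fix k assume k: "k \<in> I"
            show "\<phi> (corner k + w) *\<^sub>R indicator (cell k) x = (if k = k0 then \<phi> (corner k0 + w) else 0)"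
            proof (cases "k = k0")
              case False
              then have "x \<notin> cell k" using uniq[OF k] by auto
              then show ?thesis using False by simp
            qed (use x0 in simp)
          qed
          also have "\<dots> = \<phi> (corner k0 + w)" using True fI by simp
          finally show ?thesis using gc[OF x0] by simp
        next
          case False
          then have "x \<notin> cell k" if "k \<in> I" for k using uniq that by blast
          then have "(\<Sum>k\<in>I. \<phi> (corner k + w) *\<^sub>R indicator (cell k) x) = (0::real)"
            by (intro sum.neutral) auto
          moreover have "grid_corner h x + w \<notin> U"
          proof
            assume inU: "grid_corner h x + w \<in> U"
            have "\<lfloor>(x \<bullet> b) / h\<rfloor> \<in> {-N..N}" if b: "b \<in> Basis" for b
            proof -
              have "\<bar>(grid_corner h x + w) \<bullet> b\<bar> \<le> R" using Basis_le_norm[OF b] R[OF inU] order_trans by blast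
              moreover have "0 < w \<bullet> b" "w \<bullet> b < h" using w b by (auto simp: mem_box)
              ultimately have "\<bar>h * of_int \<lfloor>(x \<bullet> b) / h\<rfloor>\<bar> \<le> R + h"
                using b by (simp add: inner_add_left grid_corner_inner)
              then have "\<bar>of_int \<lfloor>(x \<bullet> b) / h\<rfloor>\<bar> \<le> R / h + 1"
                using h by (simp add: abs_mult field_simps)
              then have "\<bar>of_int \<lfloor>(x \<bullet> b) / h\<rfloor>\<bar> \<le> (of_int N :: real)" unfolding N_def by linarith
              then show ?thesis by auto
            qed
            then show False using False by (auto simp: k0_def I_def)
          qed
          ultimately show ?thesis using test_fun_zero_outside(1)[OF \<phi>] by simp
        qed
      qed
      have Lg: "L2_fun ?g" and span: "abs_l2 ?g \<in> span \<Phi>"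
      proof -
        have Lk: "L2_fun (\<lambda>x. \<phi> (corner k + w) *\<^sub>R (indicator (cell k) x :: real))" for k by (intro L2_fun_scaleR L)
        show "L2_fun ?g" unfolding g_eq by (rule abs_l2_sum(1)[OF fI Lk])
        have "abs_l2 ?g = (\<Sum>k\<in>I. abs_l2 (\<lambda>x. \<phi> (corner k + w) *\<^sub>R (indicator (cell k) x :: real)))"
          unfolding g_eq by (rule abs_l2_sum(2)[OF fI Lk, symmetric])
        also have "\<dots> = (\<Sum>k\<in>I. \<phi> (corner k + w) *\<^sub>R v k)" unfolding v_def by (simp add: abs_l2_scaleR[OF L])
        also have "\<dots> \<in> span \<Phi>" using \<Phi>(3) by (intro span_sum span_scale) auto
        finally show "abs_l2 ?g \<in> span \<Phi>" .
      qed
      have "norm ?r \<le> norm (abs_l2 \<phi> - abs_l2 ?g)" by (rule fourier_sum_best_approx[OF \<Phi>(1,2) span])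
      then have "ennreal ((norm ?r)\<^sup>2) \<le> ennreal ((norm (abs_l2 ?g - abs_l2 \<phi>))\<^sup>2)"
        by (intro ennreal_leI power_mono) (auto simp: norm_minus_commute)
      also have "\<dots> = (\<integral>\<^sup>+ x. ennreal ((\<phi> (grid_corner h x + w) - \<phi> x)\<^sup>2) \<partial>lborel)"
        using nn_integral_L2[OF L2_fun_diff[OF Lg L2_fun_test(1)[OF \<phi>]]]
        by (simp add: abs_l2_diff[OF Lg L2_fun_test(1)[OF \<phi>]] nn_integral_completion)
      finally show ?thesis .
    qed
    \<comment> \<open>Integrate over the box of offsets. Its volume \<open>h ^ DIM('a)\<close>
      against \<open>(2 * h) ^ DIM('a)\<close> from the estimate leaves the factor
      \<open>2 ^ DIM('a)\<close>.\<close>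
    have "ennreal (h ^ DIM('a)) * ennreal ((norm ?r)\<^sup>2)
        = (\<integral>\<^sup>+ w. indicator (box 0 (h *\<^sub>R One)) w * ennreal ((norm ?r)\<^sup>2) \<partial>(lborel :: 'a measure))"
      using h by (simp add: nn_integral_multc emeasure_lborel_box_eq)
    also have "\<dots> \<le> (\<integral>\<^sup>+ w. indicator (box 0 (h *\<^sub>R One)) w *
        (\<integral>\<^sup>+ x. ennreal ((\<phi> (grid_corner h x + w) - \<phi> x)\<^sup>2) \<partial>lborel) \<partial>lborel)"
      using step by (intro nn_integral_mono) (auto simp: indicator_def)
    also have "\<dots> \<le> ennreal ((2 * h) ^ DIM('a)) * (ennreal ((real DIM('a) * h)\<^sup>2) * (\<integral>\<^sup>+ x. ennreal ((norm (grad \<phi> x))\<^sup>2) \<partial>lborel))"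
      by (rule grid_sampling_estimate[OF test_fun_smooth[OF \<phi>] h])
    also have "(\<integral>\<^sup>+ x. ennreal ((norm (grad \<phi> x))\<^sup>2) \<partial>lborel) = ennreal ((norm (abs_l2 (grad \<phi>)))\<^sup>2)"
      using nn_integral_L2[OF L2_fun_test(2)[OF \<phi>]] by (simp add: nn_integral_completion)
    finally have "h ^ DIM('a) * (norm ?r)\<^sup>2 \<le> (2 * h) ^ DIM('a) * ((real DIM('a) * h)\<^sup>2 * (norm (abs_l2 (grad \<phi>)))\<^sup>2)"
      using h by (simp add: ennreal_mult[symmetric])
    then have "h ^ DIM('a) * (norm ?r)\<^sup>2 \<le> h ^ DIM('a) * (?C * norm (abs_l2 (grad \<phi>)))\<^sup>2"
      by (simp add: power_mult_distrib algebra_simps)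
    then have "(norm ?r)\<^sup>2 \<le> (?C * norm (abs_l2 (grad \<phi>)))\<^sup>2" using h by simp
    then have "norm ?r \<le> ?C * norm (abs_l2 (grad \<phi>))" by (rule power2_le_imp_le) (use h in simp)
    then show "norm (fst (abs_l2 \<phi>, abs_l2 (grad \<phi>)) - fourier_sum \<Phi> (fst (abs_l2 \<phi>, abs_l2 (grad \<phi>))))
       \<le> ?C * norm (snd (abs_l2 \<phi>, abs_l2 (grad \<phi>)))" by simp
  qed
  then show ?thesis using \<Phi> by (intro exI[of _ \<Phi>]) (auto simp: split_paired_all)
qed

text \<open>The gradient of the solution is bounded by the norm of the right-hand side, so the grid
  approximation with small mesh is uniform on the image of the unit ball.\<close>

lemma compact_dres:
  fixes U :: "'a::euclidean_space set"
  assumes U: "bounded U" shows "compact_op (dres U)"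
proof (rule compact_op_of_finite_rank_approx)
  show "norm (dres U x) \<le> norm x" for x by (rule pos_contraction_norm[OF pos_contraction_dres])
  fix \<epsilon> :: real assume e: "\<epsilon> > 0"
  let ?K = "sqrt (2 ^ DIM('a)) * real DIM('a)"
  have K: "?K > 0" by simp
  define h where "h = \<epsilon> / ?K"
  have h: "h > 0" "?K * h = \<epsilon>" using K e by (auto simp: h_def)
  obtain \<Phi> where \<Phi>: "finite \<Phi>" "orthonormal \<Phi>"
    "\<And>u G. (u, G) \<in> form_space U \<Longrightarrow> norm (u - fourier_sum \<Phi> u) \<le> ?K * h * norm G"
    using grid_approximation[OF U h(1)] by blast
  have "norm (dres U x - fourier_sum \<Phi> (dres U x)) \<le> \<epsilon>" if "norm x \<le> 1" for x
  proof -
    let ?p = "hproj (form_space U) (x, 0)"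
    have "(norm (snd ?p))\<^sup>2 \<le> (norm ?p)\<^sup>2" by (simp add: norm_prod_def)
    also have "\<dots> \<le> (norm x)\<^sup>2"
      using pos_contraction_inner_le[OF pos_contraction_dres, of U x] by (simp add: norm_hproj[OF form_space_props] dres_inner)
    finally have "norm (snd ?p) \<le> norm x" by (rule power2_le_imp_le) simp
    then have le1: "norm (snd ?p) \<le> 1" using that by simp
    have "(dres U x, snd ?p) \<in> form_space U" using hproj_in[OF form_space_props] by (simp add: dres_def)
    from \<Phi>(3)[OF this] have "norm (dres U x - fourier_sum \<Phi> (dres U x)) \<le> \<epsilon> * norm (snd ?p)" by (simp only: h(2))
    also have "\<dots> \<le> \<epsilon> * 1" using le1 e by (intro mult_left_mono) auto
    finally show ?thesis by simp
  qed
  then show "\<exists>\<Phi>. finite \<Phi> \<and> orthonormal \<Phi> \<and> (\<forall>x. norm x \<le> 1 \<longrightarrow> norm (dres U x - fourier_sum \<Phi> (dres U x)) \<le> \<epsilon>)"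
    using \<Phi>(1,2) by blast
qed

section \<open>Opening a thin tube\<close>

text \<open>The sum of two one-sided steps, one rising from \<open>b + s\<close> to
  \<open>b + 2 * s\<close>, the other its mirror image. At every point at least one of them
  vanishes, so the sum stays between 0 and 1.\<close>

lemma strip_cutoff:
  fixes e :: "'a::euclidean_space"
  assumes e: "norm e = 1" and s: "s > 0"
    and D: "\<And>t. (smooth_step has_real_derivative D t) (at t)" "\<And>t. \<bar>D t\<bar> \<le> C"
  obtains \<xi> where "smooth_fun \<xi>" "\<And>x. 0 \<le> \<xi> x \<and> \<xi> x \<le> 1" "\<And>x. \<bar>x \<bullet> e - b\<bar> < s \<Longrightarrow> \<xi> x = 0"
    "\<And>x. \<bar>x \<bullet> e - b\<bar> > 2 * s \<Longrightarrow> \<xi> x = 1 \<and> grad \<xi> x = 0" "\<And>x. norm (grad \<xi> x) \<le> 2 * C / s"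
proof -
  define \<alpha> where "\<alpha> x = smooth_step ((1 / s) *\<^sub>R (x \<bullet> e) + (- b / s - 1))" for x
  define \<beta> where "\<beta> x = smooth_step ((- 1 / s) *\<^sub>R (x \<bullet> e) + (b / s - 1))" for x
  define \<xi> where "\<xi> x = \<alpha> x + \<beta> x" for x
  have \<alpha>: "\<alpha> x = smooth_step ((x \<bullet> e - b) / s - 1)" for x by (simp add: \<alpha>_def diff_divide_distrib algebra_simps)
  have \<beta>: "\<beta> x = smooth_step ((b - x \<bullet> e) / s - 1)" for x by (simp add: \<beta>_def diff_divide_distrib algebra_simps)
  have bl: "bounded_linear (\<lambda>x::'a. c *\<^sub>R (x \<bullet> e))" for c
    by (intro bounded_linear_const_scaleR bounded_linear_inner_left)
  have sm: "smooth_fun \<alpha>" "smooth_fun \<beta>"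
    unfolding \<alpha>_def[abs_def] \<beta>_def[abs_def]
    by (intro smooth_fun_compose_affine[OF bl smooth_smooth_step])+
  have sm\<xi>: "smooth_fun \<xi>" unfolding \<xi>_def[abs_def] by (intro smooth_fun_add sm)
  have \<alpha>0: "\<alpha> x = 0" if "x \<bullet> e - b \<le> s" for x
    using that s by (simp add: \<alpha> smooth_step_0 divide_le_eq)
  have \<beta>0: "\<beta> x = 0" if "b - x \<bullet> e \<le> s" for x
    using that s by (simp add: \<beta> smooth_step_0 divide_le_eq)
  have \<alpha>1: "\<alpha> x = 1" if "x \<bullet> e - b \<ge> 2 * s" for x
  proof -
    have "(x \<bullet> e - b) / s \<ge> 2" using that s by (simp add: le_divide_eq)
    then show ?thesis by (simp add: \<alpha> smooth_step_1)
  qed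
  have \<beta>1: "\<beta> x = 1" if "b - x \<bullet> e \<ge> 2 * s" for x
  proof -
    have "(b - x \<bullet> e) / s \<ge> 2" using that s by (simp add: le_divide_eq)
    then show ?thesis by (simp add: \<beta> smooth_step_1)
  qed
  have one: "\<xi> x = 1" if "\<bar>x \<bullet> e - b\<bar> > 2 * s" for x
  proof (cases "x \<bullet> e - b \<ge> 0")
    case True
    then have "\<alpha> x = 1" "\<beta> x = 0" using that s by (auto intro!: \<alpha>1 \<beta>0)
    then show ?thesis by (simp add: \<xi>_def)
  next
    case False
    then have "\<alpha> x = 0" "\<beta> x = 1" using that s by (auto intro!: \<alpha>0 \<beta>1)
    then show ?thesis by (simp add: \<xi>_def)
  qed
  show ?thesis
  proof (rule that[OF sm\<xi>])
    fix x
    show "0 \<le> \<xi> x \<and> \<xi> x \<le> 1"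
    proof (cases "x \<bullet> e - b \<ge> 0")
      case True
      then have "\<beta> x = 0" using s by (intro \<beta>0) auto
      then show ?thesis using smooth_step_range by (simp add: \<xi>_def \<alpha>)
    next
      case False
      then have "\<alpha> x = 0" using s by (intro \<alpha>0) auto
      then show ?thesis using smooth_step_range by (simp add: \<xi>_def \<beta>)
    qed
    show "\<xi> x = 0" if "\<bar>x \<bullet> e - b\<bar> < s"
      using that \<alpha>0[of x] \<beta>0[of x] by (simp add: \<xi>_def)
    show "\<xi> x = 1 \<and> grad \<xi> x = 0" if x: "\<bar>x \<bullet> e - b\<bar> > 2 * s"
    proof
      have "open {x. \<bar>x \<bullet> e - b\<bar> > 2 * s}" by (intro open_Collect_less continuous_intros)
      then have "grad \<xi> x = grad (\<lambda>_. 1) x" using x one by (intro grad_cong_open) auto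
      also have "\<dots> = 0" by (rule grad_eqI) simp
      finally show "grad \<xi> x = 0" .
    qed (rule one[OF x])
    show "norm (grad \<xi> x) \<le> 2 * C / s"
    proof -
      let ?p = "(1 / s) *\<^sub>R (x \<bullet> e) + (- b / s - 1)" and ?q = "(- 1 / s) *\<^sub>R (x \<bullet> e) + (b / s - 1)"
      let ?k = "(D ?p - D ?q) / s"
      have inner: "((\<lambda>x. c *\<^sub>R (x \<bullet> e) + c') has_derivative (\<lambda>h. c *\<^sub>R (h \<bullet> e))) (at x)" for c c'
        by (auto intro!: derivative_eq_intros)
      have outer: "(smooth_step has_derivative (\<lambda>h. D t * h)) (at t)" for t
        using D(1)[of t] by (simp add: has_field_derivative_def)
      have da: "(\<alpha> has_derivative (\<lambda>h. D ?p * ((1 / s) *\<^sub>R (h \<bullet> e)))) (at x)"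
        unfolding \<alpha>_def[abs_def] by (rule has_derivative_compose[OF inner outer])
      have db: "(\<beta> has_derivative (\<lambda>h. D ?q * ((- 1 / s) *\<^sub>R (h \<bullet> e)))) (at x)"
        unfolding \<beta>_def[abs_def] by (rule has_derivative_compose[OF inner outer])
      have "(\<xi> has_derivative (\<lambda>h. (?k *\<^sub>R e) \<bullet> h)) (at x)"
        unfolding \<xi>_def[abs_def]
        by (rule has_derivative_eq_rhs[OF has_derivative_add[OF da db]])
           (auto simp: inner_commute diff_divide_distrib algebra_simps)
      then have "grad \<xi> x = ?k *\<^sub>R e" by (rule grad_eqI)
      then have "norm (grad \<xi> x) = \<bar>D ?p - D ?q\<bar> / s" using e s by simp
      also have "\<dots> \<le> 2 * C / s"
        using D(2)[of ?p] D(2)[of ?q] s by (intro divide_right_mono) (auto simp: abs_if split: if_splits)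
      finally show ?thesis .
    qed
  qed
qed

text \<open>Multiply a test function by the cutoff of the strip. By the Poincare inequality its mass
  in the strip is at most \<open>2 * M\<close> times its gradient norm. This bounds both the loss in
  the function and, multiplied by the cutoff gradient \<open>2 * C / s\<close>, the growth of the
  gradient.\<close>

lemma tube_cut_estimate:
  fixes e e2 :: "'a::euclidean_space"
  assumes e: "norm e = 1" "norm e2 = 1" "e \<bullet> e2 = 0" and s: "s > 0" and M: "M > 0"
    and D: "\<And>t. (smooth_step has_real_derivative D t) (at t)" "\<And>t. \<bar>D t\<bar> \<le> C" "C > 0"
    and sub: "\<Omega>' \<subseteq> \<Omega>" and cut: "\<And>x. x \<in> \<Omega> \<Longrightarrow> \<bar>x \<bullet> e - b\<bar> \<ge> s \<Longrightarrow> x \<in> \<Omega>'"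
    and width: "\<And>x. x \<in> \<Omega> \<Longrightarrow> \<bar>x \<bullet> e - b\<bar> \<le> 2 * s \<Longrightarrow> \<bar>x \<bullet> e2\<bar> < M"
  shows "norm (dres \<Omega> f - dres \<Omega>' f) \<le> 3 * (2 * M + 8 * (M * C / s) + 16 * (M * C / s)\<^sup>2) * norm f"
proof (rule dres_perturbation[OF sub])
  \<comment> \<open>The product of the cutoff gradient \<open>2 * C / s\<close> and the Poincare
    factor \<open>2 * M\<close>: the relative growth of the gradient norm.\<close>
  define \<tau> where "\<tau> = 4 * M * C / s"
  have \<tau>: "\<tau> > 0" using M D(3) s by (simp add: \<tau>_def)
  \<comment> \<open>Chosen so that \<open>2 * M \<le> c\<close> and
    \<open>(1 + \<tau>)\<^sup>2 \<le> 1 + c\<close>, the two requirements of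
    \<open>dres_perturbation\<close>.\<close>
  define c where "c = 2 * M + 8 * (M * C / s) + 16 * (M * C / s)\<^sup>2"
  have c_eq: "c = 2 * M + 2 * \<tau> + \<tau>\<^sup>2" by (simp add: c_def \<tau>_def power2_eq_square)
  show "0 < c" unfolding c_eq using M \<tau> by (intro add_pos_pos) auto
  fix \<phi> assume \<phi>: "test_fun \<Omega> \<phi>"
  obtain \<xi> where \<xi>: "smooth_fun \<xi>" "\<And>x. 0 \<le> \<xi> x \<and> \<xi> x \<le> 1" "\<And>x. \<bar>x \<bullet> e - b\<bar> < s \<Longrightarrow> \<xi> x = 0"
    "\<And>x. \<bar>x \<bullet> e - b\<bar> > 2 * s \<Longrightarrow> \<xi> x = 1 \<and> grad \<xi> x = 0" "\<And>x. norm (grad \<xi> x) \<le> 2 * C / s"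
    by (rule strip_cutoff[OF e(1) s D(1,2), of b]) blast
  let ?S = "{x. x \<bullet> e \<in> {b - 2 * s..b + 2 * s}}"
  have inS: "x \<in> ?S \<longleftrightarrow> \<bar>x \<bullet> e - b\<bar> \<le> 2 * s" for x by (auto simp: abs_le_iff)
  have "closed ?S" unfolding inS[abs_def] by (auto intro!: closed_Collect_le closed_Collect_conj continuous_intros)
  then have S: "?S \<in> sets lebesgue" by simp
  define \<psi> where "\<psi> x = \<xi> x * \<phi> x" for x
  have "closed {x. s \<le> \<bar>x \<bullet> e - b\<bar>}" by (intro closed_Collect_le continuous_intros)
  moreover have "\<xi> x = 0" if "x \<notin> {x. s \<le> \<bar>x \<bullet> e - b\<bar>}" for x using that by (intro \<xi>(3)) simp
  ultimately have \<psi>: "test_fun \<Omega>' \<psi>" unfolding \<psi>_def[abs_def]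
    by (rule test_fun_mult[OF \<phi> \<xi>(1)]) (use cut in auto)
  note L = L2_fun_test[OF \<phi>] L2_fun_test[OF \<psi>]
  let ?u = "abs_l2 \<phi>" and ?g = "abs_l2 (grad \<phi>)"
  have "norm (restr ?S ?u) \<le> 2 * M * norm (restr ?S ?g)"
    by (rule strip_poincare[OF e(2,3) _ M _ test_in_form_space[OF \<phi>]]) (use width inS in auto)
  also have "\<dots> \<le> 2 * M * norm ?g"
    using M pos_contraction_norm[OF pos_contraction_restr[OF S], of ?g] by simp
  finally have strip: "norm (restr ?S ?u) \<le> 2 * M * norm ?g" .
  have g_le: "norm ?g \<le> norm (?u, ?g)" and u_le: "norm ?u \<le> norm (?u, ?g)"
    by (simp_all add: norm_prod_def real_le_rsqrt)
  have 1: "norm (?u - abs_l2 \<psi>) \<le> c * norm (?u, ?g)"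
  proof -
    have "norm (?u - abs_l2 \<psi>) \<le> 1 * norm (restr ?S ?u)"
      unfolding abs_l2_diff[OF L(1,3)] restr_abs_l2[OF S L(1)]
    proof (rule norm_abs_l2_mono)
      show "L2_fun (\<lambda>x. \<phi> x - \<psi> x)" by (rule L2_fun_diff[OF L(1,3)])
      show "L2_fun (\<lambda>x. indicator ?S x *\<^sub>R \<phi> x)" by (rule L2_fun_indicator[OF S L(1)])
      show "norm (\<phi> x - \<psi> x) \<le> 1 * norm (indicator ?S x *\<^sub>R \<phi> x)" for x
      proof (cases "x \<in> ?S")
        case True
        have "\<phi> x - \<psi> x = (1 - \<xi> x) * \<phi> x" by (simp add: \<psi>_def algebra_simps)
        then have "\<bar>\<phi> x - \<psi> x\<bar> = \<bar>1 - \<xi> x\<bar> * \<bar>\<phi> x\<bar>" by (simp add: abs_mult)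
        also have "\<dots> \<le> 1 * \<bar>\<phi> x\<bar>" using \<xi>(2)[of x] by (intro mult_right_mono) auto
        finally show ?thesis using True by simp
      next
        case False
        then have "\<xi> x = 1" using \<xi>(4)[of x] inS[of x] by auto
        then show ?thesis by (simp add: \<psi>_def)
      qed
    qed simp
    also have "\<dots> \<le> 2 * M * norm (?u, ?g)"
    proof -
      have "2 * M * norm ?g \<le> 2 * M * norm (?u, ?g)" using M g_le by (intro mult_left_mono) auto
      then show ?thesis using strip by linarith
    qed
    also have "\<dots> \<le> c * norm (?u, ?g)" unfolding c_eq using \<tau> by (intro mult_right_mono) auto
    finally show ?thesis .
  qed
  have u2: "norm (abs_l2 \<psi>) \<le> norm ?u"
  proof -
    have "norm (abs_l2 \<psi>) \<le> 1 * norm ?u"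
    proof (rule norm_abs_l2_mono[OF L(3,1)])
      show "norm (\<psi> x) \<le> 1 * norm (\<phi> x)" for x
        using \<xi>(2)[of x] by (simp add: \<psi>_def abs_mult mult_left_le_one_le)
    qed simp
    then show ?thesis by simp
  qed
  have g2: "norm (abs_l2 (grad \<psi>)) \<le> (1 + \<tau>) * norm ?g"
  proof -
    let ?a = "\<lambda>x. \<xi> x *\<^sub>R grad \<phi> x" and ?b = "\<lambda>x. \<phi> x *\<^sub>R grad \<xi> x"
    have gm: "grad \<psi> x = ?a x + ?b x" for x
      unfolding \<psi>_def[abs_def] by (rule grad_mult[OF smooth_fun_differentiable[OF \<xi>(1)] test_fun_differentiable[OF \<phi>]])
    have cont: "continuous_on UNIV \<xi>" "continuous_on UNIV (grad \<xi>)"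
      by (rule smooth_fun_continuous[OF \<xi>(1)], rule continuous_grad[OF \<xi>(1)])
    have bound_b: "norm (?b x) \<le> (2 * C / s) * norm (indicator ?S x *\<^sub>R \<phi> x)" for x
    proof (cases "x \<in> ?S")
      case True
      then show ?thesis using mult_right_mono[OF \<xi>(5)[of x], of "\<bar>\<phi> x\<bar>"] by (simp add: mult.commute)
    next
      case False
      then show ?thesis using \<xi>(4)[of x] inS[of x] by auto
    qed
    have bound_a: "norm (?a x) \<le> 1 * norm (grad \<phi> x)" for x
      using \<xi>(2)[of x] by (simp add: mult_left_le_one_le)
    have mm: "\<xi> \<in> borel_measurable lebesgue" "grad \<xi> \<in> borel_measurable lebesgue"
      "\<phi> \<in> borel_measurable lebesgue" "grad \<phi> \<in> borel_measurable lebesgue"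
      using borel_measurable_continuous_onI[OF cont(1)] borel_measurable_continuous_onI[OF cont(2)] L
      by (auto simp: measurable_completion L2_fun_def)
    have La: "L2_fun ?a"
      by (rule L2_fun_bound[OF borel_measurable_scaleR[OF mm(1,4)] L(2) AE_I2[OF bound_a]])
    have Lb: "L2_fun ?b"
      by (rule L2_fun_bound[OF borel_measurable_scaleR[OF mm(3,2)] L2_fun_indicator[OF S L(1)] AE_I2[OF bound_b]])
    have "abs_l2 (grad \<psi>) = abs_l2 ?a + abs_l2 ?b"
      unfolding abs_l2_add[OF La Lb] by (simp add: gm[abs_def])
    then have "norm (abs_l2 (grad \<psi>)) \<le> norm (abs_l2 ?a) + norm (abs_l2 ?b)" by (simp add: norm_triangle_ineq)
    also have "\<dots> \<le> 1 * norm ?g + (2 * C / s) * norm (restr ?S ?u)"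
      unfolding restr_abs_l2[OF S L(1)]
    proof (rule add_mono)
      show "norm (abs_l2 ?a) \<le> 1 * norm ?g" by (rule norm_abs_l2_mono[OF La L(2) _ bound_a]) simp
      show "norm (abs_l2 ?b) \<le> (2 * C / s) * norm (abs_l2 (\<lambda>x. indicator ?S x *\<^sub>R \<phi> x))"
        by (rule norm_abs_l2_mono[OF Lb L2_fun_indicator[OF S L(1)] _ bound_b]) (use D(3) s in simp)
    qed
    also have "\<dots> \<le> 1 * norm ?g + (2 * C / s) * (2 * M * norm ?g)"
      using D(3) s strip by (intro add_left_mono mult_left_mono) auto
    also have "\<dots> = (1 + \<tau>) * norm ?g" by (simp add: \<tau>_def algebra_simps)
    finally show ?thesis .
  qed
  have 2: "(norm (abs_l2 \<psi>, abs_l2 (grad \<psi>)))\<^sup>2 \<le> (1 + c) * (norm (?u, ?g))\<^sup>2"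
  proof -
    have "(norm (abs_l2 \<psi>, abs_l2 (grad \<psi>)))\<^sup>2 = (norm (abs_l2 \<psi>))\<^sup>2 + (norm (abs_l2 (grad \<psi>)))\<^sup>2"
      by (simp add: norm_prod_def)
    also have "\<dots> \<le> (norm ?u)\<^sup>2 + ((1 + \<tau>) * norm ?g)\<^sup>2"
      using u2 g2 by (intro add_mono power_mono) auto
    also have "\<dots> \<le> (1 + \<tau>)\<^sup>2 * (norm ?u)\<^sup>2 + (1 + \<tau>)\<^sup>2 * (norm ?g)\<^sup>2"
    proof -
      have "1 \<le> (1 + \<tau>)\<^sup>2" using \<tau> by (simp add: one_le_power)
      then have "1 * (norm ?u)\<^sup>2 \<le> (1 + \<tau>)\<^sup>2 * (norm ?u)\<^sup>2" by (intro mult_right_mono) auto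
      then show ?thesis by (simp add: power_mult_distrib)
    qed
    also have "\<dots> = (1 + \<tau>)\<^sup>2 * (norm (?u, ?g))\<^sup>2" by (simp add: norm_prod_def distrib_left)
    also have "\<dots> \<le> (1 + c) * (norm (?u, ?g))\<^sup>2"
      using M by (intro mult_right_mono) (auto simp: c_eq power2_eq_square algebra_simps)
    finally show ?thesis .
  qed
  show "\<exists>\<psi>. test_fun \<Omega>' \<psi> \<and>
      norm (?u - abs_l2 \<psi>) \<le> (2 * M + 8 * (M * C / s) + 16 * (M * C / s)\<^sup>2) * norm (?u, ?g) \<and>
      (norm (abs_l2 \<psi>, abs_l2 (grad \<psi>)))\<^sup>2 \<le> (1 + (2 * M + 8 * (M * C / s) + 16 * (M * C / s)\<^sup>2)) * (norm (?u, ?g))\<^sup>2"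
    using \<psi> 1 2 unfolding c_def by blast
qed

section \<open>Similarities\<close>

definition similarity :: "real \<Rightarrow> 'a::euclidean_space \<Rightarrow> 'a \<Rightarrow> 'a" where
  "similarity r p x = p + r *\<^sub>R x"

lemma similarity_inverse:
  assumes "r > 0"
  shows "similarity r p (similarity (1 / r) (- ((1 / r) *\<^sub>R p)) y) = y"
    "similarity (1 / r) (- ((1 / r) *\<^sub>R p)) (similarity r p x) = x"
  using assms by (auto simp: similarity_def algebra_simps)

lemma similarity_affine: "similarity r p = (\<lambda>x. p + (\<Sum>j\<in>Basis. (r * (x \<bullet> j)) *\<^sub>R j))"
proof
  fix x :: 'a
  have "(\<Sum>j\<in>Basis. (r * (x \<bullet> j)) *\<^sub>R j) = r *\<^sub>R (\<Sum>j\<in>Basis. (x \<bullet> j) *\<^sub>R j)"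
    by (simp add: scaleR_sum_right)
  then show "similarity r p x = p + (\<Sum>j\<in>Basis. (r * (x \<bullet> j)) *\<^sub>R j)"
    by (simp add: similarity_def euclidean_representation)
qed

context
  fixes r :: real and p :: "'a::euclidean_space"
  assumes r: "r > 0"
begin

lemma measurable_similarity: "similarity r p \<in> lebesgue \<rightarrow>\<^sub>M lebesgue"
  unfolding similarity_affine using lebesgue_affine_measurable[of "\<lambda>_. r" p] r by simp

lemma lebesgue_similarity: "lebesgue = density (distr lebesgue lebesgue (similarity r p)) (\<lambda>_. ennreal (r ^ DIM('a)))"
  using lebesgue_affine_euclidean[of "\<lambda>_. r" p] r unfolding similarity_affine by simp

lemma measurable_compose_similarity:
  "f \<in> borel_measurable lebesgue \<Longrightarrow> (\<lambda>x. f (similarity r p x)) \<in> borel_measurable lebesgue"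
  by (rule measurable_compose[OF measurable_similarity])

lemma nn_integral_similarity:
  assumes "f \<in> borel_measurable lebesgue"
  shows "(\<integral>\<^sup>+ y. f y \<partial>lebesgue) = ennreal (r ^ DIM('a)) * (\<integral>\<^sup>+ x. f (similarity r p x) \<partial>lebesgue)"
proof -
  have "(\<integral>\<^sup>+ y. f y \<partial>lebesgue) = (\<integral>\<^sup>+ y. ennreal (r ^ DIM('a)) * f y \<partial>distr lebesgue lebesgue (similarity r p))"
    by (subst lebesgue_similarity, rule nn_integral_density)
       (auto simp: assms measurable_cong_sets[OF sets_distr refl])
  also have "\<dots> = ennreal (r ^ DIM('a)) * (\<integral>\<^sup>+ y. f y \<partial>distr lebesgue lebesgue (similarity r p))"
    by (rule nn_integral_cmult) (subst measurable_cong_sets[OF sets_distr refl], rule assms)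
  also have "(\<integral>\<^sup>+ y. f y \<partial>distr lebesgue lebesgue (similarity r p)) = (\<integral>\<^sup>+ x. f (similarity r p x) \<partial>lebesgue)"
    by (rule nn_integral_distr[OF measurable_similarity]) (simp add: assms measurable_cong_sets[OF sets_distr refl])
  finally show ?thesis .
qed

lemma integral_similarity:
  fixes f :: "'a \<Rightarrow> real"
  assumes "f \<in> borel_measurable lebesgue"
  shows "(\<integral> y. f y \<partial>lebesgue) = r ^ DIM('a) * (\<integral> x. f (similarity r p x) \<partial>lebesgue)"
proof -
  have "(\<integral> y. f y \<partial>lebesgue) = (\<integral> y. r ^ DIM('a) *\<^sub>R f y \<partial>distr lebesgue lebesgue (similarity r p))"
    using assms r by (subst lebesgue_similarity, intro integral_density)
       (auto simp: measurable_cong_sets[OF sets_distr refl])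
  also have "\<dots> = (\<integral> x. r ^ DIM('a) *\<^sub>R f (similarity r p x) \<partial>lebesgue)"
    using assms by (intro integral_distr measurable_similarity) simp
  finally show ?thesis by simp
qed

lemma L2_dist2_similarity:
  assumes "f \<in> borel_measurable lebesgue" "g \<in> borel_measurable lebesgue"
  shows "L2_dist2 f (g :: 'a \<Rightarrow> 'b::euclidean_space)
    = ennreal (r ^ DIM('a)) * L2_dist2 (\<lambda>x. f (similarity r p x)) (\<lambda>x. g (similarity r p x))"
  unfolding L2_dist2_def using assms by (subst nn_integral_similarity) auto

lemma smooth_fun_similarity: "smooth_fun \<phi> \<Longrightarrow> smooth_fun (\<lambda>x. \<phi> (similarity r p x))"
  using smooth_fun_compose_affine[of "\<lambda>x. r *\<^sub>R x" \<phi> p] bounded_linear_scaleR_right[of r]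
  by (simp add: similarity_def add.commute)

lemma grad_similarity:
  assumes "smooth_fun \<phi>" shows "grad (\<lambda>x. \<phi> (similarity r p x)) x = r *\<^sub>R grad \<phi> (similarity r p x)"
proof (rule grad_eqI)
  have "(similarity r p has_derivative (\<lambda>h. r *\<^sub>R h)) (at x)"
    unfolding similarity_def[abs_def] by (auto intro!: derivative_eq_intros)
  from has_derivative_compose[OF this has_derivative_grad[OF smooth_fun_differentiable[OF assms]]]
  show "((\<lambda>x. \<phi> (similarity r p x)) has_derivative (\<lambda>h. (r *\<^sub>R grad \<phi> (similarity r p x)) \<bullet> h)) (at x)" by simp
qed

lemma test_fun_similarity:
  assumes "test_fun (similarity r p ` \<Omega>) \<phi>" shows "test_fun \<Omega> (\<lambda>x. \<phi> (similarity r p x))"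
proof -
  obtain K where K: "smooth_fun \<phi>" "compact K" "K \<subseteq> similarity r p ` \<Omega>" "\<And>x. x \<notin> K \<Longrightarrow> \<phi> x = 0"
    using assms by (auto simp: test_fun_def)
  let ?T = "similarity (1 / r) (- ((1 / r) *\<^sub>R p))"
  have "compact (?T ` K)" unfolding similarity_def[abs_def]
    by (intro compact_continuous_image continuous_intros K)
  moreover have "?T ` K \<subseteq> \<Omega>"
  proof
    fix y assume "y \<in> ?T ` K"
    then obtain x where "x \<in> \<Omega>" "y = ?T (similarity r p x)" using K(3) by blast
    then show "y \<in> \<Omega>" using similarity_inverse(2)[OF r, of p x] by simp
  qed
  moreover have "\<phi> (similarity r p x) = 0" if "x \<notin> ?T ` K" for x
  proof (rule K(4))
    show "similarity r p x \<notin> K" using that similarity_inverse(2)[OF r, of p x] by (metis imageI)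
  qed
  ultimately show ?thesis unfolding test_fun_def using smooth_fun_similarity[OF K(1)] by blast
qed

lemma H10_similarity:
  assumes "(u, G) \<in> H10 (similarity r p ` \<Omega>)"
  shows "((\<lambda>x. u (similarity r p x)), (\<lambda>x. r *\<^sub>R G (similarity r p x))) \<in> H10 \<Omega>"
proof -
  let ?T = "similarity r p"
  obtain \<phi> where m: "u \<in> borel_measurable lebesgue" "G \<in> borel_measurable lebesgue"
    and \<phi>: "\<And>n. test_fun (?T ` \<Omega>) (\<phi> n)" "(\<lambda>n. L2_dist2 (\<phi> n) u) \<longlonglongrightarrow> 0" "(\<lambda>n. L2_dist2 (grad (\<phi> n)) G) \<longlonglongrightarrow> 0"
    using assms by (auto simp: H10_def)
  have mt: "\<phi> n \<in> borel_measurable lebesgue" "grad (\<phi> n) \<in> borel_measurable lebesgue" for n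
    using L2_fun_test[OF \<phi>(1)[of n]] by (auto simp: L2_fun_def)
  have scale: "L2_dist2 (\<lambda>x. f (?T x)) (\<lambda>x. g (?T x)) = ennreal (1 / r ^ DIM('a)) * L2_dist2 f g"
    if "f \<in> borel_measurable lebesgue" "g \<in> borel_measurable lebesgue" for f g :: "'a \<Rightarrow> 'b::euclidean_space"
  proof -
    have "ennreal (1 / r ^ DIM('a)) * ennreal (r ^ DIM('a)) = 1" using r by (simp add: ennreal_mult[symmetric])
    then show ?thesis unfolding L2_dist2_similarity[OF that] by (simp add: mult.assoc[symmetric])
  qed
  have lim0: "(\<lambda>n. ennreal c * a n) \<longlonglongrightarrow> 0" if "a \<longlonglongrightarrow> 0" for c and a :: "nat \<Rightarrow> ennreal"
    using ennreal_tendsto_cmult[OF _ that, of "ennreal c"] by simp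
  have 1: "(\<lambda>n. L2_dist2 (\<lambda>x. \<phi> n (?T x)) (\<lambda>x. u (?T x))) \<longlonglongrightarrow> 0"
    using lim0[OF \<phi>(2)] scale[OF mt(1) m(1)] by simp
  have 2: "(\<lambda>n. L2_dist2 (grad (\<lambda>x. \<phi> n (?T x))) (\<lambda>x. r *\<^sub>R G (?T x))) \<longlonglongrightarrow> 0"
  proof -
    have "L2_dist2 (grad (\<lambda>x. \<phi> n (?T x))) (\<lambda>x. r *\<^sub>R G (?T x))
       = ennreal (r\<^sup>2) * L2_dist2 (\<lambda>x. grad (\<phi> n) (?T x)) (\<lambda>x. G (?T x))" for n
    proof -
      have "L2_dist2 (grad (\<lambda>x. \<phi> n (?T x))) (\<lambda>x. r *\<^sub>R G (?T x))
          = (\<integral>\<^sup>+ x. ennreal (r\<^sup>2) * ennreal ((norm (grad (\<phi> n) (?T x) - G (?T x)))\<^sup>2) \<partial>lebesgue)"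
        unfolding L2_dist2_def grad_similarity[OF test_fun_smooth[OF \<phi>(1)]]
        by (simp add: scaleR_diff_right[symmetric] power_mult_distrib ennreal_mult)
      also have "\<dots> = ennreal (r\<^sup>2) * L2_dist2 (\<lambda>x. grad (\<phi> n) (?T x)) (\<lambda>x. G (?T x))"
        unfolding L2_dist2_def
        using measurable_compose_similarity[OF mt(2)[of n]] measurable_compose_similarity[OF m(2)]
        by (intro nn_integral_cmult) measurable
      finally show ?thesis .
    qed
    then show ?thesis using lim0[OF lim0[OF \<phi>(3)]] scale[OF mt(2) m(2)] by simp
  qed
  show ?thesis unfolding H10_def
    using 1 2 test_fun_similarity[OF \<phi>(1)] measurable_compose_similarity[OF m(1)] measurable_compose_similarity[OF m(2)]
    by (auto intro!: exI[of _ "\<lambda>n x. \<phi> n (?T x)"])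
qed

end

lemma H10_similarity_back:
  fixes p :: "'a::euclidean_space"
  assumes r: "r > 0" and "(u, G) \<in> H10 \<Omega>"
  defines "S \<equiv> similarity (1 / r) (- ((1 / r) *\<^sub>R p))"
  shows "((\<lambda>y. u (S y)), (\<lambda>y. (1 / r) *\<^sub>R G (S y))) \<in> H10 (similarity r p ` \<Omega>)"
proof -
  have "S ` similarity r p ` \<Omega> = \<Omega>"
    unfolding S_def image_image by (simp add: similarity_inverse(2)[OF r])
  then show ?thesis using H10_similarity[of "1 / r" u G "- ((1 / r) *\<^sub>R p)" "similarity r p ` \<Omega>"] assms by (simp add: S_def)
qed

text \<open>Under dilation by \<open>r\<close> the gradient form gains \<open>r\<^sup>2\<close>
  relative to the mass. This provides both the passage to an arbitrary eigenvalue at the end and the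
  comparison of rooms of different lengths.\<close>

lemma dirichlet_point_spectrum_similarity:
  fixes p :: "'a::euclidean_space"
  assumes r: "r > 0" and lam: "lam \<in> dirichlet_point_spectrum \<Omega>"
  shows "lam / r\<^sup>2 \<in> dirichlet_point_spectrum (similarity r p ` \<Omega>)"
proof -
  let ?T = "similarity r p" and ?S = "similarity (1 / r) (- ((1 / r) *\<^sub>R p))"
  obtain u G where u: "(u, G) \<in> H10 \<Omega>" "(\<integral>\<^sup>+ x. ennreal ((u x)\<^sup>2) \<partial>lebesgue) > 0"
    "\<And>v H. (v, H) \<in> H10 \<Omega> \<Longrightarrow> (\<integral> x. G x \<bullet> H x \<partial>lebesgue) = lam * (\<integral> x. u x * v x \<partial>lebesgue)"
    using lam by (auto simp: dirichlet_point_spectrum_def)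
  let ?u = "\<lambda>y. u (?S y)" and ?G = "\<lambda>y. (1 / r) *\<^sub>R G (?S y)"
  have H: "(?u, ?G) \<in> H10 (?T ` \<Omega>)" by (rule H10_similarity_back[OF r u(1)])
  then have m: "?u \<in> borel_measurable lebesgue" "?G \<in> borel_measurable lebesgue" by (auto simp: H10_def)
  note inv = similarity_inverse(2)[OF r, of p]
  have "(\<integral>\<^sup>+ y. ennreal ((?u y)\<^sup>2) \<partial>lebesgue) = ennreal (r ^ DIM('a)) * (\<integral>\<^sup>+ x. ennreal ((u x)\<^sup>2) \<partial>lebesgue)"
    using nn_integral_similarity[OF r, of "\<lambda>y. ennreal ((?u y)\<^sup>2)" p] m by (simp add: inv)
  then have pos: "(\<integral>\<^sup>+ y. ennreal ((?u y)\<^sup>2) \<partial>lebesgue) > 0"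
    using u(2) r by (simp add: ennreal_zero_less_mult_iff)
  have "(\<integral> y. ?G y \<bullet> H y \<partial>lebesgue) = lam / r\<^sup>2 * (\<integral> y. ?u y * v y \<partial>lebesgue)"
    if vH: "(v, H) \<in> H10 (?T ` \<Omega>)" for v H
  proof -
    have mv: "v \<in> borel_measurable lebesgue" "H \<in> borel_measurable lebesgue" using vH by (auto simp: H10_def)
    have "(\<integral> x. G x \<bullet> (r *\<^sub>R H (?T x)) \<partial>lebesgue) = lam * (\<integral> x. u x * v (?T x) \<partial>lebesgue)"
      using u(3)[OF H10_similarity[OF r vH]] .
    then have eq: "r * (\<integral> x. G x \<bullet> H (?T x) \<partial>lebesgue) = lam * (\<integral> x. u x * v (?T x) \<partial>lebesgue)" by simp
    have "(\<integral> y. ?G y \<bullet> H y \<partial>lebesgue) = r ^ DIM('a) * (\<integral> x. (1 / r) *\<^sub>R G x \<bullet> H (?T x) \<partial>lebesgue)"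
      using integral_similarity[OF r borel_measurable_inner[OF m(2) mv(2)], of p] by (simp only: inv)
    also have "\<dots> = r ^ DIM('a) / r\<^sup>2 * (r * (\<integral> x. G x \<bullet> H (?T x) \<partial>lebesgue))"
      using r by (simp add: power2_eq_square)
    also have "\<dots> = lam / r\<^sup>2 * (r ^ DIM('a) * (\<integral> x. u x * v (?T x) \<partial>lebesgue))" unfolding eq by simp
    also have "r ^ DIM('a) * (\<integral> x. u x * v (?T x) \<partial>lebesgue) = (\<integral> y. ?u y * v y \<partial>lebesgue)"
      using integral_similarity[OF r, of "\<lambda>y. ?u y * v y" p] m mv by (simp add: inv)
    finally show ?thesis .
  qed
  then show ?thesis unfolding dirichlet_point_spectrum_def using H pos by blast
qed

text \<open>The dilation, normalized to be unitary, conjugates the two operators up to the factor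
  \<open>r\<^sup>2\<close>. A spectral measure is therefore pushed forward by multiplication with
  \<open>r\<^sup>2\<close>, which preserves absolute continuity.\<close>

lemma dirichlet_ac_spectrum_empty_similarity:
  fixes p :: "'a::euclidean_space"
  assumes r: "r > 0" and empty: "dirichlet_ac_spectrum_empty \<Omega>"
  shows "dirichlet_ac_spectrum_empty (similarity r p ` \<Omega>)"
  unfolding dirichlet_ac_spectrum_empty_def
proof
  let ?T = "similarity r p" and ?S = "similarity (1 / r) (- ((1 / r) *\<^sub>R p))"
  note inv = similarity_inverse(2)[OF r, of p]
  fix f assume "f \<in> ac_subspace (?T ` \<Omega>)"
  then obtain \<mu> where f: "f \<in> L2_on (?T ` \<Omega>)" and \<mu>: "is_spectral_measure (?T ` \<Omega>) f \<mu>" "absolutely_continuous lborel \<mu>"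
    by (auto simp: ac_subspace_def)
  have fm: "f \<in> borel_measurable lebesgue" using f by (simp add: L2_on_def)
  have \<mu>': "sets \<mu> = sets borel" "finite_measure \<mu>" "emeasure \<mu> {..<0} = 0"
    "\<And>s w. s > 0 \<Longrightarrow> dirichlet_resolvent (?T ` \<Omega>) s f w \<Longrightarrow> (\<integral> x. w x * f x \<partial>lebesgue) = (\<integral> t. 1 / (t + s) \<partial>\<mu>)"
    using \<mu>(1) by (auto simp: is_spectral_measure_def)
  \<comment> \<open>The square root of the Jacobian, which makes the map from \<open>f\<close> to
    \<open>g\<close> norm preserving.\<close>
  define c where "c = sqrt (r ^ DIM('a))"
  have c: "c > 0" "c * c = r ^ DIM('a)" using r by (auto simp: c_def)
  define g where "g x = c * f (?T x)" for x
  have gm: "g \<in> borel_measurable lebesgue"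
    unfolding g_def[abs_def] using measurable_compose_similarity[OF r fm] by simp
  have eqfg: "(\<integral>\<^sup>+ y. ennreal ((f y)\<^sup>2) \<partial>lebesgue) = (\<integral>\<^sup>+ x. ennreal ((g x)\<^sup>2) \<partial>lebesgue)"
  proof -
    have "(\<integral>\<^sup>+ x. ennreal ((g x)\<^sup>2) \<partial>lebesgue) = (\<integral>\<^sup>+ x. ennreal (r ^ DIM('a)) * ennreal ((f (?T x))\<^sup>2) \<partial>lebesgue)"
      using c r by (simp add: g_def power_mult_distrib power2_eq_square[of c] ennreal_mult)
    also have "\<dots> = ennreal (r ^ DIM('a)) * (\<integral>\<^sup>+ x. ennreal ((f (?T x))\<^sup>2) \<partial>lebesgue)"
      using measurable_compose_similarity[OF r fm] by (intro nn_integral_cmult) simp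
    also have "\<dots> = (\<integral>\<^sup>+ y. ennreal ((f y)\<^sup>2) \<partial>lebesgue)"
      using nn_integral_similarity[OF r, of "\<lambda>y. ennreal ((f y)\<^sup>2)" p] fm by simp
    finally show ?thesis by simp
  qed
  have gL: "g \<in> L2_on \<Omega>"
    unfolding L2_on_def
  proof (intro CollectI conjI allI impI)
    show "(\<integral>\<^sup>+ x. ennreal ((g x)\<^sup>2) \<partial>lebesgue) < \<infinity>" using f eqfg by (simp add: L2_on_def)
    show "g x = 0" if "x \<notin> \<Omega>" for x
    proof -
      have "?T x \<notin> ?T ` \<Omega>"
      proof
        assume "?T x \<in> ?T ` \<Omega>"
        then obtain y where "?T x = ?T y" "y \<in> \<Omega>" by (rule imageE)
        moreover from this have "x = y" using r by (simp add: similarity_def)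
        ultimately show False using that by simp
      qed
      then show ?thesis using f by (simp add: L2_on_def g_def)
    qed
  qed (rule gm)
  define \<nu> where "\<nu> = distr \<mu> borel (\<lambda>t. r\<^sup>2 * t)"
  have mt: "(\<lambda>t. r\<^sup>2 * t) \<in> \<mu> \<rightarrow>\<^sub>M borel" unfolding measurable_cong_sets[OF \<mu>'(1) refl] by measurable
  have sp: "space \<mu> = UNIV" using sets_eq_imp_space_eq[OF \<mu>'(1)] by simp
  have "is_spectral_measure \<Omega> g \<nu>"
    unfolding is_spectral_measure_def
  proof (intro conjI allI impI)
    show "sets \<nu> = sets borel" by (simp add: \<nu>_def)
    show "finite_measure \<nu>" unfolding \<nu>_def by (rule finite_measure.finite_measure_distr[OF \<mu>'(2) mt])
    have "(\<lambda>t. r\<^sup>2 * t) -` {..<0} \<inter> space \<mu> = {..<0}" using r sp by (auto simp: mult_less_0_iff)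
    then show "emeasure \<nu> {..<0} = 0" unfolding \<nu>_def by (subst emeasure_distr[OF mt]) (auto simp: \<mu>'(3))
    fix s :: real and w assume s: "s > 0" and w: "dirichlet_resolvent \<Omega> s g w"
    obtain Gw where Gw: "(w, Gw) \<in> H10 \<Omega>"
      "\<And>v H. (v, H) \<in> H10 \<Omega> \<Longrightarrow> (\<integral> x. Gw x \<bullet> H x \<partial>lebesgue) + s * (\<integral> x. w x * v x \<partial>lebesgue) = (\<integral> x. g x * v x \<partial>lebesgue)"
      using w by (auto simp: dirichlet_resolvent_def)
    \<comment> \<open>The resolvent at \<open>-s\<close> on \<Omega> corresponds to the resolvent at
      \<open>-s/r\<^sup>2\<close> on the dilated set, larger by the factor \<open>r\<^sup>2\<close>;
      dividing by \<open>c\<close> undoes the normalization of \<open>g\<close>.\<close>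
    let ?k = "r\<^sup>2 / c"
    let ?w = "\<lambda>y. ?k * w (?S y)" and ?G = "\<lambda>y. ?k *\<^sub>R (1 / r) *\<^sub>R Gw (?S y)"
    have hback: "((\<lambda>y. w (?S y)), (\<lambda>y. (1 / r) *\<^sub>R Gw (?S y))) \<in> H10 (?T ` \<Omega>)" by (rule H10_similarity_back[OF r Gw(1)])
    then have HW: "(?w, ?G) \<in> H10 (?T ` \<Omega>)"
      unfolding H10_iff
      using subspace_scale[OF subspace_form_space, of "(abs_l2 (\<lambda>y. w (?S y)), abs_l2 (\<lambda>y. (1 / r) *\<^sub>R Gw (?S y)))" "?T ` \<Omega>" ?k]
        L2_fun_scaleR[of "\<lambda>y. w (?S y)" ?k] L2_fun_scaleR[of "\<lambda>y. (1 / r) *\<^sub>R Gw (?S y)" ?k]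
      by (simp add: abs_l2_scaleR)
    have wm: "w \<in> borel_measurable lebesgue" "Gw \<in> borel_measurable lebesgue" using Gw(1) by (auto simp: H10_def)
    have wm': "?w \<in> borel_measurable lebesgue" "?G \<in> borel_measurable lebesgue" using HW by (auto simp: H10_def)
    have "dirichlet_resolvent (?T ` \<Omega>) (s / r\<^sup>2) f ?w"
      unfolding dirichlet_resolvent_def
    proof (intro exI[of _ ?G] conjI allI impI HW)
      fix v H assume vH: "(v, H) \<in> H10 (?T ` \<Omega>)"
      then have mv: "v \<in> borel_measurable lebesgue" "H \<in> borel_measurable lebesgue" by (auto simp: H10_def)
      have 0: "r * (\<integral> x. Gw x \<bullet> H (?T x) \<partial>lebesgue) + s * (\<integral> x. w x * v (?T x) \<partial>lebesgue) = c * (\<integral> x. f (?T x) * v (?T x) \<partial>lebesgue)"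
        using Gw(2)[OF H10_similarity[OF r vH]] by (simp add: g_def mult.assoc)
      have 1: "(\<integral> y. ?G y \<bullet> H y \<partial>lebesgue) = r ^ DIM('a) * ((?k / r) * (\<integral> x. Gw x \<bullet> H (?T x) \<partial>lebesgue))"
        using integral_similarity[OF r borel_measurable_inner[OF wm'(2) mv(2)], of p] by (simp add: inv)
      have 2: "(\<integral> y. ?w y * v y \<partial>lebesgue) = r ^ DIM('a) * (?k * (\<integral> x. w x * v (?T x) \<partial>lebesgue))"
        using integral_similarity[OF r borel_measurable_times[OF wm'(1) mv(1)], of p] by (simp add: inv mult.assoc)
      have 3: "(\<integral> y. f y * v y \<partial>lebesgue) = r ^ DIM('a) * (\<integral> x. f (?T x) * v (?T x) \<partial>lebesgue)"
        using integral_similarity[OF r, of "\<lambda>y. f y * v y" p] fm mv by simp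
      have "(\<integral> y. ?G y \<bullet> H y \<partial>lebesgue) + s / r\<^sup>2 * (\<integral> y. ?w y * v y \<partial>lebesgue)
          = r ^ DIM('a) / c * (r * (\<integral> x. Gw x \<bullet> H (?T x) \<partial>lebesgue) + s * (\<integral> x. w x * v (?T x) \<partial>lebesgue))"
        unfolding 1 2 using r c(1) by (simp add: field_simps power2_eq_square)
      also have "\<dots> = (\<integral> y. f y * v y \<partial>lebesgue)" unfolding 0 3 using c(1) by simp
      finally show "(\<integral> y. ?G y \<bullet> H y \<partial>lebesgue) + s / r\<^sup>2 * (\<integral> y. ?w y * v y \<partial>lebesgue) = (\<integral> y. f y * v y \<partial>lebesgue)" .
    qed
    then have "(\<integral> y. ?w y * f y \<partial>lebesgue) = (\<integral> t. 1 / (t + s / r\<^sup>2) \<partial>\<mu>)" using s r by (intro \<mu>'(4)) auto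
    moreover have "(\<integral> y. ?w y * f y \<partial>lebesgue) = r\<^sup>2 * (\<integral> x. w x * g x \<partial>lebesgue)"
    proof -
      have "(\<integral> y. ?w y * f y \<partial>lebesgue) = r ^ DIM('a) * (?k * (\<integral> x. w x * f (?T x) \<partial>lebesgue))"
        using integral_similarity[OF r borel_measurable_times[OF wm'(1) fm], of p] by (simp add: inv mult.assoc)
      moreover have "(\<integral> x. w x * g x \<partial>lebesgue) = c * (\<integral> x. w x * f (?T x) \<partial>lebesgue)"
        unfolding g_def by (simp add: mult.left_commute)
      moreover have "r ^ DIM('a) * (?k * I) = r\<^sup>2 * (c * I)" for I
        unfolding c(2)[symmetric] using c(1) by simp
      ultimately show ?thesis by (simp only:)
    qed
    moreover have "(\<integral> t. 1 / (t + s / r\<^sup>2) \<partial>\<mu>) = r\<^sup>2 * (\<integral> t. 1 / (r\<^sup>2 * t + s) \<partial>\<mu>)"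
    proof -
      have "1 / (t + s / r\<^sup>2) = r\<^sup>2 * (1 / (r\<^sup>2 * t + s))" for t
      proof -
        have "r\<^sup>2 * t + s = r\<^sup>2 * (t + s / r\<^sup>2)" using r by (simp add: field_simps)
        then show ?thesis using r by simp
      qed
      then show ?thesis by (simp only: integral_mult_right_zero)
    qed
    ultimately have "(\<integral> x. w x * g x \<partial>lebesgue) = (\<integral> t. 1 / (r\<^sup>2 * t + s) \<partial>\<mu>)" using r by simp
    also have "\<dots> = (\<integral> t. 1 / (t + s) \<partial>\<nu>)"
      unfolding \<nu>_def by (subst integral_distr[OF mt]) auto
    finally show "(\<integral> x. w x * g x \<partial>lebesgue) = (\<integral> t. 1 / (t + s) \<partial>\<nu>)" .
  qed
  moreover have "absolutely_continuous lborel \<nu>"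
    unfolding absolutely_continuous_def
  proof
    fix N assume N: "N \<in> null_sets (lborel :: real measure)"
    \<comment> \<open>The preimage under scaling is the image under the inverse scaling, a
      differentiable map, so it is again a null set.\<close>
    let ?P = "(\<lambda>t. r\<^sup>2 * t) -` N"
    have "(\<lambda>t. t / r\<^sup>2) ` N = ?P" using r by (auto simp: image_iff field_simps intro!: bexI)
    moreover have "negligible N" using N by (simp add: negligible_iff_null_sets null_sets_completionI)
    then have "negligible ((\<lambda>t. t / r\<^sup>2) ` N)"
      by (rule negligible_differentiable_image_negligible[OF order_refl])
         (use r in \<open>auto simp: differentiable_on_def intro!: derivative_intros\<close>)
    ultimately have "negligible ?P" by simp
    moreover have Pm: "?P \<in> sets borel"
      using N by (intro measurable_sets_borel[of "\<lambda>t. r\<^sup>2 * t" borel N]) auto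
    ultimately have "?P \<in> null_sets lborel" by (simp add: negligible_iff_null_sets null_sets_completion_iff)
    then have "?P \<in> null_sets \<mu>" using \<mu>(2) by (auto simp: absolutely_continuous_def)
    then show "N \<in> null_sets \<nu>"
      using N mt sp by (auto simp: \<nu>_def null_sets_distr_iff)
  qed
  ultimately have "AE x in lebesgue. g x = 0"
    using empty gL by (auto simp: dirichlet_ac_spectrum_empty_def ac_subspace_def)
  then have "(\<integral>\<^sup>+ x. ennreal ((g x)\<^sup>2) \<partial>lebesgue) = 0"
    using gm by (subst nn_integral_0_iff_AE) auto
  then have "(\<integral>\<^sup>+ y. ennreal ((f y)\<^sup>2) \<partial>lebesgue) = 0" using eqfg by simp
  then show "AE y in lebesgue. f y = 0" using fm by (subst (asm) nn_integral_0_iff_AE) auto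
qed

section \<open>Density of test functions\<close>

text \<open>An explicit family of bumps on a box: as \<open>k\<close> grows, each factor inside the
  box tends to 1. The explicit formula lets the limit be read off, and the bound by 1 serves as
  domination.\<close>

lemma test_fun_box_bump:
  fixes c d :: "'a::euclidean_space"
  assumes "cbox c d \<subseteq> \<Omega>" "k > 0"
  defines "\<phi> \<equiv> \<lambda>x. \<Prod>i\<in>Basis. flat_exp (k *\<^sub>R (x \<bullet> i) + (- k * (c \<bullet> i))) * flat_exp ((- k) *\<^sub>R (x \<bullet> i) + k * (d \<bullet> i))"
  shows "test_fun \<Omega> \<phi>" "\<And>x. 0 \<le> \<phi> x \<and> \<phi> x \<le> 1" "\<And>x. x \<notin> box c d \<Longrightarrow> \<phi> x = 0"
    "\<And>x. x \<in> box c d \<Longrightarrow> \<phi> x = (\<Prod>i\<in>Basis. exp (- inverse (k * (x \<bullet> i - c \<bullet> i))) * exp (- inverse (k * (d \<bullet> i - x \<bullet> i))))"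
proof -
  have arg: "k *\<^sub>R (x \<bullet> i) + (- k * (c \<bullet> i)) = k * (x \<bullet> i - c \<bullet> i)" "(- k) *\<^sub>R (x \<bullet> i) + k * (d \<bullet> i) = k * (d \<bullet> i - x \<bullet> i)" for x i :: 'a
    by (auto simp: algebra_simps)
  have bl: "bounded_linear (\<lambda>x::'a. a *\<^sub>R (x \<bullet> i))" for a i
    by (intro bounded_linear_const_scaleR bounded_linear_inner_left)
  have sm: "smooth_fun \<phi>" unfolding \<phi>_def
    by (intro smooth_fun_prod smooth_fun_mult smooth_fun_compose_affine[OF bl smooth_flat_exp])
  show out: "\<phi> x = 0" if "x \<notin> box c d" for x
  proof -
    obtain i where i: "i \<in> Basis" "x \<bullet> i \<le> c \<bullet> i \<or> d \<bullet> i \<le> x \<bullet> i" using \<open>x \<notin> box c d\<close> by (force simp: mem_box)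
    then have "flat_exp (k * (x \<bullet> i - c \<bullet> i)) * flat_exp (k * (d \<bullet> i - x \<bullet> i)) = 0"
      using assms(2) by (auto simp: flat_exp_zero mult_nonneg_nonpos)
    then show ?thesis unfolding \<phi>_def arg using i(1) by (intro prod_zero) auto
  qed
  have "\<phi> x = 0" if "x \<notin> cbox c d" for x
    using that box_subset_cbox[of c d] by (intro out) auto
  then show "test_fun \<Omega> \<phi>" unfolding test_fun_def
    using sm assms(1) by (intro conjI exI[of _ "cbox c d"]) auto
  show "0 \<le> \<phi> x \<and> \<phi> x \<le> 1" for x
    unfolding \<phi>_def by (auto intro!: prod_nonneg prod_le_1 mult_nonneg_nonneg mult_le_one flat_exp_nonneg flat_exp_le_1)
  show "\<phi> x = (\<Prod>i\<in>Basis. exp (- inverse (k * (x \<bullet> i - c \<bullet> i))) * exp (- inverse (k * (d \<bullet> i - x \<bullet> i))))" if "x \<in> box c d" for x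
    unfolding \<phi>_def arg using \<open>x \<in> box c d\<close> assms(2) by (intro prod.cong) (auto simp: flat_exp_def mem_box)
qed

lemma integrable_L2_cbox:
  fixes f :: "'a::euclidean_space \<Rightarrow> real"
  assumes f: "L2_fun f" and S: "S \<in> sets lebesgue" "S \<subseteq> cbox c d"
  shows "integrable lebesgue (\<lambda>x. indicator S x * f x)"
proof -
  have "L2_fun (\<lambda>x. indicator (cbox c d) x :: real)"
  proof -
    have "integrable lebesgue (\<lambda>x. indicator (cbox c d) x :: real)"
      using lmeasurable_cbox[of c d] by (intro integrable_real_indicator) (auto simp: fmeasurable_def)
    moreover have "(norm (indicator (cbox c d) x :: real))\<^sup>2 = indicator (cbox c d) x" for x by (simp add: indicator_def)
    ultimately show ?thesis unfolding L2_fun_def by auto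
  qed
  from integrable_inner_L2[OF this f] have "integrable lebesgue (\<lambda>x. indicator (cbox c d) x * f x)" by simp
  from integrable_mult_indicator[OF S(1) this]
  have "integrable lebesgue (\<lambda>x. indicator S x * (indicator (cbox c d) x * f x))" by simp
  moreover have "indicator S x * (indicator (cbox c d) x * f x) = indicator S x * f x" for x
    using S(2) by (auto simp: indicator_def)
  ultimately show ?thesis by simp
qed

text \<open>The bumps converge to the indicator of the open box and are bounded by it; dominated
  convergence with the integrable majorant \<open>|f|\<close> on the box passes orthogonality to the
  limit.\<close>

lemma box_integral_zero:
  fixes f :: "'a::euclidean_space \<Rightarrow> real"
  assumes f: "L2_fun f" and orth: "\<And>\<phi>. test_fun \<Omega> \<phi> \<Longrightarrow> (\<integral> x. f x * \<phi> x \<partial>lebesgue) = 0" and cd: "cbox c d \<subseteq> \<Omega>"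
  shows "(\<integral> x. indicator (box c d) x * f x \<partial>lebesgue) = 0"
proof -
  let ?\<phi> = "\<lambda>k x. \<Prod>i\<in>Basis. flat_exp (k *\<^sub>R (x \<bullet> i) + (- k * (c \<bullet> i))) * flat_exp ((- k) *\<^sub>R (x \<bullet> i) + k * (d \<bullet> i))"
  note bump = test_fun_box_bump[OF cd]
  have fm: "f \<in> borel_measurable lebesgue" using f by (simp add: L2_fun_def)
  have "(\<lambda>n. \<integral> x. f x * ?\<phi> (real (Suc n)) x \<partial>lebesgue) \<longlonglongrightarrow> (\<integral> x. indicator (box c d) x * f x \<partial>lebesgue)"
  proof (rule integral_dominated_convergence)
    show "(\<lambda>x. indicator (box c d) x * f x) \<in> borel_measurable lebesgue"
      by (intro borel_measurable_times borel_measurable_indicator fm) auto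
    show "(\<lambda>x. f x * ?\<phi> (real (Suc n)) x) \<in> borel_measurable lebesgue" for n
      using fm L2_fun_test(1)[OF bump(1), of "real (Suc n)"] by (intro borel_measurable_times) (auto simp: L2_fun_def)
    show "integrable lebesgue (\<lambda>x. norm (indicator (box c d) x * f x))"
      by (intro integrable_norm integrable_L2_cbox[OF f]) (auto intro: box_subset_cbox[THEN subsetD])
    show "AE x in lebesgue. norm (f x * ?\<phi> (real (Suc n)) x) \<le> norm (indicator (box c d) x * f x)" for n
    proof (rule AE_I2)
      fix x :: 'a
      have b: "0 \<le> ?\<phi> (real (Suc n)) x \<and> ?\<phi> (real (Suc n)) x \<le> 1" by (rule bump(2)) simp
      show "norm (f x * ?\<phi> (real (Suc n)) x) \<le> norm (indicator (box c d) x * f x)"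
      proof (cases "x \<in> box c d")
        case True
        have "\<bar>f x\<bar> * \<bar>?\<phi> (real (Suc n)) x\<bar> \<le> \<bar>f x\<bar> * 1" using b by (intro mult_left_mono) auto
        then show ?thesis using True by (simp only: real_norm_def abs_mult indicator_simps mult_1 mult_1_right abs_one)
      next
        case False
        then have "?\<phi> (real (Suc n)) x = 0" by (intro bump(3)) auto
        then show ?thesis by (simp only:) simp
      qed
    qed
    show "AE x in lebesgue. (\<lambda>n. f x * ?\<phi> (real (Suc n)) x) \<longlonglongrightarrow> indicator (box c d) x * f x"
    proof (rule AE_I2)
      fix x :: 'a
      show "(\<lambda>n. f x * ?\<phi> (real (Suc n)) x) \<longlonglongrightarrow> indicator (box c d) x * f x"
      proof (cases "x \<in> box c d")
        case True
        have "(\<lambda>n. exp (- inverse (real (Suc n) * t))) \<longlonglongrightarrow> 1" if "t > 0" for t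
        proof -
          have "(\<lambda>n. inverse (real (Suc n)) * inverse t) \<longlonglongrightarrow> 0 * inverse t"
            by (intro tendsto_mult LIMSEQ_inverse_real_of_nat tendsto_const)
          then have "(\<lambda>n. exp (- inverse (real (Suc n) * t))) \<longlonglongrightarrow> exp (- 0)"
            by (intro tendsto_exp tendsto_minus) simp
          then show ?thesis by simp
        qed
        then have "(\<lambda>n. \<Prod>i\<in>Basis. exp (- inverse (real (Suc n) * (x \<bullet> i - c \<bullet> i))) * exp (- inverse (real (Suc n) * (d \<bullet> i - x \<bullet> i))))
            \<longlonglongrightarrow> (\<Prod>i\<in>(Basis::'a set). 1 * 1)"
          using True by (intro tendsto_prod tendsto_mult) (auto simp: mem_box)
        moreover have "?\<phi> (real (Suc n)) x = (\<Prod>i\<in>Basis. exp (- inverse (real (Suc n) * (x \<bullet> i - c \<bullet> i))) * exp (- inverse (real (Suc n) * (d \<bullet> i - x \<bullet> i))))" for n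
          using True by (intro bump(4)) auto
        ultimately have "(\<lambda>n. ?\<phi> (real (Suc n)) x) \<longlonglongrightarrow> (\<Prod>i\<in>(Basis::'a set). 1 * 1)" by (simp only:)
        from tendsto_mult[OF tendsto_const[of "f x"] this] show ?thesis using True by simp
      next
        case False
        then have "?\<phi> (real (Suc n)) x = 0" for n by (intro bump(3)) auto
        then have "(\<lambda>n. f x * ?\<phi> (real (Suc n)) x) = (\<lambda>n. 0)" by (simp only:) simp
        then show ?thesis using False by (simp only: indicator_simps) simp
      qed
    qed
  qed
  moreover have "(\<integral> x. f x * ?\<phi> (real (Suc n)) x \<partial>lebesgue) = 0" for n
    by (rule orth[OF bump(1)]) simp
  ultimately have "(\<lambda>n::nat. 0::real) \<longlonglongrightarrow> (\<integral> x. indicator (box c d) x * f x \<partial>lebesgue)" by (simp only:)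
  then show ?thesis using LIMSEQ_unique tendsto_const by blast
qed

lemma box_Int_eq_box:
  fixes a b c d :: "'a::euclidean_space"
  shows "box a b \<inter> box c d = box (\<Sum>i\<in>Basis. max (a \<bullet> i) (c \<bullet> i) *\<^sub>R i) (\<Sum>i\<in>Basis. min (b \<bullet> i) (d \<bullet> i) *\<^sub>R i)"
  by (auto simp: mem_box)

text \<open>Open boxes generate the Borel sets and are closed under intersection, so Dynkin's
  argument gives vanishing integrals over all Borel sets. The total integral is a separate
  assumption, since the whole space is not a box and complements refer to it.\<close>

lemma AE_zero_of_box_integrals:
  fixes g :: "'a::euclidean_space \<Rightarrow> real"
  assumes g: "integrable lborel g" and box: "\<And>c d. (\<integral> x. indicator (box c d) x * g x \<partial>lborel) = 0"
    and all: "(\<integral> x. g x \<partial>lborel) = 0"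
  shows "AE x in lborel. g x = 0"
proof -
  let ?G = "range (\<lambda>(a, b). box a b :: 'a set)"
  have int: "integrable lborel (\<lambda>x. indicator A x * g x)" if "A \<in> sets borel" for A
    using integrable_mult_indicator[of A lborel g] g that by simp
  have zero: "(\<integral> x. indicator A x * g x \<partial>lborel) = 0" if A: "A \<in> sets borel" for A
  proof -
    have sg: "A \<in> sigma_sets UNIV ?G" using A by (subst (asm) borel_eq_box) (auto simp: sets_measure_of)
    have "Int_stable ?G"
    proof (rule Int_stableI)
      fix X Y assume "X \<in> ?G" "Y \<in> ?G"
      then obtain a b c d where "X = box a b" "Y = box c d" by auto
      then show "X \<inter> Y \<in> ?G" unfolding box_Int_eq_box by (simp add: box_Int_eq_box range_eqI[of _ _ "(_, _)"])
    qed
    moreover have "?G \<subseteq> Pow UNIV" by simp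
    ultimately show ?thesis using sg
    proof (induction A rule: sigma_sets_induct_disjoint)
      case (basic A)
      then show ?case using box by auto
    next
      case empty
      show ?case by simp
    next
      case (compl A)
      have Am: "A \<in> sets borel" using compl(1) by (subst borel_eq_box) (auto simp: sets_measure_of)
      have "(\<integral> x. indicator (UNIV - A) x * g x \<partial>lborel) = (\<integral> x. g x - indicator A x * g x \<partial>lborel)"
        by (intro Bochner_Integration.integral_cong) (auto simp: indicator_def)
      also have "\<dots> = 0" using g int[OF Am] compl(2) all by simp
      finally show ?case .
    next
      case (union A)
      have Am: "A i \<in> sets borel" for i using union(2) by (subst borel_eq_box) (auto simp: sets_measure_of)
      have "set_integrable lborel (\<Union>i. A i) g"
        unfolding set_integrable_def using int[of "\<Union>i. A i"] Am by simp
      then have "(LINT x:(\<Union>i. A i)|lborel. g x) = (\<Sum>i. LINT x:A i|lborel. g x)"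
        using Am union(1) by (intro lebesgue_integral_countable_add) (auto simp: disjoint_family_on_def)
      then show ?case using union(3) by (simp add: set_lebesgue_integral_def)
    qed
  qed
  show ?thesis
  proof (rule density_unique_real[of lborel g "\<lambda>_. 0"])
    show "set_lebesgue_integral lborel A g = set_lebesgue_integral lborel A (\<lambda>_. 0)" if "A \<in> sets lborel" for A
      using zero[of A] that by (simp add: set_lebesgue_integral_def)
  qed (use g in auto)
qed

text \<open>The fundamental lemma of the calculus of variations, localized to boxes whose closures
  lie in the open set; countably many of them cover it.\<close>

lemma test_functions_separate:
  fixes f :: "'a::euclidean_space \<Rightarrow> real"
  assumes \<Omega>: "open \<Omega>" and f: "L2_fun f" and orth: "\<And>\<phi>. test_fun \<Omega> \<phi> \<Longrightarrow> (\<integral> x. f x * \<phi> x \<partial>lebesgue) = 0"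
  shows "AE x in lebesgue. x \<in> \<Omega> \<longrightarrow> f x = 0"
proof -
  \<comment> \<open>A Borel representative, because the argument with generators takes place in the
    Borel measure space.\<close>
  obtain f' where f': "f' \<in> borel_measurable lborel" "AE x in lborel. f x = f' x"
    using completion_ex_borel_measurable_real[of f lborel] f by (auto simp: L2_fun_def)
  have AEl: "AE x in lebesgue. f x = f' x" using f'(2) by (rule AE_completion)
  have fm: "f \<in> borel_measurable lebesgue" using f by (simp add: L2_fun_def)
  have one: "AE x in lebesgue. x \<in> box c d \<longrightarrow> f x = 0" if cd: "cbox c d \<subseteq> \<Omega>" for c d
  proof -
    let ?g = "\<lambda>x. indicator (box c d) x * f' x"
    have gm: "?g \<in> borel_measurable lborel" using f'(1) by simp
    have il: "integrable lebesgue (\<lambda>x. indicator (box c d) x * f x)"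
      by (rule integrable_L2_cbox[OF f]) (auto intro: box_subset_cbox[THEN subsetD])
    have "integrable lebesgue ?g"
    proof (rule integrable_cong_AE_imp[OF il])
      show "?g \<in> borel_measurable lebesgue" using gm by (simp add: measurable_completion)
      show "AE x in lebesgue. indicator (box c d) x * f x = ?g x" using AEl by eventually_elim simp
    qed
    then have gi: "integrable lborel ?g" using gm by (simp add: integrable_completion)
    have eq: "(\<integral> x. indicator A x * ?g x \<partial>lborel) = (\<integral> x. indicator (A \<inter> box c d) x * f x \<partial>lebesgue)" if A: "A \<in> sets borel" for A
    proof -
      have "(\<integral> x. indicator A x * ?g x \<partial>lborel) = (\<integral> x. indicator A x * ?g x \<partial>lebesgue)"
        using A gm by (intro integral_completion[symmetric]) auto
      also have "\<dots> = (\<integral> x. indicator (A \<inter> box c d) x * f x \<partial>lebesgue)"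
      proof (rule integral_cong_AE)
        show "(\<lambda>x. indicator A x * ?g x) \<in> borel_measurable lebesgue"
          using A measurable_completion[OF f'(1)] by (intro borel_measurable_times borel_measurable_indicator) auto
        show "(\<lambda>x. indicator (A \<inter> box c d) x * f x) \<in> borel_measurable lebesgue"
          using A fm by (intro borel_measurable_times borel_measurable_indicator) auto
        show "AE x in lebesgue. indicator A x * ?g x = indicator (A \<inter> box c d) x * f x"
          using AEl by eventually_elim (auto simp: indicator_def)
      qed
      finally show ?thesis .
    qed
    have "AE x in lborel. ?g x = 0"
    proof (rule AE_zero_of_box_integrals[OF gi])
      show "(\<integral> x. ?g x \<partial>lborel) = 0" using eq[of UNIV] box_integral_zero[OF f orth cd] by simp
      show "(\<integral> x. indicator (box a b) x * ?g x \<partial>lborel) = 0" for a b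
      proof -
        obtain c' d' where c': "box a b \<inter> box c d = box c' d'" "cbox c' d' \<subseteq> cbox c d \<or> box c' d' = {}"
        proof -
          let ?c = "\<Sum>i\<in>Basis. max (a \<bullet> i) (c \<bullet> i) *\<^sub>R i" and ?d = "\<Sum>i\<in>Basis. min (b \<bullet> i) (d \<bullet> i) *\<^sub>R i"
          have "box a b \<inter> box c d = box ?c ?d" by (rule box_Int_eq_box)
          moreover have "cbox ?c ?d \<subseteq> cbox c d" by (auto simp: mem_box)
          ultimately show ?thesis using that by blast
        qed
        show ?thesis
        proof (cases "box c' d' = {}")
          case True
          then show ?thesis using eq[of "box a b"] c'(1) by simp
        next
          case False
          then have "cbox c' d' \<subseteq> \<Omega>" using c'(2) cd by blast
          then show ?thesis using eq[of "box a b"] c'(1) box_integral_zero[OF f orth] by simp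
        qed
      qed
    qed
    then have "AE x in lebesgue. ?g x = 0" by (rule AE_completion)
    then show ?thesis using AEl by eventually_elim auto
  qed
  \<comment> \<open>Lindelof's theorem reduces the cover to a countable one, so that the exceptional
    null sets can be united.\<close>
  obtain D :: "'a set set" where D: "countable D" "\<And>X. X \<in> D \<Longrightarrow> \<exists>a b. cbox a b \<subseteq> \<Omega> \<and> X = box a b" "\<Omega> = \<Union>D"
  proof -
    let ?I = "{p::'a \<times> 'a. cbox (fst p) (snd p) \<subseteq> \<Omega>}"
    have "\<exists>D. countable D \<and> D \<subseteq> (\<lambda>p. box (fst p) (snd p)) ` ?I \<and> \<Union>D = \<Union>((\<lambda>p. box (fst p) (snd p)) ` ?I)"
      using Lindelof[of "(\<lambda>p. box (fst p) (snd p)) ` ?I"] by (metis (no_types, lifting) imageE open_box)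
    then obtain D where D: "countable D" "D \<subseteq> (\<lambda>p. box (fst p) (snd p)) ` ?I" "\<Union>D = \<Union>((\<lambda>p. box (fst p) (snd p)) ` ?I)"
      by blast
    have "\<Union>((\<lambda>p. box (fst p) (snd p)) ` ?I) = \<Omega>"
    proof
      show "\<Union>((\<lambda>p. box (fst p) (snd p)) ` ?I) \<subseteq> \<Omega>" using box_subset_cbox by fastforce
      show "\<Omega> \<subseteq> \<Union>((\<lambda>p. box (fst p) (snd p)) ` ?I)"
      proof
        fix x assume "x \<in> \<Omega>"
        from open_contains_cbox[OF \<Omega> this] obtain a b
          where "cbox a b \<subseteq> \<Omega>" "x \<in> box a b" "\<forall>i\<in>Basis. a \<bullet> i < b \<bullet> i" .
        then show "x \<in> \<Union>((\<lambda>p. box (fst p) (snd p)) ` ?I)" by (intro UnionI[of "box a b"]) (auto intro!: image_eqI[of _ _ "(a, b)"])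
      qed
    qed
    then have "\<Omega> = \<Union>D" using D(3) by simp
    moreover have "\<exists>a b. cbox a b \<subseteq> \<Omega> \<and> X = box a b" if "X \<in> D" for X using subsetD[OF D(2) that] by auto
    ultimately show ?thesis using that[of D] D(1) by simp
  qed
  have "AE x in lebesgue. \<forall>X\<in>D. x \<in> X \<longrightarrow> f x = 0"
    unfolding AE_ball_countable[OF D(1)] using D(2) one by blast
  then show ?thesis by eventually_elim (use D(3) in auto)
qed

text \<open>If the solution vanishes, the weak equation says that \<open>F\<close> is orthogonal to
  all test functions. Its later use is to turn \<open>A f = 0\<close> from the spectral argument
  into \<open>f = 0\<close>, and to start the construction with a nonzero resolvent.\<close>

lemma dres_injective:
  assumes \<Omega>: "open \<Omega>" and F: "restr \<Omega> F = F" "dres \<Omega> F = 0"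
  shows "F = 0"
proof -
  obtain G where G: "(0, G) \<in> form_space \<Omega>" "\<And>v H. (v, H) \<in> form_space \<Omega> \<Longrightarrow> 0 \<bullet> v + G \<bullet> H = F \<bullet> v"
    using F(2) by (metis dresE)
  \<comment> \<open>The pair \<open>(0, G)\<close> is itself an admissible test pair, which forces
    the gradient coordinate to vanish.\<close>
  have "G \<bullet> G = 0" using G(2)[OF G(1)] by simp
  then have "G = 0" by simp
  then have orth: "F \<bullet> v = 0" if "(v, H) \<in> form_space \<Omega>" for v H using G(2)[OF that] by simp
  have "AE x in lebesgue. x \<in> \<Omega> \<longrightarrow> rep_l2 F x = 0"
  proof (rule test_functions_separate[OF \<Omega> L2_fun_rep])
    fix \<phi> assume \<phi>: "test_fun \<Omega> \<phi>"
    show "(\<integral> x. rep_l2 F x * \<phi> x \<partial>lebesgue) = 0"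
      using orth[OF test_in_form_space[OF \<phi>]] inner_rep_abs[OF L2_fun_test(1)[OF \<phi>], of F] by simp
  qed
  moreover have "AE x in lebesgue. x \<notin> \<Omega> \<longrightarrow> rep_l2 F x = 0"
    using F(1) restr_eq_self_iff[of \<Omega> F] \<Omega> by simp
  ultimately have "AE x in lebesgue. rep_l2 F x = 0" by eventually_elim blast
  then have "abs_l2 (rep_l2 F) = abs_l2 (\<lambda>x. 0)" by (subst abs_l2_eq_iff) (auto simp: L2_fun_rep L2_fun_zero)
  then show ?thesis by (simp add: abs_l2_zero)
qed

section \<open>Chains of rooms\<close>

text \<open>The profile vanishes quadratically at both ends, which produces the cusps, and the cube
  in the denominator makes it homogeneous of degree one: all rooms are dilated and translated copies
  of a single one.\<close>

definition room :: "'a::euclidean_space \<Rightarrow> real \<Rightarrow> real \<Rightarrow> 'a set" where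
  "room e a b = {x. a < x \<bullet> e \<and> x \<bullet> e < b \<and>
     (\<forall>i\<in>Basis - {e}. \<bar>x \<bullet> i\<bar> < (x \<bullet> e - a)\<^sup>2 * (b - x \<bullet> e)\<^sup>2 / (b - a) ^ 3)}"

text \<open>Half-length \<open>s\<close> but half-width \<open>s\<^sup>2\<close>, the same order as
  the cusps that it joins at this distance from \<open>b\<close>.\<close>

definition tube :: "'a::euclidean_space \<Rightarrow> real \<Rightarrow> real \<Rightarrow> 'a set" where
  "tube e b s = {x. b - s < x \<bullet> e \<and> x \<bullet> e < b + s \<and> (\<forall>i\<in>Basis - {e}. \<bar>x \<bullet> i\<bar> < s\<^sup>2)}"

text \<open>Near \<open>b\<close> the set \<open>U\<close> is a cusp around the axis.\<close>

definition admissible :: "'a::euclidean_space \<Rightarrow> 'a \<Rightarrow> 'a set \<Rightarrow> real \<Rightarrow> bool" where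
  "admissible e e2 U b \<longleftrightarrow> open U \<and> bounded U \<and> connected U \<and> U \<noteq> {} \<and> (\<forall>x\<in>U. x \<bullet> e < b) \<and>
     (\<exists>c>0. \<exists>K>0. (\<forall>t. b - c < t \<and> t < b \<longrightarrow> t *\<^sub>R e \<in> U) \<and>
        (\<forall>x\<in>U. b - c < x \<bullet> e \<longrightarrow> \<bar>x \<bullet> e2\<bar> \<le> K * (b - x \<bullet> e)\<^sup>2))"

context
  fixes e e2 :: "'a::euclidean_space"
  assumes e: "e \<in> Basis" "e2 \<in> Basis" "e \<noteq> e2"
begin

lemma axis_basis: "e \<bullet> e = 1" "i \<in> Basis \<Longrightarrow> i \<noteq> e \<Longrightarrow> e \<bullet> i = 0"
  using e by (auto simp: inner_Basis)

lemma axis_inner: "(t *\<^sub>R e) \<bullet> e = t" "i \<in> Basis - {e} \<Longrightarrow> (t *\<^sub>R e) \<bullet> i = 0"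
  using e by (auto simp: inner_Basis)

lemma profile_set_open:
  fixes g :: "real \<Rightarrow> real"
  assumes "continuous_on UNIV g"
  shows "open {x. a < x \<bullet> e \<and> x \<bullet> e < b \<and> (\<forall>i\<in>Basis - {e}. \<bar>x \<bullet> i\<bar> < g (x \<bullet> e))}"
proof -
  have "{x. a < x \<bullet> e \<and> x \<bullet> e < b \<and> (\<forall>i\<in>Basis - {e}. \<bar>x \<bullet> i\<bar> < g (x \<bullet> e))}
      = {x. a < x \<bullet> e} \<inter> {x. x \<bullet> e < b} \<inter> (\<Inter>i\<in>Basis - {e}. {x. \<bar>x \<bullet> i\<bar> < g (x \<bullet> e)})" by auto
  also have "open \<dots>"
    by (intro open_Int open_INT open_Collect_less finite_Diff finite_Basis ballI continuous_intros
        continuous_on_compose2[OF assms]) auto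
  finally show ?thesis .
qed

text \<open>Every point is joined to the axis by a segment of constant coordinate along
  \<open>e\<close>, on which the transverse coordinates shrink.\<close>

lemma profile_set_connected:
  fixes g :: "real \<Rightarrow> real"
  assumes g: "\<And>t. a < t \<Longrightarrow> t < b \<Longrightarrow> 0 < g t" and ab: "a < b"
  shows "connected {x. a < x \<bullet> e \<and> x \<bullet> e < b \<and> (\<forall>i\<in>Basis - {e}. \<bar>x \<bullet> i\<bar> < g (x \<bullet> e))}" (is "connected ?P")
proof -
  let ?A = "(\<lambda>t. t *\<^sub>R e) ` {a<..<b}"
  have A: "connected ?A" by (intro connected_continuous_image continuous_intros) simp
  have AP: "?A \<subseteq> ?P"
  proof (rule image_subsetI)
    fix t assume t: "t \<in> {a<..<b}"
    have "\<bar>(t *\<^sub>R e) \<bullet> i\<bar> < g t" if "i \<in> Basis - {e}" for i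
      using g[of t] t unfolding axis_inner(2)[OF that] by simp
    then show "t *\<^sub>R e \<in> ?P" using t unfolding mem_Collect_eq axis_inner(1) by simp
  qed
  let ?S = "\<lambda>x. closed_segment x ((x \<bullet> e) *\<^sub>R e)"
  have seg: "?S x \<subseteq> ?P" if x: "x \<in> ?P" for x
  proof
    fix y assume "y \<in> ?S x"
    then obtain u where u: "0 \<le> u" "u \<le> 1" "y = (1 - u) *\<^sub>R x + u *\<^sub>R ((x \<bullet> e) *\<^sub>R e)" by (auto simp: in_segment)
    have "y \<bullet> e = (1 - u) * (x \<bullet> e) + u * (x \<bullet> e)"
      unfolding u(3) inner_add_left by (simp add: axis_basis)
    then have ye: "y \<bullet> e = x \<bullet> e" by (simp add: algebra_simps)
    have "\<bar>y \<bullet> i\<bar> < g (y \<bullet> e)" if i: "i \<in> Basis - {e}" for i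
    proof -
      have "y \<bullet> i = (1 - u) * (x \<bullet> i)" using u(3) axis_inner(2)[OF i, of "x \<bullet> e"] by (simp add: inner_add_left)
      then have "\<bar>y \<bullet> i\<bar> = (1 - u) * \<bar>x \<bullet> i\<bar>" using u by (simp add: abs_mult)
      also have "\<dots> \<le> \<bar>x \<bullet> i\<bar>" using u by (simp add: mult_left_le_one_le)
      also have "\<dots> < g (y \<bullet> e)" using x i ye by auto
      finally show ?thesis .
    qed
    then show "y \<in> ?P" using x ye by auto
  qed
  have "?P = \<Union>((\<lambda>x. ?S x \<union> ?A) ` ?P)"
  proof
    show "?P \<subseteq> \<Union>((\<lambda>x. ?S x \<union> ?A) ` ?P)" by (intro subsetI UnionI[OF imageI]) auto
    show "\<Union>((\<lambda>x. ?S x \<union> ?A) ` ?P) \<subseteq> ?P" using seg AP by (intro Union_least) auto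
  qed
  moreover have "connected (\<Union>((\<lambda>x. ?S x \<union> ?A) ` ?P))"
  proof (rule connected_Union)
    show "connected s" if s: "s \<in> (\<lambda>x. ?S x \<union> ?A) ` ?P" for s
    proof -
      obtain x where x: "s = ?S x \<union> ?A" "x \<in> ?P" using s by (rule imageE)
      have "(x \<bullet> e) *\<^sub>R e \<in> ?S x \<inter> ?A" using x(2) by auto
      then show ?thesis unfolding x(1) by (intro connected_Un connected_segment A) blast
    qed
    have "((a + b) / 2) *\<^sub>R e \<in> ?A" using ab by (intro imageI) auto
    then have "((a + b) / 2) *\<^sub>R e \<in> \<Inter>((\<lambda>x. ?S x \<union> ?A) ` ?P)" by (intro InterI) auto
    then show "\<Inter>((\<lambda>x. ?S x \<union> ?A) ` ?P) \<noteq> {}" by (rule ex_in_conv[THEN iffD1, OF exI])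
  qed
  ultimately show ?thesis by simp
qed

lemma open_room: "open (room e a b)"
  unfolding room_def
  using profile_set_open[of "\<lambda>t. (t - a)\<^sup>2 * (b - t)\<^sup>2 / (b - a) ^ 3" a b]
  by (simp add: divide_inverse continuous_intros)

lemma open_tube: "open (tube e b s)"
  unfolding tube_def using profile_set_open[of "\<lambda>t. s\<^sup>2" "b - s" "b + s"] by (simp add: continuous_intros)

lemma connected_room: "a < b \<Longrightarrow> connected (room e a b)"
  unfolding room_def by (rule profile_set_connected[of a b "\<lambda>t. (t - a)\<^sup>2 * (b - t)\<^sup>2 / (b - a) ^ 3"]) auto

lemma connected_tube: "s > 0 \<Longrightarrow> connected (tube e b s)"
  unfolding tube_def by (rule profile_set_connected[of "b - s" "b + s" "\<lambda>t. s\<^sup>2"]) auto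

lemma axis_in_room: "a < t \<Longrightarrow> t < b \<Longrightarrow> t *\<^sub>R e \<in> room e a b"
  by (auto simp: room_def axis_basis)

lemma axis_in_tube: "b - s < t \<Longrightarrow> t < b + s \<Longrightarrow> t *\<^sub>R e \<in> tube e b s"
  by (auto simp: tube_def axis_basis)

lemma room_profile_le:
  fixes a b t :: real
  assumes "a < b" "a < t" "t < b"
  shows "(t - a)\<^sup>2 * (b - t)\<^sup>2 / (b - a) ^ 3 \<le> (b - t)\<^sup>2 / (b - a)"
    "(t - a)\<^sup>2 * (b - t)\<^sup>2 / (b - a) ^ 3 \<le> (t - a)\<^sup>2 / (b - a)"
    "(t - a)\<^sup>2 * (b - t)\<^sup>2 / (b - a) ^ 3 \<le> b - a"
proof -
  let ?L = "b - a"
  have L: "?L > 0" using assms by simp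
  have e3: "x * y / ?L ^ 3 = (x / ?L\<^sup>2) * (y / ?L)" for x y by (simp add: power3_eq_cube power2_eq_square)
  have le: "(t - a)\<^sup>2 / ?L\<^sup>2 \<le> 1" "(b - t)\<^sup>2 / ?L\<^sup>2 \<le> 1"
    using assms by (auto simp: divide_le_eq_1 intro!: power_mono)
  show 1: "(t - a)\<^sup>2 * (b - t)\<^sup>2 / ?L ^ 3 \<le> (b - t)\<^sup>2 / ?L"
    unfolding e3 using le(1) L by (intro mult_left_le_one_le) auto
  show "(t - a)\<^sup>2 * (b - t)\<^sup>2 / ?L ^ 3 \<le> (t - a)\<^sup>2 / ?L"
    unfolding mult.commute[of "(t - a)\<^sup>2"] e3 using le(2) L by (intro mult_left_le_one_le) auto
  have "(b - t)\<^sup>2 / ?L \<le> ?L\<^sup>2 / ?L" using assms L by (intro divide_right_mono power_mono) auto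
  also have "\<dots> = ?L" by (simp add: power2_eq_square)
  finally show "(t - a)\<^sup>2 * (b - t)\<^sup>2 / ?L ^ 3 \<le> ?L" using 1 by simp
qed

lemma bounded_components:
  assumes "\<And>x i. x \<in> S \<Longrightarrow> i \<in> Basis \<Longrightarrow> \<bar>x \<bullet> i\<bar> \<le> B"
  shows "bounded (S :: 'a set)"
  unfolding bounded_iff
proof (intro exI ballI)
  fix x assume "x \<in> S"
  have "norm x \<le> (\<Sum>i\<in>Basis. \<bar>x \<bullet> i\<bar>)" by (rule norm_le_l1)
  also have "\<dots> \<le> (\<Sum>i\<in>(Basis::'a set). B)" using assms \<open>x \<in> S\<close> by (intro sum_mono) auto
  finally show "norm x \<le> (\<Sum>i\<in>(Basis::'a set). B)" .
qed

lemma bounded_room: assumes "a < b" shows "bounded (room e a b)"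
proof (rule bounded_components)
  fix x i :: 'a assume x: "x \<in> room e a b" and i: "i \<in> Basis"
  show "\<bar>x \<bullet> i\<bar> \<le> \<bar>a\<bar> + \<bar>b\<bar> + (b - a)"
  proof (cases "i = e")
    case True
    then show ?thesis using x assms by (auto simp: room_def)
  next
    case False
    then have "\<bar>x \<bullet> i\<bar> < (x \<bullet> e - a)\<^sup>2 * (b - x \<bullet> e)\<^sup>2 / (b - a) ^ 3" using x i by (auto simp: room_def)
    also have "\<dots> \<le> b - a" using x assms by (intro room_profile_le) (auto simp: room_def)
    finally show ?thesis by simp
  qed
qed

lemma bounded_tube: assumes "s > 0" shows "bounded (tube e b s)"
proof (rule bounded_components)
  fix x i :: 'a assume x: "x \<in> tube e b s" and i: "i \<in> Basis"
  show "\<bar>x \<bullet> i\<bar> \<le> \<bar>b\<bar> + s + s\<^sup>2"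
  proof (cases "i = e")
    case True
    have "b - s < x \<bullet> e" "x \<bullet> e < b + s" using x by (auto simp: tube_def)
    then have "\<bar>x \<bullet> e\<bar> \<le> \<bar>b\<bar> + s" by linarith
    then have "\<bar>x \<bullet> e\<bar> \<le> \<bar>b\<bar> + s + s\<^sup>2" using zero_le_power2[of s] by linarith
    then show ?thesis using True by (simp only:)
  next
    case False
    then have "\<bar>x \<bullet> i\<bar> < s\<^sup>2" using x i by (auto simp: tube_def)
    then show ?thesis using assms by simp
  qed
qed

lemma room_e2: "x \<in> room e a b \<Longrightarrow> \<bar>x \<bullet> e2\<bar> < (x \<bullet> e - a)\<^sup>2 * (b - x \<bullet> e)\<^sup>2 / (b - a) ^ 3"
  using e by (auto simp: room_def)

lemma admissible_room: assumes "a < b" shows "admissible e e2 (room e a b) b"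
  unfolding admissible_def
proof (intro conjI)
  show "open (room e a b)" "bounded (room e a b)" "connected (room e a b)"
    by (rule open_room, rule bounded_room[OF assms], rule connected_room[OF assms])
  show "room e a b \<noteq> {}" using axis_in_room[of a "(a + b) / 2" b] assms by auto
  show "\<forall>x\<in>room e a b. x \<bullet> e < b" by (auto simp: room_def)
  show "\<exists>c>0. \<exists>K>0. (\<forall>t. b - c < t \<and> t < b \<longrightarrow> t *\<^sub>R e \<in> room e a b) \<and>
        (\<forall>x\<in>room e a b. b - c < x \<bullet> e \<longrightarrow> \<bar>x \<bullet> e2\<bar> \<le> K * (b - x \<bullet> e)\<^sup>2)"
  proof -
    have "\<bar>x \<bullet> e2\<bar> \<le> 1 / (b - a) * (b - x \<bullet> e)\<^sup>2" if x: "x \<in> room e a b" for x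
    proof -
      have "\<bar>x \<bullet> e2\<bar> < (x \<bullet> e - a)\<^sup>2 * (b - x \<bullet> e)\<^sup>2 / (b - a) ^ 3" by (rule room_e2[OF x])
      also have "\<dots> \<le> (b - x \<bullet> e)\<^sup>2 / (b - a)" using x assms by (intro room_profile_le) (auto simp: room_def)
      finally show ?thesis by simp
    qed
    moreover have "t *\<^sub>R e \<in> room e a b" if "b - (b - a) < t" "t < b" for t using that by (intro axis_in_room) auto
    moreover have "b - a > 0" "1 / (b - a) > 0" using assms by auto
    ultimately show ?thesis by (metis (no_types, lifting))
  qed
qed

text \<open>The cusp condition at the new end only concerns the part beyond the tube, where nothing
  but the new room is left; so it is inherited with constants of that room.\<close>

lemma admissible_extend:
  assumes U: "admissible e e2 U b" and b': "b < b'" and s: "0 < s" "s < b' - b"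
  shows "admissible e e2 (U \<union> room e b b' \<union> tube e b s) b'"
proof -
  obtain c K where U': "open U" "bounded U" "connected U" "U \<noteq> {}" "\<forall>x\<in>U. x \<bullet> e < b" "c > 0"
    "\<forall>t. b - c < t \<and> t < b \<longrightarrow> t *\<^sub>R e \<in> U"
    using U unfolding admissible_def by auto
  let ?U = "U \<union> room e b b' \<union> tube e b s"
  show ?thesis unfolding admissible_def
  proof (intro conjI)
    show "open ?U" by (intro open_Un U'(1) open_room open_tube)
    show "bounded ?U" unfolding bounded_Un using U'(2) bounded_room[OF b'] bounded_tube[OF s(1)] by simp
    show "?U \<noteq> {}" using U'(4) by auto
    \<comment> \<open>A point of the axis just before \<open>b\<close> that lies both in the cusp of
      \<open>U\<close> and in the tube.\<close>
    have "b - s < b - min c s / 2" "b - c < b - min c s / 2" "b - min c s / 2 < b" "b - min c s / 2 < b + s"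
      using U'(6) s by (auto simp: min_def)
    then have "(b - min c s / 2) *\<^sub>R e \<in> U \<inter> tube e b s"
      using U'(7) axis_in_tube[of b s "b - min c s / 2"] by auto
    then have c1: "connected (U \<union> tube e b s)"
      by (intro connected_Un U'(3) connected_tube s(1)) auto
    have "b < b + s / 2" "b + s / 2 < b'" "b - s < b + s / 2" "b + s / 2 < b + s" using s by auto
    then have "(b + s / 2) *\<^sub>R e \<in> (U \<union> tube e b s) \<inter> room e b b'"
      using axis_in_room[of b "b + s / 2" b'] axis_in_tube[of b s "b + s / 2"] by auto
    then have "connected ((U \<union> tube e b s) \<union> room e b b')"
      by (intro connected_Un c1 connected_room b') auto
    then show "connected ?U" by (simp add: Un_ac)
    show "\<forall>x\<in>?U. x \<bullet> e < b'" using U'(5) b' s by (auto simp: room_def tube_def)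
    show "\<exists>c>0. \<exists>K>0. (\<forall>t. b' - c < t \<and> t < b' \<longrightarrow> t *\<^sub>R e \<in> ?U) \<and>
        (\<forall>x\<in>?U. b' - c < x \<bullet> e \<longrightarrow> \<bar>x \<bullet> e2\<bar> \<le> K * (b' - x \<bullet> e)\<^sup>2)"
    proof -
      \<comment> \<open>The witness for the constant \<open>c\<close> of the cusp is
        \<open>b' - b - s\<close>, so the condition on \<open>x\<close> reads
        \<open>b + s < x \<bullet> e\<close>, beyond the end of the tube.\<close>
      have "\<bar>x \<bullet> e2\<bar> \<le> 1 / (b' - b) * (b' - x \<bullet> e)\<^sup>2" if x: "x \<in> ?U" and h: "b' - (b' - b - s) < x \<bullet> e" for x
      proof -
        have "x \<notin> U" using U'(5) h s(1) by auto
        moreover have "x \<notin> tube e b s" using h by (auto simp: tube_def)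
        ultimately have xr: "x \<in> room e b b'" using x by simp
        have "\<bar>x \<bullet> e2\<bar> < (x \<bullet> e - b)\<^sup>2 * (b' - x \<bullet> e)\<^sup>2 / (b' - b) ^ 3" by (rule room_e2[OF xr])
        also have "\<dots> \<le> (b' - x \<bullet> e)\<^sup>2 / (b' - b)" using xr b' by (intro room_profile_le) (auto simp: room_def)
        finally show ?thesis by simp
      qed
      moreover have "t *\<^sub>R e \<in> ?U" if "b' - (b' - b - s) < t" "t < b'" for t
        using axis_in_room[of b t b'] s(1) that by auto
      moreover have "b' - b - s > 0" "1 / (b' - b) > 0" using s b' by auto
      ultimately show ?thesis by (metis (no_types, lifting))
    qed
  qed
qed

text \<open>Within this radius of the centre both distances to the ends are at least a quarter of
  the length \<open>L\<close>, so the profile is at least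
  \<open>(L/4)^4 / L^3 = L/256\<close>.\<close>

lemma room_contains_ball:
  assumes L: "0 < b - a"
  shows "ball (((a + b) / 2) *\<^sub>R e) ((b - a) / 256) \<subseteq> room e a b"
proof
  let ?L = "b - a"
  fix x assume "x \<in> ball (((a + b) / 2) *\<^sub>R e) (?L / 256)"
  then have n: "norm (x - ((a + b) / 2) *\<^sub>R e) < ?L / 256" by (simp add: dist_norm norm_minus_commute)
  have comp: "\<bar>x \<bullet> i - (((a + b) / 2) *\<^sub>R e) \<bullet> i\<bar> < ?L / 256" if "i \<in> Basis" for i
    using Basis_le_norm[OF that, of "x - ((a + b) / 2) *\<^sub>R e"] n unfolding inner_diff_left by linarith
  have "\<bar>x \<bullet> e - (a + b) / 2\<bar> < ?L / 256" using comp[OF e(1)] by (simp only: axis_inner)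
  then have near: "x \<bullet> e - (a + b) / 2 < ?L / 256 \<and> - (x \<bullet> e - (a + b) / 2) < ?L / 256" by (simp only: abs_less_iff)
  have q1: "?L / 4 \<le> x \<bullet> e - a" using conjunct2[OF near] L by (simp add: field_simps)
  have q2: "?L / 4 \<le> b - x \<bullet> e" using conjunct1[OF near] L by (simp add: field_simps)
  note q = q1 q2
  have "?L / 256 = (?L / 4)\<^sup>2 * (?L / 4)\<^sup>2 / ?L ^ 3" using L by (simp add: power2_eq_square power3_eq_cube)
  also have "\<dots> \<le> (x \<bullet> e - a)\<^sup>2 * (b - x \<bullet> e)\<^sup>2 / ?L ^ 3"
    using q L by (intro divide_right_mono mult_mono power_mono) auto
  finally have prof: "?L / 256 \<le> (x \<bullet> e - a)\<^sup>2 * (b - x \<bullet> e)\<^sup>2 / ?L ^ 3" .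
  have "\<bar>x \<bullet> i\<bar> < (x \<bullet> e - a)\<^sup>2 * (b - x \<bullet> e)\<^sup>2 / ?L ^ 3" if i: "i \<in> Basis - {e}" for i
  proof -
    have "\<bar>x \<bullet> i - 0\<bar> < ?L / 256" using comp[of i] i unfolding axis_inner(2)[OF i] by blast
    then show ?thesis using prof by linarith
  qed
  then show "x \<in> room e a b" using q L by (auto simp: room_def)
qed

lemma room_similarity:
  assumes "b < b'" shows "similarity (1 / (b' - b)) (- ((b / (b' - b)) *\<^sub>R e)) ` room e b b' = room e 0 1"
proof -
  let ?L = "b' - b" and ?S = "similarity (1 / (b' - b)) (- ((b / (b' - b)) *\<^sub>R e))"
  have L: "?L > 0" using assms by simp
  have Se: "?S x \<bullet> e = (x \<bullet> e - b) / ?L" for x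
    using e by (simp add: similarity_def inner_add_left axis_inner inner_diff_left diff_divide_distrib)
  have Si: "?S x \<bullet> i = (x \<bullet> i) / ?L" if "i \<in> Basis - {e}" for x i
    using that axis_basis(2)[of i] by (simp add: similarity_def inner_add_left inner_diff_left)
  have iff: "?S x \<in> room e 0 1 \<longleftrightarrow> x \<in> room e b b'" for x
  proof -
    have "(\<bar>(x \<bullet> i) / ?L\<bar> < ((x \<bullet> e - b) / ?L - 0)\<^sup>2 * (1 - (x \<bullet> e - b) / ?L)\<^sup>2 / (1 - 0) ^ 3)
      \<longleftrightarrow> \<bar>x \<bullet> i\<bar> < (x \<bullet> e - b)\<^sup>2 * (b' - x \<bullet> e)\<^sup>2 / ?L ^ 3" for i
    proof -
      have "1 - (x \<bullet> e - b) / ?L = (b' - x \<bullet> e) / ?L" using L by (simp add: field_simps)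
      then have "((x \<bullet> e - b) / ?L - 0)\<^sup>2 * (1 - (x \<bullet> e - b) / ?L)\<^sup>2 / (1 - 0) ^ 3 = ((x \<bullet> e - b)\<^sup>2 * (b' - x \<bullet> e)\<^sup>2 / ?L ^ 3) / ?L"
        by (simp add: power_divide power2_eq_square power3_eq_cube)
      moreover have "\<bar>(x \<bullet> i) / ?L\<bar> = \<bar>x \<bullet> i\<bar> / ?L" using L by simp
      ultimately show ?thesis using L by (simp only: divide_less_cancel) auto
    qed
    moreover have "0 < (x \<bullet> e - b) / ?L \<longleftrightarrow> b < x \<bullet> e" "(x \<bullet> e - b) / ?L < 1 \<longleftrightarrow> x \<bullet> e < b'"
      using L by (auto simp: zero_less_divide_iff divide_less_eq_1)
    ultimately show ?thesis unfolding room_def by (auto simp: Se Si)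
  qed
  show ?thesis
  proof
    show "?S ` room e b b' \<subseteq> room e 0 1" using iff by auto
    show "room e 0 1 \<subseteq> ?S ` room e b b'"
    proof
      fix y assume y: "y \<in> room e 0 1"
      let ?x = "b *\<^sub>R e + ?L *\<^sub>R y"
      have "?S ?x = y" using L by (simp add: similarity_def scaleR_add_right)
      then show "y \<in> ?S ` room e b b'" using iff[of ?x] y by (metis imageI)
    qed
  qed
qed

end

lemma geometric_increments_converge:
  fixes x :: "nat \<Rightarrow> 'v::banach"
  assumes "\<And>n. norm (x (Suc n) - x n) \<le> C * (1/2) ^ n"
  shows "\<exists>l. x \<longlonglongrightarrow> l \<and> norm (l - x 0) \<le> 2 * C"
proof -
  have g: "(\<lambda>n. C * (1/2) ^ n) sums (2 * C)" using sums_mult[OF geometric_sums[of "1/2::real"], of C] by (simp add: mult.commute)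
  have "summable (\<lambda>n. norm (x (Suc n) - x n))"
    by (rule summable_comparison_test'[OF sums_summable[OF g], where N = 0]) (use assms in auto)
  then have sm: "summable (\<lambda>n. x (Suc n) - x n)" by (rule summable_norm_cancel)
  have "(\<lambda>n. \<Sum>k<n. x (Suc k) - x k) \<longlonglongrightarrow> suminf (\<lambda>n. x (Suc n) - x n)"
    using sm by (rule summable_LIMSEQ)
  then have "(\<lambda>n. x n - x 0) \<longlonglongrightarrow> suminf (\<lambda>n. x (Suc n) - x n)" by (simp only: sum_lessThan_telescope)
  from tendsto_add[OF this tendsto_const[of "x 0"]]
  have "x \<longlonglongrightarrow> suminf (\<lambda>n. x (Suc n) - x n) + x 0" by simp
  moreover have "norm (suminf (\<lambda>n. x (Suc n) - x n)) \<le> 2 * C"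
  proof -
    have "norm (suminf (\<lambda>n. x (Suc n) - x n)) \<le> (\<Sum>n. norm (x (Suc n) - x n))"
      using \<open>summable (\<lambda>n. norm (x (Suc n) - x n))\<close> by (rule summable_norm)
    also have "\<dots> \<le> (\<Sum>n. C * (1/2) ^ n)"
      by (intro suminf_le assms sums_summable[OF g] \<open>summable (\<lambda>n. norm (x (Suc n) - x n))\<close>)
    also have "\<dots> = 2 * C" using g by (simp add: sums_iff)
    finally show ?thesis .
  qed
  ultimately show ?thesis by (intro exI[of _ "suminf (\<lambda>n. x (Suc n) - x n) + x 0"]) simp
qed

text \<open>For eigenvalue 1 the gradient would vanish, and the Poincare inequality on the whole
  bounded set would kill the function. It guarantees that the corresponding Laplace eigenvalue is
  strictly positive.\<close>

lemma eigenvalue_less_1: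
  fixes e e2 :: "'a::euclidean_space"
  assumes e: "e \<in> Basis" "e2 \<in> Basis" "e \<noteq> e2" and U: "bounded (U :: 'a set)" and x: "dres U x = a *\<^sub>R x" "x \<noteq> 0"
  shows "a < 1"
proof -
  have "a \<le> 1" by (rule eigenvalue_range(2)[OF pos_contraction_dres x])
  moreover have "a \<noteq> 1"
  proof
    assume "a = 1"
    then have x1: "dres U x = x" using x by simp
    obtain G where G: "(x, G) \<in> form_space U" "\<And>v H. (v, H) \<in> form_space U \<Longrightarrow> x \<bullet> v + G \<bullet> H = x \<bullet> v"
      using x1 by (metis dresE)
    have "G \<bullet> G = 0" using G(2)[OF G(1)] by simp
    then have G0: "G = 0" by simp
    obtain R where R: "\<And>y. y \<in> U \<Longrightarrow> norm y \<le> R" using U by (auto simp: bounded_iff)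
    have "norm (restr {y. y \<bullet> e \<in> UNIV} x) \<le> 2 * (\<bar>R\<bar> + 1) * norm (restr {y. y \<bullet> e \<in> UNIV} G)"
    proof (rule strip_poincare[OF _ _ _ _ _ G(1), of e2])
      show "norm e2 = 1" "e \<bullet> e2 = 0" using e by (auto simp: inner_Basis)
      show "\<bar>y \<bullet> e2\<bar> < \<bar>R\<bar> + 1" if "y \<in> U" for y using Basis_le_norm[OF e(2), of y] R[OF that] by linarith
    qed auto
    moreover have "restr UNIV (0 :: ('a, 'a) l2) = 0" by (intro linear_0 linear_restr) simp
    moreover have "restr UNIV x = x" by (simp add: restr_eq_self_iff)
    ultimately show False using G0 x(2) by simp
  qed
  ultimately show ?thesis by simp
qed

section \<open>Thin tubes and non-resonant rooms\<close>

context
  fixes e e2 :: "'a::euclidean_space"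
  assumes e: "e \<in> Basis" "e2 \<in> Basis" "e \<noteq> e2"
begin

text \<open>Near \<open>b\<close> all three pieces have transverse size of order
  \<open>s\<^sup>2\<close> in a strip of half-length \<open>2 * s\<close>. Inserted into
  \<open>tube_cut_estimate\<close>, \<open>M * C / s\<close> is of order \<open>s\<close>, so the
  norm difference tends to 0 with \<open>s\<close>.\<close>

lemma tube_close:
  assumes U: "admissible e e2 U b" and b': "b + 1 \<le> b'" and \<delta>: "\<delta> > 0"
  shows "\<exists>s. 0 < s \<and> s < 1/2 \<and> (\<forall>f. norm (dres (U \<union> room e b b' \<union> tube e b s) f - dres (U \<union> room e b b') f) \<le> \<delta> * norm f)"
proof -
  obtain c K where cK: "c > 0" "K > 0" "\<forall>x\<in>U. b - c < x \<bullet> e \<longrightarrow> \<bar>x \<bullet> e2\<bar> \<le> K * (b - x \<bullet> e)\<^sup>2" "\<forall>x\<in>U. x \<bullet> e < b"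
    using U unfolding admissible_def by auto
  obtain C D where D: "C > 0" "\<And>t. (smooth_step has_real_derivative D t) (at t)" "\<And>t. \<bar>D t\<bar> \<le> C"
    by (rule smooth_step_deriv_bound) blast
  \<comment> \<open>In the strip the cusp of \<open>U\<close> has size at most
    \<open>4 * K * s\<^sup>2\<close>, the new room at most \<open>4 * s\<^sup>2\<close> because its
    length is at least 1, and the tube at most \<open>s\<^sup>2\<close>; \<open>4 * K + 5\<close>
    dominates all of them strictly.\<close>
  define \<kappa> where "\<kappa> = 4 * K + 5"
  have \<kappa>: "\<kappa> > 0" using cK(2) by (simp add: \<kappa>_def)
  define B where "B = 3 * (2 * \<kappa> + 8 * (\<kappa> * C) + 16 * (\<kappa> * C)\<^sup>2)"
  have B: "B > 0" using \<kappa> D(1) by (simp add: B_def add_pos_nonneg)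
  \<comment> \<open>\<open>1/4\<close> gives \<open>s\<^sup>2 \<le> s\<close> and the bound
    \<open>1/2\<close>; \<open>c / 4\<close> keeps the strip inside the range of the cusp estimate;
    \<open>\<delta> / B\<close> absorbs all constants.\<close>
  define s where "s = min (min (1/4) (c / 4)) (\<delta> / B)"
  have s: "0 < s" "s \<le> 1/4" "s \<le> c / 4" "s \<le> \<delta> / B" using cK(1) \<delta> B by (auto simp only: s_def min_less_iff_conj min_le_iff_disj) auto
  have Bs: "B * s \<le> \<delta>" using s(4) B by (simp add: le_divide_eq mult.commute)
  let ?W = "U \<union> room e b b' \<union> tube e b s" and ?V = "U \<union> room e b b'"
  have n1: "norm e = 1" "norm e2 = 1" "e \<bullet> e2 = 0" using e by (auto simp: inner_Basis)
  have "norm (dres ?W f - dres ?V f) \<le> \<delta> * norm f" for f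
  proof -
    let ?M = "\<kappa> * s\<^sup>2"
    have "norm (dres ?W f - dres ?V f) \<le> 3 * (2 * ?M + 8 * (?M * C / s) + 16 * (?M * C / s)\<^sup>2) * norm f"
    proof (rule tube_cut_estimate[OF n1 s(1) _ D(2,3,1), where b = b])
      show "0 < ?M" using \<kappa> s(1) by simp
      show "x \<in> ?V" if "x \<in> ?W" "s \<le> \<bar>x \<bullet> e - b\<bar>" for x
        using that by (auto simp: tube_def abs_if split: if_splits)
      fix x assume x: "x \<in> ?W" "\<bar>x \<bullet> e - b\<bar> \<le> 2 * s"
      have sq: "(x \<bullet> e - b)\<^sup>2 \<le> (2 * s)\<^sup>2" using x(2) by (metis abs_ge_zero power2_abs power_mono)
      consider "x \<in> U" | "x \<in> room e b b'" | "x \<in> tube e b s" using x(1) by auto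
      then show "\<bar>x \<bullet> e2\<bar> < ?M"
      proof cases
        case 1
        have "b - c < x \<bullet> e" using x(2) s(1,3) cK(1) by linarith
        then have "\<bar>x \<bullet> e2\<bar> \<le> K * (b - x \<bullet> e)\<^sup>2" using cK(3) 1 by blast
        also have "\<dots> \<le> K * (2 * s)\<^sup>2" using sq cK(2) by (intro mult_left_mono) (auto simp: power2_commute)
        also have "\<dots> < ?M" using s(1) by (simp add: \<kappa>_def power_mult_distrib distrib_right)
        finally show ?thesis .
      next
        case 2
        have "\<bar>x \<bullet> e2\<bar> < (x \<bullet> e - b)\<^sup>2 * (b' - x \<bullet> e)\<^sup>2 / (b' - b) ^ 3" by (rule room_e2[OF e 2])
        also have "\<dots> \<le> (x \<bullet> e - b)\<^sup>2 / (b' - b)" using 2 b' by (intro room_profile_le[OF e]) (auto simp: room_def)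
        also have "\<dots> \<le> (x \<bullet> e - b)\<^sup>2 / 1" using b' by (intro divide_left_mono) auto
        also have "\<dots> \<le> (2 * s)\<^sup>2" using sq by simp
        also have "\<dots> \<le> ?M" using cK(2) s(1) by (simp add: \<kappa>_def power_mult_distrib distrib_right)
        finally show ?thesis .
      next
        case 3
        then have "\<bar>x \<bullet> e2\<bar> < s\<^sup>2" using e by (auto simp: tube_def)
        also have "\<dots> \<le> ?M" using cK(2) s(1) by (simp add: \<kappa>_def distrib_right)
        finally show ?thesis .
      qed
    qed auto
    also have "\<dots> \<le> \<delta> * norm f"
    proof (rule mult_right_mono)
      have s1: "s\<^sup>2 \<le> s" using s by (simp add: power2_eq_square mult_left_le_one_le)
      have "?M * C / s = \<kappa> * C * s" using s(1) by (simp add: power2_eq_square)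
      then have "3 * (2 * ?M + 8 * (?M * C / s) + 16 * (?M * C / s)\<^sup>2)
          = 3 * (2 * \<kappa> * s\<^sup>2 + 8 * (\<kappa> * C) * s + 16 * (\<kappa> * C)\<^sup>2 * s\<^sup>2)"
        by (simp add: power_mult_distrib)
      also have "\<dots> \<le> 3 * (2 * \<kappa> * s + 8 * (\<kappa> * C) * s + 16 * (\<kappa> * C)\<^sup>2 * s)"
        using s1 \<kappa> D(1) by (intro mult_left_mono add_mono) auto
      also have "\<dots> = B * s" by (simp add: B_def algebra_simps)
      also have "\<dots> \<le> \<delta>" by (rule Bs)
      finally show "3 * (2 * ?M + 8 * (?M * C / s) + 16 * (?M * C / s)\<^sup>2) \<le> \<delta>" .
    qed simp
    finally show ?thesis .
  qed
  then show ?thesis using s by (intro exI[of _ s]) auto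
qed

text \<open>Rescaling a room of length \<open>L\<close> to length 1 multiplies the Laplace
  eigenvalue by \<open>L\<^sup>2\<close>. If all long rooms had the eigenvalue \<open>a\<close>, the
  unit room would have uncountably many eigenvalues.\<close>

lemma nonresonant_room:
  assumes a: "0 < a" "a < 1"
  shows "\<exists>b'. b + B \<le> b' \<and> b < b' \<and> eigenspace (dres (room e b b')) a = {0}"
proof (rule ccontr)
  assume no: "\<not> ?thesis"
  define lam where "lam = 1 / a - 1"
  have lam: "lam > 0" using a by (simp add: lam_def)
  have a_eq: "1 / (1 + lam) = a" by (simp add: lam_def)
  let ?E = "{a. a > 0 \<and> eigenspace (dres (room e 0 1)) a \<noteq> {0}}"
  have cE: "countable ?E"
    by (intro countable_eigenvalues pos_contraction_dres compact_dres bounded_room[OF e]) simp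
  let ?g = "\<lambda>L. 1 / (1 + lam * L\<^sup>2)"
  have "?g L \<in> ?E" if L: "L \<in> {max 1 B<..}" for L
  proof -
    have L0: "L > 0" "L \<ge> B" using L by auto
    let ?b' = "b + L"
    have "eigenspace (dres (room e b ?b')) a \<noteq> {0}" using no L0 by auto
    moreover have "0 \<in> eigenspace (dres (room e b ?b')) a"
      by (rule subspace_0[OF subspace_eigenspace[OF pos_contraction_dres]])
    ultimately obtain x where x: "dres (room e b ?b') x = a *\<^sub>R x" "x \<noteq> 0" by (auto simp: eigenspace_def)
    have "lam \<in> dirichlet_point_spectrum (room e b ?b')"
      unfolding lam_def by (rule dres_eigenvalue_imp_point_spectrum[OF x a(1)])
    then have "lam / (1 / L)\<^sup>2 \<in> dirichlet_point_spectrum (similarity (1 / L) (- ((b / L) *\<^sub>R e)) ` room e b ?b')"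
      using L0 by (intro dirichlet_point_spectrum_similarity) auto
    moreover have "similarity (1 / L) (- ((b / L) *\<^sub>R e)) ` room e b ?b' = room e 0 1"
      using room_similarity[OF e, of b ?b'] L0 by simp
    ultimately have "lam * L\<^sup>2 \<in> dirichlet_point_spectrum (room e 0 1)" by (simp add: power_divide)
    from point_spectrum_imp_dres_eigenvalue(2)[OF this] have "eigenspace (dres (room e 0 1)) (?g L) \<noteq> {0}" .
    moreover have "?g L > 0" using lam by (simp add: add_pos_nonneg)
    ultimately show ?thesis by simp
  qed
  then have "?g ` {max 1 B<..} \<subseteq> ?E" by blast
  then have "countable (?g ` {max 1 B<..})" using cE countable_subset by blast
  moreover have "inj_on ?g {max 1 B<..}"
  proof (rule inj_onI)
    fix x y assume xy: "x \<in> {max 1 B<..}" "y \<in> {max 1 B<..}" "?g x = ?g y"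
    have "1 + lam * x\<^sup>2 \<noteq> 0" "1 + lam * y\<^sup>2 \<noteq> 0" using lam by (auto simp: add_pos_nonneg less_imp_neq[symmetric])
    then have "lam * x\<^sup>2 = lam * y\<^sup>2" using xy(3) by (simp add: field_simps)
    then have "x\<^sup>2 = y\<^sup>2" using lam by simp
    then show "x = y" using xy(1,2) by (simp add: power2_eq_iff)
  qed
  ultimately have "countable {max 1 B<..}" using countable_image_inj_on by blast
  moreover have "uncountable {max 1 B<..<max 1 B + 1}" by (rule uncountable_open_interval[THEN iffD2]) simp
  moreover have "{max 1 B<..<max 1 B + 1} \<subseteq> {max 1 B<..}" by (rule subsetI) simp
  ultimately show False using countable_subset by blast
qed

end

section \<open>Inductive construction of the chain\<close>

text \<open>All data that the argument for the absolutely continuous spectrum takes from stage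
  \<open>n\<close>. The quantifier over \<open>A\<close> allows \<beta> to be fixed now and the
  statement to be used for the final resolvent.\<close>

definition selected :: "nat \<Rightarrow> 'a::euclidean_space set \<Rightarrow> real \<Rightarrow> bool" where
  "selected n U \<beta> \<longleftrightarrow> (\<exists>\<Phi> \<alpha> Q Y. eigen_truncation (dres U) ((1/2) ^ n) \<Phi> \<alpha> \<and> open Y \<and>
     emeasure lborel Y \<le> ennreal ((1/2) ^ n) \<and>
     (\<forall>y\<in>{0..1}. 0 \<le> poly Q y \<and> poly Q y \<le> 1) \<and> (\<forall>y\<in>{0..1} - Y. poly Q y \<le> (1/2) ^ n) \<and>
     (\<forall>A. pos_contraction A \<longrightarrow> (\<forall>\<phi>\<in>\<Phi>. norm (A \<phi> - \<alpha> \<phi> *\<^sub>R \<phi>) \<le> \<beta>) \<longrightarrow>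
        (\<forall>h\<in>span \<Phi>. norm (h - poly_op A Q h) \<le> (1/2) ^ n * norm h)))"

lemma selected_exists:
  assumes "bounded U" "B > 0" shows "\<exists>\<beta>>0. \<beta> \<le> B \<and> selected n U \<beta>"
proof -
  have n0: "(0::real) < (1/2) ^ n" by simp
  obtain \<Phi> \<alpha> where T: "eigen_truncation (dres U) ((1/2) ^ n) \<Phi> \<alpha>"
    using compact_spectral_truncation[OF pos_contraction_dres compact_dres[OF assms(1)] n0] by blast
  note \<Phi> = eigen_truncationD[OF T]
  have \<alpha>: "0 \<le> \<alpha> \<phi> \<and> \<alpha> \<phi> \<le> 1" if "\<phi> \<in> \<Phi>" for \<phi> using \<Phi>(4)[OF that] n0 by linarith
  have "\<exists>\<delta>>0. \<exists>Q Y. open Y \<and> emeasure lborel Y \<le> ennreal ((1/2) ^ n) \<and>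
    (\<forall>y\<in>{0..1}. 0 \<le> poly Q y \<and> poly Q y \<le> 1) \<and> (\<forall>y\<in>{0..1} - Y. poly Q y \<le> (1/2) ^ n) \<and>
    (\<forall>A. pos_contraction A \<longrightarrow> (\<forall>\<phi>\<in>\<Phi>. norm (A \<phi> - \<alpha> \<phi> *\<^sub>R \<phi>) \<le> \<delta>) \<longrightarrow>
       (\<forall>h\<in>span \<Phi>. norm (h - poly_op A Q h) \<le> (1/2) ^ n * norm h))"
    by (rule spectral_selector[OF \<Phi>(1,2) _ n0]) (rule \<alpha>)
  then obtain \<delta> Q Y where \<delta>: "\<delta> > 0" and Y: "open Y" "emeasure lborel Y \<le> ennreal ((1/2) ^ n)"
    and Q: "\<forall>y\<in>{0..1}. 0 \<le> poly Q y \<and> poly Q y \<le> 1" "\<forall>y\<in>{0..1} - Y. poly Q y \<le> (1/2) ^ n"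
    and A: "\<forall>A. pos_contraction A \<longrightarrow> (\<forall>\<phi>\<in>\<Phi>. norm (A \<phi> - \<alpha> \<phi> *\<^sub>R \<phi>) \<le> \<delta>) \<longrightarrow>
        (\<forall>h\<in>span \<Phi>. norm (h - poly_op A Q h) \<le> (1/2) ^ n * norm h)"
    by (elim exE conjE)
  \<comment> \<open>Decreasing the tolerance only weakens the claim, so \<beta> can be made as small
    as later stages require.\<close>
  have "\<forall>A. pos_contraction A \<longrightarrow> (\<forall>\<phi>\<in>\<Phi>. norm (A \<phi> - \<alpha> \<phi> *\<^sub>R \<phi>) \<le> min \<delta> B) \<longrightarrow>
        (\<forall>h\<in>span \<Phi>. norm (h - poly_op A Q h) \<le> (1/2) ^ n * norm h)"
    using A by simp
  then have "selected n U (min \<delta> B)" unfolding selected_def using T Y Q by blast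
  then show ?thesis using \<delta> assms(2) by (intro exI[of _ "min \<delta> B"]) auto
qed

lemma has_dim_pos_nonzero:
  assumes "has_dim E m" "m > 0" shows "\<exists>x\<in>E. x \<noteq> 0"
proof -
  obtain B where B: "finite B" "independent B" "span B = E" "card B = m" using assms(1) by (auto simp: has_dim_def)
  obtain x where x: "x \<in> B" using B(4) assms(2) by fastforce
  have "x \<noteq> 0" using x B(2) real_vector.dependent_zero by blast
  moreover have "x \<in> E" using x B(3) span_base by blast
  ultimately show ?thesis by blast
qed

lemma dres_nonzero:
  assumes \<Omega>: "open (\<Omega> :: 'a::euclidean_space set)" "\<Omega> \<noteq> {}"
  shows "\<exists>f. dres \<Omega> f \<noteq> 0"
proof -
  obtain x where "x \<in> \<Omega>" using \<Omega>(2) by blast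
  then obtain r where r: "r > 0" "ball x r \<subseteq> \<Omega>" using \<Omega>(1) open_contains_ball by blast
  let ?i = "\<lambda>y. indicator (ball x r) y :: real"
  have L: "L2_fun ?i"
  proof -
    have "ball x r \<in> lmeasurable" by (intro bounded_set_imp_lmeasurable) auto
    then have "integrable lebesgue ?i" by (intro integrable_real_indicator) (auto simp: fmeasurable_def)
    moreover have "(norm (?i y))\<^sup>2 = ?i y" for y by (simp add: indicator_def)
    ultimately show ?thesis unfolding L2_fun_def by auto
  qed
  have "restr \<Omega> (abs_l2 ?i) = abs_l2 ?i"
    by (rule restr_abs_l2_self[OF _ L]) (use \<Omega>(1) r(2) in \<open>auto simp: indicator_def\<close>)
  moreover have "abs_l2 ?i \<noteq> 0"
  proof
    assume "abs_l2 ?i = 0"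
    then have "AE y in lebesgue. ?i y = 0" using abs_l2_eq_iff[OF L L2_fun_zero] by (simp add: abs_l2_zero)
    then have "AE y in lebesgue. y \<notin> ball x r" by eventually_elim (auto simp: indicator_def split: if_splits)
    then have "negligible (ball x r)"
      unfolding negligible_iff_null_sets by (subst AE_iff_null_sets) auto
    then show False using open_not_negligible[of "ball x r"] r(1) by auto
  qed
  ultimately show ?thesis using dres_injective[OF \<Omega>(1)] by blast
qed

text \<open>\<open>\<beta>\<close> bounds the total effect of all later modifications on functions supported in \<open>U\<close>.\<close>

definition stage :: "'a::euclidean_space \<Rightarrow> 'a \<Rightarrow> nat \<Rightarrow> real \<Rightarrow> nat \<Rightarrow> 'a set \<times> real \<times> real \<times> ('a, real) l2 \<times> real \<Rightarrow> bool" where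
  "stage e e2 m a0 n = (\<lambda>(U, b, a, u, \<beta>). admissible e e2 U b \<and> a > 0 \<and> u \<in> eigenspace (dres U) a \<and>
     has_dim (eigenspace (dres U) a) m \<and> \<beta> > 0 \<and> selected n U \<beta> \<and> (n = 0 \<longrightarrow> norm u = 1 \<and> a = a0))"

text \<open>The norm estimate compares with the old set together with the detached room, since
  attaching a room is not a small perturbation. The growth of \<open>b' - b\<close> with
  \<open>n\<close> makes the rooms arbitrarily large, and halving \<beta> makes the errors
  summable.\<close>

definition stage_step :: "'a::euclidean_space \<Rightarrow> real \<Rightarrow> nat \<Rightarrow> 'a set \<times> real \<times> real \<times> ('a, real) l2 \<times> real \<Rightarrow>
    'a set \<times> real \<times> real \<times> ('a, real) l2 \<times> real \<Rightarrow> bool" where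
  "stage_step e \<kappa> n = (\<lambda>(U, b, a, u, \<beta>) (U', b', a', u', \<beta>'). (\<exists>s. U' = U \<union> room e b b' \<union> tube e b s) \<and>
     b + 1 + real n \<le> b' \<and> \<beta>' \<le> \<beta> / 2 \<and>
     (\<forall>f. norm (dres U' f - dres (U \<union> room e b b') f) \<le> \<beta> / 2 * norm f) \<and>
     norm (u' - u) \<le> \<kappa> * (1/2) ^ n \<and> \<bar>a' - a\<bar> \<le> \<kappa> * (1/2) ^ n)"

context
  fixes e e2 :: "'a::euclidean_space"
  assumes e: "e \<in> Basis" "e2 \<in> Basis" "e \<noteq> e2"
begin

text \<open>The minimum is taken over all admissible sets and all their eigenvalues at once.
  Extensions stay in this class, so minimality remains available at every stage.\<close>

lemma minimal_multiplicity:
  obtains m U b a where "m > 0" "admissible e e2 U b" "a > 0" "has_dim (eigenspace (dres U) a) m"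
    "\<forall>U b a n. admissible e e2 U b \<longrightarrow> a > 0 \<longrightarrow> eigenspace (dres U) a \<noteq> {0} \<longrightarrow> has_dim (eigenspace (dres U) a) n \<longrightarrow> m \<le> n"
proof -
  define P where "P n \<longleftrightarrow> (\<exists>U b a. admissible e e2 U b \<and> a > 0 \<and> eigenspace (dres U) a \<noteq> {0} \<and> has_dim (eigenspace (dres U) a) n)" for n
  have "\<exists>n. P n"
  proof -
    let ?U = "room e 0 1"
    have U: "admissible e e2 ?U 1" by (rule admissible_room[OF e]) simp
    then have "open ?U" "?U \<noteq> {}" "bounded ?U" by (auto simp: admissible_def)
    then obtain f where f: "dres ?U f \<noteq> 0" using dres_nonzero[of ?U] by blast
    note C = pos_contraction_dres[of ?U] compact_dres[OF \<open>bounded ?U\<close>]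
    obtain a where a: "a > 0" "eigenspace (dres ?U) a \<noteq> {0}" using compact_eigenvalue_exists[OF C f] by blast
    obtain n where "has_dim (eigenspace (dres ?U) a) n" using eigenspace_finite_dim[OF C a(1)] .
    then show ?thesis unfolding P_def using U a by blast
  qed
  then have P: "P (LEAST n. P n)" by (rule LeastI_ex)
  then obtain U b a where U: "admissible e e2 U b" "a > 0" "eigenspace (dres U) a \<noteq> {0}" "has_dim (eigenspace (dres U) a) (LEAST n. P n)"
    unfolding P_def by blast
  have "(LEAST n. P n) > 0"
  proof (rule ccontr)
    assume "\<not> (LEAST n. P n) > 0"
    then obtain B where "finite B" "span B = eigenspace (dres U) a" "card B = 0" using U(4) by (auto simp: has_dim_def)
    then show False using U(3) by auto
  qed
  moreover have "(LEAST n. P n) \<le> n"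
    if "admissible e e2 U b" "a > 0" "eigenspace (dres U) a \<noteq> {0}" "has_dim (eigenspace (dres U) a) n" for U b a n
    using that by (intro Least_le) (auto simp: P_def)
  ultimately show ?thesis using that[of "LEAST n. P n" U b a] U by blast
qed

text \<open>The order of choices: first a non-resonant room, so that the eigenspace does not change;
  then the persistence threshold of the set with this room attached; finally a tube thin enough for
  that threshold and for \<beta>.\<close>

lemma extend_stage:
  assumes m: "m > 0"
    and min: "\<forall>U b a n. admissible e e2 U b \<longrightarrow> a > 0 \<longrightarrow> eigenspace (dres U) a \<noteq> {0} \<longrightarrow> has_dim (eigenspace (dres U) a) n \<longrightarrow> m \<le> n"
    and U: "admissible e e2 U b" and a: "a > 0" and u: "u \<in> eigenspace (dres U) a" and dim: "has_dim (eigenspace (dres U) a) m"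
    and \<beta>: "\<beta> > 0" and \<eta>: "\<eta> > 0"
  shows "\<exists>b' s a' u' \<beta>'. 0 < s \<and> b + 1 + real n \<le> b' \<and> admissible e e2 (U \<union> room e b b' \<union> tube e b s) b' \<and> a' > 0 \<and>
    u' \<in> eigenspace (dres (U \<union> room e b b' \<union> tube e b s)) a' \<and>
    has_dim (eigenspace (dres (U \<union> room e b b' \<union> tube e b s)) a') m \<and> 0 < \<beta>' \<and> \<beta>' \<le> \<beta> / 2 \<and>
    selected (Suc n) (U \<union> room e b b' \<union> tube e b s) \<beta>' \<and>
    (\<forall>f. norm (dres (U \<union> room e b b' \<union> tube e b s) f - dres (U \<union> room e b b') f) \<le> \<beta> / 2 * norm f) \<and>
    norm (u' - u) \<le> \<eta> \<and> \<bar>a' - a\<bar> \<le> \<eta>"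
proof -
  have Uo: "open U" "bounded U" "\<And>x. x \<in> U \<Longrightarrow> x \<bullet> e < b" using U by (auto simp: admissible_def)
  obtain x where x: "x \<in> eigenspace (dres U) a" "x \<noteq> 0" using has_dim_pos_nonzero[OF dim m] by blast
  have a1: "a < 1" by (rule eigenvalue_less_1[OF e Uo(2) _ x(2)]) (use x(1) in \<open>simp add: eigenspace_def\<close>)
  obtain b' where b': "b + (1 + real n) \<le> b'" "b < b'" "eigenspace (dres (room e b b')) a = {0}"
    using nonresonant_room[OF e a a1, of b "1 + real n"] by blast
  let ?V = "U \<union> room e b b'"
  have Vb: "bounded ?V" using Uo(2) bounded_room[OF e b'(2)] by simp
  have eq: "eigenspace (dres ?V) a = eigenspace (dres U) a"
  proof (rule eigenspace_disjoint_union[OF Uo(1) open_room[OF e] Uo(3) _ _ b'(3)])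
    show "x \<bullet> e > b" if "x \<in> room e b b'" for x using that by (auto simp: room_def)
    show "a \<noteq> 0" using a by simp
  qed
  \<comment> \<open>Persistence controls the displacement relative to \<open>norm u\<close>; this
    choice turns it into the absolute bound \<eta>, which also bounds the eigenvalue.\<close>
  define \<eta>' where "\<eta>' = \<eta> / (1 + norm u)"
  have n1: "1 + norm u > 0" by (simp add: add_pos_nonneg)
  have \<eta>': "\<eta>' > 0" "\<eta>' \<le> \<eta>" "\<eta>' * norm u \<le> \<eta>"
  proof -
    show "\<eta>' > 0" using \<eta> n1 by (simp add: \<eta>'_def)
    show "\<eta>' \<le> \<eta>" using \<eta> n1 by (simp add: \<eta>'_def divide_le_eq mult_le_cancel_left1)
    have "\<eta>' * norm u = \<eta> * (norm u / (1 + norm u))" by (simp add: \<eta>'_def)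
    also have "\<dots> \<le> \<eta> * 1" using \<eta> n1 by (intro mult_left_mono) (auto simp: divide_le_eq_1)
    finally show "\<eta>' * norm u \<le> \<eta>" by simp
  qed
  have dimV: "has_dim (eigenspace (dres ?V) a) m" using dim eq by simp
  obtain \<delta> where \<delta>: "\<delta> > 0" and pers: "\<And>L u. \<lbrakk>pos_contraction L; compact_op L; \<And>x. norm (L x - dres ?V x) \<le> \<delta> * norm x;
        \<And>b n. b > 0 \<Longrightarrow> eigenspace L b \<noteq> {0} \<Longrightarrow> has_dim (eigenspace L b) n \<Longrightarrow> m \<le> n;
        u \<in> eigenspace (dres ?V) a\<rbrakk>
      \<Longrightarrow> \<exists>b v. b > 0 \<and> \<bar>b - a\<bar> \<le> \<eta>' \<and> v \<in> eigenspace L b \<and> norm (v - u) \<le> \<eta>' * norm u \<and>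
            has_dim (eigenspace L b) m"
    by (rule eigenvector_persistence[OF pos_contraction_dres compact_dres[OF Vb] a dimV m \<eta>'(1)]) blast
  \<comment> \<open>The tube serves two purposes: \<delta> keeps the eigenvector, and
    \<open>\<beta> / 2\<close> protects what was selected at earlier stages.\<close>
  have d0: "min \<delta> (\<beta> / 2) > 0" using \<delta> \<beta> by simp
  have b1: "b + 1 \<le> b'" using b'(1) by simp
  obtain s where s: "0 < s" "s < 1/2"
    "\<And>f. norm (dres (?V \<union> tube e b s) f - dres ?V f) \<le> min \<delta> (\<beta> / 2) * norm f"
    using tube_close[OF e U b1 d0] by blast
  let ?W = "?V \<union> tube e b s"
  have W: "admissible e e2 ?W b'" by (rule admissible_extend[OF e U b'(2) s(1)]) (use s(2) b1 in simp)
  then have Wb: "bounded ?W" by (simp add: admissible_def)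
  have "\<exists>b v. b > 0 \<and> \<bar>b - a\<bar> \<le> \<eta>' \<and> v \<in> eigenspace (dres ?W) b \<and> norm (v - u) \<le> \<eta>' * norm u \<and>
            has_dim (eigenspace (dres ?W) b) m"
  proof (rule pers[OF pos_contraction_dres compact_dres[OF Wb]])
    show "norm (dres ?W x - dres ?V x) \<le> \<delta> * norm x" for x
      by (rule order_trans[OF s(3) mult_right_mono[OF min.cobounded1 norm_ge_zero]])
    show "m \<le> k" if "c > 0" "eigenspace (dres ?W) c \<noteq> {0}" "has_dim (eigenspace (dres ?W) c) k" for c k
      by (rule min[rule_format, OF W that])
    show "u \<in> eigenspace (dres ?V) a" using u eq by simp
  qed
  then obtain a' u' where a': "a' > 0" "\<bar>a' - a\<bar> \<le> \<eta>'" "u' \<in> eigenspace (dres ?W) a'" "norm (u' - u) \<le> \<eta>' * norm u"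
    "has_dim (eigenspace (dres ?W) a') m" by blast
  obtain \<beta>' where \<beta>': "\<beta>' > 0" "\<beta>' \<le> \<beta> / 2" "selected (Suc n) ?W \<beta>'"
    using selected_exists[OF Wb, of "\<beta> / 2" "Suc n"] \<beta> by auto
  have close: "\<forall>f. norm (dres ?W f - dres ?V f) \<le> \<beta> / 2 * norm f"
    by (rule allI, rule order_trans[OF s(3) mult_right_mono[OF min.cobounded2 norm_ge_zero]])
  have "norm (u' - u) \<le> \<eta>" "\<bar>a' - a\<bar> \<le> \<eta>" using a'(2,4) \<eta>'(2,3) by auto
  then show ?thesis
    using s(1) b'(1) W a'(1,3,5) \<beta>' close
    by - (rule exI[of _ b'], rule exI[of _ s], rule exI[of _ a'], rule exI[of _ u'], rule exI[of _ \<beta>'], simp only: add.assoc simp_thms)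
qed

lemma stages_exist:
  obtains a0 \<kappa> U b a u \<beta> m where "0 < a0" "a0 < 1" "0 < \<kappa>" "\<kappa> \<le> a0 / 8" "\<kappa> \<le> (1 - a0) / 8"
    "\<And>n. stage e e2 m a0 n (U n, b n, a n, u n, \<beta> n)"
    "\<And>n. stage_step e \<kappa> n (U n, b n, a n, u n, \<beta> n) (U (Suc n), b (Suc n), a (Suc n), u (Suc n), \<beta> (Suc n))"
proof -
  obtain m U0 b0 a0 where m: "m > 0" "admissible e e2 U0 b0" "a0 > 0" "has_dim (eigenspace (dres U0) a0) m"
    and min: "\<forall>U b a n. admissible e e2 U b \<longrightarrow> a > 0 \<longrightarrow> eigenspace (dres U) a \<noteq> {0} \<longrightarrow> has_dim (eigenspace (dres U) a) n \<longrightarrow> m \<le> n"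
    by (rule minimal_multiplicity)
  obtain x where x: "x \<in> eigenspace (dres U0) a0" "x \<noteq> 0" using has_dim_pos_nonzero[OF m(4,1)] by blast
  have U0b: "bounded U0" using m(2) by (simp add: admissible_def)
  have a1: "a0 < 1" by (rule eigenvalue_less_1[OF e U0b _ x(2)]) (use x(1) in \<open>simp add: eigenspace_def\<close>)
  \<comment> \<open>The increments \<open>\<kappa> * (1/2) ^ n\<close> sum to
    \<open>2 * \<kappa>\<close>, at most a quarter of the distances from \<open>a0\<close> to 0 and
    to 1. Hence the limit eigenvalue lies strictly between 0 and 1, and the unit vector moves by
    less than its length.\<close>
  define \<kappa> where "\<kappa> = min (a0 / 8) ((1 - a0) / 8)"
  have \<kappa>: "\<kappa> > 0" "\<kappa> \<le> a0 / 8" "\<kappa> \<le> (1 - a0) / 8" using m(3) a1 by (auto simp only: \<kappa>_def min_less_iff_conj min_le_iff_disj) auto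
  define u0 where "u0 = (1 / norm x) *\<^sub>R x"
  have u0: "u0 \<in> eigenspace (dres U0) a0" "norm u0 = 1"
    using x subspace_scale[OF subspace_eigenspace[OF pos_contraction_dres] x(1)] by (auto simp: u0_def)
  obtain \<beta>0 where \<beta>0: "\<beta>0 > 0" "selected 0 U0 \<beta>0" using selected_exists[OF U0b, of 1 0] by auto
  have "\<exists>f. \<forall>n. stage e e2 m a0 n (f n) \<and> stage_step e \<kappa> n (f n) (f (Suc n))"
  proof (rule dependent_nat_choice)
    show "\<exists>x. stage e e2 m a0 0 x"
      by (rule exI[of _ "(U0, b0, a0, u0, \<beta>0)"]) (use m u0 \<beta>0 in \<open>simp add: stage_def\<close>)
    fix x n assume st: "stage e e2 m a0 n x"
    obtain U b a u \<beta> where xe: "x = (U, b, a, u, \<beta>)" by (metis surj_pair)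
    have st': "admissible e e2 U b" "a > 0" "u \<in> eigenspace (dres U) a" "has_dim (eigenspace (dres U) a) m" "\<beta> > 0"
      using st by (auto simp: stage_def xe)
    have \<eta>: "\<kappa> * (1/2) ^ n > 0" using \<kappa>(1) by simp
    from extend_stage[where n = n and m = m, OF m(1) min st' \<eta>]
    obtain b' s a' u' \<beta>' where *: "b + 1 + real n \<le> b'" "admissible e e2 (U \<union> room e b b' \<union> tube e b s) b'" "a' > 0"
      "u' \<in> eigenspace (dres (U \<union> room e b b' \<union> tube e b s)) a'"
      "has_dim (eigenspace (dres (U \<union> room e b b' \<union> tube e b s)) a') m" "0 < \<beta>'" "\<beta>' \<le> \<beta> / 2"
      "selected (Suc n) (U \<union> room e b b' \<union> tube e b s) \<beta>'"
      "\<forall>f. norm (dres (U \<union> room e b b' \<union> tube e b s) f - dres (U \<union> room e b b') f) \<le> \<beta> / 2 * norm f"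
      "norm (u' - u) \<le> \<kappa> * (1/2) ^ n" "\<bar>a' - a\<bar> \<le> \<kappa> * (1/2) ^ n"
      by (elim exE conjE)
    show "\<exists>y. stage e e2 m a0 (Suc n) y \<and> stage_step e \<kappa> n x y"
    proof (intro exI conjI)
      show "stage e e2 m a0 (Suc n) (U \<union> room e b b' \<union> tube e b s, b', a', u', \<beta>')"
        unfolding stage_def using * by simp
      show "stage_step e \<kappa> n x (U \<union> room e b b' \<union> tube e b s, b', a', u', \<beta>')"
        unfolding stage_step_def xe prod.case using *(1,7,9,10,11) by (intro conjI exI[of _ s]) (rule refl | assumption)+
    qed
  qed
  then obtain f where f: "\<And>n. stage e e2 m a0 n (f n)" "\<And>n. stage_step e \<kappa> n (f n) (f (Suc n))" by blast
  show ?thesis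
    by (rule that[of a0 \<kappa> m "\<lambda>n. fst (f n)" "\<lambda>n. fst (snd (f n))" "\<lambda>n. fst (snd (snd (f n)))"
          "\<lambda>n. fst (snd (snd (snd (f n))))" "\<lambda>n. snd (snd (snd (snd (f n))))"])
       (use m(3) a1 \<kappa> f in auto)
qed

end

section \<open>The limit domain\<close>

lemma restr_mono_self:
  assumes "open S" "open T" "S \<subseteq> T" "restr S f = f" shows "restr T f = f"
proof -
  have "restr T (restr S f) = restr (T \<inter> S) f" using assms by (intro restr_restr) auto
  also have "T \<inter> S = S" using assms(3) by blast
  finally show ?thesis using assms(4) by simp
qed

text \<open>A detached room does not see a function supported in \<open>U\<close>. This converts the
  norm estimate for the tube into one between consecutive stages, valid for such functions.\<close>

lemma dres_beyond_support:
  assumes U: "open U" "open W" "\<And>x. x \<in> U \<Longrightarrow> x \<bullet> e < b" "\<And>x. x \<in> W \<Longrightarrow> x \<bullet> e > b"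
    and f: "restr U f = f"
  shows "dres (U \<union> W) f = dres U f"
proof -
  have "W \<inter> U = {}" using U(3,4) by fastforce
  then have "restr W (restr U f) = 0" using U(1,2) by (subst restr_restr) (auto simp: restr_empty)
  then have "dres W f = dres W 0" using dres_support(2)[OF U(2), of f] f by simp
  also have "\<dots> = 0" by (rule linear_0[OF pos_contraction_linear[OF pos_contraction_dres]])
  finally show ?thesis using dres_disjoint_union[OF U, of f] by simp
qed

lemma dres_eigenvector_support:
  assumes "open U" "dres U u = a *\<^sub>R u" "a \<noteq> 0" shows "restr U u = u"
proof -
  have "restr U (dres U u) = dres U u" by (rule dres_support(1)[OF assms(1)])
  moreover have "restr U (a *\<^sub>R u) = a *\<^sub>R restr U u" using assms(1) by (intro linear_cmul linear_restr) simp
  ultimately have "a *\<^sub>R restr U u = a *\<^sub>R u" using assms(2) by simp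
  then show ?thesis using assms(3) by simp
qed

context
  fixes U :: "nat \<Rightarrow> 'a::euclidean_space set" and \<beta> :: "nat \<Rightarrow> real"
  assumes U: "\<And>n. open (U n)" "\<And>n. U n \<subseteq> U (Suc n)"
    and step: "\<And>n f. restr (U n) f = f \<Longrightarrow> norm (dres (U (Suc n)) f - dres (U n) f) \<le> \<beta> n / 2 * norm f"
    and \<beta>: "\<And>n. \<beta> n > 0" "\<And>n. \<beta> (Suc n) \<le> \<beta> n / 2"
begin

lemma dres_limit_estimate:
  assumes f: "restr (U n) f = f"
  shows "norm (dres (\<Union>n. U n) f - dres (U n) f) \<le> \<beta> n * norm f"
proof -
  have supp: "restr (U (n + j)) f = f" for j
    by (rule restr_mono_self[OF U(1) U(1) _ f]) (rule lift_Suc_mono_le[of U, OF U(2)], simp)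
  \<comment> \<open>Halving gives \<open>\<beta> k / 2 \<le> \<beta> k - \<beta> (Suc k)\<close>, so
    the errors telescope and the total stays below \<open>\<beta> n\<close>.\<close>
  have est: "norm (dres (U (n + j)) f - dres (U n) f) \<le> (\<beta> n - \<beta> (n + j)) * norm f" for j
  proof (induction j)
    case (Suc j)
    have "norm (dres (U (n + Suc j)) f - dres (U n) f)
        \<le> norm (dres (U (Suc (n + j))) f - dres (U (n + j)) f) + norm (dres (U (n + j)) f - dres (U n) f)"
      using norm_triangle_ineq[of "dres (U (Suc (n + j))) f - dres (U (n + j)) f" "dres (U (n + j)) f - dres (U n) f"] by simp
    also have "\<dots> \<le> \<beta> (n + j) / 2 * norm f + (\<beta> n - \<beta> (n + j)) * norm f"
      by (intro add_mono Suc step supp)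
    also have "\<dots> = (\<beta> n - \<beta> (n + j) / 2) * norm f" by (simp add: field_simps)
    also have "\<dots> \<le> (\<beta> n - \<beta> (n + Suc j)) * norm f"
      using \<beta>(2)[of "n + j"] by (intro mult_right_mono) auto
    finally show ?case .
  qed simp
  have "(\<lambda>j. dres (U (j + n)) f) \<longlonglongrightarrow> dres (\<Union>n. U n) f"
    by (rule LIMSEQ_ignore_initial_segment[OF dres_exhaustion[of U, OF U]])
  then have "(\<lambda>j. norm (dres (U (j + n)) f - dres (U n) f)) \<longlonglongrightarrow> norm (dres (\<Union>n. U n) f - dres (U n) f)"
    by (intro tendsto_intros)
  moreover have "norm (dres (U (j + n)) f - dres (U n) f) \<le> \<beta> n * norm f" for j
  proof -
    have "(\<beta> n - \<beta> (n + j)) * norm f \<le> \<beta> n * norm f" using \<beta>(1)[of "n + j"] by (intro mult_right_mono) auto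
    then show ?thesis using est[of j] by (simp add: add.commute)
  qed
  ultimately show ?thesis by (intro LIMSEQ_le_const2) auto
qed

lemma stage_bounds_tendsto_0: "\<beta> \<longlonglongrightarrow> 0"
proof (rule tendsto_sandwich[of "\<lambda>_. 0" _ _ "\<lambda>n. \<beta> 0 * (1/2) ^ n"])
  have "\<beta> n \<le> \<beta> 0 * (1/2) ^ n" for n
  proof (induction n)
    case (Suc n) then show ?case using \<beta>(2)[of n] by simp
  qed simp
  then show "eventually (\<lambda>n. \<beta> n \<le> \<beta> 0 * (1/2) ^ n) sequentially" by simp
  show "eventually (\<lambda>n. 0 \<le> \<beta> n) sequentially" using \<beta>(1) by (simp add: less_imp_le)
  show "(\<lambda>n. \<beta> 0 * (1/2) ^ n) \<longlonglongrightarrow> 0" by (intro tendsto_mult_right_zero LIMSEQ_realpow_zero) auto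
qed simp

text \<open>An eigenvector of stage \<open>n\<close> is supported in \<open>U n\<close>, so the
  final resolvent treats it as an eigenvector up to \<open>\<beta> n\<close>; this error vanishes
  along the convergent sequence.\<close>

lemma dres_limit_eigenvector:
  assumes u: "\<And>n. dres (U n) (u n) = a n *\<^sub>R u n" "\<And>n. a n \<noteq> 0"
    and lim: "u \<longlonglongrightarrow> v" "a \<longlonglongrightarrow> c"
  shows "dres (\<Union>n. U n) v = c *\<^sub>R v"
proof -
  let ?A = "dres (\<Union>n. U n)"
  have "(\<lambda>n. ?A (u n) - a n *\<^sub>R u n) \<longlonglongrightarrow> 0"
  proof (rule Lim_null_comparison)
    have "norm (?A (u n) - a n *\<^sub>R u n) \<le> \<beta> n * norm (u n)" for n
      using dres_limit_estimate[OF dres_eigenvector_support[OF U(1) u(1,2)], of n] by (simp add: u(1))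
    then show "eventually (\<lambda>n. norm (?A (u n) - a n *\<^sub>R u n) \<le> \<beta> n * norm (u n)) sequentially" by simp
    show "(\<lambda>n. \<beta> n * norm (u n)) \<longlonglongrightarrow> 0"
      using tendsto_mult[OF stage_bounds_tendsto_0 tendsto_norm[OF lim(1)]] by simp
  qed
  moreover have "(\<lambda>n. ?A (u n) - a n *\<^sub>R u n) \<longlonglongrightarrow> ?A v - c *\<^sub>R v"
    by (intro tendsto_diff tendsto_scaleR lim pos_contraction_tendsto[OF pos_contraction_dres])
  ultimately have "?A v - c *\<^sub>R v = 0" by (rule LIMSEQ_unique[rotated])
  then show ?thesis by simp
qed

text \<open>The eigenvectors selected at stage \<open>n\<close> are moved by at most
  \<open>\<beta> n\<close> when the final resolvent replaces that of the stage, so all selected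
  polynomials apply to one operator, and \<open>spectrally_singular_imp_zero\<close> gives
  \<open>A f = 0\<close>.\<close>

lemma selected_exhaustion_ac_empty:
  assumes sel: "\<And>n. selected n (U n) (\<beta> n)"
  shows "dirichlet_ac_spectrum_empty (\<Union>n. U n)"
  unfolding dirichlet_ac_spectrum_empty_def
proof
  let ?O = "\<Union>n. U n"
  let ?A = "dres ?O"
  have O: "open ?O" using U(1) by auto
  fix f assume "f \<in> ac_subspace ?O"
  then obtain \<mu> where f: "f \<in> L2_on ?O" and \<mu>: "is_spectral_measure ?O f \<mu>" and ac: "absolutely_continuous lborel \<mu>"
    unfolding ac_subspace_def by blast
  have L: "L2_fun f" using f by (simp add: L2_on_def L2_fun_iff_nn_integral)
  let ?F = "abs_l2 f"
  have meas: "sets \<mu> = sets borel" "finite_measure \<mu>" "emeasure \<mu> {..<0} = 0"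
    and res: "\<And>s w. s > 0 \<Longrightarrow> dirichlet_resolvent ?O s f w \<Longrightarrow> (\<integral> x. w x * f x \<partial>lebesgue) = (\<integral> t. 1 / (t + s) \<partial>\<mu>)"
    using \<mu> by (auto simp: is_spectral_measure_def)
  have A: "pos_contraction ?A" by (rule pos_contraction_dres)
  have mom: "op_power ?A (Suc k) ?F \<bullet> ?F = (\<integral> t. (1 / (1 + t)) ^ Suc k \<partial>\<mu>)" for k
  proof (rule spectral_moments[OF meas A])
    fix s :: real and w assume s: "0 < s" and w: "w = ?A (?F + (1 - s) *\<^sub>R w)"
    show "w \<bullet> ?F = (\<integral> t. 1 / (t + s) \<partial>\<mu>)"
      using res[OF s dirichlet_resolvent_dres[OF L w]] inner_rep_abs[OF L, of w] by simp
  qed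
  obtain \<Phi> \<alpha> Q Y where T: "\<And>n. eigen_truncation (dres (U n)) ((1/2) ^ n) (\<Phi> n) (\<alpha> n)" and Y: "\<And>n. open (Y n)"
      "\<And>n. emeasure lborel (Y n) \<le> ennreal ((1/2) ^ n)"
    and Q: "\<And>n. \<forall>y\<in>{0..1}. 0 \<le> poly (Q n) y \<and> poly (Q n) y \<le> 1" "\<And>n. \<forall>y\<in>{0..1} - Y n. poly (Q n) y \<le> (1/2) ^ n"
    and S: "\<And>n. \<forall>A. pos_contraction A \<longrightarrow> (\<forall>\<phi>\<in>\<Phi> n. norm (A \<phi> - \<alpha> n \<phi> *\<^sub>R \<phi>) \<le> \<beta> n) \<longrightarrow>
        (\<forall>h\<in>span (\<Phi> n). norm (h - poly_op A (Q n) h) \<le> (1/2) ^ n * norm h)"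
    using sel unfolding selected_def by metis
  \<comment> \<open>The stage resolvent applied to \<open>f\<close> is approximated in the span of
    its eigenvectors; by exhaustion these approximants tend to the final resolvent applied to
    \<open>f\<close>.\<close>
  have "\<forall>n. \<exists>h. h \<in> span (\<Phi> n) \<and> norm (dres (U n) ?F - h) \<le> (1/2) ^ n * norm ?F"
  proof
    fix n show "\<exists>h. h \<in> span (\<Phi> n) \<and> norm (dres (U n) ?F - h) \<le> (1/2) ^ n * norm ?F"
      using compact_approx_by_eigenvectors[OF pos_contraction_dres T[of n], of ?F] by auto
  qed
  then obtain h where h: "\<And>n. h n \<in> span (\<Phi> n)" "\<And>n. norm (dres (U n) ?F - h n) \<le> (1/2) ^ n * norm ?F" by metis
  have "norm (h n - poly_op ?A (Q n) (h n)) \<le> (1/2) ^ n * norm (h n)" for n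
  proof -
    note \<Phi> = eigen_truncationD[OF T[of n]]
    have "norm (?A \<phi> - \<alpha> n \<phi> *\<^sub>R \<phi>) \<le> \<beta> n" if \<phi>: "\<phi> \<in> \<Phi> n" for \<phi>
    proof -
      have "(0::real) < (1/2) ^ n" by simp
      then have "\<alpha> n \<phi> \<noteq> 0" using \<Phi>(4)[OF \<phi>] by linarith
      then have "norm (?A \<phi> - dres (U n) \<phi>) \<le> \<beta> n * norm \<phi>"
        by (intro dres_limit_estimate dres_eigenvector_support[OF U(1) \<Phi>(3)[OF \<phi>]])
      moreover have "norm \<phi> = 1" using \<Phi>(2) \<phi> by (simp add: orthonormal_def)
      ultimately show ?thesis using \<Phi>(3)[OF \<phi>] by simp
    qed
    then show ?thesis using S[of n] A h(1)[of n] by simp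
  qed
  moreover have "h \<longlonglongrightarrow> ?A ?F"
  proof -
    have "(\<lambda>n. dres (U n) ?F - h n) \<longlonglongrightarrow> 0"
    proof (rule Lim_null_comparison)
      show "eventually (\<lambda>n. norm (dres (U n) ?F - h n) \<le> (1/2) ^ n * norm ?F) sequentially" using h(2) by simp
      show "(\<lambda>n. (1/2) ^ n * norm ?F) \<longlonglongrightarrow> 0" by (intro tendsto_mult_left_zero LIMSEQ_realpow_zero) auto
    qed
    from tendsto_diff[OF dres_exhaustion[of U ?F, OF U] this] show ?thesis by simp
  qed
  ultimately have "?A ?F = 0"
    using Q by (intro spectrally_singular_imp_zero[OF meas A ac mom Y, where Q = Q and h = h]) auto
  moreover have "restr ?O ?F = ?F"
    using f O by (intro restr_abs_l2_self L) (auto simp: L2_on_def)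
  ultimately have "?F = 0" using dres_injective[OF O] by blast
  then show "AE x in lebesgue. f x = 0" using abs_l2_eq_iff[OF L L2_fun_zero] by (simp add: abs_l2_zero)
qed

end

lemma connected_increasing_union:
  assumes "\<And>n::nat. connected (U n)" "\<And>n. U n \<subseteq> U (Suc n)" "U 0 \<noteq> {}"
  shows "connected (\<Union>n. U n)"
proof (rule connected_Union)
  have "U 0 \<subseteq> U n" for n by (rule lift_Suc_mono_le[of U, OF assms(2)]) simp
  then show "\<Inter> (range U) \<noteq> {}" using assms(3) by blast
qed (use assms(1) in auto)

lemma quasi_conical_domain_exists:
  assumes "DIM('a::euclidean_space) \<ge> 2"
  shows "\<exists>\<Omega>::'a set. open \<Omega> \<and> connected \<Omega> \<and> quasi_conical \<Omega> \<and> dirichlet_ac_spectrum_empty \<Omega> \<and>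
    (\<exists>lam>0. lam \<in> dirichlet_point_spectrum \<Omega>)"
proof -
  obtain e :: 'a where e1: "e \<in> Basis" using nonempty_Basis by blast
  \<comment> \<open>The dimension hypothesis supplies a second axis, the direction in which the
    Poincare inequality is applied.\<close>
  have "Basis \<noteq> {e}"
  proof
    assume "Basis = {e}"
    then have "DIM('a) = 1" by (metis card_1_singleton_iff One_nat_def)
    then show False using assms by simp
  qed
  then obtain e2 where e: "e \<in> Basis" "e2 \<in> Basis" "e \<noteq> e2" using e1 by blast
  obtain a0 \<kappa> U b a u \<beta> m where a0: "0 < a0" "a0 < 1" and \<kappa>: "0 < \<kappa>" "\<kappa> \<le> a0 / 8" "\<kappa> \<le> (1 - a0) / 8"
    and st: "\<And>n. stage e e2 m a0 n (U n, b n, a n, u n, \<beta> n)"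
    and ss: "\<And>n. stage_step e \<kappa> n (U n, b n, a n, u n, \<beta> n) (U (Suc n), b (Suc n), a (Suc n), u (Suc n), \<beta> (Suc n))"
    by (rule stages_exist[OF e]) blast
  have adm: "admissible e e2 (U n) (b n)" and an: "a n > 0" and un: "dres (U n) (u n) = a n *\<^sub>R u n"
    and \<beta>: "\<beta> n > 0" and sel: "selected n (U n) (\<beta> n)" for n
    using st[of n] by (auto simp: stage_def eigenspace_def)
  have st0: "norm (u 0) = 1" "a 0 = a0" using st[of 0] by (auto simp: stage_def)
  have Uo: "open (U n)" "connected (U n)" "U n \<noteq> {}" "\<And>x. x \<in> U n \<Longrightarrow> x \<bullet> e < b n" for n
    using adm[of n] by (auto simp: admissible_def)
  have nxt: "\<exists>s. U (Suc n) = U n \<union> room e (b n) (b (Suc n)) \<union> tube e (b n) s"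
    and bn: "b n + 1 + real n \<le> b (Suc n)" and \<beta>s: "\<beta> (Suc n) \<le> \<beta> n / 2"
    and cl: "norm (dres (U (Suc n)) f - dres (U n \<union> room e (b n) (b (Suc n))) f) \<le> \<beta> n / 2 * norm f"
    and us: "norm (u (Suc n) - u n) \<le> \<kappa> * (1/2) ^ n" and as: "norm (a (Suc n) - a n) \<le> \<kappa> * (1/2) ^ n" for n f
    using ss[of n] unfolding stage_step_def by simp_all
  have inc: "U n \<subseteq> U (Suc n)" and room: "room e (b n) (b (Suc n)) \<subseteq> U (Suc n)" for n using nxt[of n] by auto
  have step: "norm (dres (U (Suc n)) f - dres (U n) f) \<le> \<beta> n / 2 * norm f" if f: "restr (U n) f = f" for n f
  proof -
    have "dres (U n \<union> room e (b n) (b (Suc n))) f = dres (U n) f"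
      by (rule dres_beyond_support[OF Uo(1) open_room[OF e] Uo(4) _ f]) (auto simp: room_def)
    then show ?thesis using cl[of n f] by simp
  qed
  note ctx = Uo(1) inc step \<beta> \<beta>s
  let ?O = "\<Union>n. U n"
  obtain v where v: "u \<longlonglongrightarrow> v" "norm (v - u 0) \<le> 2 * \<kappa>" using geometric_increments_converge[of u \<kappa>] us by blast
  obtain c where c: "a \<longlonglongrightarrow> c" "norm (c - a 0) \<le> 2 * \<kappa>" using geometric_increments_converge[of a \<kappa>] as by blast
  \<comment> \<open>\<open>norm (u 0) = 1\<close> while the total displacement is at most
    \<open>2 * \<kappa> \<le> a0 / 4 < 1\<close>.\<close>
  have "v \<noteq> 0" using v(2) st0(1) \<kappa> a0 by auto
  have c01: "0 < c" "c < 1" using c(2) st0(2) \<kappa> a0 by (auto simp: abs_le_iff)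
  have an0: "a n \<noteq> 0" for n using an[of n] by simp
  have "dres ?O v = c *\<^sub>R v" by (rule dres_limit_eigenvector[of U \<beta>, OF ctx un an0 v(1) c(1)])
  then have "1 / c - 1 \<in> dirichlet_point_spectrum ?O"
    by (rule dres_eigenvalue_imp_point_spectrum[OF _ \<open>v \<noteq> 0\<close> c01(1)])
  moreover have "1 / c - 1 > 0" using c01 by simp
  moreover have "dirichlet_ac_spectrum_empty ?O" by (rule selected_exhaustion_ac_empty[of U \<beta>, OF ctx sel])
  moreover have "connected ?O" by (rule connected_increasing_union[of U, OF Uo(2) inc Uo(3)])
  moreover have "open ?O" using Uo(1) by auto
  moreover have "quasi_conical ?O"
    unfolding quasi_conical_def
  proof (intro allI impI)
    fix r :: real
    \<comment> \<open>The room added at step \<open>n\<close> has length at least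
      \<open>1 + n\<close> and contains a ball of radius 1/256 of its length.\<close>
    obtain n :: nat where n: "256 * r \<le> real n" using real_arch_simple by blast
    have "ball (((b n + b (Suc n)) / 2) *\<^sub>R e) r \<subseteq> ball (((b n + b (Suc n)) / 2) *\<^sub>R e) ((b (Suc n) - b n) / 256)"
      using bn[of n] n by (intro subset_ball) simp
    also have "\<dots> \<subseteq> room e (b n) (b (Suc n))" using bn[of n] by (intro room_contains_ball[OF e]) simp
    also have "\<dots> \<subseteq> ?O" using room[of n] by blast
    finally show "\<exists>x. ball x r \<subseteq> ?O" by blast
  qed
  ultimately show ?thesis by blast
qed

lemma quasi_conical_scaling:
  assumes "r > 0" "quasi_conical \<Omega>" shows "quasi_conical (similarity r 0 ` \<Omega>)"
  unfolding quasi_conical_def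
proof (intro allI impI)
  fix R :: real assume "R > 0"
  then have "R / r > 0" using assms(1) by simp
  then obtain x where x: "ball x (R / r) \<subseteq> \<Omega>" using assms(2) unfolding quasi_conical_def by blast
  have "ball (r *\<^sub>R x) R \<subseteq> similarity r 0 ` \<Omega>"
  proof
    fix y assume "y \<in> ball (r *\<^sub>R x) R"
    then have d: "norm (r *\<^sub>R x - y) < R" by (simp add: dist_norm)
    have "r *\<^sub>R x - y = r *\<^sub>R (x - (1 / r) *\<^sub>R y)" using assms(1) by (simp add: scaleR_diff_right)
    then have "norm (r *\<^sub>R x - y) = r * norm (x - (1 / r) *\<^sub>R y)" using assms(1) by (metis abs_of_pos norm_scaleR)
    then have "norm (x - (1 / r) *\<^sub>R y) < R / r" using d assms(1) by (simp only: pos_less_divide_eq mult.commute)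
    then have "(1 / r) *\<^sub>R y \<in> \<Omega>" using x by (auto simp: dist_norm)
    moreover have "y = similarity r 0 ((1 / r) *\<^sub>R y)" using assms(1) by (simp add: similarity_def)
    ultimately show "y \<in> similarity r 0 ` \<Omega>" by blast
  qed
  then show "\<exists>x. ball x R \<subseteq> similarity r 0 ` \<Omega>" by blast
qed

theorem theorem1p1:
  assumes "DIM('a::euclidean_space) \<ge> 2"
  shows "(\<forall>lam>0. \<exists>\<Omega>::'a set. open \<Omega> \<and> connected \<Omega> \<and> quasi_conical \<Omega> \<and>
             lam \<in> dirichlet_point_spectrum \<Omega>) \<and>
         (\<forall>lam>0. \<exists>\<Omega>::'a set. open \<Omega> \<and> connected \<Omega> \<and> quasi_conical \<Omega> \<and>
             lam \<in> dirichlet_point_spectrum \<Omega> \<and> dirichlet_ac_spectrum_empty \<Omega>)"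
proof -
  obtain \<Omega> :: "'a set" and l where \<Omega>: "open \<Omega>" "connected \<Omega>" "quasi_conical \<Omega>" "dirichlet_ac_spectrum_empty \<Omega>"
    and l: "l > 0" "l \<in> dirichlet_point_spectrum \<Omega>" using quasi_conical_domain_exists[OF assms] by blast
  have "\<exists>\<Omega>::'a set. open \<Omega> \<and> connected \<Omega> \<and> quasi_conical \<Omega> \<and> lam \<in> dirichlet_point_spectrum \<Omega> \<and> dirichlet_ac_spectrum_empty \<Omega>"
    if lam: "lam > 0" for lam
  proof (intro exI conjI)
    \<comment> \<open>Dilation by \<open>r\<close> divides Laplace eigenvalues by
      \<open>r\<^sup>2\<close>, so this factor carries \<open>l\<close> to
      \<open>lam\<close>.\<close>
    define r where "r = sqrt (l / lam)"
    have r: "r > 0" "l / r\<^sup>2 = lam" using lam l(1) by (auto simp: r_def)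
    have sim: "similarity r 0 = (\<lambda>x::'a. r *\<^sub>R x)" by (simp add: similarity_def fun_eq_iff)
    show "open (similarity r 0 ` \<Omega>)" unfolding sim using r(1) by (intro open_scaling \<Omega>(1)) simp
    show "connected (similarity r 0 ` \<Omega>)" unfolding sim
      by (intro connected_continuous_image \<Omega>(2) continuous_intros)
    show "quasi_conical (similarity r 0 ` \<Omega>)" by (rule quasi_conical_scaling[OF r(1) \<Omega>(3)])
    show "lam \<in> dirichlet_point_spectrum (similarity r 0 ` \<Omega>)"
      using dirichlet_point_spectrum_similarity[OF r(1) l(2), of 0] r(2) by simp
    show "dirichlet_ac_spectrum_empty (similarity r 0 ` \<Omega>)"
      by (rule dirichlet_ac_spectrum_empty_similarity[OF r(1) \<Omega>(4)])
  qed
  then show ?thesis by blast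
qed

end
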